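(* (The fractional Laplacian kernel.) For $s\in(0,1)$ and $\omega$ and $\boldsymbol\rho$ defined as $$\omega(\mathbf x,\mathbf y)=|\mathbf y-\mathbf x|\,\phi(|\mathbf y-\mathbf x|)\ \text{ with }\ \phi(|\mathbf y-\mathbf x|)=\frac1{|\mathbf y-\mathbf x|^{n+1+s}},\qquad\boldsymbol\rho(\mathbf x,\mathbf y)=\frac{\mathbf y-\mathbf x}{|\mathbf y-\mathbf x|}\ \text{ with }\ \delta=\infty,$$ for which $\boldsymbol\alpha(\mathbf x,\mathbf y)\omega(\mathbf x,\mathbf y)=(\mathbf y-\mathbf x)|\mathbf y-\mathbf x|^{-(n+s+1)}$, the equivalence kernel is $$2\gamma_{\rm eq}(\mathbf x,\mathbf y)=-\frac{C_{n,s}D_{n,s}}{G_s^2}\,\frac1{|\mathbf x-\mathbf y|^{n+2s}},$$ where $G_s=s/\Gamma(1-s)$ and $D_{n,s}$ is the negative constant defined in the context. Then the equivalence of the weighted Laplacian $\mathcal L_\omega=\mathcal D_\omega\mathcal G_\omega$ with the unweighted Laplacian $\mathcal L$ with kernel $\gamma_{\rm eq}$ is valid for $u\in H^s(\mathbb R^n)$, and $$\mathcal L=\mathcal L_\omega=\frac{D_{n,s}}{G_s^2}(-\Delta)^s.$$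
   Context: $n\in\{1,2,3\}$, and $H^s(\mathbb R^n)$ is the space of $u$ with $\int(1+|\boldsymbol\xi|^2)^s|\hat u|^2\,d\boldsymbol\xi<\infty$. The interaction kernel is $\boldsymbol\alpha(\mathbf x,\mathbf y)=\boldsymbol\rho(\mathbf x,\mathbf y)\mathbf 1(|\mathbf x-\mathbf y|\le\delta)$, so $\boldsymbol\alpha=\boldsymbol\rho$ for $\delta=\infty$. With $\boldsymbol\eta=\boldsymbol\alpha\omega$, the equivalence kernel is $$2\gamma_{\rm eq}(\mathbf x,\mathbf y)=\int_{\mathbb R^n}[\boldsymbol\eta(\mathbf x,\mathbf y)\cdot\boldsymbol\eta(\mathbf x,\mathbf z)+\boldsymbol\eta(\mathbf z,\mathbf y)\cdot\boldsymbol\eta(\mathbf x,\mathbf y)+\boldsymbol\eta(\mathbf z,\mathbf y)\cdot\boldsymbol\eta(\mathbf x,\mathbf z)]\,d\mathbf z,$$ and $$\mathcal G_\omega u(\mathbf x)=\int_{\mathbb R^n}(u(\mathbf y)-u(\mathbf x))\boldsymbol\eta(\mathbf x,\mathbf y)\,d\mathbf y,\quad\mathcal D_\omega\mathbf v(\mathbf x)=\int_{\mathbb R^n}(\omega(\mathbf x,\mathbf y)\mathbf v(\mathbf x)+\omega(\mathbf y,\mathbf x)\mathbf v(\mathbf y))\cdot\boldsymbol\alpha(\mathbf x,\mathbf y)\,d\mathbf y,$$ $$\mathcal Lu(\mathbf x)=2\int_{\mathbb R^n}(u(\mathbf y)-u(\mathbf x))\gamma_{\rm eq}(\mathbf x,\mathbf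 y)\,d\mathbf y.$$ Integrals are intended in the principal value sense where needed. The fractional Laplacian is $(-\Delta)^su(\mathbf x)=C_{n,s}\int_{\mathbb R^n}\frac{u(\mathbf x)-u(\mathbf y)}{|\mathbf x-\mathbf y|^{n+2s}}\,d\mathbf y$ with $C_{n,s}=\frac{4^s\Gamma(s+n/2)}{\pi^{n/2}|\Gamma(-s)|}$. The constant $D_{n,s}<0$ is the one for which $$\int_{|\boldsymbol\theta|=1}\int_{|\boldsymbol\theta'|=1}\boldsymbol\theta\cdot\boldsymbol\theta'(i\boldsymbol\theta\cdot\boldsymbol\xi)^s(i\boldsymbol\theta'\cdot\boldsymbol\xi)^s\,d\boldsymbol\theta\,d\boldsymbol\theta'=D_{n,s}|\boldsymbol\xi|^{2s},$$ where $(iy)^s=|y|^se^{i\,\mathrm{sgn}(y)\pi s/2}$ for real $y$. *)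

theory Defs
  imports "HOL-Analysis.Analysis"
begin

text \<open>
  Functions on \<^term>\<open>UNIV :: (real^'n) set\<close> take complex values, as is natural for spaces defined
  through the Fourier transform; real-valued functions are the special case of values in \<^term>\<open>\<real> :: complex set\<close>.
  Elements of \<open>L\<^sup>2\<close> are given by Borel representatives.
\<close>

section \<open>Fourier transform and Sobolev spaces\<close>

definition L2 :: "('a::euclidean_space \<Rightarrow> 'b::euclidean_space) set" where
  "L2 = {f \<in> borel_measurable borel. integrable lborel (\<lambda>x. (norm (f x))\<^sup>2)}"

text \<open>\<open>L\<^sup>2\<close>-convergence; the extended nonnegative integral avoids the default value \<open>0\<close> of the Bochner
  integral at non-integrable functions.\<close>

definition L2_tendsto ::
  "('i \<Rightarrow> 'a::euclidean_space \<Rightarrow> 'b::euclidean_space) \<Rightarrow> ('a \<Rightarrow> 'b) \<Rightarrow> 'i filter \<Rightarrow> bool" where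
  "L2_tendsto f g F \<longleftrightarrow> ((\<lambda>i. \<integral>\<^sup>+x. ennreal ((norm (f i x - g x))\<^sup>2) \<partial>lborel) \<longlongrightarrow> 0) F"

text \<open>The Fourier(-Plancherel) transform of a square-integrable function, as the \<open>L\<^sup>2\<close>-limit of the
  Fourier integrals over growing balls.\<close>

definition has_fourier :: "(real^'n \<Rightarrow> complex) \<Rightarrow> (real^'n \<Rightarrow> complex) \<Rightarrow> bool" where
  "has_fourier u v \<longleftrightarrow> v \<in> L2 \<and>
     L2_tendsto (\<lambda>R \<xi>. LINT x:cball 0 R|lborel. cis (- (x \<bullet> \<xi>)) * u x) v at_top"

definition sobolev :: "real \<Rightarrow> (real^'n \<Rightarrow> complex) set" where
  "sobolev s = {u \<in> L2. \<exists>v. has_fourier u v \<and>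
     integrable lborel (\<lambda>\<xi>. (1 + (norm \<xi>)\<^sup>2) powr s * (cmod (v \<xi>))\<^sup>2)}"

section \<open>Principal values\<close>

text \<open>Principal value of an integral whose integrand is singular at the points of \<open>S\<close>.\<close>

definition has_pv_integral :: "'a::euclidean_space set \<Rightarrow> ('a \<Rightarrow> real) \<Rightarrow> real \<Rightarrow> bool" where
  "has_pv_integral S f I \<longleftrightarrow>
     (\<forall>\<epsilon>>0. set_integrable lborel {z. \<forall>p\<in>S. \<epsilon> < dist p z} f) \<and>
     ((\<lambda>\<epsilon>. LINT z:{z. \<forall>p\<in>S. \<epsilon> < dist p z}|lborel. f z) \<longlongrightarrow> I) (at_right 0)"

definition pv_integral :: "'a::euclidean_space set \<Rightarrow> ('a \<Rightarrow> real) \<Rightarrow> real" where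
  "pv_integral S f = (THE I. has_pv_integral S f I)"

text \<open>
  An integral operator \<open>x \<mapsto> \<integral> K x y dy\<close> with a singularity at \<open>y = x\<close> is the limit, as \<open>\<epsilon>\<close> tends to 0,
  of its truncations.  For \<open>u \<in> H\<^sup>s\<close> the fractional gradient is an \<open>L\<^sup>2\<close> function, whereas operators of
  order \<open>2s\<close> only map \<open>H\<^sup>s\<close> into the dual space \<open>H\<^sup>-\<^sup>s\<close>: the truncated integrals need not
  converge at any point outside a null set (consider lacunary Fourier series).  Accordingly the limit is
  taken in \<open>L\<^sup>2\<close> in the former case (\<open>has_pv_L2\<close>), and in the latter in duality with \<open>H\<^sup>s\<close>, the result
  being a functional on \<open>H\<^sup>s\<close> (\<open>has_pv_dual\<close>).
\<close>

definition truncation ::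
  "real \<Rightarrow> ('a::euclidean_space \<Rightarrow> 'a \<Rightarrow> 'b::euclidean_space) \<Rightarrow> 'a \<Rightarrow> 'b" where
  "truncation \<epsilon> K x = (LINT y:{y. \<epsilon> < dist x y}|lborel. K x y)"

definition truncations_defined :: "('a::euclidean_space \<Rightarrow> 'a \<Rightarrow> 'b::euclidean_space) \<Rightarrow> bool" where
  "truncations_defined K \<longleftrightarrow>
     (\<forall>\<epsilon>>0. AE x in lborel. set_integrable lborel {y. \<epsilon> < dist x y} (K x))"

definition has_pv_L2 ::
  "('a::euclidean_space \<Rightarrow> 'a \<Rightarrow> 'b::euclidean_space) \<Rightarrow> ('a \<Rightarrow> 'b) \<Rightarrow> bool" where
  "has_pv_L2 K g \<longleftrightarrow> truncations_defined K \<and> g \<in> L2 \<and>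
     L2_tendsto (\<lambda>\<epsilon>. truncation \<epsilon> K) g (at_right 0)"

definition has_pv_dual ::
  "real \<Rightarrow> (real^'n \<Rightarrow> real^'n \<Rightarrow> complex) \<Rightarrow> ((real^'n \<Rightarrow> complex) \<Rightarrow> complex) \<Rightarrow> bool" where
  "has_pv_dual s K \<Lambda> \<longleftrightarrow> truncations_defined K \<and>
     (\<forall>\<psi>\<in>sobolev s.
        (\<forall>\<epsilon>>0. integrable lborel (\<lambda>x. truncation \<epsilon> K x * \<psi> x)) \<and>
        ((\<lambda>\<epsilon>. LINT x|lborel. truncation \<epsilon> K x * \<psi> x) \<longlongrightarrow> \<Lambda> \<psi>) (at_right 0))"

section \<open>Nonlocal operators\<close>

definition interaction_kernel ::
  "(real^'n \<Rightarrow> real^'n \<Rightarrow> real^'n) \<Rightarrow> ereal \<Rightarrow> real^'n \<Rightarrow> real^'n \<Rightarrow> real^'n" where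
  "interaction_kernel \<rho> \<delta> x y = (if ereal (norm (x - y)) \<le> \<delta> then \<rho> x y else 0)"

definition weighted_kernel ::
  "(real^'n \<Rightarrow> real^'n \<Rightarrow> real) \<Rightarrow> (real^'n \<Rightarrow> real^'n \<Rightarrow> real^'n) \<Rightarrow> real^'n \<Rightarrow> real^'n \<Rightarrow> real^'n" where
  "weighted_kernel \<omega> \<alpha> x y = \<omega> x y *\<^sub>R \<alpha> x y"

definition equivalence_integrand ::
  "(real^'n \<Rightarrow> real^'n \<Rightarrow> real) \<Rightarrow> (real^'n \<Rightarrow> real^'n \<Rightarrow> real^'n) \<Rightarrow> real^'n \<Rightarrow> real^'n \<Rightarrow> real^'n \<Rightarrow> real" where
  "equivalence_integrand \<omega> \<alpha> x y z =
     (let \<eta> = weighted_kernel \<omega> \<alpha> in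
       \<eta> x y \<bullet> \<eta> x z + \<eta> z y \<bullet> \<eta> x y + \<eta> z y \<bullet> \<eta> x z)"

definition equivalence_kernel ::
  "(real^'n \<Rightarrow> real^'n \<Rightarrow> real) \<Rightarrow> (real^'n \<Rightarrow> real^'n \<Rightarrow> real^'n) \<Rightarrow> real^'n \<Rightarrow> real^'n \<Rightarrow> real" where
  "equivalence_kernel \<omega> \<alpha> x y = pv_integral {x, y} (equivalence_integrand \<omega> \<alpha> x y) / 2"

definition has_weighted_gradient ::
  "(real^'n \<Rightarrow> real^'n \<Rightarrow> real) \<Rightarrow> (real^'n \<Rightarrow> real^'n \<Rightarrow> real^'n) \<Rightarrow>
   (real^'n \<Rightarrow> complex) \<Rightarrow> (real^'n \<Rightarrow> complex^'n) \<Rightarrow> bool" where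
  "has_weighted_gradient \<omega> \<alpha> u g \<longleftrightarrow>
     has_pv_L2 (\<lambda>x y. \<chi> i. (u y - u x) * of_real (weighted_kernel \<omega> \<alpha> x y $ i)) g"

definition has_weighted_divergence ::
  "real \<Rightarrow> (real^'n \<Rightarrow> real^'n \<Rightarrow> real) \<Rightarrow> (real^'n \<Rightarrow> real^'n \<Rightarrow> real^'n) \<Rightarrow>
   (real^'n \<Rightarrow> complex^'n) \<Rightarrow> ((real^'n \<Rightarrow> complex) \<Rightarrow> complex) \<Rightarrow> bool" where
  "has_weighted_divergence s \<omega> \<alpha> v \<Lambda> \<longleftrightarrow>
     has_pv_dual s
       (\<lambda>x y. \<Sum>i\<in>UNIV. (\<omega> x y *\<^sub>R v x + \<omega> y x *\<^sub>R v y) $ i * of_real (\<alpha> x y $ i)) \<Lambda>"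

definition has_weighted_laplacian ::
  "real \<Rightarrow> (real^'n \<Rightarrow> real^'n \<Rightarrow> real) \<Rightarrow> (real^'n \<Rightarrow> real^'n \<Rightarrow> real^'n) \<Rightarrow>
   (real^'n \<Rightarrow> complex) \<Rightarrow> ((real^'n \<Rightarrow> complex) \<Rightarrow> complex) \<Rightarrow> bool" where
  "has_weighted_laplacian s \<omega> \<alpha> u \<Lambda> \<longleftrightarrow>
     (\<exists>g. has_weighted_gradient \<omega> \<alpha> u g \<and> has_weighted_divergence s \<omega> \<alpha> g \<Lambda>)"

definition has_nonlocal_laplacian ::
  "real \<Rightarrow> (real^'n \<Rightarrow> real^'n \<Rightarrow> real) \<Rightarrow>
   (real^'n \<Rightarrow> complex) \<Rightarrow> ((real^'n \<Rightarrow> complex) \<Rightarrow> complex) \<Rightarrow> bool" where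
  "has_nonlocal_laplacian s \<gamma> u \<Lambda> \<longleftrightarrow>
     has_pv_dual s (\<lambda>x y. 2 * ((u y - u x) * of_real (\<gamma> x y))) \<Lambda>"

definition C_const :: "nat \<Rightarrow> real \<Rightarrow> real" where
  "C_const n s = 4 powr s * Gamma (s + real n / 2) / (pi powr (real n / 2) * \<bar>Gamma (- s)\<bar>)"

definition has_fractional_laplacian ::
  "real \<Rightarrow> (real^'n \<Rightarrow> complex) \<Rightarrow> ((real^'n \<Rightarrow> complex) \<Rightarrow> complex) \<Rightarrow> bool" where
  "has_fractional_laplacian s u \<Lambda> \<longleftrightarrow>
     has_pv_dual s
       (\<lambda>x y. of_real (C_const CARD('n) s) *
              ((u x - u y) / of_real (norm (x - y) powr (real CARD('n) + 2 * s)))) \<Lambda>"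

section \<open>Surface measure and constants\<close>

text \<open>Surface measure of the unit sphere: a set of directions \<open>A\<close> has \<open>n\<close> times the volume of the
  cone \<open>{r\<theta> | 0 < r < 1, \<theta> \<in> A}\<close>.  In dimension one this is the counting measure on \<open>{-1, 1}\<close>.\<close>

definition sphere_measure :: "'a::euclidean_space measure" where
  "sphere_measure =
     distr (density lborel (\<lambda>x. of_nat DIM('a) * indicator (ball 0 1) x)) borel sgn"

text \<open>The branch of \<open>(iy)\<^sup>s\<close> for real \<open>y\<close>.\<close>

definition ipowr :: "real \<Rightarrow> real \<Rightarrow> complex" where
  "ipowr y s = of_real (\<bar>y\<bar> powr s) * cis (sgn y * pi * s / 2)"

definition D_const :: "'n::finite itself \<Rightarrow> real \<Rightarrow> real" where
  "D_const _ s = (THE D. D < 0 \<and> (\<forall>\<xi>::real^'n.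
     (LINT \<theta>:sphere 0 1|sphere_measure. LINT \<theta>':sphere 0 1|sphere_measure.
        of_real (\<theta> \<bullet> \<theta>') * ipowr (\<theta> \<bullet> \<xi>) s * ipowr (\<theta>' \<bullet> \<xi>) s)
     = of_real (D * norm \<xi> powr (2 * s))))"

definition G_const :: "real \<Rightarrow> real" where
  "G_const s = s / Gamma (1 - s)"

end

theory Submission
  imports Defs "HOL-Probability.Probability"
begin

text \<open>
  Put \<open>\<eta>(h) = h \<bar>h\<bar>\<^bsup>-(n+s+1)\<^esup>\<close>, so that \<open>\<omega> \<alpha> = \<eta>(y - x)\<close>, and regularise it as a superposition of Gaussians,
  \<open>\<eta>\<^sub>T(h) = \<Gamma>(a)\<^bsup>-1\<^esup> \<integral>\<^sub>0\<^sup>T t\<^bsup>a-1\<^esup> h exp(- t \<bar>h\<bar>\<^sup>2) dt\<close> with \<open>a = (n+s+1)/2\<close>.  Convolutions of Gaussians are explicit,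
  hence \<open>\<eta>\<^sub>T * \<eta>\<^sub>T\<^sub>'\<close> is a double integral over \<open>t\<close> and \<open>t'\<close>, dominated by a multiple of \<open>\<bar>h\<bar>\<^bsup>-n-2s\<^esup>\<close>
  and convergent to \<open>\<kappa> \<bar>h\<bar>\<^bsup>-n-2s\<^esup>\<close>.  Integrating homogeneous functions against a Gaussian gives \<open>D\<close> in terms of
  Gamma functions, and then \<open>\<kappa> = - C D / G\<^sup>2\<close>.  The sharp truncation of \<open>\<eta>\<close> at radius \<open>\<epsilon>\<close> differs from \<open>\<eta>\<^sub>T\<close>,
  \<open>T = \<epsilon>\<^bsup>-2\<^esup>\<close>, by an odd kernel of mass \<open>O(\<epsilon>\<^bsup>-s\<^esup>)\<close> living at scale \<open>\<epsilon>\<close>, which is negligible in the limit;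
  so \<open>\<kappa> \<bar>x - y\<bar>\<^bsup>-n-2s\<^esup>\<close> is also the principal value defining the equivalence kernel.

  For odd kernels, \<open>\<integral> (p * u) (q * w) = 1/2 \<integral> (p * q)(l) A(l) dl\<close> with \<open>A(l) = \<integral> (u(x+l) - u(x)) (w(x+l) - w(x)) dx\<close>.
  If the Gagliardo seminorms of \<open>u\<close> and \<open>w\<close> are finite, dominated convergence shows that the regularised gradients are
  Cauchy in \<open>L\<^sup>2\<close> and that the limits satisfy \<open>\<integral> \<G>u \<cdot> \<G>w = \<kappa>/2 \<integral> \<bar>l\<bar>\<^bsup>-n-2s\<^esup> A(l) dl\<close>.  By antisymmetry the left side is
  \<open>- \<langle>\<D>\<G>u, w\<rangle>\<close>, while the right side is \<open>\<kappa>/C\<close> times the quadratic form of the fractional Laplacian.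
  Finally, Gaussian means of \<open>\<parallel>u(\<cdot> + h) - u\<parallel>\<^sup>2\<close> equal \<open>\<integral> (1 - exp(- \<bar>\<xi>\<bar>\<^sup>2/4t)) \<bar>v\<bar>\<^sup>2 d\<xi>\<close> up to a constant,
  \<open>v\<close> being the Fourier transform of \<open>u\<close>; integrating with weight \<open>t\<^bsup>s-1\<^esup> dt\<close> bounds the Gagliardo seminorm of \<open>u \<in> H\<^sup>s\<close>.
\<close>

section \<open>Gaussian integrals\<close>

text \<open>The obstacle is that \<open>riesz\<close> is not integrable at the origin, so neither
  its convolution square nor the composition of divergence and gradient exists absolutely.
  Subordination to Gaussians replaces it by bounded integrable kernels, for which Fubini is free.
  For fixed h \<noteq> 0 the resulting integrand in (t, t') is absolutely integrable and independent
  of the cut-offs T and T', so limits along different T and T' agree; these mixed limits make the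
  regularised gradients Cauchy. The choice T = \<epsilon>^-2 matches the length T^(-1/2) of exp(- T
  |z|^2) with the truncation radius. The defect has mass \<epsilon>^(-s), which blows up. Pointwise,
  oddness saves a factor \<epsilon> and leaves \<epsilon>^(1-s), which tends to 0 since s < 1. In L2
  the Cauchy-Schwarz inequality brings in the defect a second time, integrated against the squared
  increments of u, and this integral is o(\<epsilon>^s). The factor s in \<open>kappa\<close> is a
  difference of two coefficients, (n/2 + s) - n/2.\<close>

lemma nn_integral_lborel_scale:
  fixes f :: "'a::euclidean_space \<Rightarrow> ennreal"
  assumes [measurable]: "f \<in> borel_measurable borel" and c: "c \<noteq> 0"
  shows "(\<integral>\<^sup>+x. f x \<partial>lborel) = ennreal (\<bar>c\<bar> ^ DIM('a)) * (\<integral>\<^sup>+x. f (c *\<^sub>R x) \<partial>lborel)"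
  by (subst lborel_affine[OF c, of 0])
     (simp add: nn_integral_density nn_integral_distr nn_integral_cmult)

section \<open>Radial integration and Gamma integrals\<close>

lemma nn_integral_powr_from_0:
  fixes q R :: real
  assumes q: "q > 0" and R: "R \<ge> 0"
  shows "(\<integral>\<^sup>+t. ennreal (t powr (q - 1)) * indicator {0<..R} t \<partial>lborel) = ennreal (R powr q / q)"
proof -
  have "((\<lambda>t. t powr (q - 1)) has_integral (R powr (q - 1 + 1) / (q - 1 + 1))) {0..R}"
    by (rule has_integral_powr_from_0) (use q R in auto)
  then have "(\<integral>\<^sup>+t. ennreal (indicator {0..R} t * t powr (q - 1)) \<partial>lborel) = ennreal (R powr q / q)"
    by (subst nn_integral_has_integral_lebesgue) auto
  then show ?thesis
    by (rule trans[rotated]) (auto intro!: nn_integral_cong_AE AE_mp[OF AE_lborel_singleton[of 0]]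
          AE_I2 split: split_indicator)
qed

lemma nn_integral_Gamma:
  fixes c q :: real
  assumes q: "q > 0" and c: "c > 0"
  shows "(\<integral>\<^sup>+t. ennreal (t powr (q - 1) * exp (- (c * t))) * indicator {0<..} t \<partial>lborel)
    = ennreal (Gamma q * c powr (- q))"
proof -
  have "ennreal (Gamma q) = (\<integral>\<^sup>+t. ennreal (indicator {0..} t * t powr (q - 1) / exp t) \<partial>lborel)"
    by (rule Gamma_conv_nn_integral_real[OF q])
  also have "\<dots> = \<bar>c\<bar> * (\<integral>\<^sup>+t. ennreal (indicator {0..} (0 + c * t) * (0 + c * t) powr (q - 1) / exp (0 + c * t)) \<partial>lborel)"
    by (rule nn_integral_real_affine) (use c in auto)
  also have "(\<integral>\<^sup>+t. ennreal (indicator {0..} (0 + c * t) * (0 + c * t) powr (q - 1) / exp (0 + c * t)) \<partial>lborel)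
     = (\<integral>\<^sup>+t. ennreal (c powr (q - 1)) * (ennreal (t powr (q - 1) * exp (- (c * t))) * indicator {0<..} t) \<partial>lborel)"
    using c by (auto intro!: nn_integral_cong_AE AE_mp[OF AE_lborel_singleton[of 0]]
          AE_I2 split: split_indicator simp: powr_mult exp_minus field_simps zero_le_mult_iff ennreal_mult[symmetric])
  also have "\<dots> = ennreal (c powr (q - 1)) * (\<integral>\<^sup>+t. (ennreal (t powr (q - 1) * exp (- (c * t))) * indicator {0<..} t) \<partial>lborel)"
    by (rule nn_integral_cmult) auto
  finally have *: "ennreal (Gamma q) = ennreal (c powr q) * (\<integral>\<^sup>+t. (ennreal (t powr (q - 1) * exp (- (c * t))) * indicator {0<..} t) \<partial>lborel)"
    using c by (simp add: mult.assoc[symmetric] ennreal_mult[symmetric] powr_mult_base)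

  have "ennreal (Gamma q * c powr (- q)) = ennreal (c powr (- q)) * ennreal (Gamma q)"
    by (simp add: ennreal_mult mult.commute Gamma_real_nonneg q less_imp_le)
  also have "\<dots> = (\<integral>\<^sup>+t. (ennreal (t powr (q - 1) * exp (- (c * t))) * indicator {0<..} t) \<partial>lborel)"
    unfolding * mult.assoc[symmetric] using c by (simp add: ennreal_mult[symmetric] powr_add[symmetric])
  finally show ?thesis ..
qed

text \<open>Polar coordinates without a surface measure. Homogeneity alone determines the mass of
  {..R} under the image of f(x) dx by |x|^2: it is M R^q with q = (DIM + p) / 2, and the density on
  the right gives the same. Half-lines generate the Borel sets, so the two measures coincide. The
  variable |x|^2 rather than |x| makes Gaussian integrals Gamma integrals at once.\<close>

lemma nn_integral_homogeneous_radial: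
  fixes f :: "'a::euclidean_space \<Rightarrow> real" and g :: "real \<Rightarrow> ennreal" and p M :: real
  assumes [measurable]: "f \<in> borel_measurable borel" "g \<in> borel_measurable borel"
    and nonneg: "\<And>x. 0 \<le> f x"
    and hom: "\<And>r x. r > 0 \<Longrightarrow> f (r *\<^sub>R x) = r powr p * f x"
    and p: "DIM('a) + p > 0"
    and M: "(\<integral>\<^sup>+x. f x * indicator (cball 0 1) x \<partial>lborel) = ennreal M" "M \<ge> 0"
  shows "(\<integral>\<^sup>+x. ennreal (f x) * g ((norm x)\<^sup>2) \<partial>lborel) =
    (\<integral>\<^sup>+r. ennreal ((DIM('a) + p) / 2 * M * r powr ((DIM('a) + p) / 2 - 1)) * indicator {0<..} r * g r \<partial>lborel)"
proof -
  define q where "q = (DIM('a) + p) / 2"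
  have cb[measurable]: "cball (0::'a) r \<in> sets borel" for r by simp
  have q: "q > 0" using p by (simp add: q_def)
  define \<mu> where "\<mu> = distr (density lborel (\<lambda>x. ennreal (f x))) borel (\<lambda>x. (norm x)\<^sup>2)"
  define \<nu> where "\<nu> = density lborel (\<lambda>r. ennreal (q * M * r powr (q - 1)) * indicator {0<..} r)"
  have \<nu>: "emeasure \<nu> {..R} = ennreal (M * R powr q)" if "R > 0" for R
  proof -
    have "emeasure \<nu> {..R} = (\<integral>\<^sup>+r. ennreal (q * M) * (ennreal (r powr (q - 1)) * indicator {0<..R} r) \<partial>lborel)"
      unfolding \<nu>_def using q M by (subst emeasure_density)
        (auto intro!: nn_integral_cong simp: ennreal_mult[symmetric] split: split_indicator)
    also have "\<dots> = ennreal (q * M) * ennreal (R powr q / q)"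
      using that by (subst nn_integral_cmult) (auto simp: nn_integral_powr_from_0[OF q])
    finally show ?thesis using q M by (simp add: ennreal_mult[symmetric])
  qed
  have \<mu>: "emeasure \<mu> {..R} = ennreal (M * R powr q)" if R: "R > 0" for R
  proof -
    define r where "r = sqrt R"
    have r: "r > 0" "r\<^sup>2 = R" using R by (auto simp: r_def)
    have mem: "(norm x)\<^sup>2 \<le> R \<longleftrightarrow> norm x \<le> r" for x :: 'a
      using r by (metis abs_le_square_iff abs_norm_cancel abs_of_pos)
    have [measurable]: "(\<lambda>x::'a. (norm x)\<^sup>2) -` {..R} \<in> sets borel"
      using measurable_sets[of "\<lambda>x::'a. (norm x)\<^sup>2" borel borel "{..R}"] by simp
    have "emeasure \<mu> {..R} = (\<integral>\<^sup>+x. ennreal (f x) * indicator (cball 0 r) x \<partial>lborel)"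
      unfolding \<mu>_def
      by (subst emeasure_distr, simp, simp, subst emeasure_density)
         (auto intro!: nn_integral_cong simp: mem split: split_indicator)
    also have "\<dots> = ennreal (\<bar>r\<bar> ^ DIM('a)) * (\<integral>\<^sup>+x. ennreal (f (r *\<^sub>R x)) * indicator (cball 0 r) (r *\<^sub>R x) \<partial>lborel)"
      by (rule nn_integral_lborel_scale, measurable) (use r in auto)
    also have "(\<integral>\<^sup>+x. ennreal (f (r *\<^sub>R x)) * indicator (cball 0 r) (r *\<^sub>R x) \<partial>lborel)
       = (\<integral>\<^sup>+x. ennreal (r powr p) * (f x * indicator (cball 0 1) x) \<partial>lborel)"
      using r by (auto intro!: nn_integral_cong simp: hom ennreal_mult nonneg split: split_indicator)
    also have "\<dots> = ennreal (r powr p) * ennreal M"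
      by (subst nn_integral_cmult) (simp_all only: M, measurable)
    also have "ennreal (\<bar>r\<bar> ^ DIM('a)) * \<dots> = ennreal (M * R powr q)"
    proof -
      have "R powr q = r powr (DIM('a)) * r powr p"
      proof -
        have "R = r powr 2" using r by simp
        moreover have "2 * q = DIM('a) + p" by (simp add: q_def)
        ultimately show ?thesis by (simp add: powr_powr powr_add[symmetric])
      qed
      then show ?thesis using r M by (simp add: ennreal_mult[symmetric] powr_realpow mult_ac)
    qed
    finally show ?thesis .
  qed
  \<comment> \<open>Half-lines with R \<le> 0 meet the range of |x|^2 at most in the image of the
    null set {0}; they belong to the generator, and R = 0 occurs in the exhausting cover.\<close>
  have z\<mu>: "emeasure \<mu> {..R} = 0" if "R \<le> 0" for R
  proof -
    have [measurable]: "(\<lambda>x::'a. (norm x)\<^sup>2) -` {..R} \<in> sets borel"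
      using measurable_sets[of "\<lambda>x::'a. (norm x)\<^sup>2" borel borel "{..R}"] by simp
    have "emeasure \<mu> {..R} = (\<integral>\<^sup>+x. ennreal (f x) * indicator ((\<lambda>x. (norm x)\<^sup>2) -` {..R}) x \<partial>lborel)"
      unfolding \<mu>_def
      by (subst emeasure_distr, simp, simp, subst emeasure_density) (auto intro!: nn_integral_cong)
    also have "\<dots> = (\<integral>\<^sup>+x. 0 \<partial>(lborel::'a measure))"
    proof (rule nn_integral_cong_AE)
      show "AE x in lborel. ennreal (f x) * indicator ((\<lambda>x. (norm x)\<^sup>2) -` {..R}) x = 0"
        using AE_lborel_singleton[of "0::'a"]
      proof eventually_elim
        fix x :: 'a assume "x \<noteq> 0"
        then have "\<not> (norm x)\<^sup>2 \<le> R" using that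
          by (meson leD not_le order.trans zero_less_norm_iff zero_less_power)
        then show "ennreal (f x) * indicator ((\<lambda>x. (norm x)\<^sup>2) -` {..R}) x = 0" by simp
      qed
    qed
    finally show ?thesis by simp
  qed
  have z\<nu>: "emeasure \<nu> {..R} = 0" if "R \<le> 0" for R
  proof -
    have "emeasure \<nu> {..R} = (\<integral>\<^sup>+x. 0 \<partial>(lborel::real measure))"
      unfolding \<nu>_def using that
      by (subst emeasure_density, measurable) (rule nn_integral_cong, auto split: split_indicator)
    then show ?thesis by simp
  qed
  have borel: "sets (borel :: real measure) = sigma_sets UNIV (range (\<lambda>a::real. {..a}))"
    by (subst borel_eq_atMost) simp
  have "\<mu> = \<nu>"
  proof (rule measure_eqI_generator_eq)
    show "Int_stable (range (\<lambda>a::real. {..a}))" by (auto simp: Int_stable_def)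
    show "range (\<lambda>a::real. {..a}) \<subseteq> Pow UNIV" by auto
    show "sets \<mu> = sigma_sets UNIV (range (\<lambda>a::real. {..a}))"
         "sets \<nu> = sigma_sets UNIV (range (\<lambda>a::real. {..a}))"
      using borel by (simp_all add: \<mu>_def \<nu>_def)
    fix X assume "X \<in> range (\<lambda>a::real. {..a})"
    then obtain R where X: "X = {..R}" by auto
    show "emeasure \<mu> X = emeasure \<nu> X"
      unfolding X by (cases "R > 0") (auto simp: \<mu> \<nu> z\<mu> z\<nu>)
  next
    show "range (\<lambda>i::nat. {..real i}) \<subseteq> range (\<lambda>a::real. {..a})" by auto
    show "(\<Union>i. {..real i}) = UNIV" by (auto intro: real_arch_simple)
    show "emeasure \<mu> {..real i} \<noteq> \<infinity>" for i
      by (cases "i = 0") (auto simp: \<mu> z\<mu>)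
  qed
  then have "(\<integral>\<^sup>+r. g r \<partial>\<mu>) = (\<integral>\<^sup>+r. g r \<partial>\<nu>)" by simp
  then show ?thesis
    unfolding \<mu>_def \<nu>_def q_def by (simp add: nn_integral_distr nn_integral_density)
qed

lemma nn_integral_radial:
  fixes g :: "real \<Rightarrow> ennreal"
  assumes [measurable]: "g \<in> borel_measurable borel"
  shows "(\<integral>\<^sup>+x. g ((norm (x::'a::euclidean_space))\<^sup>2) \<partial>lborel) =
    (\<integral>\<^sup>+r. ennreal (DIM('a) / 2 * unit_ball_vol DIM('a) * r powr (DIM('a) / 2 - 1)) * indicator {0<..} r * g r \<partial>lborel)"
proof -
  have "(\<integral>\<^sup>+x. ennreal (1 * indicator (cball 0 1) (x::'a)) \<partial>lborel) = ennreal (unit_ball_vol DIM('a))"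
    by (simp add: emeasure_cball ennreal_indicator)
  then show ?thesis
    using nn_integral_homogeneous_radial[of "\<lambda>_::'a. 1" g 0 "unit_ball_vol DIM('a)"] by simp
qed

text \<open>The coefficient \<open>n / 2 * unit_ball_vol n\<close> is the density constant of
  \<open>nn_integral_radial\<close>, half the area of the unit sphere; against a Gaussian it meets
  Gamma (n / 2) and only the power of \<pi> survives.\<close>

lemma unit_ball_vol_Gamma: "real n / 2 * unit_ball_vol n * Gamma (real n / 2) = pi powr (real n / 2)" if "n > 0" for n :: nat
proof -
  have "Gamma (real n / 2 + 1) = real n / 2 * Gamma (real n / 2)"
    by (rule Gamma_plus1) (use that in \<open>auto simp: nonpos_Ints_def\<close>)
  moreover have "Gamma (real n / 2) \<noteq> 0" using that Gamma_real_pos[of "real n / 2"] by linarith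
  ultimately show ?thesis using that by (simp add: unit_ball_vol_def field_simps)
qed

lemma
  fixes t :: real
  assumes t: "t > 0"
  shows nn_integral_gaussian: "(\<integral>\<^sup>+x. ennreal (exp (- (t * (norm (x::'a::euclidean_space))\<^sup>2))) \<partial>lborel)
      = ennreal ((pi / t) powr (DIM('a) / 2))" (is ?A)
    and nn_integral_gaussian_moment2: "(\<integral>\<^sup>+x. ennreal ((norm (x::'a::euclidean_space))\<^sup>2 * exp (- (t * (norm x)\<^sup>2))) \<partial>lborel)
      = ennreal (DIM('a) / (2 * t) * (pi / t) powr (DIM('a) / 2))" (is ?B)
proof -
  define n where "n = DIM('a)"
  have n: "n > 0" by (simp add: n_def)
  define c where "c = n / 2 * unit_ball_vol n"
  have c: "c \<ge> 0" by (simp add: c_def)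
  have "(\<integral>\<^sup>+x. ennreal (exp (- (t * (norm (x::'a))\<^sup>2))) \<partial>lborel)
     = (\<integral>\<^sup>+r. ennreal (c * r powr (n / 2 - 1)) * indicator {0<..} r * ennreal (exp (- (t * r))) \<partial>lborel)"
    unfolding c_def n_def by (rule nn_integral_radial) simp
  also have "\<dots> = (\<integral>\<^sup>+r. ennreal c * (ennreal (r powr (n / 2 - 1) * exp (- (t * r))) * indicator {0<..} r) \<partial>lborel)"
    using c by (auto intro!: nn_integral_cong simp: ennreal_mult[symmetric] mult_ac split: split_indicator)
  also have "\<dots> = ennreal c * ennreal (Gamma (n / 2) * t powr (- (n / 2)))"
    using n t by (subst nn_integral_cmult) (auto simp: nn_integral_Gamma)
  also have "\<dots> = ennreal (pi powr (n / 2) * t powr (- (n / 2)))"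
    using c n t unit_ball_vol_Gamma[OF n] by (auto simp: ennreal_mult[symmetric] c_def mult.assoc[symmetric] Gamma_real_nonneg)
  also have "pi powr (n / 2) * t powr (- (n / 2)) = (pi / t) powr (n / 2)"
    using t by (simp add: powr_divide powr_minus_divide)
  finally show ?A unfolding n_def .
  have base: "c * r powr (n / 2 - 1) * (r * exp (- (t * r))) = c * (r powr (n / 2) * exp (- (t * r)))" if "r > 0" for r
    using that powr_mult_base[of r "n / 2 - 1"] by (simp add: mult.commute)
  have G: "Gamma (n / 2 + 1) = n / 2 * Gamma (n / 2)"
    by (rule Gamma_plus1) (use n in \<open>auto simp: nonpos_Ints_def\<close>)
  have "(\<integral>\<^sup>+x. ennreal ((norm (x::'a))\<^sup>2 * exp (- (t * (norm x)\<^sup>2))) \<partial>lborel)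
     = (\<integral>\<^sup>+r. ennreal (c * r powr (n / 2 - 1)) * indicator {0<..} r * ennreal (r * exp (- (t * r))) \<partial>lborel)"
    unfolding c_def n_def by (rule nn_integral_radial) simp
  also have "\<dots> = (\<integral>\<^sup>+r. ennreal c * (ennreal (r powr ((n / 2 + 1) - 1) * exp (- (t * r))) * indicator {0<..} r) \<partial>lborel)"
    using c by (auto intro!: nn_integral_cong simp: ennreal_mult[symmetric] base split: split_indicator)
  also have "\<dots> = ennreal c * ennreal (Gamma (n / 2 + 1) * t powr (- (n / 2 + 1)))"
    using n t nn_integral_Gamma[of "n / 2 + 1" t] by (subst nn_integral_cmult) auto
  also have "\<dots> = ennreal (n / (2 * t) * (pi / t) powr (n / 2))"
  proof -
    have "c * (Gamma (n / 2 + 1) * t powr (- (n / 2 + 1))) = (c * Gamma (n / 2)) * (n / 2) * (t powr (- (n / 2)) / t)"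
      unfolding G using t by (simp add: powr_diff)
    also have "\<dots> = n / (2 * t) * (pi / t) powr (n / 2)"
      unfolding c_def unit_ball_vol_Gamma[OF n] using t by (simp add: powr_divide powr_minus_divide mult_ac)
    finally show ?thesis using c n t by (auto simp: ennreal_mult[symmetric] Gamma_real_nonneg)
  qed
  finally show ?B unfolding n_def .
qed

lemma
  fixes t :: real
  assumes t: "t > 0"
  shows integrable_gaussian: "integrable lborel (\<lambda>x::'a::euclidean_space. exp (- (t * (norm x)\<^sup>2)))"
    and integral_gaussian: "(LINT x|lborel. exp (- (t * (norm (x::'a))\<^sup>2))) = (pi / t) powr (DIM('a) / 2)"
    and integrable_gaussian_moment2: "integrable lborel (\<lambda>x::'a. (norm x)\<^sup>2 * exp (- (t * (norm x)\<^sup>2)))"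
    and integral_gaussian_moment2: "(LINT x|lborel. (norm (x::'a))\<^sup>2 * exp (- (t * (norm x)\<^sup>2))) = DIM('a) / (2 * t) * (pi / t) powr (DIM('a) / 2)"
  using nn_integral_eq_integrable[of "\<lambda>x::'a. exp (- (t * (norm x)\<^sup>2))" lborel "(pi / t) powr (DIM('a) / 2)"]
    nn_integral_eq_integrable[of "\<lambda>x::'a. (norm x)\<^sup>2 * exp (- (t * (norm x)\<^sup>2))" lborel "DIM('a) / (2 * t) * (pi / t) powr (DIM('a) / 2)"]
    nn_integral_gaussian[OF t, where 'a='a] nn_integral_gaussian_moment2[OF t, where 'a='a] t
  by auto

section \<open>Characteristic integrals of Gaussians and of their first moments\<close>

lemma
  fixes f :: "'a::euclidean_space \<Rightarrow> real \<Rightarrow> 'b::{real_normed_field,banach,second_countable_topology}"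
  assumes "\<And>b. b \<in> Basis \<Longrightarrow> integrable lborel (f b)"
  shows integrable_prod_Basis: "integrable lborel (\<lambda>x::'a. \<Prod>b\<in>Basis. f b (x \<bullet> b))"
    and integral_prod_Basis: "(LINT x|lborel. (\<Prod>b\<in>Basis. f b ((x::'a) \<bullet> b))) = (\<Prod>b\<in>Basis. LINT y|lborel. f b y)"
proof -
  interpret product_sigma_finite "\<lambda>_::'a. lborel :: real measure"
    by standard
  have [measurable]: "b \<in> Basis \<Longrightarrow> f b \<in> borel_measurable borel" for b
    using borel_measurable_integrable[OF assms, of b] by simp
  have eq: "(\<Prod>b\<in>Basis. f b ((\<Sum>c\<in>Basis. x c *\<^sub>R c) \<bullet> b)) = (\<Prod>b\<in>Basis. f b (x b))" for x :: "'a \<Rightarrow> real"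
    by (intro prod.cong) auto
  show "integrable lborel (\<lambda>x::'a. \<Prod>b\<in>Basis. f b (x \<bullet> b))"
    using product_integrable_prod[OF finite_Basis assms]
    by (subst lborel_eq, subst integrable_distr_eq) (auto simp: eq)
  show "(LINT x|lborel. (\<Prod>b\<in>Basis. f b ((x::'a) \<bullet> b))) = (\<Prod>b\<in>Basis. LINT y|lborel. f b y)"
    using product_integral_prod[OF finite_Basis assms]
    by (subst lborel_eq, subst integral_distr) (auto simp: eq)
qed

lemma
  fixes t :: real
  assumes t: "t > 0"
  shows integrable_gaussian_real: "integrable lborel (\<lambda>x::real. exp (- (t * x\<^sup>2)))"
    and integrable_gaussian_cis_real: "integrable lborel (\<lambda>x::real. cis (l * x) * exp (- (t * x\<^sup>2)))"
    and integrable_gaussian_moment_cis_real: "integrable lborel (\<lambda>x::real. x * cis (l * x) * exp (- (t * x\<^sup>2)))"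
proof -
  show *: "integrable lborel (\<lambda>x::real. exp (- (t * x\<^sup>2)))"
    using integrable_gaussian[OF t, where 'a=real] by simp
  show "integrable lborel (\<lambda>x::real. cis (l * x) * exp (- (t * x\<^sup>2)))"
    by (rule Bochner_Integration.integrable_bound[OF *]) (auto simp: norm_mult cis_conv_exp)
  have "integrable lborel (\<lambda>x::real. exp (- (t * x\<^sup>2)) + x\<^sup>2 * exp (- (t * x\<^sup>2)))"
    using integrable_gaussian_moment2[OF t, where 'a=real] * by simp
  then show "integrable lborel (\<lambda>x::real. x * cis (l * x) * exp (- (t * x\<^sup>2)))"
  proof (rule Bochner_Integration.integrable_bound)
    have "\<bar>x\<bar> \<le> 1 + x\<^sup>2" for x :: real
    proof -
      have "0 \<le> (\<bar>x\<bar> - 1)\<^sup>2" by simp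
      then have "2 * \<bar>x\<bar> \<le> 1 + x\<^sup>2" by (simp add: power2_diff)
      then show ?thesis by simp
    qed
    then have "\<bar>x\<bar> * exp (- (t * x\<^sup>2)) \<le> (1 + x\<^sup>2) * exp (- (t * x\<^sup>2))" for x
      by (intro mult_right_mono) auto
    then show "AE x in lborel. cmod (x * cis (l * x) * exp (- (t * x\<^sup>2))) \<le> norm (exp (- (t * x\<^sup>2)) + x\<^sup>2 * exp (- (t * x\<^sup>2)))"
      by (auto simp: norm_mult algebra_simps)
  qed (auto simp: cis_conv_exp)
qed

lemma integral_gaussian_cis_real:
  fixes t l :: real
  assumes t: "t > 0"
  shows "(LINT x|lborel. cis (l * x) * exp (- (t * x\<^sup>2))) = sqrt (pi / t) * exp (- (l\<^sup>2 / (4 * t)))"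
proof -
  \<comment> \<open>With y = c x the exponent - y^2 / 2 of the standard normal density becomes - t
    x^2, so the known characteristic function applies.\<close>
  define c where "c = sqrt (2 * t)"
  have c: "c > 0" "c\<^sup>2 = 2 * t" using t by (auto simp: c_def)
  have "complex_of_real (exp (- ((l / c)^2) / 2)) = char std_normal_distribution (l / c)"
    by (simp add: char_std_normal_distribution)
  also have "\<dots> = (LINT x|lborel. std_normal_density x *\<^sub>R iexp (l / c * x))"
    unfolding char_def by (subst integral_density) (auto simp: normal_density_nonneg)
  also have "\<dots> = \<bar>c\<bar> *\<^sub>R (LINT x|lborel. std_normal_density (0 + c * x) *\<^sub>R iexp (l / c * (0 + c * x)))"
    by (rule lborel_integral_real_affine) (use c in auto)
  also have "(\<lambda>x. std_normal_density (0 + c * x) *\<^sub>R iexp (l / c * (0 + c * x)))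
     = (\<lambda>x. (1 / sqrt (2 * pi)) *\<^sub>R (cis (l * x) * exp (- (t * x\<^sup>2))))"
  proof
    fix x
    have "std_normal_density (0 + c * x) = 1 / sqrt (2 * pi) * exp (- (t * x\<^sup>2))"
      using c by (simp add: normal_density_def power_mult_distrib)
    moreover have "iexp (l / c * (0 + c * x)) = cis (l * x)"
      using c by (simp add: cis_conv_exp)
    ultimately show "std_normal_density (0 + c * x) *\<^sub>R iexp (l / c * (0 + c * x)) = (1 / sqrt (2 * pi)) *\<^sub>R (cis (l * x) * exp (- (t * x\<^sup>2)))"
      by (simp add: scaleR_conv_of_real)
  qed
  finally have "complex_of_real (exp (- ((l / c)^2) / 2)) = c / sqrt (2 * pi) * (LINT x|lborel. (cis (l * x) * exp (- (t * x\<^sup>2))))"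
    using c by (simp add: scaleR_conv_of_real)
  then have "(LINT x|lborel. (cis (l * x) * exp (- (t * x\<^sup>2)))) = complex_of_real (sqrt (2 * pi) / c * exp (- ((l / c)^2) / 2))"
    using c by (simp add: field_simps)
  also have "sqrt (2 * pi) / c = sqrt (pi / t)" by (simp add: c_def real_sqrt_divide[symmetric])
  also have "- ((l / c)^2) / 2 = - (l\<^sup>2 / (4 * t))" using c by (simp add: power_divide)
  finally show ?thesis by simp
qed

text \<open>Integration by parts: \<open>F\<close> is a primitive of the difference \<open>f\<close>
  of the two integrands and vanishes at both ends, so the first moment is a multiple of the plain
  integral.\<close>

lemma integral_gaussian_moment_cis_real:
  fixes t l :: real
  assumes t: "t > 0"
  shows "(LINT x|lborel. x * cis (l * x) * exp (- (t * x\<^sup>2))) = \<i> * l / (2 * t) * (sqrt (pi / t) * exp (- (l\<^sup>2 / (4 * t))))"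
proof -
  define F where "F = (\<lambda>x::real. - 1 / (2 * t) * (cis (l * x) * exp (- (t * x\<^sup>2))))"
  define f where "f = (\<lambda>x::real. x * cis (l * x) * exp (- (t * x\<^sup>2)) - \<i> * l / (2 * t) * (cis (l * x) * exp (- (t * x\<^sup>2))))"
  have int: "integrable lborel f"
    unfolding f_def using integrable_gaussian_moment_cis_real[OF t, of l] integrable_gaussian_cis_real[OF t, of l] by auto
  have lim: "((\<lambda>x. exp (- (t * x\<^sup>2))) \<longlongrightarrow> 0) at_top" "((\<lambda>x. exp (- (t * x\<^sup>2))) \<longlongrightarrow> 0) at_bot"
    using t by real_asymp+
  have nF: "norm (F x) = 1 / (2 * t) * exp (- (t * x\<^sup>2))" for x
    using t by (simp add: F_def norm_mult norm_divide)
  have limF: "(F \<longlongrightarrow> 0) at_top" "(F \<longlongrightarrow> 0) at_bot"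
    using lim[THEN tendsto_mult_right_zero, of "1 / (2 * t)"]
    by (simp_all add: tendsto_norm_zero_iff[symmetric, of F] nF)
  have "(LBINT x=-\<infinity>..\<infinity>. f x) = 0 - 0"
  proof (rule interval_integral_FTC_integrable)
    show "(F has_vector_derivative f x) (at x)" for x
      unfolding F_def f_def cis_conv_exp using t
      by (auto intro!: derivative_eq_intros has_vector_derivative_real_field simp: field_simps power2_eq_square)
    show "isCont f x" for x unfolding f_def cis_conv_exp using t
      by (intro continuous_intros) auto
    show "set_integrable lborel (einterval (- \<infinity>) \<infinity>) f"
      using int by (simp add: set_integrable_def)
    show "((F \<circ> real_of_ereal) \<longlongrightarrow> 0) (at_right (- \<infinity>))" "((F \<circ> real_of_ereal) \<longlongrightarrow> 0) (at_left \<infinity>)"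
      using limF by (simp_all add: ereal_tendsto_simps)
  qed auto
  then have "(LINT x|lborel. f x) = 0"
    by (simp add: interval_lebesgue_integral_def set_lebesgue_integral_def)
  then have "(LINT x|lborel. x * cis (l * x) * exp (- (t * x\<^sup>2))) = \<i> * l / (2 * t) * (LINT x|lborel. cis (l * x) * exp (- (t * x\<^sup>2)))"
    unfolding f_def using integrable_gaussian_moment_cis_real[OF t, of l] integrable_gaussian_cis_real[OF t, of l]
    by simp
  then show ?thesis by (simp add: integral_gaussian_cis_real[OF t])
qed

lemma
  fixes t :: real and \<xi> :: "'a::euclidean_space"
  assumes t: "t > 0"
  shows integrable_gaussian_cis: "integrable lborel (\<lambda>x. cis (x \<bullet> \<xi>) * exp (- (t * (norm x)\<^sup>2)))" (is ?A)
    and integral_gaussian_cis: "(LINT x|lborel. cis (x \<bullet> \<xi>) * exp (- (t * (norm x)\<^sup>2)))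
      = of_real ((pi / t) powr (DIM('a) / 2) * exp (- ((norm \<xi>)\<^sup>2 / (4 * t))))" (is ?B)
    and integrable_gaussian_moment_cis: "\<And>b. b \<in> Basis \<Longrightarrow>
      integrable lborel (\<lambda>x. (x \<bullet> b) * cis (x \<bullet> \<xi>) * exp (- (t * (norm x)\<^sup>2)))" (is "\<And>b. _ \<Longrightarrow> ?C b")
    and integral_gaussian_moment_cis: "\<And>b. b \<in> Basis \<Longrightarrow>
      (LINT x|lborel. (x \<bullet> b) * cis (x \<bullet> \<xi>) * exp (- (t * (norm x)\<^sup>2)))
      = \<i> * (\<xi> \<bullet> b) / (2 * t) * of_real ((pi / t) powr (DIM('a) / 2) * exp (- ((norm \<xi>)\<^sup>2 / (4 * t))))" (is "\<And>b. _ \<Longrightarrow> ?D b")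
proof -
  define F where "F = (\<lambda>j y. cis ((\<xi> \<bullet> j) * y) * exp (- (t * y\<^sup>2)))"
  have norm2: "(norm x)\<^sup>2 = (\<Sum>j\<in>Basis. (x \<bullet> j)\<^sup>2)" for x :: 'a
    unfolding power2_norm_eq_inner by (subst euclidean_inner) (simp add: power2_eq_square)
  have inner: "x \<bullet> \<xi> = (\<Sum>j\<in>Basis. (\<xi> \<bullet> j) * (x \<bullet> j))" for x
    by (subst euclidean_inner) (simp add: mult.commute)
  have prod: "cis (x \<bullet> \<xi>) * exp (- (t * (norm x)\<^sup>2)) = (\<Prod>j\<in>Basis. F j (x \<bullet> j))" for x
  proof -
    have "cis (x \<bullet> \<xi>) = (\<Prod>j\<in>Basis. cis ((\<xi> \<bullet> j) * (x \<bullet> j)))"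
      unfolding inner cis_conv_exp by (simp add: exp_sum sum_distrib_left)
    moreover have "exp (- (t * (norm x)\<^sup>2)) = (\<Prod>j\<in>Basis. exp (- (t * (x \<bullet> j)\<^sup>2)))"
      unfolding norm2 by (simp add: sum_distrib_left exp_sum sum_negf[symmetric])
    ultimately show ?thesis by (simp add: F_def prod.distrib)
  qed
  have F_int: "integrable lborel (F j)" "(LINT y|lborel. F j y) = sqrt (pi / t) * exp (- ((\<xi> \<bullet> j)\<^sup>2 / (4 * t)))" for j
    using integrable_gaussian_cis_real[OF t, of "\<xi> \<bullet> j"] integral_gaussian_cis_real[OF t, of "\<xi> \<bullet> j"]
    by (simp_all add: F_def)
  have pr: "(\<Prod>j\<in>(Basis::'a set). complex_of_real (sqrt (pi / t) * exp (- ((\<xi> \<bullet> j)\<^sup>2 / (4 * t)))))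
     = of_real ((pi / t) powr (DIM('a) / 2) * exp (- ((norm \<xi>)\<^sup>2 / (4 * t))))"
  proof -
    have "(\<Prod>j\<in>(Basis::'a set). sqrt (pi / t) * exp (- ((\<xi> \<bullet> j)\<^sup>2 / (4 * t))))
       = sqrt (pi / t) ^ DIM('a) * exp (\<Sum>j\<in>Basis. - ((\<xi> \<bullet> j)\<^sup>2 / (4 * t)))"
      by (simp add: prod.distrib exp_sum)
    also have "(\<Sum>j\<in>Basis. - ((\<xi> \<bullet> j)\<^sup>2 / (4 * t))) = - ((norm \<xi>)\<^sup>2 / (4 * t))"
      unfolding norm2 by (simp add: sum_negf sum_divide_distrib)
    also have "sqrt (pi / t) ^ DIM('a) = (pi / t) powr (DIM('a) / 2)"
      using t by (simp add: powr_half_sqrt[symmetric] powr_powr powr_realpow[symmetric])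
    finally show ?thesis unfolding of_real_prod[symmetric] by simp
  qed
  show ?A unfolding prod by (rule integrable_prod_Basis) (rule F_int)
  show ?B unfolding prod pr[symmetric]
    by (subst integral_prod_Basis) (auto simp: F_int)
  fix b :: 'a assume b: "b \<in> Basis"
  \<comment> \<open>Only the factor of the coordinate b carries the moment; \<open>delta\<close>
    pulls it out of the product.\<close>
  define G where "G = (\<lambda>j y. (if j = b then complex_of_real y else 1) * F j y)"
  define c where "c = \<i> * (\<xi> \<bullet> b) / (2 * t)"
  have delta: "(\<Prod>j\<in>Basis. (if j = b then z j else 1) * w j) = z b * (\<Prod>j\<in>Basis. w j)" for z w :: "'a \<Rightarrow> complex"
    using b by (simp add: prod.distrib prod.delta)
  have prodG: "(x \<bullet> b) * cis (x \<bullet> \<xi>) * exp (- (t * (norm x)\<^sup>2)) = (\<Prod>j\<in>Basis. G j (x \<bullet> j))" for x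
    unfolding G_def delta prod[symmetric] by simp
  have G_int: "integrable lborel (G j)" for j
    using integrable_gaussian_moment_cis_real[OF t, of "\<xi> \<bullet> j"] F_int(1)[of j]
    by (cases "j = b") (simp_all add: G_def F_def mult.assoc)
  have G_val: "(LINT y|lborel. G j y) = (if j = b then c else 1) * (sqrt (pi / t) * exp (- ((\<xi> \<bullet> j)\<^sup>2 / (4 * t))))" for j
    using integral_gaussian_moment_cis_real[OF t, of "\<xi> \<bullet> j"] F_int(2)[of j]
    by (cases "j = b") (simp_all add: G_def F_def mult.assoc c_def)
  show "?C b" unfolding prodG by (rule integrable_prod_Basis) (rule G_int)
  have "(LINT x|lborel. (\<Prod>j\<in>Basis. G j (x \<bullet> j))) = (\<Prod>j\<in>Basis. (if j = b then c else 1) * complex_of_real (sqrt (pi / t) * exp (- ((\<xi> \<bullet> j)\<^sup>2 / (4 * t)))))"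
    by (subst integral_prod_Basis) (auto simp: G_int G_val)
  then show "?D b" unfolding prodG delta pr c_def by simp
qed

lemma
  fixes f :: "'a::euclidean_space \<Rightarrow> 'b::{banach, second_countable_topology}"
  shows integrable_lborel_uminus: "integrable lborel (\<lambda>x. f (- x)) \<longleftrightarrow> integrable lborel f"
    and integral_lborel_uminus: "(LINT x|lborel. f (- x)) = (LINT x|lborel. f x)"
proof -
  have d: "distr lborel borel uminus = (lborel :: 'a measure)"
    by (subst lborel_affine[of "-1" "0::'a"]) (auto simp: density_1 one_ennreal_def[symmetric] distr_distr comp_def)
  have *: "integrable lborel (\<lambda>x. g (- x))" if "integrable lborel g" for g :: "'a \<Rightarrow> 'b"
    using that by (subst (asm) d[symmetric], subst (asm) integrable_distr_eq) auto
  show "integrable lborel (\<lambda>x. f (- x)) \<longleftrightarrow> integrable lborel f"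
    using *[of f] *[of "\<lambda>x. f (- x)"] by auto
  show "(LINT x|lborel. f (- x)) = (LINT x|lborel. f x)"
  proof (cases "integrable lborel f")
    case True
    then have [measurable]: "f \<in> borel_measurable borel" by auto
    show ?thesis by (subst (2) d[symmetric], subst integral_distr) auto
  next
    case False
    then have "\<not> integrable lborel (\<lambda>x. f (- x))" using *[of "\<lambda>x. f (- x)"] by auto
    then show ?thesis by (metis not_integrable_integral_eq False)
  qed
qed

text \<open>The reflection rule holds for every function, non-integrable ones being covered by the
  default value 0 of the integral.\<close>

lemma integral_lborel_odd:
  fixes f :: "'a::euclidean_space \<Rightarrow> 'b::{banach, second_countable_topology}"
  assumes "\<And>x. f (- x) = - f x"
  shows "(LINT x|lborel. f x) = 0"
proof -
  have "(LINT x|lborel. f x) = - (LINT x|lborel. f x)"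
    using integral_lborel_uminus[of f] by (simp add: assms)
  then have "2 *\<^sub>R (LINT x|lborel. f x) = 0" by (simp add: scaleR_2 eq_neg_iff_add_eq_0)
  then show ?thesis by simp
qed

section \<open>The sphere integral defining \<open>D\<close>\<close>

lemma emeasure_sphere_measure: "emeasure (sphere_measure :: 'a::euclidean_space measure) UNIV < \<infinity>"
proof -
  have "emeasure (sphere_measure :: 'a measure) UNIV = (\<integral>\<^sup>+x. of_nat DIM('a) * indicator (ball 0 1) (x::'a) \<partial>lborel)"
  proof -
    have [measurable]: "ball (0::'a) 1 \<in> sets borel" by simp
    have m: "(\<lambda>x::'a. of_nat DIM('a) * indicator (ball 0 1) x :: ennreal) \<in> borel_measurable lborel"
      by measurable
    show ?thesis unfolding sphere_measure_def
      by (subst emeasure_distr, simp, simp, subst emeasure_density[OF m], simp, intro nn_integral_cong, simp)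
  qed
  also have "\<dots> = of_nat DIM('a) * emeasure lborel (ball (0::'a) 1)"
  proof -
    have [measurable]: "ball (0::'a) 1 \<in> sets borel" by simp
    have "(indicator (ball (0::'a) 1) :: 'a \<Rightarrow> ennreal) \<in> borel_measurable lborel" by measurable
    then show ?thesis by (subst nn_integral_cmult) (auto simp del: mem_ball_0)
  qed
  also have "\<dots> < \<infinity>"
    by (simp add: emeasure_ball ennreal_mult_less_top of_nat_less_top)
  finally show ?thesis .
qed

lemma
  fixes f :: "'a::euclidean_space \<Rightarrow> 'b::{banach, second_countable_topology}"
  assumes [measurable]: "f \<in> borel_measurable borel" and bound: "\<And>x. norm (f x) \<le> C"
  shows integrable_sphere_measure: "integrable sphere_measure f"
    and set_integrable_sphere_measure: "set_integrable sphere_measure (sphere 0 1) f"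
    and set_integral_sphere_measure: "(LINT \<theta>:sphere 0 1|sphere_measure. f \<theta>) = DIM('a) *\<^sub>R (LINT x:ball 0 1|lborel. f (sgn x))"
proof -
  interpret finite_measure "sphere_measure :: 'a measure"
    by standard (use emeasure_sphere_measure[where 'a='a] in \<open>auto simp: sphere_measure_def\<close>)
  have sets: "sets (sphere_measure :: 'a measure) = sets borel" by (simp add: sphere_measure_def)
  note meas = measurable_cong_sets[OF sets refl]
  have [measurable]: "sphere (0::'a) 1 \<in> sets borel" "ball (0::'a) 1 \<in> sets borel" by simp_all
  show "integrable sphere_measure f"
    by (rule integrable_const_bound[of _ C]) (auto simp: bound meas)
  show "set_integrable sphere_measure (sphere 0 1) f"
    unfolding set_integrable_def
    by (rule integrable_const_bound[of _ "\<bar>C\<bar>"]) (auto simp: meas split: split_indicator intro!: AE_I2 order.trans[OF bound])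
  have "(LINT \<theta>:sphere 0 1|sphere_measure. f \<theta>) =
     (LINT x|density lborel (\<lambda>x. of_nat DIM('a) * indicator (ball 0 1) x). indicator (sphere 0 1) (sgn x) *\<^sub>R f (sgn x))"
    unfolding set_lebesgue_integral_def sphere_measure_def by (subst integral_distr) auto
  also have "\<dots> = (LINT x|density lborel (\<lambda>x::'a. ennreal (real DIM('a) * indicator (ball 0 1) x)). indicator (sphere 0 1) (sgn x) *\<^sub>R f (sgn x))"
    by (intro arg_cong2[where f="integral\<^sup>L"] density_cong refl)
       (auto split: split_indicator simp: ennreal_of_nat_eq_real_of_nat)
  also have "\<dots> = (LINT x|lborel. (real DIM('a) * indicator (ball 0 1) x) *\<^sub>R (indicator (sphere 0 1) (sgn x) *\<^sub>R f (sgn x)))"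
    by (subst integral_density) (auto split: split_indicator)
  also have "\<dots> = (LINT x|lborel. DIM('a) *\<^sub>R (indicator (ball 0 1) x *\<^sub>R f (sgn x)))"
  proof (rule integral_cong_AE)
    show "AE x in lborel. (real DIM('a) * indicator (ball 0 1) x) *\<^sub>R (indicator (sphere 0 1) (sgn x) *\<^sub>R f (sgn x))
        = DIM('a) *\<^sub>R (indicator (ball (0::'a) 1) x *\<^sub>R f (sgn x))"
      using AE_lborel_singleton[of "0::'a"] by eventually_elim (auto simp: norm_sgn split: split_indicator)
  qed auto
  also have "\<dots> = DIM('a) *\<^sub>R (LINT x:ball 0 1|lborel. f (sgn x))"
    unfolding set_lebesgue_integral_def by (simp del: scaleR_scaleR)
  finally show "(LINT \<theta>:sphere 0 1|sphere_measure. f \<theta>) = DIM('a) *\<^sub>R (LINT x:ball 0 1|lborel. f (sgn x))" .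
qed

text \<open>Both sides are multiples of the integral M of f over the unit ball: the radial formula
  gives (n + p) M for the surface integral and (n + p) / 2 Gamma ((n + p) / 2) M for the Gaussian
  one. Gaussians are preferable to balls since their integrals factor over coordinates.\<close>

lemma sphere_integral_gaussian_nonneg:
  fixes f :: "'a::euclidean_space \<Rightarrow> real" and p C :: real
  assumes [measurable]: "f \<in> borel_measurable borel"
    and nonneg: "\<And>x. 0 \<le> f x"
    and hom: "\<And>r x. r > 0 \<Longrightarrow> f (r *\<^sub>R x) = r powr p * f x"
    and p: "p \<ge> 0" and C: "\<And>x. \<bar>f x\<bar> \<le> C * norm x powr p"
  shows "integrable lborel (\<lambda>x. f x * exp (- (norm x)\<^sup>2))"
    and "Gamma ((DIM('a) + p) / 2) * (LINT \<theta>:sphere 0 1|sphere_measure. f \<theta>)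
      = 2 * (LINT x|lborel. f x * exp (- (norm x)\<^sup>2))"
proof -
  define n where "n = DIM('a)"
  have n: "n > 0" by (simp add: n_def)
  have C0: "C \<ge> 0"
  proof -
    obtain b :: 'a where "b \<in> Basis" using nonempty_Basis by blast
    then have "\<bar>f b\<bar> \<le> C" using C[of b] by simp
    then show ?thesis by linarith
  qed
  have cb[measurable]: "cball (0::'a) r \<in> sets borel" "ball (0::'a) r \<in> sets borel" for r by simp_all
  define M where "M = enn2real (\<integral>\<^sup>+x. f x * indicator (cball 0 1) x \<partial>lborel)"
  have "(\<integral>\<^sup>+x. f x * indicator (cball 0 1) x \<partial>lborel) \<le> (\<integral>\<^sup>+x. ennreal C * indicator (cball 0 1) (x::'a) \<partial>lborel)"
  proof (intro nn_integral_mono)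
    fix x :: 'a
    have "f x \<le> C" if "norm x \<le> 1"
      using C[of x] that C0 p powr_mono2[of p "norm x" 1] mult_left_mono[of "norm x powr p" 1 C] by force
    then show "ennreal (f x * indicator (cball 0 1) x) \<le> ennreal C * indicator (cball 0 1) x"
      by (auto split: split_indicator intro: ennreal_leI)
  qed
  also have "\<dots> < \<infinity>"
    by (subst nn_integral_cmult) (auto simp: emeasure_cball ennreal_mult_less_top)
  finally have M: "(\<integral>\<^sup>+x. f x * indicator (cball 0 1) x \<partial>lborel) = ennreal M" "M \<ge> 0"
    unfolding M_def by auto
  note rad = nn_integral_homogeneous_radial[of f _ p M, OF _ _ nonneg hom _ M]
  have 1: "(\<integral>\<^sup>+x. ennreal (f x * exp (- (norm x)\<^sup>2)) \<partial>lborel) = ennreal ((n + p) / 2 * M * Gamma ((n + p) / 2))"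
  proof -
    have "(\<integral>\<^sup>+x. ennreal (f x * exp (- (norm x)\<^sup>2)) \<partial>lborel) = (\<integral>\<^sup>+x. ennreal (f x) * ennreal (exp (- (norm x)\<^sup>2)) \<partial>lborel)"
      by (simp add: ennreal_mult nonneg)
    also have "\<dots> = (\<integral>\<^sup>+r. ennreal ((n + p) / 2 * M * r powr ((n + p) / 2 - 1)) * indicator {0<..} r * ennreal (exp (- r)) \<partial>lborel)"
      unfolding n_def by (rule rad) (use p in \<open>auto simp: add_pos_nonneg\<close>)
    also have "\<dots> = (\<integral>\<^sup>+r. ennreal ((n + p) / 2 * M) * (ennreal (r powr ((n + p) / 2 - 1) * exp (- (1 * r))) * indicator {0<..} r) \<partial>lborel)"
      using p M by (auto intro!: nn_integral_cong simp: ennreal_mult[symmetric] split: split_indicator)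
    also have "\<dots> = ennreal ((n + p) / 2 * M) * ennreal (Gamma ((n + p) / 2))"
      using n p nn_integral_Gamma[of "(n + p) / 2" 1] by (subst nn_integral_cmult) auto
    finally show ?thesis using M p n by (simp add: ennreal_mult[symmetric] Gamma_real_nonneg)
  qed
  have 2: "(\<integral>\<^sup>+x. ennreal (indicator (ball 0 1) x * f (sgn x)) \<partial>lborel) = ennreal ((n + p) / n * M)"
  proof -
    have AE: "AE x in lborel. ennreal (indicator (ball 0 1) x * f (sgn x))
      = ennreal (f x) * (ennreal ((norm x)\<^sup>2 powr (- p / 2)) * indicator {0<..1} ((norm x)\<^sup>2))"
    proof -
      \<comment> \<open>The open ball omits the unit sphere, while \<open>{0<..1}\<close> in the
        variable |x|^2 includes it.\<close>
      have "sphere (0::'a) 1 \<in> null_sets lborel"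
        using negligible_sphere[of "0::'a" 1]
        by (auto simp: null_sets_completion_iff negligible_iff_null_sets negligible_convex_frontier)
      then have "AE x in lborel. x \<notin> sphere (0::'a) 1" by (rule AE_not_in)
      then show ?thesis using AE_lborel_singleton[of "0::'a"]
      proof eventually_elim
        fix x :: 'a assume x: "x \<notin> sphere 0 1" "x \<noteq> 0"
        have "f (sgn x) = f x * (norm x)\<^sup>2 powr (- p / 2)"
        proof -
          have "f (sgn x) = (1 / norm x) powr p * f x"
            unfolding sgn_div_norm using hom[of "1 / norm x" x] x by (simp add: divide_inverse)
          also have "(1 / norm x) powr p = norm x powr (- p)" using x by (simp add: powr_divide powr_minus_divide)
          also have "\<dots> = (norm x powr 2) powr (- p / 2)" by (simp only: powr_powr) simp
          also have "norm x powr 2 = (norm x)\<^sup>2" using x by simp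
          finally show ?thesis by simp
        qed
        moreover have "(norm x)\<^sup>2 \<le> 1 \<longleftrightarrow> norm x < 1"
          using x by (simp add: power_le_one_iff abs_square_le_1 less_le)
        ultimately show "ennreal (indicator (ball 0 1) x * f (sgn x))
          = ennreal (f x) * (ennreal ((norm x)\<^sup>2 powr (- p / 2)) * indicator {0<..1} ((norm x)\<^sup>2))"
          using x nonneg by (auto split: split_indicator simp: ennreal_mult[symmetric])
      qed
    qed
    have "(\<integral>\<^sup>+x. ennreal (indicator (ball 0 1) x * f (sgn x)) \<partial>lborel) =
       (\<integral>\<^sup>+x. ennreal (f x) * (ennreal ((norm x)\<^sup>2 powr (- p / 2)) * indicator {0<..1} ((norm x)\<^sup>2)) \<partial>lborel)"
      by (rule nn_integral_cong_AE) (rule AE)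
    also have "\<dots> = (\<integral>\<^sup>+r. ennreal ((n + p) / 2 * M * r powr ((n + p) / 2 - 1)) * indicator {0<..} r * (ennreal (r powr (- p / 2)) * indicator {0<..1} r) \<partial>lborel)"
      unfolding n_def by (rule rad) (use p in \<open>auto simp: add_pos_nonneg\<close>)
    also have "\<dots> = (\<integral>\<^sup>+r. ennreal ((n + p) / 2 * M) * (ennreal (r powr (n / 2 - 1)) * indicator {0<..1} r) \<partial>lborel)"
    proof -
      have e: "r powr ((n + p) / 2 - 1) * r powr (- p / 2) = r powr (n / 2 - 1)" for r
        by (simp add: powr_add[symmetric] add_divide_distrib)
      have "ennreal ((n + p) / 2 * M * r powr ((n + p) / 2 - 1)) * ennreal (r powr (- p / 2)) = ennreal ((n + p) / 2 * M) * ennreal (r powr (n / 2 - 1))" for r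
        unfolding e[symmetric] using p M by (simp add: ennreal_mult[symmetric] mult.assoc)
      then show ?thesis
        by (auto intro!: nn_integral_cong split: split_indicator)
    qed
    also have "\<dots> = ennreal ((n + p) / 2 * M) * ennreal (1 powr (n / 2) / (n / 2))"
      using n by (subst nn_integral_cmult) (auto simp only: nn_integral_powr_from_0[of "n / 2" 1], auto)
    finally show ?thesis using M p n by (simp add: ennreal_mult[symmetric])
  qed
  show i1: "integrable lborel (\<lambda>x. f x * exp (- (norm x)\<^sup>2))"
    using 1 nonneg by (intro integrableI_nonneg) auto
  have v1: "(LINT x|lborel. f x * exp (- (norm x)\<^sup>2)) = (n + p) / 2 * M * Gamma ((n + p) / 2)"
    using 1 nonneg M p n by (intro integral_eq_nn_integral[THEN trans]) (auto simp: Gamma_real_nonneg)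
  have v2: "(LINT x:ball 0 1|lborel. f (sgn x)) = (n + p) / n * M"
    unfolding set_lebesgue_integral_def using 2 nonneg M p n
    by (intro integral_eq_nn_integral[THEN trans]) auto
  have "(LINT \<theta>:sphere 0 1|sphere_measure. f \<theta>) = n * ((n + p) / n * M)"
  proof -
    \<comment> \<open>A homogeneous f may be unbounded, so it is cut off outside the closed unit
      ball, which leaves its values on the sphere unchanged.\<close>
    define f' where "f' = (\<lambda>x. if norm x \<le> 1 then f x else 0)"
    have [measurable]: "f' \<in> borel_measurable borel" unfolding f'_def by simp
    have b: "norm (f' x) \<le> C" for x
      using C[of x] C0 p powr_mono2[of p "norm x" 1] mult_left_mono[of "norm x powr p" 1 C] by (force simp: f'_def)
    have "(LINT \<theta>:sphere 0 1|sphere_measure. f \<theta>) = (LINT \<theta>:sphere 0 1|sphere_measure. f' \<theta>)"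
      unfolding set_lebesgue_integral_def
      by (intro Bochner_Integration.integral_cong) (auto simp: f'_def split: split_indicator)
    also have "\<dots> = n *\<^sub>R (LINT x:ball 0 1|lborel. f' (sgn x))"
      unfolding n_def by (rule set_integral_sphere_measure[OF _ b]) simp
    also have "(LINT x:ball 0 1|lborel. f' (sgn x)) = (LINT x:ball 0 1|lborel. f (sgn x))"
    proof -
      have "norm (sgn x) \<le> 1" for x :: 'a by (simp add: norm_sgn)
      then show ?thesis by (simp add: f'_def)
    qed
    finally show ?thesis by (simp add: v2)
  qed
  then show "Gamma ((DIM('a) + p) / 2) * (LINT \<theta>:sphere 0 1|sphere_measure. f \<theta>)
      = 2 * (LINT x|lborel. f x * exp (- (norm x)\<^sup>2))"
    using n unfolding n_def[symmetric] by (simp add: v1)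
qed

lemma
  fixes f :: "'a::euclidean_space \<Rightarrow> real" and p C :: real
  assumes [measurable]: "f \<in> borel_measurable borel"
    and hom: "\<And>r x. r > 0 \<Longrightarrow> f (r *\<^sub>R x) = r powr p * f x"
    and p: "p \<ge> 0" and C: "\<And>x. \<bar>f x\<bar> \<le> C * norm x powr p"
  shows integrable_homogeneous_gaussian: "integrable lborel (\<lambda>x. f x * exp (- (norm x)\<^sup>2))"
    and sphere_integral_gaussian: "Gamma ((DIM('a) + p) / 2) * (LINT \<theta>:sphere 0 1|sphere_measure. f \<theta>)
      = 2 * (LINT x|lborel. f x * exp (- (norm x)\<^sup>2))"
proof -
  \<comment> \<open>The positive and the negative part are again homogeneous of degree p and obey
    the same bound.\<close>
  define fp fn where "fp = (\<lambda>x. max 0 (f x))" and "fn = (\<lambda>x. max 0 (- f x))"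
  have f: "f = (\<lambda>x. fp x - fn x)" by (auto simp: fp_def fn_def)
  have [measurable]: "fp \<in> borel_measurable borel" "fn \<in> borel_measurable borel"
    unfolding fp_def fn_def by simp_all
  have hp: "fp (r *\<^sub>R x) = r powr p * fp x" "fn (r *\<^sub>R x) = r powr p * fn x" if "r > 0" for r x
    using that by (auto simp: fp_def fn_def hom max_mult_distrib_left)
  have Cp: "\<bar>fp x\<bar> \<le> C * norm x powr p" "\<bar>fn x\<bar> \<le> C * norm x powr p" for x
    using C[of x] by (auto simp: fp_def fn_def)
  note gp = sphere_integral_gaussian_nonneg[of fp, OF _ _ hp(1) p Cp(1)]
    sphere_integral_gaussian_nonneg[of fn, OF _ _ hp(2) p Cp(2)]
  have int: "integrable lborel (\<lambda>x. fp x * exp (- (norm x)\<^sup>2))" "integrable lborel (\<lambda>x. fn x * exp (- (norm x)\<^sup>2))"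
    by (rule gp; simp add: fp_def fn_def)+
  have eq: "Gamma ((DIM('a) + p) / 2) * (LINT \<theta>:sphere 0 1|sphere_measure. fp \<theta>) = 2 * (LINT x|lborel. fp x * exp (- (norm x)\<^sup>2))"
    "Gamma ((DIM('a) + p) / 2) * (LINT \<theta>:sphere 0 1|sphere_measure. fn \<theta>) = 2 * (LINT x|lborel. fn x * exp (- (norm x)\<^sup>2))"
    by (rule gp; simp add: fp_def fn_def)+
  have sets: "sets (sphere_measure :: 'a measure) = sets borel" by (simp add: sphere_measure_def)
  note meas = measurable_cong_sets[OF sets refl]
  have [measurable]: "sphere (0::'a) 1 \<in> sets borel" by simp
  have sint: "set_integrable sphere_measure (sphere 0 1) g" if "\<And>x. \<bar>g x\<bar> \<le> C * norm x powr p" "g \<in> borel_measurable borel" for g :: "'a \<Rightarrow> real"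
  proof -
    have "set_integrable sphere_measure (sphere 0 1) (\<lambda>x. indicator (sphere 0 1) x * g x)"
      using that by (intro set_integrable_sphere_measure[of _ "\<bar>C\<bar>"])
         (auto split: split_indicator intro: order.trans[OF that(1)])
    moreover have "(\<lambda>x. indicator (sphere 0 1) x *\<^sub>R (indicator (sphere 0 1) x * g x)) = (\<lambda>x. indicator (sphere 0 1) x *\<^sub>R g x)"
      by (auto split: split_indicator)
    ultimately show ?thesis unfolding set_integrable_def by simp
  qed
  show "integrable lborel (\<lambda>x. f x * exp (- (norm x)\<^sup>2))"
    using int unfolding f by (simp add: left_diff_distrib)
  have "(LINT \<theta>:sphere 0 1|sphere_measure. f \<theta>) = (LINT \<theta>:sphere 0 1|sphere_measure. fp \<theta>) - (LINT \<theta>:sphere 0 1|sphere_measure. fn \<theta>)"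
    unfolding f by (rule set_integral_diff) (auto intro!: sint Cp)
  moreover have "(LINT x|lborel. f x * exp (- (norm x)\<^sup>2)) = (LINT x|lborel. fp x * exp (- (norm x)\<^sup>2)) - (LINT x|lborel. fn x * exp (- (norm x)\<^sup>2))"
    unfolding f using int by (simp add: left_diff_distrib)
  ultimately show "Gamma ((DIM('a) + p) / 2) * (LINT \<theta>:sphere 0 1|sphere_measure. f \<theta>)
      = 2 * (LINT x|lborel. f x * exp (- (norm x)\<^sup>2))"
    using eq by (simp add: right_diff_distrib)
qed

section \<open>Integrability of powers of the norm near the origin and at infinity\<close>

lemma nn_integral_powr_tail:
  fixes q R :: real
  assumes q: "q > 0" and R: "R > 0"
  shows "(\<integral>\<^sup>+t. ennreal (t powr (- q - 1)) * indicator {R..} t \<partial>lborel) = ennreal (R powr (- q) / q)"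
proof -
  have "((\<lambda>t. t powr (- q - 1)) has_integral (- (R powr ((- q - 1) + 1)) / ((- q - 1) + 1))) {R..}"
    by (rule has_integral_powr_to_inf) (use q R in auto)
  then have "(\<integral>\<^sup>+t. ennreal (indicator {R..} t * t powr (- q - 1)) \<partial>lborel) = ennreal (R powr (- q) / q)"
    using q by (subst nn_integral_has_integral_lebesgue) auto
  then show ?thesis
    by (rule trans[rotated]) (auto intro!: nn_integral_cong split: split_indicator)
qed

lemma integrable_norm_powr_ball:
  assumes p: "p > - real DIM('a)"
  shows "integrable lborel (\<lambda>x::'a::euclidean_space. norm x powr p * indicator (cball 0 R) x)"
proof (cases "R \<ge> 0")
  case True
  define c where "c = DIM('a) / 2 * unit_ball_vol DIM('a)"
  have c: "c \<ge> 0" by (simp add: c_def)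
  have [measurable]: "cball (0::'a) R \<in> sets borel" by simp
  have "(\<integral>\<^sup>+x. ennreal (norm (x::'a) powr p * indicator (cball 0 R) x) \<partial>lborel)
     = (\<integral>\<^sup>+x. ennreal (((norm (x::'a))\<^sup>2) powr (p / 2)) * indicator {..R\<^sup>2} ((norm x)\<^sup>2) \<partial>lborel)"
  proof (intro nn_integral_cong)
    fix x :: 'a
    have "(norm x)\<^sup>2 powr (p / 2) = norm x powr p"
    proof (cases "x = 0")
      case False
      have "(norm x)\<^sup>2 powr (p / 2) = (norm x powr 2) powr (p / 2)" using False by simp
      also have "\<dots> = norm x powr p" by (simp only: powr_powr) simp
      finally show ?thesis .
    qed simp
    moreover have "norm x \<le> R \<longleftrightarrow> (norm x)\<^sup>2 \<le> R\<^sup>2" using True by (simp add: power_mono_iff)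
    ultimately show "ennreal (norm x powr p * indicator (cball 0 R) x) = ennreal (((norm x)\<^sup>2) powr (p / 2)) * indicator {..R\<^sup>2} ((norm x)\<^sup>2)"
      by (auto split: split_indicator)
  qed
  also have "\<dots> = (\<integral>\<^sup>+r. ennreal (c * r powr (DIM('a) / 2 - 1)) * indicator {0<..} r * (ennreal (r powr (p / 2)) * indicator {..R\<^sup>2} r) \<partial>lborel)"
    unfolding c_def by (rule nn_integral_radial) simp
  also have "\<dots> = (\<integral>\<^sup>+r. ennreal c * (ennreal (r powr ((DIM('a) + p) / 2 - 1)) * indicator {0<..R\<^sup>2} r) \<partial>lborel)"
  proof (intro nn_integral_cong)
    fix r :: real
    have "r powr (DIM('a) / 2 - 1) * r powr (p / 2) = r powr ((DIM('a) + p) / 2 - 1)"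
      by (simp add: powr_add[symmetric] add_divide_distrib algebra_simps)
    then have "ennreal (c * r powr (DIM('a) / 2 - 1)) * ennreal (r powr (p / 2)) = ennreal c * ennreal (r powr ((DIM('a) + p) / 2 - 1))"
      using c by (simp add: ennreal_mult[symmetric] mult.assoc)
    then show "ennreal (c * r powr (DIM('a) / 2 - 1)) * indicator {0<..} r * (ennreal (r powr (p / 2)) * indicator {..R\<^sup>2} r)
      = ennreal c * (ennreal (r powr ((DIM('a) + p) / 2 - 1)) * indicator {0<..R\<^sup>2} r)"
      by (auto split: split_indicator)
  qed
  also have "\<dots> = ennreal c * ennreal (R\<^sup>2 powr ((DIM('a) + p) / 2) / ((DIM('a) + p) / 2))"
    using p nn_integral_powr_from_0[of "(DIM('a) + p) / 2" "R\<^sup>2"] by (subst nn_integral_cmult) auto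
  also have "\<dots> < \<infinity>" by (simp add: ennreal_mult_less_top)
  finally show ?thesis
    by (intro integrableI_nonneg) auto
next
  case False
  then have "cball (0::'a) R = {}" by simp
  then show ?thesis by simp
qed

lemma integrable_norm_powr_tail:
  assumes p: "p < - real DIM('a)" and R: "R > 0"
  shows "integrable lborel (\<lambda>x::'a::euclidean_space. norm x powr p * indicator {x. R \<le> norm x} x)"
proof -
  define c where "c = DIM('a) / 2 * unit_ball_vol DIM('a)"
  have c: "c \<ge> 0" by (simp add: c_def)
  have "(\<integral>\<^sup>+x. ennreal (norm (x::'a) powr p * indicator {x. R \<le> norm x} x) \<partial>lborel)
     = (\<integral>\<^sup>+x. ennreal (((norm (x::'a))\<^sup>2) powr (p / 2)) * indicator {R\<^sup>2..} ((norm x)\<^sup>2) \<partial>lborel)"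
  proof (intro nn_integral_cong)
    fix x :: 'a
    have "(norm x)\<^sup>2 powr (p / 2) = norm x powr p"
    proof (cases "x = 0")
      case False
      have "(norm x)\<^sup>2 powr (p / 2) = (norm x powr 2) powr (p / 2)" using False by simp
      also have "\<dots> = norm x powr p" by (simp only: powr_powr) simp
      finally show ?thesis .
    qed simp
    moreover have "R \<le> norm x \<longleftrightarrow> R\<^sup>2 \<le> (norm x)\<^sup>2" using R by (simp add: power_mono_iff)
    ultimately show "ennreal (norm x powr p * indicator {x. R \<le> norm x} x) = ennreal (((norm x)\<^sup>2) powr (p / 2)) * indicator {R\<^sup>2..} ((norm x)\<^sup>2)"
      by (auto split: split_indicator)
  qed
  also have "\<dots> = (\<integral>\<^sup>+r. ennreal (c * r powr (DIM('a) / 2 - 1)) * indicator {0<..} r * (ennreal (r powr (p / 2)) * indicator {R\<^sup>2..} r) \<partial>lborel)"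
    unfolding c_def by (rule nn_integral_radial) simp
  also have "\<dots> = (\<integral>\<^sup>+r. ennreal c * (ennreal (r powr (- (- (DIM('a) + p) / 2) - 1)) * indicator {R\<^sup>2..} r) \<partial>lborel)"
  proof (intro nn_integral_cong)
    fix r :: real
    have R2: "R\<^sup>2 > 0" using R by simp
    have e: "(DIM('a) / 2 - 1) + p / 2 = - (- (DIM('a) + p) / 2) - 1" by (simp add: field_simps)
    have "r powr (DIM('a) / 2 - 1) * r powr (p / 2) = r powr (- (- (DIM('a) + p) / 2) - 1)"
      by (simp only: powr_add[symmetric] e)
    then have "ennreal (c * r powr (DIM('a) / 2 - 1)) * ennreal (r powr (p / 2)) = ennreal c * ennreal (r powr (- (- (DIM('a) + p) / 2) - 1))"
      using c by (simp add: ennreal_mult[symmetric] mult.assoc)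
    moreover have "R\<^sup>2 \<le> r \<Longrightarrow> r > 0" using R2 by linarith
    ultimately show "ennreal (c * r powr (DIM('a) / 2 - 1)) * indicator {0<..} r * (ennreal (r powr (p / 2)) * indicator {R\<^sup>2..} r)
      = ennreal c * (ennreal (r powr (- (- (DIM('a) + p) / 2) - 1)) * indicator {R\<^sup>2..} r)"
      by (cases "R\<^sup>2 \<le> r") auto
  qed
  also have "\<dots> = ennreal c * ennreal (R\<^sup>2 powr (- (- (DIM('a) + p) / 2)) / (- (DIM('a) + p) / 2))"
    using p R nn_integral_powr_tail[of "- (DIM('a) + p) / 2" "R\<^sup>2"] by (subst nn_integral_cmult) auto
  also have "\<dots> < \<infinity>" by (simp add: ennreal_mult_less_top)
  finally show ?thesis
    by (intro integrableI_nonneg) auto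
qed

lemma
  fixes q c :: real
  assumes q: "q > -1" and c: "c > 0"
  shows integrable_abs_powr_gaussian: "integrable lborel (\<lambda>l::real. \<bar>l\<bar> powr q * exp (- (c * l\<^sup>2)))"
    and integral_abs_powr_gaussian: "(LINT l|lborel. \<bar>l\<bar> powr q * exp (- (c * l\<^sup>2))) = Gamma ((q + 1) / 2) * c powr (- ((q + 1) / 2))"
proof -
  have sq: "(l\<^sup>2) powr (q / 2) = \<bar>l\<bar> powr q" for l :: real
  proof (cases "l = 0")
    case False
    have "l\<^sup>2 powr (q / 2) = (\<bar>l\<bar> powr 2) powr (q / 2)" using False by simp
    also have "\<dots> = \<bar>l\<bar> powr q" by (simp only: powr_powr) simp
    finally show ?thesis .
  qed simp
  have "(\<integral>\<^sup>+l. ennreal (\<bar>l\<bar> powr q * exp (- (c * l\<^sup>2))) \<partial>lborel) = (\<integral>\<^sup>+l. ennreal ((norm l)\<^sup>2 powr (q / 2) * exp (- (c * (norm (l::real))\<^sup>2))) \<partial>lborel)"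
    by (simp add: sq)
  also have "\<dots> = (\<integral>\<^sup>+r. ennreal (DIM(real) / 2 * unit_ball_vol DIM(real) * r powr (DIM(real) / 2 - 1)) * indicator {0<..} r * ennreal (r powr (q / 2) * exp (- (c * r))) \<partial>lborel)"
    by (rule nn_integral_radial) simp
  also have "\<dots> = (\<integral>\<^sup>+r. ennreal (r powr ((q + 1) / 2 - 1) * exp (- (c * r))) * indicator {0<..} r \<partial>lborel)"
  proof (intro nn_integral_cong)
    fix r :: real
    have "r powr (1 / 2 - 1) * r powr (q / 2) = r powr ((q + 1) / 2 - 1)"
      by (simp add: powr_add[symmetric] add_divide_distrib algebra_simps)
    then show "ennreal (DIM(real) / 2 * unit_ball_vol DIM(real) * r powr (DIM(real) / 2 - 1)) * indicator {0<..} r * ennreal (r powr (q / 2) * exp (- (c * r)))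
       = ennreal (r powr ((q + 1) / 2 - 1) * exp (- (c * r))) * indicator {0<..} r"
      by (auto split: split_indicator simp: ennreal_mult[symmetric] mult.assoc[symmetric])
  qed
  also have "\<dots> = ennreal (Gamma ((q + 1) / 2) * c powr (- ((q + 1) / 2)))"
    by (rule nn_integral_Gamma) (use q c in auto)
  finally have *: "(\<integral>\<^sup>+l. ennreal (\<bar>l\<bar> powr q * exp (- (c * l\<^sup>2))) \<partial>lborel) = ennreal (Gamma ((q + 1) / 2) * c powr (- ((q + 1) / 2)))" .
  show "integrable lborel (\<lambda>l::real. \<bar>l\<bar> powr q * exp (- (c * l\<^sup>2)))"
    using * by (intro integrableI_nonneg) auto
  show "(LINT l|lborel. \<bar>l\<bar> powr q * exp (- (c * l\<^sup>2))) = Gamma ((q + 1) / 2) * c powr (- ((q + 1) / 2))"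
    using * q by (intro integral_eq_nn_integral[THEN trans]) (auto simp: Gamma_real_nonneg)
qed

lemma set_lebesgue_integral_sum:
  fixes f :: "'i \<Rightarrow> 'a \<Rightarrow> 'b::{banach, second_countable_topology}"
  assumes "\<And>i. i \<in> I \<Longrightarrow> set_integrable M A (f i)"
  shows "(LINT x:A|M. \<Sum>i\<in>I. f i x) = (\<Sum>i\<in>I. LINT x:A|M. f i x)"
  using assms unfolding set_lebesgue_integral_def set_integrable_def scaleR_sum_right
  by (rule Bochner_Integration.integral_sum)

section \<open>Sphere integrals of (i y)^s in closed form\<close>

context
  fixes s :: real
  assumes s: "0 < s" "s < 1"
begin

text \<open>Up to a constant factor, sgn y |y|^s is a superposition of the sines sin (l y) with
  weight sgn l |l|^(-1-s). The integral converges at 0 because |sin l| \<le> |l| and s < 1, at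
  infinity because s > 0. The constant itself is left unevaluated.\<close>

lemma integrable_sin_kernel: "integrable lborel (\<lambda>l::real. sin (l * y) * (sgn l * \<bar>l\<bar> powr (- 1 - s)))"
  and integral_sin_kernel: "(LINT l|lborel. sin (l * y) * (sgn l * \<bar>l\<bar> powr (- 1 - s)))
    = sgn y * \<bar>y\<bar> powr s * (LINT l|lborel. sin l * (sgn l * \<bar>l\<bar> powr (- 1 - s)))"
  and integral_abs_sin_kernel: "(LINT l|lborel. \<bar>sin (l * y) * (sgn l * \<bar>l\<bar> powr (- 1 - s))\<bar>)
    = \<bar>y\<bar> powr s * (LINT l|lborel. \<bar>sin l * (sgn l * \<bar>l\<bar> powr (- 1 - s))\<bar>)"
proof -
  define k where "k = (\<lambda>l::real. sin l * (sgn l * \<bar>l\<bar> powr (- 1 - s)))"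
  have [measurable]: "k \<in> borel_measurable borel" unfolding k_def by simp
  have k: "integrable lborel k"
  proof (rule Bochner_Integration.integrable_bound)
    show "integrable lborel (\<lambda>l::real. norm l powr (- s) * indicator (cball 0 1) l + norm l powr (- 1 - s) * indicator {l. 1 \<le> norm l} l)"
      using s by (intro Bochner_Integration.integrable_add integrable_norm_powr_ball integrable_norm_powr_tail) auto
    have "\<bar>k l\<bar> \<le> \<bar>l\<bar> powr (- s) * indicator (cball 0 1) l + \<bar>l\<bar> powr (- 1 - s) * indicator {l. 1 \<le> \<bar>l\<bar>} l" for l
    proof (cases "l = 0")
      case False
      have 1: "\<bar>k l\<bar> = \<bar>sin l\<bar> * \<bar>l\<bar> powr (- 1 - s)" using False by (simp add: k_def abs_mult)
      show ?thesis
      proof (cases "\<bar>l\<bar> \<le> 1")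
        case True
        have "\<bar>sin l\<bar> * \<bar>l\<bar> powr (- 1 - s) \<le> \<bar>l\<bar> * \<bar>l\<bar> powr (- 1 - s)"
          by (intro mult_right_mono abs_sin_x_le_abs_x) auto
        also have "\<dots> = \<bar>l\<bar> powr (- s)" using False by (simp add: powr_mult_base)
        finally show ?thesis using True 1 by (auto split: split_indicator simp: add_increasing2)
      next
        case F: False
        have "\<bar>sin l\<bar> * \<bar>l\<bar> powr (- 1 - s) \<le> 1 * \<bar>l\<bar> powr (- 1 - s)"
          by (intro mult_right_mono) auto
        then show ?thesis using F 1 by (auto split: split_indicator)
      qed
    qed (auto simp: k_def)
    then show "AE l in lborel. norm (k l) \<le> norm (norm l powr (- s) * indicator (cball 0 1) l + norm l powr (- 1 - s) * indicator {l. 1 \<le> norm l} l)"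
      by (intro AE_I2) (simp add: abs_of_nonneg)
  qed simp
  have scale: "sin (l * y) * (sgn l * \<bar>l\<bar> powr (- 1 - s)) = sgn y * \<bar>y\<bar> powr (1 + s) * k (0 + y * l)" if "y \<noteq> 0" for l
  proof -
    have "\<bar>y * l\<bar> powr (- 1 - s) = \<bar>y\<bar> powr (- 1 - s) * \<bar>l\<bar> powr (- 1 - s)" by (simp add: abs_mult powr_mult)
    moreover have "\<bar>y\<bar> powr (1 + s) * \<bar>y\<bar> powr (- 1 - s) = 1" using that by (simp add: powr_add[symmetric])
    ultimately have "\<bar>y\<bar> powr (1 + s) * \<bar>y * l\<bar> powr (- 1 - s) = \<bar>l\<bar> powr (- 1 - s)" by (metis mult.assoc mult_1)
    moreover have "sgn y * sgn (y * l) = sgn l"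
      using that by (auto simp: sgn_if zero_less_mult_iff)
    moreover have "sgn y * \<bar>y\<bar> powr (1 + s) * k (0 + y * l) = sin (y * l) * ((sgn y * sgn (y * l)) * (\<bar>y\<bar> powr (1 + s) * \<bar>y * l\<bar> powr (- 1 - s)))"
      by (simp add: k_def mult_ac)
    ultimately show ?thesis by (simp add: mult.commute)
  qed
  have kl: "sin l * (sgn l * \<bar>l\<bar> powr (- 1 - s)) = k l" for l by (simp add: k_def)
  have base: "\<bar>y\<bar> powr (1 + s) = \<bar>y\<bar> * \<bar>y\<bar> powr s" by (simp add: powr_mult_base)
  show "integrable lborel (\<lambda>l::real. sin (l * y) * (sgn l * \<bar>l\<bar> powr (- 1 - s)))"
    using lborel_integrable_real_affine[OF k, of y 0] by (cases "y = 0") (simp_all add: scale)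
  show "(LINT l|lborel. sin (l * y) * (sgn l * \<bar>l\<bar> powr (- 1 - s)))
    = sgn y * \<bar>y\<bar> powr s * (LINT l|lborel. sin l * (sgn l * \<bar>l\<bar> powr (- 1 - s)))"
    unfolding k_def[symmetric]
    using lborel_integral_real_affine[of y k 0] by (cases "y = 0") (simp_all add: scale base)
  show "(LINT l|lborel. \<bar>sin (l * y) * (sgn l * \<bar>l\<bar> powr (- 1 - s))\<bar>)
    = \<bar>y\<bar> powr s * (LINT l|lborel. \<bar>sin l * (sgn l * \<bar>l\<bar> powr (- 1 - s))\<bar>)"
    unfolding kl
    using lborel_integral_real_affine[of y "\<lambda>l. \<bar>k l\<bar>" 0] by (cases "y = 0") (simp_all add: scale base abs_mult)
qed

text \<open>Writing the signed power as a superposition of sines and exchanging integrals leaves the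
  explicit sine moment of a Gaussian, then a one-dimensional Gamma integral in l. The still unknown
  sine constant appears as a factor on the left.\<close>

lemma signed_gaussian_moment_aux:
  fixes \<xi> b :: "'a::euclidean_space"
  assumes b: "b \<in> Basis" and \<xi>: "\<xi> \<noteq> 0"
  shows "integrable lborel (\<lambda>x. (x \<bullet> b) * (sgn (x \<bullet> \<xi>) * \<bar>x \<bullet> \<xi>\<bar> powr s) * exp (- (norm x)\<^sup>2))"
    and "(LINT l|lborel. sin l * (sgn l * \<bar>l\<bar> powr (- 1 - s))) *
      (LINT x|lborel. (x \<bullet> b) * (sgn (x \<bullet> \<xi>) * \<bar>x \<bullet> \<xi>\<bar> powr s) * exp (- (norm x)\<^sup>2))
     = (\<xi> \<bullet> b) / 2 * pi powr (DIM('a) / 2) * Gamma ((1 - s) / 2) * ((norm \<xi>)\<^sup>2 / 4) powr (- ((1 - s) / 2))"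
proof -
  define k where "k = (\<lambda>l::real. sgn l * \<bar>l\<bar> powr (- 1 - s))"
  define e where "e = (\<lambda>x::'a. (x \<bullet> b) * exp (- (norm x)\<^sup>2))"
  have [measurable]: "k \<in> borel_measurable borel" unfolding k_def by simp
  have [measurable]: "e \<in> borel_measurable borel" unfolding e_def by simp
  define S where "S = (LINT l|lborel. sin l * k l)"
  define S' where "S' = (LINT l|lborel. \<bar>sin l * k l\<bar>)"
  \<comment> \<open>\<open>f\<close> is the identity for the signed power itself and the constant 1
    for its absolute value, which is the majorant in the Fubini argument.\<close>
  have hom: "(r *\<^sub>R x \<bullet> b) * (f (sgn (r *\<^sub>R x \<bullet> \<xi>)) * \<bar>r *\<^sub>R x \<bullet> \<xi>\<bar> powr s) = r powr (1 + s) * ((x \<bullet> b) * (f (sgn (x \<bullet> \<xi>)) * \<bar>x \<bullet> \<xi>\<bar> powr s))"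
    if "r > 0" for r x and f :: "real \<Rightarrow> real"
    using that powr_mult_base[of r s] by (simp add: sgn_mult abs_mult powr_mult)
  have bd: "\<bar>(x \<bullet> b) * (f (sgn (x \<bullet> \<xi>)) * \<bar>x \<bullet> \<xi>\<bar> powr s)\<bar> \<le> norm \<xi> powr s * norm x powr (1 + s)" if "\<And>z. \<bar>f (sgn z)\<bar> \<le> 1" for x and f :: "real \<Rightarrow> real"
  proof -
    have "\<bar>x \<bullet> b\<bar> \<le> norm x" using b by (rule Basis_le_norm)
    moreover have "\<bar>x \<bullet> \<xi>\<bar> powr s \<le> (norm x * norm \<xi>) powr s"
      using s by (intro powr_mono2 Cauchy_Schwarz_ineq2) auto
    ultimately have "\<bar>x \<bullet> b\<bar> * (\<bar>f (sgn (x \<bullet> \<xi>))\<bar> * \<bar>x \<bullet> \<xi>\<bar> powr s) \<le> norm x * (1 * (norm x * norm \<xi>) powr s)"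
      using that by (intro mult_mono) auto
    also have "\<dots> = norm \<xi> powr s * norm x powr (1 + s)"
      using powr_mult_base[of "norm x" s] by (simp add: powr_mult mult_ac)
    finally show ?thesis by (simp add: abs_mult)
  qed
  have i1: "integrable lborel (\<lambda>x. (x \<bullet> b) * (f (sgn (x \<bullet> \<xi>)) * \<bar>x \<bullet> \<xi>\<bar> powr s) * exp (- (norm x)\<^sup>2))"
    if "\<And>z. \<bar>f (sgn z)\<bar> \<le> 1" "f \<in> borel_measurable borel" for f :: "real \<Rightarrow> real"
    using s that(2) by (intro integrable_homogeneous_gaussian[where C="norm \<xi> powr s" and p="1 + s"] hom bd that) auto
  show "integrable lborel (\<lambda>x. (x \<bullet> b) * (sgn (x \<bullet> \<xi>) * \<bar>x \<bullet> \<xi>\<bar> powr s) * exp (- (norm x)\<^sup>2))"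
    using i1[of "\<lambda>z. z"] by (simp add: sgn_if)
  have sin1: "integrable lborel (\<lambda>l. sin (l * y) * k l)" "(LINT l|lborel. sin (l * y) * k l) = sgn y * \<bar>y\<bar> powr s * S"
    "(LINT l|lborel. \<bar>sin (l * y) * k l\<bar>) = \<bar>y\<bar> powr s * S'" for y
    unfolding k_def S_def S'_def by (rule integrable_sin_kernel integral_sin_kernel integral_abs_sin_kernel)+
  have int: "integrable (lborel \<Otimes>\<^sub>M lborel) (\<lambda>(x, l). e x * (sin (l * (x \<bullet> \<xi>)) * k l))"
  proof (rule lborel_pair.Fubini_integrable)
    have "integrable lborel (\<lambda>x. S' * \<bar>(x \<bullet> b) * (1 * \<bar>x \<bullet> \<xi>\<bar> powr s) * exp (- (norm x)\<^sup>2)\<bar>)"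
      using i1[of "\<lambda>_. 1"] by (intro integrable_mult_right integrable_abs) auto
    also have "(\<lambda>x. S' * \<bar>(x \<bullet> b) * (1 * \<bar>x \<bullet> \<xi>\<bar> powr s) * exp (- (norm x)\<^sup>2)\<bar>) = (\<lambda>x. LINT l|lborel. norm (case (x, l) of (x, l) \<Rightarrow> e x * (sin (l * (x \<bullet> \<xi>)) * k l)))"
    proof
      fix x
      have "(LINT l|lborel. norm (case (x, l) of (x, l) \<Rightarrow> e x * (sin (l * (x \<bullet> \<xi>)) * k l))) = (LINT l|lborel. \<bar>e x\<bar> * \<bar>sin (l * (x \<bullet> \<xi>)) * k l\<bar>)"
        by (simp add: abs_mult)
      also have "\<dots> = \<bar>e x\<bar> * (\<bar>x \<bullet> \<xi>\<bar> powr s * S')" using sin1(3) by simp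
      finally show "S' * \<bar>(x \<bullet> b) * (1 * \<bar>x \<bullet> \<xi>\<bar> powr s) * exp (- (norm x)\<^sup>2)\<bar> = (LINT l|lborel. norm (case (x, l) of (x, l) \<Rightarrow> e x * (sin (l * (x \<bullet> \<xi>)) * k l)))"
        by (auto simp add: e_def abs_mult mult.commute)
    qed
    finally show "integrable lborel (\<lambda>x. LINT l|lborel. norm (case (x, l) of (x, l) \<Rightarrow> e x * (sin (l * (x \<bullet> \<xi>)) * k l)))" .
    show "AE x in lborel. integrable lborel (\<lambda>l. case (x, l) of (x, l) \<Rightarrow> e x * (sin (l * (x \<bullet> \<xi>)) * k l))"
      using sin1(1) by auto
  qed (simp add: borel_prod[symmetric])
  have "S * (LINT x|lborel. (x \<bullet> b) * (sgn (x \<bullet> \<xi>) * \<bar>x \<bullet> \<xi>\<bar> powr s) * exp (- (norm x)\<^sup>2))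
     = (LINT x|lborel. e x * (sgn (x \<bullet> \<xi>) * \<bar>x \<bullet> \<xi>\<bar> powr s * S))"
    by (subst integral_mult_right_zero[symmetric]) (simp add: e_def mult_ac)
  also have "\<dots> = (LINT x|lborel. LINT l|lborel. e x * (sin (l * (x \<bullet> \<xi>)) * k l))"
    by (simp add: sin1)
  also have "\<dots> = (LINT l|lborel. LINT x|lborel. e x * (sin (l * (x \<bullet> \<xi>)) * k l))"
    by (rule lborel_pair.Fubini_integral[symmetric]) (rule int)
  also have "\<dots> = (LINT l|lborel. (\<xi> \<bullet> b) / 2 * pi powr (DIM('a) / 2) * (\<bar>l\<bar> powr (- s) * exp (- ((norm \<xi>)\<^sup>2 / 4 * l\<^sup>2))))"
  proof (intro Bochner_Integration.integral_cong refl)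
    fix l :: real
    have "(LINT x|lborel. e x * sin (l * (x \<bullet> \<xi>))) = (LINT x|lborel. Im ((x \<bullet> b) * cis (x \<bullet> (l *\<^sub>R \<xi>)) * exp (- (1 * (norm x)\<^sup>2))))"
      by (simp add: e_def mult_ac)
    also have "\<dots> = Im (LINT x|lborel. (x \<bullet> b) * cis (x \<bullet> (l *\<^sub>R \<xi>)) * exp (- (1 * (norm x)\<^sup>2)))"
      using integrable_gaussian_moment_cis[OF zero_less_one b, of "l *\<^sub>R \<xi>"] by (rule integral_Im)
    also have "\<dots> = l * (\<xi> \<bullet> b) / 2 * (pi powr (DIM('a) / 2) * exp (- ((norm \<xi>)\<^sup>2 / 4 * l\<^sup>2)))"
      by (subst integral_gaussian_moment_cis[OF zero_less_one b]) (simp add: power_mult_distrib mult_ac)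
    finally have 1: "(LINT x|lborel. e x * sin (l * (x \<bullet> \<xi>))) = l * (\<xi> \<bullet> b) / 2 * (pi powr (DIM('a) / 2) * exp (- ((norm \<xi>)\<^sup>2 / 4 * l\<^sup>2)))" .
    have 2: "l * k l = \<bar>l\<bar> powr (- s)"
    proof (cases "l = 0")
      case False
      have "l * k l = \<bar>l\<bar> * \<bar>l\<bar> powr (- 1 - s)" by (simp add: k_def sgn_if)
      then show ?thesis using False by (simp add: powr_mult_base)
    qed (use s in auto)
    have "(LINT x|lborel. e x * (sin (l * (x \<bullet> \<xi>)) * k l)) = (LINT x|lborel. e x * sin (l * (x \<bullet> \<xi>))) * k l"
      by (subst integral_mult_left_zero[symmetric]) (simp add: mult.assoc)
    also have "\<dots> = (\<xi> \<bullet> b) / 2 * (pi powr (DIM('a) / 2) * exp (- ((norm \<xi>)\<^sup>2 / 4 * l\<^sup>2))) * (l * k l)"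
      unfolding 1 by (simp add: mult_ac)
    finally show "(LINT x|lborel. e x * (sin (l * (x \<bullet> \<xi>)) * k l)) = (\<xi> \<bullet> b) / 2 * pi powr (DIM('a) / 2) * (\<bar>l\<bar> powr (- s) * exp (- ((norm \<xi>)\<^sup>2 / 4 * l\<^sup>2)))"
      unfolding 2 by (simp add: mult_ac)
  qed
  also have "\<dots> = (\<xi> \<bullet> b) / 2 * pi powr (DIM('a) / 2) * (Gamma ((- s + 1) / 2) * ((norm \<xi>)\<^sup>2 / 4) powr (- ((- s + 1) / 2)))"
    using s \<xi> by (subst integral_mult_right_zero, subst integral_abs_powr_gaussian) auto
  finally show "(LINT l|lborel. sin l * (sgn l * \<bar>l\<bar> powr (- 1 - s))) *
      (LINT x|lborel. (x \<bullet> b) * (sgn (x \<bullet> \<xi>) * \<bar>x \<bullet> \<xi>\<bar> powr s) * exp (- (norm x)\<^sup>2))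
     = (\<xi> \<bullet> b) / 2 * pi powr (DIM('a) / 2) * Gamma ((1 - s) / 2) * ((norm \<xi>)\<^sup>2 / 4) powr (- ((1 - s) / 2))"
    unfolding S_def k_def by simp
qed

text \<open>The sine constant S is eliminated by comparison with dimension one, b = \<xi> = 1, where
  the moment is directly the Gamma integral Gamma (1 + s / 2). The same comparison shows that S is
  not 0.\<close>

lemma signed_gaussian_moment:
  fixes \<xi> b :: "'a::euclidean_space"
  assumes b: "b \<in> Basis" and \<xi>: "\<xi> \<noteq> 0"
  shows "(LINT x|lborel. (x \<bullet> b) * (sgn (x \<bullet> \<xi>) * \<bar>x \<bullet> \<xi>\<bar> powr s) * exp (- (norm x)\<^sup>2))
     = (\<xi> \<bullet> b) * norm \<xi> powr (s - 1) * pi powr ((DIM('a) - 1) / 2) * Gamma (1 + s / 2)"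
proof -
  define S where "S = (LINT l|lborel. sin l * (sgn l * \<bar>l\<bar> powr (- 1 - s)))"
  define Q where "Q = Gamma ((1 - s) / 2) * (1 / 4) powr (- ((1 - s) / 2)) / 2"
  have Q: "Q > 0" unfolding Q_def using s by (intro divide_pos_pos mult_pos_pos Gamma_real_pos) auto
  have r: "y * (sgn y * \<bar>y\<bar> powr s) = \<bar>y\<bar> powr (1 + s)" for y :: real
    using powr_mult_base[of "\<bar>y\<bar>" s] by (auto simp: sgn_if)
  have SG: "S * Gamma (1 + s / 2) = pi powr (1 / 2) * Q"
  proof -
    have "(LINT y|lborel. y * (sgn y * \<bar>y\<bar> powr s) * exp (- y\<^sup>2)) = (LINT y|lborel. \<bar>y\<bar> powr (1 + s) * exp (- (1 * y\<^sup>2)))"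
      unfolding r by simp
    also have "\<dots> = Gamma (((1 + s) + 1) / 2) * 1 powr (- (((1 + s) + 1) / 2))"
      by (rule integral_abs_powr_gaussian) (use s in auto)
    also have "\<dots> = Gamma (1 + s / 2)" by (simp add: add_divide_distrib)
    finally have "(LINT y|lborel. y * (sgn y * \<bar>y\<bar> powr s) * exp (- y\<^sup>2)) = Gamma (1 + s / 2)" .
    then show ?thesis
      using signed_gaussian_moment_aux(2)[of "1::real" "1::real"] unfolding S_def Q_def by (simp add: mult_ac)
  qed
  moreover have "S * (LINT x|lborel. (x \<bullet> b) * (sgn (x \<bullet> \<xi>) * \<bar>x \<bullet> \<xi>\<bar> powr s) * exp (- (norm x)\<^sup>2))
     = (\<xi> \<bullet> b) * norm \<xi> powr (s - 1) * pi powr (DIM('a) / 2) * Q"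
  proof -
    have "((norm \<xi>)\<^sup>2 / 4) powr (- ((1 - s) / 2)) = (norm \<xi> powr 2 * (1 / 4)) powr (- ((1 - s) / 2))"
      using \<xi> by simp
    also have "\<dots> = (norm \<xi> powr 2) powr (- ((1 - s) / 2)) * (1 / 4) powr (- ((1 - s) / 2))"
      by (rule powr_mult)
    also have "(norm \<xi> powr 2) powr (- ((1 - s) / 2)) = norm \<xi> powr (s - 1)"
    proof -
      have e: "2 * - ((1 - s) / 2) = s - 1" by (simp add: field_simps)
      show ?thesis by (simp only: powr_powr e)
    qed
    finally show ?thesis
      using signed_gaussian_moment_aux(2)[OF b \<xi>] unfolding S_def Q_def by (simp add: mult_ac)
  qed
  moreover have "pi powr (DIM('a) / 2) = pi powr ((DIM('a) - 1) / 2) * pi powr (1 / 2)"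
    using DIM_positive[where 'a='a] by (simp add: powr_add[symmetric] add_divide_distrib[symmetric] of_nat_diff Suc_leI)
  moreover have "(\<xi> \<bullet> b) * norm \<xi> powr (s - 1) * (pi powr ((DIM('a) - 1) / 2) * pi powr (1 / 2)) * Q
     = S * ((\<xi> \<bullet> b) * norm \<xi> powr (s - 1) * pi powr ((DIM('a) - 1) / 2) * Gamma (1 + s / 2))"
    using arg_cong[OF SG, of "\<lambda>z. (\<xi> \<bullet> b) * norm \<xi> powr (s - 1) * pi powr ((DIM('a) - 1) / 2) * z"] by (simp only: mult_ac)
  ultimately have "S * (LINT x|lborel. (x \<bullet> b) * (sgn (x \<bullet> \<xi>) * \<bar>x \<bullet> \<xi>\<bar> powr s) * exp (- (norm x)\<^sup>2))
     = S * ((\<xi> \<bullet> b) * norm \<xi> powr (s - 1) * pi powr ((DIM('a) - 1) / 2) * Gamma (1 + s / 2))"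
    by (simp only:)
  moreover have "S \<noteq> 0"
    using SG Q by auto
  ultimately show ?thesis by simp
qed

text \<open>By symmetry the vector integral of \<theta> sgn(\<theta> . \<xi>) |\<theta> . \<xi>|^s
  over the sphere is parallel to \<xi>; this is its length for |\<xi>| = 1.\<close>

definition sphere_const :: "'a::euclidean_space itself \<Rightarrow> real" where
  "sphere_const _ = 2 * pi powr ((DIM('a) - 1) / 2) * Gamma (1 + s / 2) / Gamma ((DIM('a) + 1 + s) / 2)"

text \<open>(i y)^s = |y|^s (cos (\<pi> s / 2) + i sgn y sin (\<pi> s / 2)). Multiplied by the odd
  factor \<theta> . b, the cosine part is odd and integrates to 0; the sine part is the signed
  Gaussian moment.\<close>

lemma sphere_integral_ipowr:
  fixes \<xi> b :: "'a::euclidean_space"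
  assumes b: "b \<in> Basis" and \<xi>: "\<xi> \<noteq> 0"
  shows "set_integrable sphere_measure (sphere 0 1) (\<lambda>\<theta>. of_real (\<theta> \<bullet> b) * ipowr (\<theta> \<bullet> \<xi>) s)"
    and "(LINT \<theta>:sphere 0 1|sphere_measure. of_real (\<theta> \<bullet> b) * ipowr (\<theta> \<bullet> \<xi>) s)
     = \<i> * of_real (sin (pi * s / 2) * sphere_const TYPE('a) * (\<xi> \<bullet> b) * norm \<xi> powr (s - 1))"
proof -
  define fe fo where "fe = (\<lambda>x::'a. (x \<bullet> b) * \<bar>x \<bullet> \<xi>\<bar> powr s)"
    and "fo = (\<lambda>x::'a. (x \<bullet> b) * (sgn (x \<bullet> \<xi>) * \<bar>x \<bullet> \<xi>\<bar> powr s))"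
  have [measurable]: "fe \<in> borel_measurable borel" "fo \<in> borel_measurable borel"
    unfolding fe_def fo_def by simp_all
  have hom: "fe (r *\<^sub>R x) = r powr (1 + s) * fe x" "fo (r *\<^sub>R x) = r powr (1 + s) * fo x" if "r > 0" for r x
    using that powr_mult_base[of r s] by (simp_all add: fe_def fo_def sgn_mult abs_mult powr_mult)
  have bd: "\<bar>fe x\<bar> \<le> norm \<xi> powr s * norm x powr (1 + s)" for x
  proof -
    have "\<bar>x \<bullet> b\<bar> \<le> norm x" using b by (rule Basis_le_norm)
    moreover have "\<bar>x \<bullet> \<xi>\<bar> powr s \<le> (norm x * norm \<xi>) powr s"
      using s by (intro powr_mono2 Cauchy_Schwarz_ineq2) auto
    ultimately have "\<bar>x \<bullet> b\<bar> * \<bar>x \<bullet> \<xi>\<bar> powr s \<le> norm x * (norm x * norm \<xi>) powr s"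
      by (intro mult_mono) auto
    also have "\<dots> = norm \<xi> powr s * norm x powr (1 + s)"
      using powr_mult_base[of "norm x" s] by (simp add: powr_mult mult_ac)
    finally show ?thesis by (simp add: abs_mult fe_def)
  qed
  have bdo: "\<bar>fo x\<bar> \<le> norm \<xi> powr s * norm x powr (1 + s)" for x
  proof -
    have "\<bar>fo x\<bar> \<le> \<bar>fe x\<bar>" by (auto simp: fo_def fe_def abs_mult sgn_if)
    then show ?thesis using bd[of x] by linarith
  qed
  have ps: "1 + s \<ge> 0" using s by simp
  have G: "Gamma ((DIM('a) + (1 + s)) / 2) > 0"
    using s by (intro Gamma_real_pos) auto
  have "Gamma ((DIM('a) + (1 + s)) / 2) * (LINT \<theta>:sphere 0 1|sphere_measure. fe \<theta>) = 2 * (LINT x|lborel. fe x * exp (- (norm x)\<^sup>2))"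
    by (rule sphere_integral_gaussian[OF _ hom(1) ps bd]) auto
  moreover have "(LINT x|lborel. fe x * exp (- (norm x)\<^sup>2)) = 0"
    by (rule integral_lborel_odd) (simp add: fe_def)
  ultimately have e: "(LINT \<theta>:sphere 0 1|sphere_measure. fe \<theta>) = 0" using G by auto
  have "Gamma ((DIM('a) + (1 + s)) / 2) * (LINT \<theta>:sphere 0 1|sphere_measure. fo \<theta>) = 2 * (LINT x|lborel. fo x * exp (- (norm x)\<^sup>2))"
    by (rule sphere_integral_gaussian[OF _ hom(2) ps bdo]) auto
  moreover have "(LINT x|lborel. fo x * exp (- (norm x)\<^sup>2)) = (\<xi> \<bullet> b) * norm \<xi> powr (s - 1) * pi powr ((DIM('a) - 1) / 2) * Gamma (1 + s / 2)"
    unfolding fo_def by (rule signed_gaussian_moment[OF b \<xi>])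
  ultimately have o: "(LINT \<theta>:sphere 0 1|sphere_measure. fo \<theta>) = sphere_const TYPE('a) * (\<xi> \<bullet> b) * norm \<xi> powr (s - 1)"
    using G by (simp add: sphere_const_def field_simps)
  have split: "of_real (x \<bullet> b) * ipowr (x \<bullet> \<xi>) s = of_real (cos (pi * s / 2) * fe x) + \<i> * of_real (sin (pi * s / 2) * fo x)" for x
    using s by (auto simp: ipowr_def fe_def fo_def sgn_if cis.ctr complex_eq_iff)
  have sets: "sets (sphere_measure :: 'a measure) = sets borel" by (simp add: sphere_measure_def)
  have [measurable]: "sphere (0::'a) 1 \<in> sets borel" by simp
  have sint: "set_integrable sphere_measure (sphere 0 1) g" if "\<And>x. \<bar>g x\<bar> \<le> norm \<xi> powr s * norm x powr (1 + s)" "g \<in> borel_measurable borel" for g :: "'a \<Rightarrow> real"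
  proof -
    have "set_integrable sphere_measure (sphere 0 1) (\<lambda>x. indicator (sphere 0 1) x * g x)"
      using that by (intro set_integrable_sphere_measure[of _ "norm \<xi> powr s"])
         (auto split: split_indicator intro: order.trans[OF that(1)])
    moreover have "(\<lambda>x. indicator (sphere 0 1) x *\<^sub>R (indicator (sphere 0 1) x * g x)) = (\<lambda>x. indicator (sphere 0 1) x *\<^sub>R g x)"
      by (auto split: split_indicator)
    ultimately show ?thesis unfolding set_integrable_def by simp
  qed
  note ie = sint[OF bd, simplified] and io = sint[OF bdo, simplified]
  have cint: "set_integrable sphere_measure (sphere 0 1) (\<lambda>x. z * complex_of_real (c * f x))"
    if "set_integrable sphere_measure (sphere 0 1) f" for z c and f :: "'a \<Rightarrow> real"
  proof -
    have "integrable sphere_measure (\<lambda>x. z * complex_of_real (c * (indicator (sphere 0 1) x *\<^sub>R f x)))"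
      using that unfolding set_integrable_def by (intro integrable_mult_right integrable_of_real)
    moreover have "(\<lambda>x. z * complex_of_real (c * (indicator (sphere 0 1) x *\<^sub>R f x))) = (\<lambda>x. indicator (sphere 0 1) x *\<^sub>R (z * complex_of_real (c * f x)))"
      by (auto split: split_indicator)
    ultimately show ?thesis unfolding set_integrable_def by simp
  qed
  have ie': "set_integrable sphere_measure (sphere 0 1) (\<lambda>x. complex_of_real (cos (pi * s / 2) * fe x))"
    using cint[OF ie, of 1 "cos (pi * s / 2)"] by (simp only: mult_1)
  have io': "set_integrable sphere_measure (sphere 0 1) (\<lambda>x. \<i> * complex_of_real (sin (pi * s / 2) * fo x))"
    using cint[OF io] .
  show "set_integrable sphere_measure (sphere 0 1) (\<lambda>\<theta>. of_real (\<theta> \<bullet> b) * ipowr (\<theta> \<bullet> \<xi>) s)"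
    unfolding split using ie' io' by (rule set_integral_add)
  have "(LINT \<theta>:sphere 0 1|sphere_measure. of_real (\<theta> \<bullet> b) * ipowr (\<theta> \<bullet> \<xi>) s)
     = (LINT \<theta>:sphere 0 1|sphere_measure. complex_of_real (cos (pi * s / 2) * fe \<theta>)) + (LINT \<theta>:sphere 0 1|sphere_measure. \<i> * complex_of_real (sin (pi * s / 2) * fo \<theta>))"
    unfolding split using ie' io' by (rule set_integral_add)
  also have "(LINT \<theta>:sphere 0 1|sphere_measure. complex_of_real (cos (pi * s / 2) * fe \<theta>)) = of_real (cos (pi * s / 2) * (LINT \<theta>:sphere 0 1|sphere_measure. fe \<theta>))"
    unfolding set_integral_complex_of_real by simp
  also have "(LINT \<theta>:sphere 0 1|sphere_measure. \<i> * complex_of_real (sin (pi * s / 2) * fo \<theta>)) = \<i> * of_real (sin (pi * s / 2) * (LINT \<theta>:sphere 0 1|sphere_measure. fo \<theta>))"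
    unfolding set_integral_mult_right set_integral_complex_of_real by simp
  finally show "(LINT \<theta>:sphere 0 1|sphere_measure. of_real (\<theta> \<bullet> b) * ipowr (\<theta> \<bullet> \<xi>) s)
     = \<i> * of_real (sin (pi * s / 2) * sphere_const TYPE('a) * (\<xi> \<bullet> b) * norm \<xi> powr (s - 1))"
    unfolding e o by (simp add: mult.assoc)
qed

text \<open>Expanding \<theta> . \<theta>' over the basis makes the double integral the sum of
  squares of the components of one vector, i c \<xi> |\<xi>|^(s-1) with c real; the sign of D is
  that of i^2.\<close>

lemma sphere_double_integral_ipowr:
  fixes \<xi> :: "'a::euclidean_space"
  shows "(LINT \<theta>:sphere 0 1|sphere_measure. LINT \<theta>':sphere 0 1|sphere_measure.
        of_real (\<theta> \<bullet> \<theta>') * ipowr (\<theta> \<bullet> \<xi>) s * ipowr (\<theta>' \<bullet> \<xi>) s)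
     = of_real (- (sin (pi * s / 2) * sphere_const TYPE('a))\<^sup>2 * norm \<xi> powr (2 * s))"
proof (cases "\<xi> = 0")
  case True
  then show ?thesis using s by (simp add: ipowr_def)
next
  case False
  define V where "V = (\<lambda>b. LINT \<theta>:sphere (0::'a) 1|sphere_measure. complex_of_real (\<theta> \<bullet> b) * ipowr (\<theta> \<bullet> \<xi>) s)"
  note si = sphere_integral_ipowr[OF _ False]
  have V: "V b = \<i> * of_real (sin (pi * s / 2) * sphere_const TYPE('a) * (\<xi> \<bullet> b) * norm \<xi> powr (s - 1))" if "b \<in> Basis" for b
    unfolding V_def using that by (rule si(2))
  have 1: "of_real (\<theta> \<bullet> \<theta>') * ipowr (\<theta> \<bullet> \<xi>) s * ipowr (\<theta>' \<bullet> \<xi>) s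
     = (\<Sum>b\<in>Basis. (of_real (\<theta> \<bullet> b) * ipowr (\<theta> \<bullet> \<xi>) s) * (of_real (\<theta>' \<bullet> b) * ipowr (\<theta>' \<bullet> \<xi>) s))" for \<theta> \<theta>' :: 'a
    by (subst euclidean_inner) (simp add: sum_distrib_right sum_distrib_left mult_ac)
  have 2: "(LINT \<theta>':sphere 0 1|sphere_measure. of_real (\<theta> \<bullet> \<theta>') * ipowr (\<theta> \<bullet> \<xi>) s * ipowr (\<theta>' \<bullet> \<xi>) s)
     = (\<Sum>b\<in>Basis. (of_real (\<theta> \<bullet> b) * ipowr (\<theta> \<bullet> \<xi>) s) * V b)" for \<theta> :: 'a
    unfolding 1 V_def
    by (subst set_lebesgue_integral_sum) (auto intro!: si(1) sum.cong)
  have "(LINT \<theta>:sphere 0 1|sphere_measure. \<Sum>b\<in>Basis. (of_real (\<theta> \<bullet> b) * ipowr (\<theta> \<bullet> \<xi>) s) * V b) = (\<Sum>b\<in>Basis. V b * V b)"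
    by (subst set_lebesgue_integral_sum) (auto intro!: si(1) sum.cong simp: V_def)
  also have "\<dots> = (\<Sum>b\<in>Basis. of_real (- (sin (pi * s / 2) * sphere_const TYPE('a))\<^sup>2 * (norm \<xi> powr (s - 1))\<^sup>2 * (\<xi> \<bullet> b)\<^sup>2))"
    by (intro sum.cong refl) (simp add: V power2_eq_square mult_ac)
  also have "\<dots> = of_real (- (sin (pi * s / 2) * sphere_const TYPE('a))\<^sup>2 * (norm \<xi> powr (s - 1))\<^sup>2 * (\<Sum>b\<in>Basis. (\<xi> \<bullet> b)\<^sup>2))"
    by (simp only: of_real_sum sum_distrib_left)
  also have "(\<Sum>b\<in>Basis. (\<xi> \<bullet> b)\<^sup>2) = (norm \<xi>)\<^sup>2"
    unfolding power2_norm_eq_inner by (subst euclidean_inner) (simp add: power2_eq_square)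
  also have "- (sin (pi * s / 2) * sphere_const TYPE('a))\<^sup>2 * (norm \<xi> powr (s - 1))\<^sup>2 * (norm \<xi>)\<^sup>2 = - (sin (pi * s / 2) * sphere_const TYPE('a))\<^sup>2 * norm \<xi> powr (2 * s)"
  proof -
    have "(norm \<xi> powr (s - 1))\<^sup>2 * (norm \<xi>)\<^sup>2 = (norm \<xi> * norm \<xi> powr (s - 1))\<^sup>2" by (simp add: power_mult_distrib)
    also have "norm \<xi> * norm \<xi> powr (s - 1) = norm \<xi> powr s" using powr_mult_base[of "norm \<xi>" "s - 1"] by simp
    also have "(norm \<xi> powr s)\<^sup>2 = norm \<xi> powr (2 * s)" by (simp add: power2_eq_square powr_add[symmetric])
    finally show ?thesis by (simp add: mult.assoc)
  qed
  finally show ?thesis unfolding 2 .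
qed

lemma D_const_eq: "D_const TYPE('n::finite) s = - (sin (pi * s / 2) * sphere_const TYPE(real^'n))\<^sup>2"
proof -
  have "sin (pi * s / 2) > 0" using s by (intro sin_gt_zero) auto
  moreover have "sphere_const TYPE(real^'n) > 0"
    unfolding sphere_const_def using s by (intro divide_pos_pos mult_pos_pos Gamma_real_pos) auto
  ultimately have neg: "- (sin (pi * s / 2) * sphere_const TYPE(real^'n))\<^sup>2 < 0" by simp
  show ?thesis unfolding D_const_def
  proof (rule the_equality)
    fix D assume D: "D < 0 \<and> (\<forall>\<xi>::real^'n. (LINT \<theta>:sphere 0 1|sphere_measure. LINT \<theta>':sphere 0 1|sphere_measure.
        of_real (\<theta> \<bullet> \<theta>') * ipowr (\<theta> \<bullet> \<xi>) s * ipowr (\<theta>' \<bullet> \<xi>) s) = of_real (D * norm \<xi> powr (2 * s)))"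
    \<comment> \<open>A single unit vector in place of \<xi> already determines D.\<close>
    obtain b :: "real^'n" where "b \<in> Basis" using nonempty_Basis by blast
    then have "norm b = 1" by simp
    with D have "complex_of_real (D * 1) = of_real (- (sin (pi * s / 2) * sphere_const TYPE(real^'n))\<^sup>2 * 1)"
      using sphere_double_integral_ipowr[of b] D[THEN conjunct2, rule_format, of b] by simp
    then show "D = - (sin (pi * s / 2) * sphere_const TYPE(real^'n))\<^sup>2" by (simp only: of_real_eq_iff mult_1_right)
  qed (rule conjI, rule neg, rule allI, rule sphere_double_integral_ipowr)
qed

text \<open>Reflection at s / 2 removes the sine, and duplication at (1 - s) / 2 brings in Gamma ((1
  - s) / 2); the auxiliary factor Gamma (1 - s / 2) of both formulas cancels.\<close>

lemma Gamma_half_angle: "sin (pi * s / 2) * Gamma (s / 2) * Gamma (1 - s) = sqrt pi * 2 powr (- s) * Gamma ((1 - s) / 2)"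
proof -
  have "Gamma (s / 2) * Gamma (1 - s / 2) = pi / sin (pi * (s / 2))"
  proof -
    have "complex_of_real (Gamma (s / 2) * Gamma (1 - s / 2)) = Gamma (of_real (s / 2)) * Gamma (1 - of_real (s / 2))"
      by (metis Gamma_complex_of_real of_real_1 of_real_diff of_real_mult)
    also have "\<dots> = of_real pi / sin (of_real pi * of_real (s / 2))" by (rule Gamma_reflection_complex)
    also have "\<dots> = of_real (pi / sin (pi * (s / 2)))" by (simp only: of_real_mult[symmetric] sin_of_real of_real_divide[symmetric])
    finally show ?thesis by (simp only: of_real_eq_iff)
  qed
  moreover have "Gamma ((1 - s) / 2) * Gamma (1 - s / 2) = 2 powr s * sqrt pi * Gamma (1 - s)"
  proof -
    define z where "z = (1 - s) / 2"
    have z: "z > 0" using s by (simp add: z_def)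
    have "complex_of_real (Gamma z * Gamma (z + 1 / 2)) = Gamma (of_real z) * Gamma (of_real z + 1 / 2)"
      using Gamma_complex_of_real[of z] Gamma_complex_of_real[of "z + 1 / 2"] by simp
    also have "\<dots> = exp ((1 - 2 * of_real z) * of_real (ln 2)) * of_real (sqrt pi) * Gamma (2 * of_real z)"
    proof (rule Gamma_legendre_duplication)
      have nz: "x \<notin> \<int>\<^sub>\<le>\<^sub>0" if "x > 0" for x :: real using that by (auto elim!: nonpos_Ints_cases)
      show "complex_of_real z \<notin> \<int>\<^sub>\<le>\<^sub>0" using nz[OF z] by (simp add: of_real_in_nonpos_Ints_iff)
      have "complex_of_real (z + 1 / 2) \<notin> \<int>\<^sub>\<le>\<^sub>0" using nz[of "z + 1 / 2"] z
        by (simp only: of_real_in_nonpos_Ints_iff) simp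
      then show "complex_of_real z + 1 / 2 \<notin> \<int>\<^sub>\<le>\<^sub>0" by simp
    qed
    also have "\<dots> = of_real (exp ((1 - 2 * z) * ln 2) * sqrt pi * Gamma (2 * z))"
      using Gamma_complex_of_real[of "2 * z"] by (simp add: exp_of_real[symmetric])
    also have "exp ((1 - 2 * z) * ln 2) = 2 powr s" by (simp add: z_def powr_def field_simps)
    finally have "Gamma z * Gamma (z + 1 / 2) = 2 powr s * sqrt pi * Gamma (2 * z)" by (simp only: of_real_eq_iff)
    moreover have "z + 1 / 2 = 1 - s / 2" "2 * z = 1 - s" by (simp_all add: z_def field_simps)
    ultimately show ?thesis unfolding z_def[symmetric] by (simp only:)
  qed
  moreover have "sin (pi * s / 2) > 0" using s by (intro sin_gt_zero) auto
  moreover have "Gamma (1 - s / 2) > 0" using s by (intro Gamma_real_pos) auto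
  moreover have "2 powr s * 2 powr (- s) = (1::real)" by (simp add: powr_add[symmetric])
  moreover have "sqrt pi * sqrt pi = pi" by simp
  ultimately show ?thesis
  proof -
    assume r: "Gamma (s / 2) * Gamma (1 - s / 2) = pi / sin (pi * (s / 2))"
      and d: "Gamma ((1 - s) / 2) * Gamma (1 - s / 2) = 2 powr s * sqrt pi * Gamma (1 - s)"
      and sn: "sin (pi * s / 2) > 0" and G: "Gamma (1 - s / 2) > 0" and t: "2 powr s * 2 powr (- s) = (1::real)" and sq: "sqrt pi * sqrt pi = pi"
    have "sin (pi * s / 2) * Gamma (s / 2) * Gamma (1 - s) * Gamma (1 - s / 2) = sin (pi * s / 2) * (Gamma (s / 2) * Gamma (1 - s / 2)) * Gamma (1 - s)"
      by (simp add: mult_ac)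
    also have "\<dots> = pi * Gamma (1 - s)" unfolding r using sn by simp
    also have "\<dots> = (sqrt pi * sqrt pi) * (2 powr s * 2 powr (- s)) * Gamma (1 - s)" unfolding sq t by simp
    also have "\<dots> = sqrt pi * 2 powr (- s) * (2 powr s * sqrt pi * Gamma (1 - s))" by (simp only: mult_ac)
    also have "\<dots> = sqrt pi * 2 powr (- s) * Gamma ((1 - s) / 2) * Gamma (1 - s / 2)" unfolding d[symmetric] by (simp only: mult_ac)
    finally show ?thesis using G by simp
  qed
qed

text \<open>The base of the square is the modulus of the Fourier multiplier of h |h|^(-(n+s+1)) at
  unit frequencies. The factor 1 / s in 1 / G_s turns Gamma (1 + s / 2) into Gamma (s / 2) / 2, so
  that the half-angle identity applies.\<close>

lemma D_const_G_const: "- (D_const TYPE('n::finite) s / (G_const s)\<^sup>2)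
    = (pi powr (CARD('n) / 2) * 2 powr (- s) * Gamma ((1 - s) / 2) / Gamma ((CARD('n) + 1 + s) / 2))\<^sup>2"
proof -
  have G: "Gamma (1 - s) > 0" using s by (intro Gamma_real_pos) auto
  have G1: "Gamma (1 + s / 2) = s / 2 * Gamma (s / 2)"
  proof -
    have "s / 2 \<notin> \<int>\<^sub>\<le>\<^sub>0" using s by (auto elim!: nonpos_Ints_cases)
    then show ?thesis using Gamma_plus1[of "s / 2"] by (simp add: add.commute)
  qed
  have p: "pi powr (CARD('n) / 2) = pi powr ((CARD('n) - 1) / 2) * sqrt pi"
  proof -
    have "pi powr (CARD('n) / 2) = pi powr ((CARD('n) - 1) / 2) * pi powr (1 / 2)"
      by (simp add: powr_add[symmetric] add_divide_distrib[symmetric] of_nat_diff Suc_leI)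
    then show ?thesis by (simp add: powr_half_sqrt)
  qed
  have "sin (pi * s / 2) * sphere_const TYPE(real^'n) / G_const s
    = 2 / s * pi powr ((CARD('n) - 1) / 2) / Gamma ((CARD('n) + 1 + s) / 2) * (sin (pi * s / 2) * Gamma (1 + s / 2) * Gamma (1 - s))"
    by (simp add: sphere_const_def G_const_def mult_ac)
  also have "\<dots> = pi powr ((CARD('n) - 1) / 2) / Gamma ((CARD('n) + 1 + s) / 2) * (sin (pi * s / 2) * Gamma (s / 2) * Gamma (1 - s))"
    unfolding G1 using s by simp
  also have "\<dots> = pi powr (CARD('n) / 2) * 2 powr (- s) * Gamma ((1 - s) / 2) / Gamma ((CARD('n) + 1 + s) / 2)"
    unfolding Gamma_half_angle p by (simp add: mult_ac)
  finally have e: "sin (pi * s / 2) * sphere_const TYPE(real^'n) / G_const s = \<dots>" .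
  have "- (D_const TYPE('n) s / (G_const s)\<^sup>2) = (sin (pi * s / 2) * sphere_const TYPE(real^'n) / G_const s)\<^sup>2"
    unfolding D_const_eq by (simp add: power_divide)
  then show ?thesis unfolding e .
qed

end

section \<open>Gaussian regularisation of the Riesz kernel\<close>

text \<open>This is the Beta value B(p, p). Replacing (1 + y)^(-2p) by a Gamma integral in r and
  integrating over y first leaves a Gamma integral in each variable.\<close>

lemma nn_integral_Beta2:
  fixes p :: real
  assumes p: "p > 0"
  shows "(\<integral>\<^sup>+y. ennreal (y powr (p - 1) * (1 + y) powr (- (2 * p))) * indicator {0<..} y \<partial>lborel)
    = ennreal ((Gamma p)\<^sup>2 / Gamma (2 * p))"
proof -
  have G: "Gamma (2 * p) > 0" "Gamma p > 0" using p by (auto intro: Gamma_real_pos)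
  have "ennreal (Gamma (2 * p)) * (\<integral>\<^sup>+y. ennreal (y powr (p - 1) * (1 + y) powr (- (2 * p))) * indicator {0<..} y \<partial>lborel)
     = (\<integral>\<^sup>+y. ennreal (y powr (p - 1)) * indicator {0<..} y * (ennreal (Gamma (2 * p) * (1 + y) powr (- (2 * p)))) \<partial>lborel)"
    by (subst nn_integral_cmult[symmetric]) (use G in \<open>auto intro!: nn_integral_cong simp: ennreal_mult[symmetric] mult_ac split: split_indicator\<close>)
  also have "\<dots> = (\<integral>\<^sup>+y. (\<integral>\<^sup>+r. ennreal (y powr (p - 1)) * indicator {0<..} y * (ennreal (r powr (2 * p - 1) * exp (- ((1 + y) * r))) * indicator {0<..} r) \<partial>lborel) \<partial>lborel)"
  proof (intro nn_integral_cong)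
    fix y :: real
    show "ennreal (y powr (p - 1)) * indicator {0<..} y * (ennreal (Gamma (2 * p) * (1 + y) powr (- (2 * p))))
       = (\<integral>\<^sup>+r. ennreal (y powr (p - 1)) * indicator {0<..} y * (ennreal (r powr (2 * p - 1) * exp (- ((1 + y) * r))) * indicator {0<..} r) \<partial>lborel)"
      using p nn_integral_Gamma[of "2 * p" "1 + y"] by (cases "y > 0") (auto simp: nn_integral_cmult)
  qed
  also have "\<dots> = (\<integral>\<^sup>+r. (\<integral>\<^sup>+y. ennreal (y powr (p - 1)) * indicator {0<..} y * (ennreal (r powr (2 * p - 1) * exp (- ((1 + y) * r))) * indicator {0<..} r) \<partial>lborel) \<partial>lborel)"
    by (rule lborel_pair.Fubini') measurable
  also have "\<dots> = (\<integral>\<^sup>+r. ennreal (Gamma p) * (ennreal (r powr (p - 1) * exp (- (1 * r))) * indicator {0<..} r) \<partial>lborel)"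
  proof (intro nn_integral_cong)
    fix r :: real
    show "(\<integral>\<^sup>+y. ennreal (y powr (p - 1)) * indicator {0<..} y * (ennreal (r powr (2 * p - 1) * exp (- ((1 + y) * r))) * indicator {0<..} r) \<partial>lborel)
      = ennreal (Gamma p) * (ennreal (r powr (p - 1) * exp (- (1 * r))) * indicator {0<..} r)"
    proof (cases "r > 0")
      case True
      have "(\<integral>\<^sup>+y. ennreal (y powr (p - 1)) * indicator {0<..} y * (ennreal (r powr (2 * p - 1) * exp (- ((1 + y) * r))) * indicator {0<..} r) \<partial>lborel)
        = (\<integral>\<^sup>+y. ennreal (r powr (2 * p - 1) * exp (- r)) * (ennreal (y powr (p - 1) * exp (- (r * y))) * indicator {0<..} y) \<partial>lborel)"
        using True by (intro nn_integral_cong) (auto simp: ennreal_mult[symmetric] algebra_simps exp_add exp_diff exp_minus divide_simps split: split_indicator)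
      also have "\<dots> = ennreal (r powr (2 * p - 1) * exp (- r)) * ennreal (Gamma p * r powr (- p))"
        using p True by (subst nn_integral_cmult) (auto simp: nn_integral_Gamma)
      also have "\<dots> = ennreal (Gamma p) * ennreal (r powr (p - 1) * exp (- (1 * r)))"
      proof -
        have e: "(2 * p - 1) + - p = p - 1" by simp
        have "r powr (2 * p - 1) * r powr (- p) = r powr (p - 1)" by (simp only: powr_add[symmetric] e)
        then have "r powr (2 * p - 1) * exp (- r) * (Gamma p * r powr (- p)) = Gamma p * (r powr (p - 1) * exp (- (1 * r)))"
          by (simp add: algebra_simps)
        then show ?thesis using G by (simp add: ennreal_mult[symmetric])
      qed
      finally show ?thesis using True by simp
    qed simp
  qed
  also have "\<dots> = ennreal (Gamma p) * ennreal (Gamma p * 1 powr (- p))"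
    using p nn_integral_Gamma[of p 1] by (subst nn_integral_cmult) auto
  finally have *: "ennreal (Gamma (2 * p)) * (\<integral>\<^sup>+y. ennreal (y powr (p - 1) * (1 + y) powr (- (2 * p))) * indicator {0<..} y \<partial>lborel) = ennreal ((Gamma p)\<^sup>2)"
    using G by (simp add: ennreal_mult[symmetric] power2_eq_square)
  have "ennreal ((Gamma p)\<^sup>2 / Gamma (2 * p)) = ennreal (1 / Gamma (2 * p)) * ennreal ((Gamma p)\<^sup>2)"
    using G by (simp add: ennreal_mult[symmetric])
  also have "\<dots> = (\<integral>\<^sup>+y. ennreal (y powr (p - 1) * (1 + y) powr (- (2 * p))) * indicator {0<..} y \<partial>lborel)"
    unfolding *[symmetric] mult.assoc[symmetric] using G by (simp add: ennreal_mult[symmetric])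
  finally show ?thesis ..
qed

text \<open>The exponent t t' / (t + t') is the one produced by convolving two Gaussians. With t' =
  t y it becomes t y / (1 + y), linear in t, so the t-integration is a Gamma integral of order q = 2
  \<alpha> - \<beta> and the y-integration a Beta integral with p = \<beta> - \<alpha>; the
  conditions on \<alpha> and \<beta> say that q and p are positive.\<close>

lemma nn_integral_harmonic_exp:
  fixes \<alpha> \<beta> \<rho> :: real
  assumes ab: "\<beta> < 2 * \<alpha>" "\<alpha> < \<beta>" and \<rho>: "\<rho> > 0"
  shows "(\<integral>\<^sup>+t. \<integral>\<^sup>+t'. ennreal ((t * t') powr (\<alpha> - 1) * (t + t') powr (- \<beta>) * exp (- (t * t' / (t + t') * \<rho>)))
      * indicator {0<..} t' * indicator {0<..} t \<partial>lborel \<partial>lborel)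
    = ennreal (Gamma (2 * \<alpha> - \<beta>) * \<rho> powr (- (2 * \<alpha> - \<beta>)) * ((Gamma (\<beta> - \<alpha>))\<^sup>2 / Gamma (2 * (\<beta> - \<alpha>))))"
proof -
  define F where "F = (\<lambda>t t'. ennreal ((t * t') powr (\<alpha> - 1) * (t + t') powr (- \<beta>) * exp (- (t * t' / (t + t') * \<rho>))) * indicator {0<..} t' * indicator {0<..} t)"
  define q where "q = 2 * \<alpha> - \<beta>"
  define p where "p = \<beta> - \<alpha>"
  have q: "q > 0" and p: "p > 0" using ab by (auto simp: q_def p_def)
  have [measurable]: "case_prod F \<in> borel_measurable (borel \<Otimes>\<^sub>M borel)" unfolding F_def by measurable
  define H where "H = (\<lambda>t y. ennreal (t powr (q - 1) * exp (- (\<rho> * (y / (1 + y)) * t))) * indicator {0<..} t * (ennreal (y powr (\<alpha> - 1) * (1 + y) powr (- \<beta>)) * indicator {0<..} y))"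
  have [measurable]: "case_prod H \<in> borel_measurable (borel \<Otimes>\<^sub>M borel)" unfolding H_def by measurable
  have "(\<integral>\<^sup>+t. \<integral>\<^sup>+t'. F t t' \<partial>lborel \<partial>lborel) = (\<integral>\<^sup>+t. \<integral>\<^sup>+y. H t y \<partial>lborel \<partial>lborel)"
  proof (rule nn_integral_cong)
    fix t :: real
    show "(\<integral>\<^sup>+t'. F t t' \<partial>lborel) = (\<integral>\<^sup>+y. H t y \<partial>lborel)"
    proof (cases "t > 0")
      case True
      have "(\<integral>\<^sup>+t'. F t t' \<partial>lborel) = \<bar>t\<bar> * (\<integral>\<^sup>+y. F t (0 + t * y) \<partial>lborel)"
        by (rule nn_integral_real_affine) (use True in auto)
      also have "\<dots> = (\<integral>\<^sup>+y. \<bar>t\<bar> * F t (0 + t * y) \<partial>lborel)"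
        by (rule nn_integral_cmult[symmetric]) measurable
      also have "\<dots> = (\<integral>\<^sup>+y. H t y \<partial>lborel)"
      proof (intro nn_integral_cong)
        fix y :: real
        show "\<bar>t\<bar> * F t (0 + t * y) = H t y"
        proof (cases "y > 0")
          case y: True
          have 1: "t + t * y = t * (1 + y)" by (simp add: algebra_simps)
          have "t * (t * y) / (t * (1 + y)) = t * y / (1 + y)" using True by (intro mult_divide_mult_cancel_left) auto
          then have 2: "t * (t * y) / (t * (1 + y)) * \<rho> = \<rho> * (y / (1 + y)) * t" by simp
          have 3: "t powr (q - 1) = t * (t powr (\<alpha> - 1) * t powr (\<alpha> - 1) * t powr (- \<beta>))"
          proof -
            have e: "1 + (\<alpha> - 1) + (\<alpha> - 1) + - \<beta> = q - 1" by (simp add: q_def)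
            have "t powr 1 * t powr (\<alpha> - 1) * t powr (\<alpha> - 1) * t powr (- \<beta>) = t powr (q - 1)"
              by (simp only: powr_add[symmetric] e)
            then show ?thesis using True by (simp add: mult.assoc)
          qed
          have "\<bar>t\<bar> * ((t * (t * y)) powr (\<alpha> - 1) * (t + t * y) powr (- \<beta>) * exp (- (t * (t * y) / (t + t * y) * \<rho>)))
             = t powr (q - 1) * exp (- (\<rho> * (y / (1 + y)) * t)) * (y powr (\<alpha> - 1) * (1 + y) powr (- \<beta>))"
            unfolding 1 2 3 using True y by (simp add: powr_mult mult_ac)
          then show ?thesis using True y by (simp add: F_def H_def ennreal_mult[symmetric])
        next
          case False
          then have "\<not> t * y > 0" using True by (simp add: zero_less_mult_iff)
          then show ?thesis using False by (simp add: F_def H_def)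
        qed
      qed
      finally show ?thesis .
    qed (simp add: F_def H_def)
  qed
  also have "\<dots> = (\<integral>\<^sup>+y. \<integral>\<^sup>+t. H t y \<partial>lborel \<partial>lborel)"
    by (rule lborel_pair.Fubini'[symmetric]) measurable
  also have "\<dots> = (\<integral>\<^sup>+y. ennreal (Gamma q * \<rho> powr (- q)) * (ennreal (y powr (p - 1) * (1 + y) powr (- (2 * p))) * indicator {0<..} y) \<partial>lborel)"
  proof (intro nn_integral_cong)
    fix y :: real
    show "(\<integral>\<^sup>+t. H t y \<partial>lborel) = ennreal (Gamma q * \<rho> powr (- q)) * (ennreal (y powr (p - 1) * (1 + y) powr (- (2 * p))) * indicator {0<..} y)"
    proof (cases "y > 0")
      case True
      have c: "\<rho> * (y / (1 + y)) > 0" using True \<rho> by auto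
      have "(\<integral>\<^sup>+t. H t y \<partial>lborel) = ennreal (Gamma q * (\<rho> * (y / (1 + y))) powr (- q)) * (ennreal (y powr (\<alpha> - 1) * (1 + y) powr (- \<beta>)) * indicator {0<..} y)"
        unfolding H_def by (subst nn_integral_multc, measurable) (simp only: nn_integral_Gamma[OF q c])
      also have "\<dots> = ennreal (Gamma q * \<rho> powr (- q)) * (ennreal (y powr (p - 1) * (1 + y) powr (- (2 * p))) * indicator {0<..} y)"
      proof -
        have e1: "- q + (\<alpha> - 1) = p - 1" and e2: "q + - \<beta> = - (2 * p)" by (simp_all add: q_def p_def)
        have "(\<rho> * (y / (1 + y))) powr (- q) = \<rho> powr (- q) * (y powr (- q) * (1 + y) powr q)"
          using True \<rho> by (simp add: powr_mult powr_divide powr_minus_divide)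
        moreover have "y powr (- q) * y powr (\<alpha> - 1) = y powr (p - 1)" by (simp only: powr_add[symmetric] e1)
        moreover have "(1 + y) powr q * (1 + y) powr (- \<beta>) = (1 + y) powr (- (2 * p))" by (simp only: powr_add[symmetric] e2)
        moreover have "Gamma q * (\<rho> powr (- q) * (y powr (- q) * (1 + y) powr q)) * (y powr (\<alpha> - 1) * (1 + y) powr (- \<beta>))
           = Gamma q * \<rho> powr (- q) * ((y powr (- q) * y powr (\<alpha> - 1)) * ((1 + y) powr q * (1 + y) powr (- \<beta>)))"
          by (simp only: mult_ac)
        ultimately have "Gamma q * (\<rho> * (y / (1 + y))) powr (- q) * (y powr (\<alpha> - 1) * (1 + y) powr (- \<beta>)) = Gamma q * \<rho> powr (- q) * (y powr (p - 1) * (1 + y) powr (- (2 * p)))"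
          by (simp only:)
        then show ?thesis using True q by (simp add: ennreal_mult[symmetric] Gamma_real_nonneg)
      qed
      finally show ?thesis .
    qed (simp add: H_def)
  qed
  also have "\<dots> = ennreal (Gamma q * \<rho> powr (- q)) * ennreal ((Gamma p)\<^sup>2 / Gamma (2 * p))"
    by (subst nn_integral_cmult) (auto simp: nn_integral_Beta2[OF p])
  also have "\<dots> = ennreal (Gamma q * \<rho> powr (- q) * ((Gamma p)\<^sup>2 / Gamma (2 * p)))"
    using p q by (simp add: ennreal_mult[symmetric] Gamma_real_nonneg)
  finally show ?thesis unfolding F_def p_def q_def .
qed

lemma
  fixes h :: "'a::euclidean_space" and t t' :: real
  assumes t: "t > 0" "t' > 0"
  shows integral_gaussian_convolution: "(LINT z|lborel. (z \<bullet> (h - z)) * (exp (- (t * (norm z)\<^sup>2)) * exp (- (t' * (norm (h - z))\<^sup>2))))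
    = exp (- (t * t' / (t + t') * (norm h)\<^sup>2)) * (pi / (t + t')) powr (DIM('a) / 2)
       * (t * t' / (t + t')\<^sup>2 * (norm h)\<^sup>2 - DIM('a) / (2 * (t + t')))"
proof -
  define \<sigma> where "\<sigma> = t + t'"
  have \<sigma>: "\<sigma> > 0" using t by (simp add: \<sigma>_def)
  \<comment> \<open>Centre of the product Gaussian: after the shift z = c + w the exponent has no
    mixed term, and the part of the inner product linear in w is odd.\<close>
  define c where "c = (t' / \<sigma>) *\<^sub>R h"
  define E where "E = exp (- (t * t' / \<sigma> * (norm h)\<^sup>2))"
  define f where "f = (\<lambda>z. (z \<bullet> (h - z)) * (exp (- (t * (norm z)\<^sup>2)) * exp (- (t' * (norm (h - z))\<^sup>2))))"
  define g where "g = (\<lambda>w::'a. exp (- (\<sigma> * (norm w)\<^sup>2)))"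
  have [measurable]: "f \<in> borel_measurable borel" unfolding f_def by measurable
  have tt: "t / \<sigma> = 1 - t' / \<sigma>" using \<sigma> by (simp add: \<sigma>_def field_simps)
  have hc: "h - c = (t / \<sigma>) *\<^sub>R h" by (simp add: c_def tt algebra_simps)
  have f: "f (c + w) = E * ((t * t' / \<sigma>\<^sup>2 * (norm h)\<^sup>2) * g w - (norm w)\<^sup>2 * g w + ((t / \<sigma> - t' / \<sigma>) * (w \<bullet> h)) * g w)" for w
  proof -
    have hw: "h - (c + w) = (t / \<sigma>) *\<^sub>R h - w" using hc by (simp add: algebra_simps)
    have 1: "(c + w) \<bullet> (h - (c + w)) = t * t' / \<sigma>\<^sup>2 * (norm h)\<^sup>2 - (norm w)\<^sup>2 + (t / \<sigma> - t' / \<sigma>) * (w \<bullet> h)"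
    proof -
      have "(v *\<^sub>R h + w) \<bullet> (u *\<^sub>R h - w) = u * v * (h \<bullet> h) - w \<bullet> w + (u - v) * (w \<bullet> h)" for u v
        by (simp add: inner_add_left inner_diff_right inner_commute[of h w] algebra_simps)
      from this[of "t' / \<sigma>" "t / \<sigma>"] show ?thesis
        unfolding hw unfolding c_def power2_norm_eq_inner by (simp add: power2_eq_square)
    qed
    have 2: "t * (norm (c + w))\<^sup>2 + t' * (norm (h - (c + w)))\<^sup>2 = t * t' / \<sigma> * (norm h)\<^sup>2 + \<sigma> * (norm w)\<^sup>2"
    proof -
      have q: "(norm (v *\<^sub>R h + w))\<^sup>2 = v\<^sup>2 * (h \<bullet> h) + 2 * v * (h \<bullet> w) + w \<bullet> w"
        "(norm (v *\<^sub>R h - w))\<^sup>2 = v\<^sup>2 * (h \<bullet> h) - 2 * v * (h \<bullet> w) + w \<bullet> w" for v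
        unfolding power2_norm_eq_inner
        by (simp_all add: inner_add_left inner_add_right inner_diff_left inner_diff_right inner_commute[of w h] power2_eq_square algebra_simps)
      have "t * (norm (c + w))\<^sup>2 + t' * (norm (h - (c + w)))\<^sup>2 = (t * (t' / \<sigma>)\<^sup>2 + t' * (t / \<sigma>)\<^sup>2) * (h \<bullet> h) + (t + t') * (w \<bullet> w) + (2 * t * (t' / \<sigma>) - 2 * t' * (t / \<sigma>)) * (h \<bullet> w)"
        unfolding hw unfolding c_def q by (simp add: algebra_simps)
      also have "t * (t' / \<sigma>)\<^sup>2 + t' * (t / \<sigma>)\<^sup>2 = t * t' / \<sigma>"
      proof -
        have "t * (t' / \<sigma>)\<^sup>2 + t' * (t / \<sigma>)\<^sup>2 = t * t' * (t + t') / \<sigma>\<^sup>2" by (simp add: power2_eq_square add_divide_distrib algebra_simps)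
        then show ?thesis using \<sigma> by (simp add: \<sigma>_def[symmetric] power2_eq_square)
      qed
      finally show ?thesis by (simp add: power2_norm_eq_inner \<sigma>_def)
    qed
    have 3: "exp (- (t * (norm (c + w))\<^sup>2)) * exp (- (t' * (norm (h - (c + w)))\<^sup>2)) = E * g w"
      unfolding E_def g_def exp_add[symmetric] using 2 by (intro arg_cong[of _ _ exp]) simp
    show ?thesis unfolding f_def 1 3 by (simp add: algebra_simps)
  qed
  have i1: "integrable lborel g" unfolding g_def by (rule integrable_gaussian[OF \<sigma>])
  have i2: "integrable lborel (\<lambda>w::'a. (norm w)\<^sup>2 * g w)" unfolding g_def by (rule integrable_gaussian_moment2[OF \<sigma>])
  have i3: "integrable lborel (\<lambda>w::'a. ((t / \<sigma> - t' / \<sigma>) * (w \<bullet> h)) * g w)"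
  proof (rule Bochner_Integration.integrable_bound)
    show "integrable lborel (\<lambda>w::'a. \<bar>t / \<sigma> - t' / \<sigma>\<bar> * norm h * (g w + (norm w)\<^sup>2 * g w))"
      using i1 i2 by (intro integrable_mult_right Bochner_Integration.integrable_add)
    have "\<bar>(t / \<sigma> - t' / \<sigma>) * (w \<bullet> h) * g w\<bar> \<le> \<bar>t / \<sigma> - t' / \<sigma>\<bar> * norm h * (g w + (norm w)\<^sup>2 * g w)" for w
    proof -
      have "0 \<le> (norm w - 1)\<^sup>2" by simp
      then have "2 * norm w \<le> 1 + (norm w)\<^sup>2" by (simp add: power2_diff)
      then have "norm w \<le> 1 + (norm w)\<^sup>2" using norm_ge_zero[of w] by linarith
      have "\<bar>w \<bullet> h\<bar> \<le> norm w * norm h" by (rule Cauchy_Schwarz_ineq2)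
      also have "\<dots> \<le> (1 + (norm w)\<^sup>2) * norm h" using \<open>norm w \<le> 1 + (norm w)\<^sup>2\<close> by (intro mult_right_mono) auto
      finally have "\<bar>w \<bullet> h\<bar> \<le> (1 + (norm w)\<^sup>2) * norm h" .
      then have "\<bar>t / \<sigma> - t' / \<sigma>\<bar> * \<bar>w \<bullet> h\<bar> * \<bar>g w\<bar> \<le> \<bar>t / \<sigma> - t' / \<sigma>\<bar> * ((1 + (norm w)\<^sup>2) * norm h) * \<bar>g w\<bar>"
        by (intro mult_right_mono mult_left_mono) auto
      moreover have "\<bar>g w\<bar> = g w" by (simp add: g_def)
      moreover have "\<bar>t / \<sigma> - t' / \<sigma>\<bar> * ((1 + (norm w)\<^sup>2) * norm h) * g w = \<bar>t / \<sigma> - t' / \<sigma>\<bar> * norm h * (g w + (norm w)\<^sup>2 * g w)"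
        by (simp only: distrib_left distrib_right mult_1_left mult_ac)
      ultimately show ?thesis by (simp only: abs_mult)
    qed
    then show "AE w in lborel. norm ((t / \<sigma> - t' / \<sigma>) * (w \<bullet> h) * g w) \<le> norm (\<bar>t / \<sigma> - t' / \<sigma>\<bar> * norm h * (g w + (norm w)\<^sup>2 * g w))"
      by (intro AE_I2) (simp add: g_def)
  qed (simp add: g_def)
  have odd: "(LINT w|lborel. ((t / \<sigma> - t' / \<sigma>) * (w \<bullet> h)) * g w) = 0"
    by (rule integral_lborel_odd) (simp add: g_def)
  have "(LINT z|lborel. f z) = (LINT w|lborel. f (c + w))"
    by (subst lborel_distr_plus[of c, symmetric], subst integral_distr) auto
  also have "\<dots> = E * ((t * t' / \<sigma>\<^sup>2 * (norm h)\<^sup>2) * (LINT w|lborel. g w) - (LINT w|lborel. (norm w)\<^sup>2 * g w))"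
    unfolding f using i1 i2 i3 odd by simp
  also have "\<dots> = E * ((t * t' / \<sigma>\<^sup>2 * (norm h)\<^sup>2) * (pi / \<sigma>) powr (DIM('a) / 2) - DIM('a) / (2 * \<sigma>) * (pi / \<sigma>) powr (DIM('a) / 2))"
    unfolding g_def by (simp only: integral_gaussian[OF \<sigma>] integral_gaussian_moment2[OF \<sigma>])
  finally show ?thesis unfolding f_def E_def \<sigma>_def by (simp add: algebra_simps)
qed

lemma
  fixes u v :: "real \<Rightarrow> real"
  assumes u: "integrable lborel u" and v: "integrable lborel v"
  shows integrable_lborel_times: "integrable (lborel :: (real \<times> real) measure) (\<lambda>p. u (fst p) * v (snd p))"
    and integral_lborel_times: "(LINT p|(lborel :: (real \<times> real) measure). u (fst p) * v (snd p)) = (LINT t|lborel. u t) * (LINT t|lborel. v t)"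
proof -
  have [measurable]: "u \<in> borel_measurable borel" "v \<in> borel_measurable borel" using u v by auto
  have *: "integrable (lborel \<Otimes>\<^sub>M lborel) (\<lambda>p. u (fst p) * v (snd p))"
    using u v by (intro lborel_pair.Fubini_integrable) (auto simp: abs_mult)
  then show "integrable (lborel :: (real \<times> real) measure) (\<lambda>p. u (fst p) * v (snd p))" by (simp add: lborel_prod)
  show "(LINT p|(lborel :: (real \<times> real) measure). u (fst p) * v (snd p)) = (LINT t|lborel. u t) * (LINT t|lborel. v t)"
    unfolding lborel_prod[symmetric]
    using lborel_pair.integral_fst'[OF *] by simp
qed

section \<open>Truncated Gamma integrals and the regularised kernel\<close>

definition gam :: "real \<Rightarrow> real \<Rightarrow> real \<Rightarrow> real" where
  "gam a T \<rho> = (LINT t|lborel. indicator {0<..T} t * (t powr (a - 1) * exp (- (t * \<rho>)))) / Gamma a"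

lemma
  fixes a \<rho> :: real
  assumes a: "a > 0" and \<rho>: "\<rho> > 0"
  shows integrable_Gamma: "integrable lborel (\<lambda>t. indicator {0<..} t * (t powr (a - 1) * exp (- (t * \<rho>))))"
    and integral_Gamma: "(LINT t|lborel. indicator {0<..} t * (t powr (a - 1) * exp (- (t * \<rho>)))) = Gamma a * \<rho> powr (- a)"
proof -
  have "(\<integral>\<^sup>+t. ennreal (indicator {0<..} t * (t powr (a - 1) * exp (- (t * \<rho>)))) \<partial>lborel) = (\<integral>\<^sup>+t. ennreal (t powr (a - 1) * exp (- (\<rho> * t))) * indicator {0<..} t \<partial>lborel)"
    by (intro nn_integral_cong) (auto split: split_indicator simp: mult.commute)
  also have "\<dots> = ennreal (Gamma a * \<rho> powr (- a))" by (rule nn_integral_Gamma[OF a \<rho>])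
  finally have *: "(\<integral>\<^sup>+t. ennreal (indicator {0<..} t * (t powr (a - 1) * exp (- (t * \<rho>)))) \<partial>lborel) = ennreal (Gamma a * \<rho> powr (- a))" .
  show "integrable lborel (\<lambda>t. indicator {0<..} t * (t powr (a - 1) * exp (- (t * \<rho>))))"
    using * by (intro integrableI_nonneg) auto
  show "(LINT t|lborel. indicator {0<..} t * (t powr (a - 1) * exp (- (t * \<rho>)))) = Gamma a * \<rho> powr (- a)"
    using * a by (intro integral_eq_nn_integral[THEN trans]) (auto simp: Gamma_real_nonneg)
qed

context
  fixes a :: real
  assumes a: "a > 0"
begin

lemma Gamma_a: "Gamma a > 0" using a by (rule Gamma_real_pos)

lemma integrable_gam:
  assumes "\<rho> \<ge> 0"
  shows "integrable lborel (\<lambda>t. indicator {0<..T} t * (t powr (a - 1) * exp (- (t * \<rho>))))" (is ?A)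
    and gam_le_T: "T > 0 \<Longrightarrow> gam a T \<rho> \<le> T powr a / (a * Gamma a)"
proof -
  have "(\<integral>\<^sup>+t. ennreal (indicator {0<..T} t * t powr (a - 1)) \<partial>lborel) = (\<integral>\<^sup>+t. ennreal (t powr (a - 1)) * indicator {0<..T} t \<partial>lborel)"
    by (intro nn_integral_cong) (auto split: split_indicator)
  moreover have "(\<integral>\<^sup>+t. ennreal (t powr (a - 1)) * indicator {0<..T} t \<partial>lborel) = ennreal (T powr a / a)" if "T \<ge> 0"
    by (rule nn_integral_powr_from_0[OF a that])
  ultimately have *: "(\<integral>\<^sup>+t. ennreal (indicator {0<..T} t * t powr (a - 1)) \<partial>lborel) = ennreal (T powr a / a)" if "T \<ge> 0"
    using that by simp
  have 1: "integrable lborel (\<lambda>t. indicator {0<..T} t * t powr (a - 1))"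
  proof (cases "T \<ge> 0")
    case True
    then show ?thesis using * by (intro integrableI_nonneg) auto
  qed simp
  have le: "indicator {0<..T} t * (t powr (a - 1) * exp (- (t * \<rho>))) \<le> indicator {0<..T} t * t powr (a - 1)" for t
    using assms by (auto split: split_indicator intro!: mult_left_le)
  show 2: ?A
    by (rule Bochner_Integration.integrable_bound[OF 1]) (use le in \<open>auto simp: abs_mult\<close>)
  assume T: "T > 0"
  have "(LINT t|lborel. indicator {0<..T} t * (t powr (a - 1) * exp (- (t * \<rho>)))) \<le> (LINT t|lborel. indicator {0<..T} t * t powr (a - 1))"
    by (rule integral_mono[OF 2 1 le])
  also have "\<dots> = T powr a / a"
    using * T a by (intro integral_eq_nn_integral[THEN trans]) auto
  finally show "gam a T \<rho> \<le> T powr a / (a * Gamma a)"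
    unfolding gam_def using Gamma_a by (simp add: divide_right_mono field_simps)
qed

lemma gam_nonneg: "0 \<le> gam a T \<rho>"
  unfolding gam_def using Gamma_a by (intro divide_nonneg_pos integral_nonneg) auto

lemma gam_le:
  assumes \<rho>: "\<rho> > 0"
  shows "gam a T \<rho> \<le> \<rho> powr (- a)"
proof -
  have "(LINT t|lborel. indicator {0<..T} t * (t powr (a - 1) * exp (- (t * \<rho>)))) \<le> (LINT t|lborel. indicator {0<..} t * (t powr (a - 1) * exp (- (t * \<rho>))))"
    using \<rho> by (intro integral_mono integrable_gam integrable_Gamma a) (auto split: split_indicator)
  then have "(LINT t|lborel. indicator {0<..T} t * (t powr (a - 1) * exp (- (t * \<rho>)))) \<le> Gamma a * \<rho> powr (- a)"
    by (simp only: integral_Gamma[OF a \<rho>])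
  then show ?thesis
    unfolding gam_def using Gamma_a by (simp only: pos_divide_le_eq mult.commute)
qed

text \<open>For t > T the factor t / T exceeds 1; inserting it raises the exponent of t by one and
  turns the tail into 1 / T times a Gamma integral of order a + 1. The constant a comes from Gamma
  (a + 1) = a Gamma a.\<close>

lemma gam_tail:
  assumes \<rho>: "\<rho> > 0" and T: "T > 0"
  shows "\<rho> powr (- a) - gam a T \<rho> \<le> a / T * \<rho> powr (- a - 1)"
proof -
  define f where "f = (\<lambda>t. t powr (a - 1) * exp (- (t * \<rho>)))"
  have i1: "integrable lborel (\<lambda>t. indicator {0<..} t * f t)" unfolding f_def by (rule integrable_Gamma[OF a \<rho>])
  have i2: "integrable lborel (\<lambda>t. indicator {0<..T} t * f t)" unfolding f_def by (rule integrable_gam) (use \<rho> in auto)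
  have i3: "integrable lborel (\<lambda>t. 1 / T * (indicator {0<..} t * (t powr ((a + 1) - 1) * exp (- (t * \<rho>)))))"
    using a \<rho> by (intro integrable_mult_right integrable_Gamma) auto
  have "\<rho> powr (- a) - gam a T \<rho> = ((LINT t|lborel. indicator {0<..} t * f t) - (LINT t|lborel. indicator {0<..T} t * f t)) / Gamma a"
    unfolding gam_def f_def using Gamma_a by (simp add: integral_Gamma[OF a \<rho>] diff_divide_distrib)
  also have "(LINT t|lborel. indicator {0<..} t * f t) - (LINT t|lborel. indicator {0<..T} t * f t) = (LINT t|lborel. indicator {0<..} t * f t - indicator {0<..T} t * f t)"
    using i1 i2 by simp
  also have "\<dots> \<le> (LINT t|lborel. 1 / T * (indicator {0<..} t * (t powr ((a + 1) - 1) * exp (- (t * \<rho>)))))"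
  proof (rule integral_mono[OF _ i3])
    show "integrable lborel (\<lambda>t. indicator {0<..} t * f t - indicator {0<..T} t * f t)" using i1 i2 by auto
    fix t :: real
    show "indicator {0<..} t * f t - indicator {0<..T} t * f t \<le> 1 / T * (indicator {0<..} t * (t powr ((a + 1) - 1) * exp (- (t * \<rho>))))"
    proof (cases "t > T")
      case True
      have "t powr ((a + 1) - 1) = t * t powr (a - 1)" using True T powr_mult_base[of t "a - 1"] by simp
      then have "1 / T * (t powr ((a + 1) - 1) * exp (- (t * \<rho>))) = (t / T) * f t" by (simp add: f_def)
      moreover have "1 * f t \<le> (t / T) * f t" using True T by (intro mult_right_mono) (auto simp: f_def)
      ultimately show ?thesis using True T by auto
    next
      case False
      then show ?thesis using T by (auto split: split_indicator)
    qed
  qed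
  also have "\<dots> = 1 / T * (Gamma (a + 1) * \<rho> powr (- (a + 1)))"
    using a \<rho> integral_Gamma[of "a + 1" \<rho>] by (subst integral_mult_right_zero) simp
  also have "Gamma (a + 1) = a * Gamma a"
  proof (rule Gamma_plus1)
    show "a \<notin> \<int>\<^sub>\<le>\<^sub>0" using a by (auto elim!: nonpos_Ints_cases)
  qed
  finally show ?thesis using Gamma_a T a by (simp add: divide_le_eq mult_ac)
qed

lemma borel_measurable_gam[measurable]: "gam a T \<in> borel_measurable borel"
  unfolding gam_def by measurable

end

text \<open>Chosen so that (|h|^2)^(-kexp) = |h|^(-(n+s+1)), with n the dimension.\<close>

definition kexp :: "'a::euclidean_space itself \<Rightarrow> real \<Rightarrow> real" where
  "kexp _ s = (real DIM('a) + s + 1) / 2"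

text \<open>The kernel called \<eta> in the overview; at the origin it is 0.\<close>

definition riesz :: "real \<Rightarrow> 'a::euclidean_space \<Rightarrow> 'a" where
  "riesz s h = norm h powr (- (real DIM('a) + s + 1)) *\<^sub>R h"

text \<open>By \<open>\<integral>\<^sub>0\<^sup>\<infinity> t\<^sup>a\<^sup>-\<^sup>1 exp(- t r) dt = \<Gamma>(a) / r\<^sup>a\<close>, the kernel \<open>reg s T\<close> tends to \<open>riesz s\<close> as \<open>T\<close> tends to infinity.\<close>

definition reg :: "real \<Rightarrow> real \<Rightarrow> 'a::euclidean_space \<Rightarrow> 'a" where
  "reg s T z = gam (kexp TYPE('a) s) T ((norm z)\<^sup>2) *\<^sub>R z"

lemma powr_norm_square: "((norm x)\<^sup>2) powr p = norm x powr (2 * p)" for x :: "'a::real_normed_vector"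
proof (cases "x = 0")
  case False
  then have "(norm x)\<^sup>2 powr p = (norm x powr 2) powr p" by simp
  then show ?thesis by (simp only: powr_powr)
qed simp

lemma riesz_minus: "riesz s (- h) = - riesz s h"
  by (simp add: riesz_def)

lemma reg_minus: "reg s T (- h) = - reg s T h"
  by (simp add: reg_def)

lemma norm_riesz: "norm (riesz s (h::'a::euclidean_space)) = norm h powr (- (real DIM('a) + s))"
proof (cases "h = 0")
  case False
  have e: "1 + - (DIM('a) + s + 1) = - (DIM('a) + s)" by simp
  have "norm (riesz s h) = norm h powr 1 * norm h powr (- (DIM('a) + s + 1))" using False by (simp add: riesz_def)
  then show ?thesis by (simp only: powr_add[symmetric] e)
qed (simp add: riesz_def)

lemma borel_measurable_riesz[measurable]: "riesz s \<in> borel_measurable borel"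
  unfolding riesz_def by measurable

context
  fixes s :: real
  assumes s: "0 < s" "s < 1"
begin

lemma kexp_pos: "kexp TYPE('a::euclidean_space) s > 0"
  using s by (simp add: kexp_def add_pos_pos)

lemma borel_measurable_reg[measurable]: "(reg s T :: 'a::euclidean_space \<Rightarrow> 'a) \<in> borel_measurable borel"
proof -
  note borel_measurable_gam[OF kexp_pos, measurable]
  show ?thesis unfolding reg_def by measurable
qed

lemma norm_reg_le: "norm (reg s T (z::'a::euclidean_space)) \<le> norm z powr (- (DIM('a) + s))"
proof (cases "z = 0")
  case False
  define a where "a = kexp TYPE('a) s"
  have "gam a T ((norm z)\<^sup>2) \<le> ((norm z)\<^sup>2) powr (- a)"
    unfolding a_def by (rule gam_le[OF kexp_pos]) (use False in auto)
  also have "\<dots> = norm z powr (- (DIM('a) + s + 1))"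
    unfolding powr_norm_square a_def kexp_def by (rule arg_cong[of _ _ "(powr) (norm z)"]) (simp add: field_simps)
  finally have "gam a T ((norm z)\<^sup>2) * norm z \<le> norm z powr (- (DIM('a) + s + 1)) * norm z"
    by (intro mult_right_mono) auto
  also have "\<dots> = norm (riesz s z)" by (simp add: riesz_def)
  finally show ?thesis unfolding norm_riesz using gam_nonneg[OF kexp_pos[where 'a='a], of T "(norm z)\<^sup>2"] by (simp add: reg_def a_def)
qed (simp add: reg_def)

lemma norm_reg_le_T:
  assumes "T > 0"
  shows "norm (reg s T (z::'a::euclidean_space)) \<le> T powr kexp TYPE('a) s / (kexp TYPE('a) s * Gamma (kexp TYPE('a) s)) * norm z"
  unfolding reg_def using gam_nonneg[OF kexp_pos[where 'a='a], of T "(norm z)\<^sup>2"]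
    mult_right_mono[OF gam_le_T[OF kexp_pos[where 'a='a] _ assms, of "(norm z)\<^sup>2"], of "norm z"]
  by simp

text \<open>Relative to |riesz s z| = |z|^(-(n+s)) the error carries the factor 1 / (T |z|^2): the
  regularisation acts at length T^(-1/2).\<close>

lemma norm_riesz_minus_reg:
  assumes T: "T > 0"
  shows "norm (riesz s z - reg s T (z::'a::euclidean_space)) \<le> kexp TYPE('a) s / T * norm z powr (- (DIM('a) + s + 2))"
proof (cases "z = 0")
  case False
  define a where "a = kexp TYPE('a) s"
  have n: "((norm z)\<^sup>2) powr (- a) = norm z powr (- (DIM('a) + s + 1))"
    unfolding powr_norm_square a_def kexp_def by (rule arg_cong[of _ _ "(powr) (norm z)"]) (simp add: field_simps)
  have le: "0 \<le> ((norm z)\<^sup>2) powr (- a) - gam a T ((norm z)\<^sup>2)"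
    using gam_le[OF kexp_pos[where 'a='a], of "(norm z)\<^sup>2" T] False by (simp add: a_def)
  have "norm (riesz s z - reg s T z) = (((norm z)\<^sup>2) powr (- a) - gam a T ((norm z)\<^sup>2)) * norm z"
    unfolding riesz_def reg_def n[symmetric] a_def[symmetric] scaleR_diff_left[symmetric] using le by simp
  also have "\<dots> \<le> (a / T * ((norm z)\<^sup>2) powr (- a - 1)) * norm z"
    using gam_tail[OF kexp_pos[where 'a='a], of "(norm z)\<^sup>2" T] False T
    by (intro mult_right_mono) (auto simp: a_def)
  also have "((norm z)\<^sup>2) powr (- a - 1) = norm z powr (- (DIM('a) + s + 3))"
    unfolding powr_norm_square a_def kexp_def by (rule arg_cong[of _ _ "(powr) (norm z)"]) (simp add: field_simps)
  also have "a / T * norm z powr (- (DIM('a) + s + 3)) * norm z = a / T * norm z powr (- (DIM('a) + s + 2))"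
  proof -
    have e: "1 + - (DIM('a) + s + 3) = - (DIM('a) + s + 2)" by simp
    show ?thesis using powr_mult_base[of "norm z" "- (DIM('a) + s + 3)"] unfolding e by (simp add: mult_ac)
  qed
  finally show ?thesis by (simp add: a_def)
qed (simp add: riesz_def reg_def)

lemma integrable_reg:
  assumes "T > 0"
  shows "integrable lborel (reg s T :: 'a::euclidean_space \<Rightarrow> 'a)"
    and bounded_reg: "\<exists>C. \<forall>z::'a. norm (reg s T z) \<le> C"
proof -
  define C where "C = T powr kexp TYPE('a) s / (kexp TYPE('a) s * Gamma (kexp TYPE('a) s))"
  have C: "C \<ge> 0" unfolding C_def using kexp_pos[where 'a='a] by (simp add: Gamma_real_nonneg less_imp_le)
  have 1: "norm (reg s T z) \<le> C * norm z" for z :: 'a unfolding C_def by (rule norm_reg_le_T[OF assms])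
  have *: "norm (reg s T z) \<le> norm (C * indicator (cball 0 1) z + norm z powr (- (DIM('a) + s)) * indicator {z. 1 \<le> norm z} z)" for z :: 'a
  proof (cases "norm z \<le> 1")
    case True
    have "norm (reg s T z) \<le> C * norm z" by (rule 1)
    also have "\<dots> \<le> C" using C True by (simp add: mult_left_le)
    also have "\<dots> \<le> C * indicator (cball 0 1) z + norm z powr (- (DIM('a) + s)) * indicator {z. 1 \<le> norm z} z" using True by simp
    finally show ?thesis by simp
  next
    case False
    then show ?thesis using norm_reg_le[of T z] by simp
  qed
  have cb: "integrable lborel (\<lambda>z::'a. C * indicator (cball 0 1) z)"
    by (intro integrable_mult_right integrable_real_indicator) (auto simp: emeasure_cball)
  show "integrable lborel (reg s T :: 'a \<Rightarrow> 'a)"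
  proof (rule Bochner_Integration.integrable_bound)
    show "integrable lborel (\<lambda>z::'a. C * indicator (cball 0 1) z + norm z powr (- (DIM('a) + s)) * indicator {z. 1 \<le> norm z} z)"
      using s by (intro Bochner_Integration.integrable_add cb integrable_norm_powr_tail) auto
    show "AE z in lborel. norm (reg s T z) \<le> norm (C * indicator (cball 0 1) z + norm z powr (- (DIM('a) + s)) * indicator {z::'a. 1 \<le> norm z} z)"
      by (intro AE_I2 *)
  qed simp
  have "norm (reg s T z) \<le> C + 1" for z :: 'a
  proof (cases "norm z \<le> 1")
    case True
    then show ?thesis using 1[of z] C mult_left_le[of "norm z" C] by linarith
  next
    case False
    have "norm z powr (- (DIM('a) + s)) \<le> norm z powr 0" using False s by (intro powr_mono) auto
    then show ?thesis using norm_reg_le[of T z] C False by (cases "z = 0") auto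
  qed
  then show "\<exists>C. \<forall>z::'a. norm (reg s T z) \<le> C" by blast
qed

end

section \<open>Convolution of two regularised kernels and its limit\<close>

definition rconv :: "real \<Rightarrow> real \<Rightarrow> real \<Rightarrow> 'a::euclidean_space \<Rightarrow> real" where
  "rconv s T T' h = (LINT z|lborel. reg s T z \<bullet> reg s T' (h - z))"

text \<open>Origin of the factors: \<pi>^(n/2) from the Gaussian convolution, the quotient with
  squared numerator from the Beta integral with p = (1 - s) / 2, the division by a squared Gamma
  value from normalising both kernels, and s Gamma (n/2 + s) from Gamma (n/2 + s + 1) - n/2 Gamma
  (n/2 + s).\<close>

definition kappa :: "'a::euclidean_space itself \<Rightarrow> real \<Rightarrow> real" where
  "kappa _ s = pi powr (real DIM('a) / 2) * ((Gamma ((1 - s) / 2))\<^sup>2 / Gamma (1 - s)) / (Gamma (kexp TYPE('a) s))\<^sup>2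
     * (s * Gamma (real DIM('a) / 2 + s))"

definition harm :: "real \<Rightarrow> real \<Rightarrow> real \<Rightarrow> real \<times> real \<Rightarrow> real" where
  "harm \<alpha> \<beta> \<rho> p = indicator {0<..} (fst p) * indicator {0<..} (snd p) *
     ((fst p * snd p) powr (\<alpha> - 1) * (fst p + snd p) powr (- \<beta>) * exp (- (fst p * snd p / (fst p + snd p) * \<rho>)))"

lemma borel_measurable_harm[measurable]: "harm \<alpha> \<beta> \<rho> \<in> borel_measurable borel"
proof -
  have "harm \<alpha> \<beta> \<rho> \<in> borel_measurable (borel \<Otimes>\<^sub>M borel)" unfolding harm_def by measurable
  then show ?thesis by (simp add: borel_prod)
qed

lemma harm_nonneg: "0 \<le> harm \<alpha> \<beta> \<rho> p"
  by (simp add: harm_def)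

lemma
  fixes \<alpha> \<beta> \<rho> :: real
  assumes ab: "\<beta> < 2 * \<alpha>" "\<alpha> < \<beta>" and \<rho>: "\<rho> > 0"
  shows integrable_harm: "integrable lborel (harm \<alpha> \<beta> \<rho>)"
    and integral_harm: "(LINT p|lborel. harm \<alpha> \<beta> \<rho> p) = Gamma (2 * \<alpha> - \<beta>) * \<rho> powr (- (2 * \<alpha> - \<beta>)) * ((Gamma (\<beta> - \<alpha>))\<^sup>2 / Gamma (2 * (\<beta> - \<alpha>)))"
proof -
  define v where "v = Gamma (2 * \<alpha> - \<beta>) * \<rho> powr (- (2 * \<alpha> - \<beta>)) * ((Gamma (\<beta> - \<alpha>))\<^sup>2 / Gamma (2 * (\<beta> - \<alpha>)))"
  have v: "v \<ge> 0" unfolding v_def using ab by (intro mult_nonneg_nonneg divide_nonneg_nonneg Gamma_real_nonneg) auto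
  have [measurable]: "harm \<alpha> \<beta> \<rho> \<in> borel_measurable (borel \<Otimes>\<^sub>M borel)" by (simp add: borel_prod)
  have "(\<integral>\<^sup>+p. ennreal (harm \<alpha> \<beta> \<rho> p) \<partial>lborel) = (\<integral>\<^sup>+t. \<integral>\<^sup>+t'. ennreal (harm \<alpha> \<beta> \<rho> (t, t')) \<partial>lborel \<partial>lborel)"
    unfolding lborel_prod[symmetric] by (subst lborel.nn_integral_fst[symmetric]) auto
  also have "\<dots> = (\<integral>\<^sup>+t. \<integral>\<^sup>+t'. ennreal ((t * t') powr (\<alpha> - 1) * (t + t') powr (- \<beta>) * exp (- (t * t' / (t + t') * \<rho>)))
      * indicator {0<..} t' * indicator {0<..} t \<partial>lborel \<partial>lborel)"
    by (intro nn_integral_cong) (auto simp: harm_def split: split_indicator)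
  also have "\<dots> = ennreal v" unfolding v_def by (rule nn_integral_harmonic_exp[OF ab \<rho>])
  finally have *: "(\<integral>\<^sup>+p. ennreal (harm \<alpha> \<beta> \<rho> p) \<partial>lborel) = ennreal v" .
  show "integrable lborel (harm \<alpha> \<beta> \<rho>)"
    using * harm_nonneg by (intro integrableI_nonneg) auto
  show "(LINT p|lborel. harm \<alpha> \<beta> \<rho> p) = v"
    using * v harm_nonneg by (intro integral_eq_nn_integral[THEN trans]) auto
qed

context
  fixes s :: real
  assumes s: "0 < s" "s < 1"
begin

text \<open>Convolution of the Gaussian kernels \<open>z exp(- t \<bar>z\<bar>\<^sup>2)\<close> and \<open>z exp(- t' \<bar>z\<bar>\<^sup>2)\<close>,
  weighted with \<open>(t t')\<close> to the power \<open>kexp - 1\<close>; the argument \<open>p\<close> is the pair \<open>(t, t')\<close>.\<close>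

definition subord :: "'a::euclidean_space \<Rightarrow> real \<times> real \<Rightarrow> real" where
  "subord h p = pi powr (real DIM('a) / 2) *
     ((norm h)\<^sup>2 * harm (kexp TYPE('a) s + 1) (real DIM('a) / 2 + 2) ((norm h)\<^sup>2) p
      - real DIM('a) / 2 * harm (kexp TYPE('a) s) (real DIM('a) / 2 + 1) ((norm h)\<^sup>2) p)"

lemma borel_measurable_subord[measurable]: "subord (h::'a::euclidean_space) \<in> borel_measurable borel"
  unfolding subord_def by measurable

text \<open>Each regularised kernel is an integral over t \<le> T, so Fubini gives a double integral
  of Gaussian convolutions. The cut-offs enter only through indicators; the integrand
  \<open>subord h\<close> is the same for all T and T', which reduces the later limits and bounds to
  one integrable function.\<close>

lemma rconv_eq:
  fixes h :: "'a::euclidean_space"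
  assumes T: "T > 0" "T' > 0"
  shows "rconv s T T' h = (LINT p|lborel. indicator {..T} (fst p) * indicator {..T'} (snd p) * subord h p) / (Gamma (kexp TYPE('a) s))\<^sup>2"
proof -
  define a where "a = kexp TYPE('a) s"
  have a: "a > 0" unfolding a_def by (rule kexp_pos[OF s])
  define n where "n = real DIM('a)"
  define G where "G = Gamma a"
  have G: "G > 0" unfolding G_def using a by (rule Gamma_real_pos)
  define u where "u = (\<lambda>T \<rho> t. indicator {0<..T} t * (t powr (a - 1) * exp (- (t * \<rho>))))"
  define F where "F = (\<lambda>z (p::real\<times>real). (z \<bullet> (h - z)) * (u T ((norm z)\<^sup>2) (fst p) * u T' ((norm (h - z))\<^sup>2) (snd p)))"
  have u: "integrable lborel (u S \<rho>)" "(LINT t|lborel. u S \<rho> t) = G * gam a S \<rho>" if "\<rho> \<ge> 0" for S \<rho>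
    using integrable_gam[OF a that, of S] G by (auto simp: u_def gam_def G_def)
  have upos: "u S \<rho> t \<ge> 0" for S \<rho> t by (simp add: u_def)
  have Fp: "(LINT p|lborel. F z p) = G\<^sup>2 * (reg s T z \<bullet> reg s T' (h - z))" for z
  proof -
    have "(LINT p|lborel. F z p) = (z \<bullet> (h - z)) * (LINT p|lborel. u T ((norm z)\<^sup>2) (fst p) * u T' ((norm (h - z))\<^sup>2) (snd p))"
      unfolding F_def by (rule integral_mult_right_zero)
    also have "\<dots> = (z \<bullet> (h - z)) * ((G * gam a T ((norm z)\<^sup>2)) * (G * gam a T' ((norm (h - z))\<^sup>2)))"
      by (subst integral_lborel_times) (auto simp: u)
    finally show ?thesis by (simp add: reg_def a_def[symmetric] power2_eq_square)
  qed
  have Fabs: "(LINT p|lborel. norm (F z p)) \<le> G\<^sup>2 * (norm (reg s T z) * norm (reg s T' (h - z)))" for z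
  proof -
    have "(LINT p|lborel. norm (F z p)) = (LINT p|lborel. \<bar>z \<bullet> (h - z)\<bar> * (u T ((norm z)\<^sup>2) (fst p) * u T' ((norm (h - z))\<^sup>2) (snd p)))"
      unfolding F_def using upos by (simp add: abs_mult)
    also have "\<dots> = \<bar>z \<bullet> (h - z)\<bar> * (LINT p|lborel. u T ((norm z)\<^sup>2) (fst p) * u T' ((norm (h - z))\<^sup>2) (snd p))"
      by (rule integral_mult_right_zero)
    also have "\<dots> = \<bar>z \<bullet> (h - z)\<bar> * ((G * gam a T ((norm z)\<^sup>2)) * (G * gam a T' ((norm (h - z))\<^sup>2)))"
      by (subst integral_lborel_times) (auto simp: u)
    also have "\<dots> \<le> (norm z * norm (h - z)) * ((G * gam a T ((norm z)\<^sup>2)) * (G * gam a T' ((norm (h - z))\<^sup>2)))"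
      using G gam_nonneg[OF a] by (intro mult_right_mono Cauchy_Schwarz_ineq2 mult_nonneg_nonneg) auto
    also have "\<dots> = G\<^sup>2 * (norm (reg s T z) * norm (reg s T' (h - z)))"
      using gam_nonneg[OF a] by (simp add: reg_def a_def[symmetric] power2_eq_square)
    finally show ?thesis .
  qed
  note borel_measurable_reg[OF s, measurable]
  have meas: "(\<lambda>(z, p). F z p) \<in> borel_measurable (borel \<Otimes>\<^sub>M borel)"
    unfolding F_def u_def by (simp add: borel_prod[symmetric] split_beta')
  have int: "integrable (lborel \<Otimes>\<^sub>M lborel) (\<lambda>(z, p). F z p)"
  proof (rule lborel_pair.Fubini_integrable)
    show "(\<lambda>(z, p). F z p) \<in> borel_measurable (lborel \<Otimes>\<^sub>M lborel)" using meas by simp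
    show "AE z in lborel. integrable lborel (\<lambda>p. case (z, p) of (z, p) \<Rightarrow> F z p)"
      unfolding F_def using integrable_lborel_times[OF u(1) u(1)] by auto
    \<comment> \<open>One kernel is integrable and the other bounded, so the product of their norms
      is integrable.\<close>
    obtain C where C: "\<And>z::'a. norm (reg s T' z) \<le> C" using bounded_reg[OF s T(2)] by blast
    show "integrable lborel (\<lambda>z. LINT p|lborel. norm (case (z, p) of (z, p) \<Rightarrow> F z p))"
    proof (rule Bochner_Integration.integrable_bound)
      show "integrable lborel (\<lambda>z::'a. G\<^sup>2 * (norm (reg s T z) * C))"
        using integrable_reg[OF s T(1)] by (intro integrable_mult_right integrable_mult_left integrable_norm)
      have "(LINT p|lborel. norm (F z p)) \<le> G\<^sup>2 * (norm (reg s T z) * C)" for z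
        using Fabs[of z] mult_left_mono[OF mult_left_mono[OF C[of "h - z"], of "norm (reg s T z)"], of "G\<^sup>2"] by simp
      then show "AE z in lborel. norm (LINT p|lborel. norm (case (z, p) of (z, p) \<Rightarrow> F z p)) \<le> norm (G\<^sup>2 * (norm (reg s T z) * C))"
        by (intro AE_I2) (simp add: order.trans[OF _ abs_ge_self])
      have "(\<lambda>(z, p). norm (F z p)) \<in> borel_measurable (borel \<Otimes>\<^sub>M lborel)" using meas by (simp add: split_beta')
      then show "(\<lambda>z. LINT p|lborel. norm (case (z, p) of (z, p) \<Rightarrow> F z p)) \<in> borel_measurable lborel"
        by (simp add: lborel.borel_measurable_lebesgue_integral)
    qed
  qed
  have Fz: "(LINT z|lborel. F z p) = indicator {..T} (fst p) * indicator {..T'} (snd p) * subord h p" for p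
  proof (cases "fst p > 0 \<and> snd p > 0")
    case True
    define t t' where "t = fst p" and "t' = snd p"
    have t: "t > 0" "t' > 0" using True by (auto simp: t_def t'_def)
    define \<sigma> where "\<sigma> = t + t'"
    have \<sigma>: "\<sigma> > 0" using t by (simp add: \<sigma>_def)
    define E where "E = exp (- (t * t' / \<sigma> * (norm h)\<^sup>2))"
    define c where "c = indicator {..T} t * indicator {..T'} t' * (t * t') powr (a - 1)"
    have "(LINT z|lborel. F z p) = (LINT z|lborel. c * ((z \<bullet> (h - z)) * (exp (- (t * (norm z)\<^sup>2)) * exp (- (t' * (norm (h - z))\<^sup>2)))))"
      unfolding F_def u_def c_def t_def[symmetric] t'_def[symmetric] using t
      by (intro Bochner_Integration.integral_cong) (auto simp: powr_mult split: split_indicator)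
    also have "\<dots> = c * (LINT z|lborel. (z \<bullet> (h - z)) * (exp (- (t * (norm z)\<^sup>2)) * exp (- (t' * (norm (h - z))\<^sup>2))))"
      by (rule integral_mult_right_zero)
    also have "\<dots> = c * (E * (pi / \<sigma>) powr (n / 2) * (t * t' / \<sigma>\<^sup>2 * (norm h)\<^sup>2 - n / (2 * \<sigma>)))"
      unfolding n_def E_def \<sigma>_def by (subst integral_gaussian_convolution[OF t]) simp
    also have "\<dots> = indicator {..T} t * indicator {..T'} t' * (pi powr (n / 2) * ((norm h)\<^sup>2 * ((t * t') powr (a + 1 - 1) * \<sigma> powr (- (n / 2 + 2)) * E)
         - n / 2 * ((t * t') powr (a - 1) * \<sigma> powr (- (n / 2 + 1)) * E)))"
    proof -
      have "\<sigma> powr (- (n / 2 + 2)) = \<sigma> powr (- (n / 2)) * \<sigma> powr (- 2)"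
        by (simp add: powr_add[symmetric])
      also have "\<sigma> powr (- 2) = 1 / \<sigma>\<^sup>2" using \<sigma> by (simp add: powr_minus_divide)
      finally have 1: "\<sigma> powr (- (n / 2 + 2)) = \<sigma> powr (- (n / 2)) / \<sigma>\<^sup>2" by simp
      have e: "- (n / 2) + - 1 = - (n / 2 + 1)" by simp
      have "\<sigma> powr (- (n / 2 + 1)) = \<sigma> powr (- (n / 2)) * \<sigma> powr (- 1)"
        by (simp only: powr_add[symmetric] e)
      also have "\<sigma> powr (- 1) = 1 / \<sigma>" using \<sigma> by (simp add: powr_minus_divide)
      finally have 2: "\<sigma> powr (- (n / 2 + 1)) = \<sigma> powr (- (n / 2)) / \<sigma>" by simp
      have 3: "(pi / \<sigma>) powr (n / 2) = pi powr (n / 2) * \<sigma> powr (- (n / 2))"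
        using \<sigma> by (simp add: powr_divide powr_minus_divide)
      have 4: "(t * t') powr (a + 1 - 1) = (t * t') * (t * t') powr (a - 1)"
        using t powr_mult_base[of "t * t'" "a - 1"] by simp
      show ?thesis unfolding c_def 1 2 3 4 by (simp add: algebra_simps)
    qed
    also have "\<dots> = indicator {..T} (fst p) * indicator {..T'} (snd p) * subord h p"
      unfolding subord_def harm_def a_def[symmetric] n_def[symmetric] t_def[symmetric] t'_def[symmetric] E_def \<sigma>_def using t by simp
    finally show ?thesis .
  next
    case False
    then have "F z p = 0" for z by (auto simp: F_def u_def)
    moreover have "subord h p = 0" using False by (auto simp: subord_def harm_def)
    ultimately show ?thesis by simp
  qed
  have "G\<^sup>2 * rconv s T T' h = (LINT z|lborel. LINT p|lborel. F z p)"
    unfolding rconv_def Fp by (rule integral_mult_right_zero[symmetric])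
  also have "\<dots> = (LINT p|lborel. LINT z|lborel. F z p)"
    by (rule lborel_pair.Fubini_integral[symmetric]) (rule int)
  also have "\<dots> = (LINT p|lborel. indicator {..T} (fst p) * indicator {..T'} (snd p) * subord h p)"
    unfolding Fz ..
  finally show ?thesis using G by (simp add: field_simps G_def a_def)
qed

context
  fixes h :: "'a::euclidean_space"
  assumes h: "h \<noteq> 0"
begin

text \<open>Convergence conditions of the two integrals of type \<open>harm\<close>; the upper
  bounds on \<open>kexp\<close> are the condition s < 1.\<close>

private lemma ranges:
  "real DIM('a) / 2 + 2 < 2 * (kexp TYPE('a) s + 1)" "kexp TYPE('a) s + 1 < real DIM('a) / 2 + 2"
  "real DIM('a) / 2 + 1 < 2 * kexp TYPE('a) s" "kexp TYPE('a) s < real DIM('a) / 2 + 1" "(norm h)\<^sup>2 > 0"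
  using s h by (auto simp: kexp_def field_simps add_pos_pos)

private lemma harm1: "(norm h)\<^sup>2 * (LINT p|lborel. harm (kexp TYPE('a) s + 1) (real DIM('a) / 2 + 2) ((norm h)\<^sup>2) p)
    = Gamma (real DIM('a) / 2 + s + 1) * norm h powr (- (real DIM('a) + 2 * s)) * ((Gamma ((1 - s) / 2))\<^sup>2 / Gamma (1 - s))"
proof -
  have e: "2 * (kexp TYPE('a) s + 1) - (real DIM('a) / 2 + 2) = real DIM('a) / 2 + s + 1"
    "real DIM('a) / 2 + 2 - (kexp TYPE('a) s + 1) = (1 - s) / 2" "2 * ((1 - s) / 2) = 1 - s"
    by (simp_all add: kexp_def field_simps)
  have e2: "2 * - (real DIM('a) / 2 + s + 1) = - (real DIM('a) + 2 * s) - 2" by simp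
  have "(norm h)\<^sup>2 * ((norm h)\<^sup>2) powr (- (real DIM('a) / 2 + s + 1)) = norm h powr (- (real DIM('a) + 2 * s))"
    unfolding powr_norm_square e2 using h by (simp add: powr_diff)
  then show ?thesis
    unfolding integral_harm[OF ranges(1,2,5)] e by (simp add: mult_ac)
qed

private lemma harm2: "(LINT p|lborel. harm (kexp TYPE('a) s) (real DIM('a) / 2 + 1) ((norm h)\<^sup>2) p)
    = Gamma (real DIM('a) / 2 + s) * norm h powr (- (real DIM('a) + 2 * s)) * ((Gamma ((1 - s) / 2))\<^sup>2 / Gamma (1 - s))"
proof -
  have e: "2 * kexp TYPE('a) s - (real DIM('a) / 2 + 1) = real DIM('a) / 2 + s"
    "real DIM('a) / 2 + 1 - kexp TYPE('a) s = (1 - s) / 2" "2 * ((1 - s) / 2) = 1 - s"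
    by (simp_all add: kexp_def field_simps)
  have e2: "2 * - (real DIM('a) / 2 + s) = - (real DIM('a) + 2 * s)" by simp
  show ?thesis
    unfolding integral_harm[OF ranges(3,4,5)] e powr_norm_square e2 ..
qed

lemma integrable_subord: "integrable lborel (subord h)"
  unfolding subord_def using integrable_harm[OF ranges(1,2,5)] integrable_harm[OF ranges(3,4,5)] by auto

text \<open>In both integrals \<beta> - \<alpha> = (1 - s) / 2, so they share the Beta factor and
  differ only by Gamma (x + 1) = x Gamma x with x = n/2 + s. Their weighted difference has the
  coefficient x - n/2 = s.\<close>

lemma integral_subord: "(LINT p|lborel. subord h p) = (Gamma (kexp TYPE('a) s))\<^sup>2 * (kappa TYPE('a) s * norm h powr (- (real DIM('a) + 2 * s)))"
proof -
  define N where "N = norm h powr (- (real DIM('a) + 2 * s))"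
  define B where "B = (Gamma ((1 - s) / 2))\<^sup>2 / Gamma (1 - s)"
  define x where "x = real DIM('a) / 2 + s"
  have x: "x > 0" using s by (simp add: x_def add_nonneg_pos)
  have G: "Gamma (x + 1) = x * Gamma x"
    by (rule Gamma_plus1) (use x in \<open>auto elim!: nonpos_Ints_cases\<close>)
  have Gk: "Gamma (kexp TYPE('a) s) > 0" using kexp_pos[OF s, where 'a='a] by (rule Gamma_real_pos)
  have "(LINT p|lborel. subord h p) = pi powr (real DIM('a) / 2) * ((norm h)\<^sup>2 * (LINT p|lborel. harm (kexp TYPE('a) s + 1) (real DIM('a) / 2 + 2) ((norm h)\<^sup>2) p)
      - real DIM('a) / 2 * (LINT p|lborel. harm (kexp TYPE('a) s) (real DIM('a) / 2 + 1) ((norm h)\<^sup>2) p))"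
    unfolding subord_def using integrable_harm[OF ranges(1,2,5)] integrable_harm[OF ranges(3,4,5)] by simp
  also have "\<dots> = pi powr (real DIM('a) / 2) * (Gamma (x + 1) * N * B - real DIM('a) / 2 * (Gamma x * N * B))"
    unfolding harm1 harm2 N_def B_def x_def ..
  also have "\<dots> = pi powr (real DIM('a) / 2) * B * (s * Gamma x) * N"
    unfolding G by (simp add: x_def algebra_simps)
  also have "\<dots> = (Gamma (kexp TYPE('a) s))\<^sup>2 * (kappa TYPE('a) s * N)"
    using Gk unfolding kappa_def B_def[symmetric] x_def[symmetric] by (simp add: field_simps)
  finally show ?thesis unfolding N_def .
qed

lemma integral_abs_subord: "(LINT p|lborel. \<bar>subord h p\<bar>) \<le> pi powr (real DIM('a) / 2) *
     (Gamma (real DIM('a) / 2 + s + 1) + real DIM('a) / 2 * Gamma (real DIM('a) / 2 + s)) * ((Gamma ((1 - s) / 2))\<^sup>2 / Gamma (1 - s))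
     * norm h powr (- (real DIM('a) + 2 * s))"
proof -
  have "(LINT p|lborel. \<bar>subord h p\<bar>) \<le> (LINT p|lborel. pi powr (real DIM('a) / 2) *
     ((norm h)\<^sup>2 * harm (kexp TYPE('a) s + 1) (real DIM('a) / 2 + 2) ((norm h)\<^sup>2) p
      + real DIM('a) / 2 * harm (kexp TYPE('a) s) (real DIM('a) / 2 + 1) ((norm h)\<^sup>2) p))"
  proof (rule integral_mono)
    show "integrable lborel (\<lambda>p. \<bar>subord h p\<bar>)" by (intro integrable_abs integrable_subord)
    show "integrable lborel (\<lambda>p. pi powr (real DIM('a) / 2) *
     ((norm h)\<^sup>2 * harm (kexp TYPE('a) s + 1) (real DIM('a) / 2 + 2) ((norm h)\<^sup>2) p
      + real DIM('a) / 2 * harm (kexp TYPE('a) s) (real DIM('a) / 2 + 1) ((norm h)\<^sup>2) p))"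
      using integrable_harm[OF ranges(1,2,5)] integrable_harm[OF ranges(3,4,5)] by auto
    fix p
    show "\<bar>subord h p\<bar> \<le> pi powr (real DIM('a) / 2) *
     ((norm h)\<^sup>2 * harm (kexp TYPE('a) s + 1) (real DIM('a) / 2 + 2) ((norm h)\<^sup>2) p
      + real DIM('a) / 2 * harm (kexp TYPE('a) s) (real DIM('a) / 2 + 1) ((norm h)\<^sup>2) p)"
      unfolding subord_def abs_mult
      by (intro mult_mono order.trans[OF abs_triangle_ineq4]) (auto simp: harm_nonneg abs_mult)
  qed
  also have "\<dots> = pi powr (real DIM('a) / 2) * ((norm h)\<^sup>2 * (LINT p|lborel. harm (kexp TYPE('a) s + 1) (real DIM('a) / 2 + 2) ((norm h)\<^sup>2) p)
      + real DIM('a) / 2 * (LINT p|lborel. harm (kexp TYPE('a) s) (real DIM('a) / 2 + 1) ((norm h)\<^sup>2) p))"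
    using integrable_harm[OF ranges(1,2,5)] integrable_harm[OF ranges(3,4,5)] by simp
  also have "\<dots> = pi powr (real DIM('a) / 2) *
     (Gamma (real DIM('a) / 2 + s + 1) + real DIM('a) / 2 * Gamma (real DIM('a) / 2 + s)) * ((Gamma ((1 - s) / 2))\<^sup>2 / Gamma (1 - s))
     * norm h powr (- (real DIM('a) + 2 * s))"
    unfolding harm1 harm2 by (simp add: distrib_left distrib_right mult_ac)
  finally show ?thesis .
qed

lemma rconv_tendsto:
  fixes T T' :: "nat \<Rightarrow> real"
  assumes "\<And>k. T k > 0" "\<And>k. T' k > 0" and lim: "filterlim T at_top sequentially" "filterlim T' at_top sequentially"
  shows "(\<lambda>k. rconv s (T k) (T' k) h) \<longlonglongrightarrow> kappa TYPE('a) s * norm h powr (- (real DIM('a) + 2 * s))"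
proof -
  have "(\<lambda>k. (LINT p|lborel. indicator {..T k} (fst p) * indicator {..T' k} (snd p) * subord h p)) \<longlonglongrightarrow> (LINT p|lborel. subord h p)"
  proof (rule integral_dominated_convergence[where w="\<lambda>p. \<bar>subord h p\<bar>"])
    show "integrable lborel (\<lambda>p. \<bar>subord h p\<bar>)" by (intro integrable_abs integrable_subord)
    have [measurable]: "subord h \<in> borel_measurable (borel \<Otimes>\<^sub>M borel)" by (simp add: borel_prod)
    have "(\<lambda>p. indicator {..T k} (fst p) * indicator {..T' k} (snd p) * subord h p) \<in> borel_measurable (borel \<Otimes>\<^sub>M borel)" for k
      by measurable
    then show "(\<lambda>p. indicator {..T k} (fst p) * indicator {..T' k} (snd p) * subord h p) \<in> borel_measurable lborel" for k
      by (simp add: borel_prod)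
    show "AE p in lborel. (\<lambda>k. indicator {..T k} (fst p) * indicator {..T' k} (snd p) * subord h p) \<longlonglongrightarrow> subord h p"
    proof (rule AE_I2)
      fix p :: "real \<times> real"
      have "eventually (\<lambda>k. fst p \<le> T k) sequentially" "eventually (\<lambda>k. snd p \<le> T' k) sequentially"
        using lim by (auto simp: filterlim_at_top)
      then have "eventually (\<lambda>k. indicator {..T k} (fst p) * indicator {..T' k} (snd p) * subord h p = subord h p) sequentially"
        by eventually_elim simp
      then show "(\<lambda>k. indicator {..T k} (fst p) * indicator {..T' k} (snd p) * subord h p) \<longlonglongrightarrow> subord h p"
        by (rule tendsto_eventually)
    qed
    show "AE p in lborel. norm (indicator {..T k} (fst p) * indicator {..T' k} (snd p) * subord h p) \<le> \<bar>subord h p\<bar>" for k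
      by (intro AE_I2) (auto split: split_indicator)
  qed simp
  then have "(\<lambda>k. (LINT p|lborel. indicator {..T k} (fst p) * indicator {..T' k} (snd p) * subord h p) / (Gamma (kexp TYPE('a) s))\<^sup>2) \<longlonglongrightarrow> (LINT p|lborel. subord h p) / (Gamma (kexp TYPE('a) s))\<^sup>2"
    using Gamma_real_pos[OF kexp_pos[OF s, where 'a='a]] by (intro tendsto_divide tendsto_const) auto
  then show ?thesis
    using Gamma_real_pos[OF kexp_pos[OF s, where 'a='a]] assms(1,2) by (simp add: integral_subord rconv_eq)
qed

end

text \<open>The constant is uniform in T and T': this is the majorant for passing to the limit in
  the quadratic form.\<close>

lemma rconv_bound: "\<exists>C\<ge>0. \<forall>T>0. \<forall>T'>0. \<forall>h::'a::euclidean_space. h \<noteq> 0 \<longrightarrow> \<bar>rconv s T T' h\<bar> \<le> C * norm h powr (- (real DIM('a) + 2 * s))"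
proof -
  define C where "C = pi powr (real DIM('a) / 2) *
     (Gamma (real DIM('a) / 2 + s + 1) + real DIM('a) / 2 * Gamma (real DIM('a) / 2 + s)) * ((Gamma ((1 - s) / 2))\<^sup>2 / Gamma (1 - s)) / (Gamma (kexp TYPE('a) s))\<^sup>2"
  have G: "Gamma (kexp TYPE('a) s) > 0" by (rule Gamma_real_pos[OF kexp_pos[OF s, where 'a='a]])
  have "C \<ge> 0" unfolding C_def using s
    by (intro mult_nonneg_nonneg divide_nonneg_nonneg add_nonneg_nonneg Gamma_real_nonneg) auto
  moreover have "\<bar>rconv s T T' h\<bar> \<le> C * norm h powr (- (real DIM('a) + 2 * s))" if "T > 0" "T' > 0" "h \<noteq> 0" for T T' and h :: 'a
  proof -
    have "\<bar>LINT p|lborel. indicator {..T} (fst p) * indicator {..T'} (snd p) * subord h p\<bar> \<le> (LINT p|lborel. \<bar>indicator {..T} (fst p) * indicator {..T'} (snd p) * subord h p\<bar>)"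
      by (rule integral_abs_bound)
    also have "\<dots> \<le> (LINT p|lborel. \<bar>subord h p\<bar>)"
    proof (rule integral_mono')
      show "integrable lborel (\<lambda>p. \<bar>subord h p\<bar>)" by (intro integrable_abs integrable_subord that)
    qed (auto split: split_indicator)
    also have "\<dots> \<le> C * norm h powr (- (real DIM('a) + 2 * s)) * (Gamma (kexp TYPE('a) s))\<^sup>2"
      using integral_abs_subord[OF that(3)] G by (simp add: C_def mult_ac)
    finally show ?thesis unfolding rconv_eq[OF that(1,2)] using G by (simp add: divide_le_eq)
  qed
  ultimately show ?thesis by blast
qed

text \<open>\<open>D_const_G_const\<close> supplies the squared Gamma quotient. In
  \<open>C_const\<close> the power 4^s cancels the squared 2^(-s), one factor \<pi>^(n/2) cancels,
  and |Gamma (- s)| = Gamma (1 - s) / s provides the s of \<open>kappa\<close>.\<close>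

lemma kappa_eq: "kappa TYPE(real^'n::finite) s = - (C_const CARD('n) s * D_const TYPE('n) s / (G_const s)\<^sup>2)"
proof -
  define c where "c = pi powr (CARD('n) / 2) * 2 powr (- s) * Gamma ((1 - s) / 2) / Gamma ((CARD('n) + 1 + s) / 2)"
  have k: "Gamma ((CARD('n) + 1 + s) / 2) = Gamma (kexp TYPE(real^'n) s)" by (simp add: kexp_def add_ac)
  have Gs: "\<bar>Gamma (- s)\<bar> = Gamma (1 - s) / s"
  proof -
    have "- s \<notin> \<int>\<^sub>\<le>\<^sub>0"
    proof
      assume "- s \<in> \<int>\<^sub>\<le>\<^sub>0"
      then obtain k where k: "- s = of_int k" by (auto elim!: nonpos_Ints_cases)
      have "real_of_int (-1) < real_of_int k" "real_of_int k < real_of_int 0" using s k by auto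
      then have "-1 < k" "k < 0" by (simp_all only: of_int_less_iff)
      then show False by linarith
    qed
    then have "Gamma (- s + 1) = - s * Gamma (- s)" by (rule Gamma_plus1)
    moreover have "Gamma (1 - s) > 0" using s by (intro Gamma_real_pos) auto
    ultimately have "Gamma (- s) = - (Gamma (1 - s) / s)" using s by (simp add: field_simps)
    then show ?thesis using \<open>Gamma (1 - s) > 0\<close> s by simp
  qed
  have p4: "(2 powr (- s))\<^sup>2 * 4 powr s = (1::real)"
  proof -
    have "(2 powr (- s))\<^sup>2 * 4 powr s = 2 powr (- s) * 2 powr (- s) * (2 powr 2) powr s" by (simp add: power2_eq_square)
    also have "\<dots> = 2 powr (- s + - s + 2 * s)" by (simp only: powr_powr powr_add)
    finally show ?thesis by simp
  qed
  have pp: "(pi powr (CARD('n) / 2))\<^sup>2 / pi powr (CARD('n) / 2) = pi powr (CARD('n) / 2)"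
    by (simp add: power2_eq_square)
  have "- (C_const CARD('n) s * D_const TYPE('n) s / (G_const s)\<^sup>2) = C_const CARD('n) s * - (D_const TYPE('n) s / (G_const s)\<^sup>2)" by simp
  also have "\<dots> = C_const CARD('n) s * c\<^sup>2" unfolding D_const_G_const[OF s] c_def ..
  also have "\<dots> = ((2 powr (- s))\<^sup>2 * 4 powr s) * ((pi powr (CARD('n) / 2))\<^sup>2 / pi powr (CARD('n) / 2)) * (Gamma ((1 - s) / 2))\<^sup>2 / (Gamma (kexp TYPE(real^'n) s))\<^sup>2 * Gamma (s + CARD('n) / 2) * s / Gamma (1 - s)"
    unfolding C_const_def c_def Gs k power_mult_distrib power_divide by (simp add: mult_ac)
  also have "\<dots> = kappa TYPE(real^'n) s" unfolding p4 pp kappa_def by (simp add: mult_ac add.commute)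
  finally show ?thesis ..
qed

end

section \<open>Sharp truncations and the equivalence kernel\<close>

lemma
  fixes f :: "'a::euclidean_space \<Rightarrow> 'b::{banach, second_countable_topology}"
  assumes f: "integrable lborel f" and c: "c \<noteq> 0"
  shows integrable_lborel_scale: "integrable lborel (\<lambda>x. f (c *\<^sub>R x))"
    and integral_lborel_scale: "(LINT x|lborel. f (c *\<^sub>R x)) = (1 / \<bar>c\<bar> ^ DIM('a)) *\<^sub>R (LINT x|lborel. f x)"
proof -
  have [measurable]: "f \<in> borel_measurable borel" using f by auto
  have d: "lborel = density (distr lborel borel (\<lambda>x::'a. 0 + c *\<^sub>R x)) (\<lambda>_. \<bar>c\<bar>^DIM('a))" by (rule lborel_affine[OF c])
  have c': "\<bar>c\<bar>^DIM('a) > 0" using c by simp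
  have "integrable (density (distr lborel borel (\<lambda>x::'a. 0 + c *\<^sub>R x)) (\<lambda>_. \<bar>c\<bar>^DIM('a))) f" using f by (subst d[symmetric])
  then have "integrable lborel (\<lambda>x::'a. (\<bar>c\<bar>^DIM('a)) *\<^sub>R f (c *\<^sub>R x))"
    by (subst (asm) integrable_density) (auto simp: integrable_distr_eq)
  then have "integrable lborel (\<lambda>x::'a. (1 / \<bar>c\<bar>^DIM('a)) *\<^sub>R ((\<bar>c\<bar>^DIM('a)) *\<^sub>R f (c *\<^sub>R x)))"
    by (rule integrable_scaleR_right)
  then show "integrable lborel (\<lambda>x. f (c *\<^sub>R x))" using c' by simp
  have "(LINT x|lborel. f x) = (LINT x|density (distr lborel borel (\<lambda>x::'a. 0 + c *\<^sub>R x)) (\<lambda>_. \<bar>c\<bar>^DIM('a)). f x)"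
    by (subst d[symmetric]) simp
  also have "\<dots> = (LINT x|lborel. (\<bar>c\<bar>^DIM('a)) *\<^sub>R f (c *\<^sub>R x))"
    by (subst integral_density) (auto simp: integral_distr)
  finally show "(LINT x|lborel. f (c *\<^sub>R x)) = (1 / \<bar>c\<bar> ^ DIM('a)) *\<^sub>R (LINT x|lborel. f x)" using c' by simp
qed

lemma
  fixes f :: "'a::euclidean_space \<Rightarrow> 'b::{banach, second_countable_topology}"
  shows integrable_lborel_shift: "integrable lborel (\<lambda>x. f (c + x)) \<longleftrightarrow> integrable lborel f"
    and integral_lborel_shift: "(LINT x|lborel. f (c + x)) = (LINT x|lborel. f x)"
proof -
  have *: "integrable lborel (\<lambda>x. g (d + x))" if "integrable lborel g" for g :: "'a \<Rightarrow> 'b" and d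
    using that by (subst (asm) lborel_distr_plus[of d, symmetric], subst (asm) integrable_distr_eq) auto
  show 1: "integrable lborel (\<lambda>x. f (c + x)) \<longleftrightarrow> integrable lborel f"
    using *[of f c] *[of "\<lambda>x. f (c + x)" "- c"] by auto
  show "(LINT x|lborel. f (c + x)) = (LINT x|lborel. f x)"
  proof (cases "integrable lborel f")
    case True
    then have [measurable]: "f \<in> borel_measurable borel" by auto
    show ?thesis by (subst (2) lborel_distr_plus[of c, symmetric], subst integral_distr) auto
  next
    case False
    then have "\<not> integrable lborel (\<lambda>x. f (c + x))" using 1 by simp
    then show ?thesis by (metis not_integrable_integral_eq False)
  qed
qed

lemma
  fixes f :: "'a::euclidean_space \<Rightarrow> 'b::{banach, second_countable_topology}"
  shows integrable_lborel_reflect: "integrable lborel (\<lambda>x. f (c - x)) \<longleftrightarrow> integrable lborel f"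
    and integral_lborel_reflect: "(LINT x|lborel. f (c - x)) = (LINT x|lborel. f x)"
  using integrable_lborel_uminus[of "\<lambda>x. f (c + x)"] integral_lborel_uminus[of "\<lambda>x. f (c + x)"]
    integrable_lborel_shift[of f c] integral_lborel_shift[of f c] by auto

lemma powr_neg_Lipschitz:
  fixes p r u v :: real
  assumes p: "p > 0" and r: "r > 0" "u \<ge> r" "v \<ge> r"
  shows "\<bar>u powr (- p) - v powr (- p)\<bar> \<le> p * r powr (- p - 1) * \<bar>u - v\<bar>"
proof -
  have "norm (u powr (- p) - v powr (- p)) \<le> p * r powr (- p - 1) * norm (u - v)"
  proof (rule field_differentiable_bound[of "{r..}" "\<lambda>x. x powr (- p)" "\<lambda>x. (- p) * x powr (- p - 1)"])
    show "((\<lambda>x. x powr (- p)) has_field_derivative - p * z powr (- p - 1)) (at z within {r..})" if "z \<in> {r..}" for z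
      using that r(1) by (auto intro!: derivative_eq_intros)
    show "norm (- p * z powr (- p - 1)) \<le> p * r powr (- p - 1)" if "z \<in> {r..}" for z
      using that r(1) p by (auto simp: abs_mult intro!: mult_left_mono powr_mono2')
  qed (use r in auto)
  then show ?thesis by simp
qed

section \<open>The sharply truncated kernel and its distance from the regularised one\<close>

context
  fixes s :: real
  assumes s: "0 < s" "s < 1"
begin

text \<open>For |z| \<le> |h| / 2 the point h - z keeps the distance |h| / 2 from the singularity.
  Against an odd kernel at scale \<epsilon> the constant term of the expansion disappears, and this
  bound controls the remainder.\<close>

lemma riesz_Lipschitz:
  fixes h :: "'a::euclidean_space"
  assumes h: "h \<noteq> 0"
  shows "\<exists>L\<ge>0. \<forall>z. norm z \<le> norm h / 2 \<longrightarrow> norm (riesz s (h - z) - riesz s h) \<le> L * norm z"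
proof -
  define p where "p = real DIM('a) + s + 1"
  have p: "p > 0" using s by (simp add: p_def add_nonneg_pos)
  define r where "r = norm h / 2"
  have r: "r > 0" using h by (simp add: r_def)
  define L where "L = r powr (- p) + p * r powr (- p - 1) * norm h"
  have "norm (riesz s (h - z) - riesz s h) \<le> L * norm z" if z: "norm z \<le> r" for z
  proof -
    have n: "norm (h - z) \<ge> r" using norm_triangle_ineq2[of h z] z by (simp add: r_def)
    have "riesz s (h - z) - riesz s h = - (norm (h - z) powr (- p) *\<^sub>R z) + (norm (h - z) powr (- p) - norm h powr (- p)) *\<^sub>R h"
      by (simp add: riesz_def p_def algebra_simps)
    then have "norm (riesz s (h - z) - riesz s h) \<le> norm (- (norm (h - z) powr (- p) *\<^sub>R z)) + norm ((norm (h - z) powr (- p) - norm h powr (- p)) *\<^sub>R h)"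
      by (simp only: norm_triangle_ineq)
    also have "norm (- (norm (h - z) powr (- p) *\<^sub>R z)) = norm (norm (h - z) powr (- p) *\<^sub>R z)" by (rule norm_minus_cancel)
    also have "norm (norm (h - z) powr (- p) *\<^sub>R z) \<le> r powr (- p) * norm z"
      using n r p by (auto intro!: mult_right_mono powr_mono2')
    also have "norm ((norm (h - z) powr (- p) - norm h powr (- p)) *\<^sub>R h) \<le> (p * r powr (- p - 1) * norm z) * norm h"
    proof -
      have "\<bar>norm (h - z) powr (- p) - norm h powr (- p)\<bar> \<le> p * r powr (- p - 1) * \<bar>norm (h - z) - norm h\<bar>"
        using p r n by (intro powr_neg_Lipschitz) (auto simp: r_def)
      also have "\<dots> \<le> p * r powr (- p - 1) * norm z"
        using p norm_triangle_ineq3[of "h - z" h] by (intro mult_left_mono) auto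
      finally show ?thesis by (simp add: mult_right_mono)
    qed
    finally show ?thesis by (simp add: L_def algebra_simps)
  qed
  moreover have "L \<ge> 0" using p by (simp add: L_def)
  ultimately show ?thesis by (auto simp: r_def)
qed

definition cut :: "real \<Rightarrow> 'a::euclidean_space \<Rightarrow> 'a" where
  "cut \<epsilon> z = indicator {z. \<epsilon> < norm z} z *\<^sub>R riesz s z"

lemma cut_minus: "cut \<epsilon> (- z) = - cut \<epsilon> z"
  by (simp add: cut_def riesz_minus indicator_def)

lemma borel_measurable_cut[measurable]: "(cut \<epsilon> :: 'a::euclidean_space \<Rightarrow> 'a) \<in> borel_measurable borel"
  unfolding cut_def by measurable

text \<open>T = 1 / \<epsilon>^2 makes the defect, up to the factor \<epsilon>^(-(n+s)), a fixed
  profile in z / \<epsilon>.\<close>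

definition cut_defect :: "real \<Rightarrow> 'a::euclidean_space \<Rightarrow> 'a" where
  "cut_defect \<epsilon> z = cut \<epsilon> z - reg s (1 / \<epsilon>\<^sup>2) z"

lemma cut_defect_minus: "cut_defect \<epsilon> (- z) = - cut_defect \<epsilon> z"
  by (simp add: cut_defect_def cut_minus reg_minus)

lemma borel_measurable_cut_defect[measurable]: "(cut_defect \<epsilon> :: 'a::euclidean_space \<Rightarrow> 'a) \<in> borel_measurable borel"
proof -
  note borel_measurable_reg[OF s, measurable]
  show ?thesis unfolding cut_defect_def by measurable
qed

text \<open>Majorant of the defect at scale one: linear near the origin, where only the regularised
  kernel remains, and of order -(n+s+2) at infinity, where the tail of the Gamma integral
  remains.\<close>

definition maj :: "'a::euclidean_space \<Rightarrow> real" where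
  "maj w = min (norm w powr (- (real DIM('a) + s + 2))) (norm w)"

lemma maj_nonneg: "0 \<le> maj w" by (simp add: maj_def)

lemma borel_measurable_maj[measurable]: "(maj :: 'a::euclidean_space \<Rightarrow> real) \<in> borel_measurable borel"
  unfolding maj_def by measurable

lemma integrable_maj: "integrable lborel (maj :: 'a::euclidean_space \<Rightarrow> real)"
  and integrable_norm_maj: "integrable lborel (\<lambda>w::'a. norm w * maj w)"
proof -
  have cb: "integrable lborel (\<lambda>z::'a. indicator (cball 0 1) z :: real)"
    by (intro integrable_real_indicator) (auto simp: emeasure_cball)
  have 1: "maj w \<le> indicator (cball 0 1) w + norm w powr (- (real DIM('a) + s + 2)) * indicator {z. 1 \<le> norm z} w" for w :: 'a
  proof (cases "norm w \<le> 1")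
    case True
    have "maj w \<le> norm w" by (simp add: maj_def)
    then have "maj w \<le> 1" using True by linarith
    then show ?thesis using True by (auto split: split_indicator simp: add_increasing2)
  qed (auto simp: maj_def)
  show "integrable lborel (maj :: 'a \<Rightarrow> real)"
  proof (rule Bochner_Integration.integrable_bound)
    show "integrable lborel (\<lambda>w::'a. indicator (cball 0 1) w + norm w powr (- (real DIM('a) + s + 2)) * indicator {z. 1 \<le> norm z} w)"
      using s by (intro Bochner_Integration.integrable_add cb integrable_norm_powr_tail) auto
    show "AE w in lborel. norm (maj w) \<le> norm (indicator (cball 0 1) w + norm w powr (- (real DIM('a) + s + 2)) * indicator {z::'a. 1 \<le> norm z} w)"
      using 1 by (intro AE_I2) (simp add: order.trans[OF _ abs_ge_self] abs_of_nonneg[OF maj_nonneg])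
  qed simp
  have 2: "norm w * maj w \<le> indicator (cball 0 1) w + norm w powr (- (real DIM('a) + s + 1)) * indicator {z. 1 \<le> norm z} w" for w :: 'a
  proof (cases "norm w \<le> 1")
    case True
    have "maj w \<le> 1" using True by (auto simp: maj_def min_le_iff_disj)
    then have "norm w * maj w \<le> 1 * 1" using True maj_nonneg by (intro mult_mono) auto
    then show ?thesis using True by (auto split: split_indicator simp: add_increasing2)
  next
    case False
    have e: "1 + - (real DIM('a) + s + 2) = - (real DIM('a) + s + 1)" by simp
    have "norm w * maj w \<le> norm w * norm w powr (- (real DIM('a) + s + 2))" by (intro mult_left_mono) (auto simp: maj_def)
    also have "\<dots> = norm w powr (- (real DIM('a) + s + 1))" using powr_mult_base[of "norm w" "- (real DIM('a) + s + 2)"] unfolding e by simp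
    finally show ?thesis using False by simp
  qed
  show "integrable lborel (\<lambda>w::'a. norm w * maj w)"
  proof (rule Bochner_Integration.integrable_bound)
    show "integrable lborel (\<lambda>w::'a. indicator (cball 0 1) w + norm w powr (- (real DIM('a) + s + 1)) * indicator {z. 1 \<le> norm z} w)"
      using s by (intro Bochner_Integration.integrable_add cb integrable_norm_powr_tail) auto
    show "AE w in lborel. norm (norm w * maj w) \<le> norm (indicator (cball 0 1) w + norm w powr (- (real DIM('a) + s + 1)) * indicator {z::'a. 1 \<le> norm z} w)"
      using 2 by (intro AE_I2) (simp add: abs_mult order.trans[OF _ abs_ge_self] abs_of_nonneg[OF maj_nonneg])
  qed simp
qed

text \<open>Inside radius \<epsilon> the sharp kernel is absent and \<open>norm_reg_le_T\<close>
  applies; outside, the difference is a Gamma tail bounded by \<open>norm_riesz_minus_reg\<close>.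
  The choice T = 1 / \<epsilon>^2 gives both the same power of \<epsilon>.\<close>

lemma cut_defect_bound: "\<exists>C\<ge>0. \<forall>\<epsilon>>0. \<forall>z::'a::euclidean_space. norm (cut_defect \<epsilon> z) \<le> C * \<epsilon> powr (- (real DIM('a) + s)) * maj ((1 / \<epsilon>) *\<^sub>R z)"
proof -
  define n where "n = real DIM('a)"
  define a where "a = kexp TYPE('a) s"
  have a: "a > 0" unfolding a_def by (rule kexp_pos[OF s])
  define C where "C = max a (1 / (a * Gamma a))"
  have C: "C \<ge> 0" using a by (simp add: C_def)
  have "norm (cut_defect \<epsilon> z) \<le> C * \<epsilon> powr (- (n + s)) * maj ((1 / \<epsilon>) *\<^sub>R z)" if \<epsilon>: "\<epsilon> > 0" for \<epsilon> and z :: 'a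
  proof (cases "z = 0")
    case True
    then show ?thesis by (simp add: cut_defect_def cut_def riesz_def reg_def maj_def)
  next
    case False
    define w where "w = norm z / \<epsilon>"
    have w: "w > 0" "norm z = \<epsilon> * w" using False \<epsilon> by (auto simp: w_def)
    have maj: "maj ((1 / \<epsilon>) *\<^sub>R z) = min (w powr (- (n + s + 2))) w"
      using \<epsilon> by (simp add: maj_def w_def n_def)
    show ?thesis
    proof (cases "w > 1")
      case True
      have "\<epsilon> < norm z" using True \<epsilon> by (simp add: w)
      then have "norm (cut_defect \<epsilon> z) = norm (riesz s z - reg s (1 / \<epsilon>\<^sup>2) z)" by (simp add: cut_defect_def cut_def)
      also have "\<dots> \<le> a / (1 / \<epsilon>\<^sup>2) * norm z powr (- (n + s + 2))"
        unfolding a_def n_def by (rule norm_riesz_minus_reg[OF s]) (use \<epsilon> in auto)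
      also have "\<dots> = a * (\<epsilon> powr (- (n + s)) * w powr (- (n + s + 2)))"
      proof -
        have e: "2 + - (n + s + 2) = - (n + s)" by simp
        have "\<epsilon>\<^sup>2 * \<epsilon> powr (- (n + s + 2)) = \<epsilon> powr 2 * \<epsilon> powr (- (n + s + 2))" using \<epsilon> by simp
        also have "\<dots> = \<epsilon> powr (- (n + s))" by (simp only: powr_add[symmetric] e)
        finally show ?thesis using \<epsilon> w by (simp add: powr_mult mult_ac)
      qed
      also have "\<dots> \<le> C * (\<epsilon> powr (- (n + s)) * w powr (- (n + s + 2)))"
        by (intro mult_right_mono) (auto simp: C_def)
      also have "w powr (- (n + s + 2)) = maj ((1 / \<epsilon>) *\<^sub>R z)"
      proof -
        have "w powr (- (n + s + 2)) \<le> w powr 0" using True s by (intro powr_mono) (auto simp: n_def)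
        then show ?thesis unfolding maj using True by simp
      qed
      finally show ?thesis by (simp add: mult.assoc)
    next
      case w1: False
      have "\<not> \<epsilon> < norm z" using w1 \<epsilon> by (simp add: w)
      then have "norm (cut_defect \<epsilon> z) = norm (reg s (1 / \<epsilon>\<^sup>2) z)" by (simp add: cut_defect_def cut_def)
      also have "\<dots> \<le> (1 / \<epsilon>\<^sup>2) powr a / (a * Gamma a) * norm z"
        unfolding a_def by (rule norm_reg_le_T[OF s]) (use \<epsilon> in auto)
      also have "(1 / \<epsilon>\<^sup>2) powr a = \<epsilon> powr (- (n + s + 1))"
      proof -
        have e: "2 * a = n + s + 1" by (simp add: a_def n_def kexp_def)
        have "(1 / \<epsilon>\<^sup>2) powr a = 1 / ((norm \<epsilon>)\<^sup>2 powr a)" using \<epsilon> by (simp add: powr_divide)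
        also have "\<dots> = 1 / \<epsilon> powr (n + s + 1)" unfolding powr_norm_square e using \<epsilon> by simp
        finally show ?thesis by (simp only: powr_minus_divide)
      qed
      also have "\<epsilon> powr (- (n + s + 1)) / (a * Gamma a) * norm z = 1 / (a * Gamma a) * (\<epsilon> powr (- (n + s)) * w)"
      proof -
        have e: "1 + - (n + s + 1) = - (n + s)" by simp
        show ?thesis using powr_mult_base[of \<epsilon> "- (n + s + 1)"] \<epsilon> unfolding e w by (simp add: mult_ac)
      qed
      also have "\<dots> \<le> C * (\<epsilon> powr (- (n + s)) * w)"
        using w by (intro mult_right_mono) (auto simp: C_def)
      also have "w = maj ((1 / \<epsilon>) *\<^sub>R z)"
      proof -
        have "w powr 0 \<le> w powr (- (n + s + 2))" using w w1 s by (intro powr_mono') (auto simp: n_def)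
        then show ?thesis unfolding maj using w w1 by simp
      qed
      finally show ?thesis by (simp add: mult.assoc)
    qed
  qed
  then show ?thesis using C unfolding n_def by blast
qed

lemma norm_cut_le: "norm (cut \<epsilon> (z::'a::euclidean_space)) \<le> norm z powr (- (real DIM('a) + s)) * indicator {z. \<epsilon> \<le> norm z} z"
  by (auto simp: cut_def norm_riesz split: split_indicator)

lemma integrable_cut:
  assumes \<epsilon>: "\<epsilon> > 0"
  shows "integrable lborel (cut \<epsilon> :: 'a::euclidean_space \<Rightarrow> 'a)"
proof (rule Bochner_Integration.integrable_bound)
  show "integrable lborel (\<lambda>z::'a. norm z powr (- (real DIM('a) + s)) * indicator {z. \<epsilon> \<le> norm z} z)"
    using s \<epsilon> by (intro integrable_norm_powr_tail) auto
  show "AE z in lborel. norm (cut \<epsilon> z) \<le> norm (norm z powr (- (real DIM('a) + s)) * indicator {z::'a. \<epsilon> \<le> norm z} z)"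
    using norm_cut_le by (intro AE_I2) (simp add: order.trans[OF _ abs_ge_self])
qed simp

lemma bounded_cut:
  assumes \<epsilon>: "\<epsilon> > 0"
  shows "norm (cut \<epsilon> (z::'a::euclidean_space)) \<le> \<epsilon> powr (- (real DIM('a) + s))"
proof (cases "\<epsilon> < norm z")
  case True
  then show ?thesis using \<epsilon> s by (auto simp: cut_def norm_riesz intro!: powr_mono2' add_nonneg_nonneg)
qed (simp add: cut_def)

lemma integrable_cut_defect:
  assumes \<epsilon>: "\<epsilon> > 0"
  shows "integrable lborel (cut_defect \<epsilon> :: 'a::euclidean_space \<Rightarrow> 'a)"
  unfolding cut_defect_def using \<epsilon> integrable_reg[OF s, of "1 / \<epsilon>\<^sup>2"] integrable_cut[OF \<epsilon>] by auto

text \<open>Scaling by \<epsilon>: homogeneity contributes \<epsilon>^(-(n+s)) and the volume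
  element \<epsilon>^n.\<close>

lemma L1_cut: "\<exists>C\<ge>0. \<forall>\<epsilon>>0. (LINT z|lborel. norm (cut \<epsilon> (z::'a::euclidean_space))) \<le> C * \<epsilon> powr (- s)"
proof -
  define g where "g = (\<lambda>w::'a. norm w powr (- (real DIM('a) + s)) * indicator {w. 1 \<le> norm w} w)"
  have g: "integrable lborel g" unfolding g_def using s by (intro integrable_norm_powr_tail) auto
  have "(LINT z|lborel. norm (cut \<epsilon> (z::'a))) \<le> (LINT w|lborel. g w) * \<epsilon> powr (- s)" if \<epsilon>: "\<epsilon> > 0" for \<epsilon>
  proof -
    have le: "norm (cut \<epsilon> z) \<le> \<epsilon> powr (- (real DIM('a) + s)) * g ((1 / \<epsilon>) *\<^sub>R z)" for z :: 'a
    proof (cases "\<epsilon> < norm z")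
      case True
      have "norm (cut \<epsilon> z) \<le> (\<epsilon> * (norm z / \<epsilon>)) powr (- (real DIM('a) + s))" using norm_cut_le[of \<epsilon> z] True \<epsilon> by simp
      also have "\<dots> = \<epsilon> powr (- (real DIM('a) + s)) * (norm z / \<epsilon>) powr (- (real DIM('a) + s))"
        by (rule powr_mult)
      finally show ?thesis using True \<epsilon> by (simp add: g_def)
    qed (simp add: cut_def g_def)
    have "(LINT z|lborel. norm (cut \<epsilon> (z::'a))) \<le> (LINT z|lborel. \<epsilon> powr (- (real DIM('a) + s)) * g ((1 / \<epsilon>) *\<^sub>R z))"
      using \<epsilon> by (intro integral_mono integrable_norm integrable_cut integrable_mult_right integrable_lborel_scale g le) auto
    also have "\<dots> = \<epsilon> powr (- (real DIM('a) + s)) * (\<epsilon> powr DIM('a) * (LINT w|lborel. g w))"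
      using \<epsilon> by (simp add: integral_lborel_scale[OF g] power_one_over powr_realpow divide_simps)
    also have "\<dots> = (LINT w|lborel. g w) * \<epsilon> powr (- s)"
    proof -
      have e: "- (real DIM('a) + s) + real DIM('a) = - s" by simp
      have "\<epsilon> powr (- (real DIM('a) + s)) * \<epsilon> powr DIM('a) = \<epsilon> powr (- s)" by (simp only: powr_add[symmetric] e)
      then show ?thesis by (simp only: mult.assoc[symmetric]) (simp add: mult.commute)
    qed
    finally show ?thesis .
  qed
  moreover have "(LINT w|lborel. g w) \<ge> 0" by (intro integral_nonneg_AE) (auto simp: g_def)
  ultimately show ?thesis by blast
qed

text \<open>The mass grows like \<epsilon>^(-s), but a factor |z| is worth \<epsilon>, so the first
  moment is of order \<epsilon>^(1-s) and vanishes in the limit.\<close>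

lemma L1_cut_defect: "\<exists>C\<ge>0. \<forall>\<epsilon>>0. (LINT z|lborel. norm (cut_defect \<epsilon> (z::'a::euclidean_space))) \<le> C * \<epsilon> powr (- s)
    \<and> integrable lborel (\<lambda>z::'a. norm z * norm (cut_defect \<epsilon> z))
    \<and> (LINT z|lborel. norm z * norm (cut_defect \<epsilon> (z::'a))) \<le> C * \<epsilon> powr (1 - s)"
proof -
  obtain B where B: "B \<ge> 0" "\<And>\<epsilon> z. \<epsilon> > 0 \<Longrightarrow> norm (cut_defect \<epsilon> (z::'a)) \<le> B * \<epsilon> powr (- (real DIM('a) + s)) * maj ((1 / \<epsilon>) *\<^sub>R z)"
    using cut_defect_bound by blast
  define C where "C = max (B * (LINT w|lborel. maj (w::'a))) (B * (LINT w|lborel. norm w * maj (w::'a)))"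
  have pos: "(LINT w|lborel. maj (w::'a)) \<ge> 0" by (intro integral_nonneg_AE) (auto simp: maj_nonneg)
  have "B * (LINT w|lborel. maj (w::'a)) \<le> C" unfolding C_def by (rule max.cobounded1)
  then have C: "C \<ge> 0" using mult_nonneg_nonneg[OF B(1) pos] by linarith
  have "(LINT z|lborel. norm (cut_defect \<epsilon> (z::'a))) \<le> C * \<epsilon> powr (- s)
    \<and> integrable lborel (\<lambda>z::'a. norm z * norm (cut_defect \<epsilon> z))
    \<and> (LINT z|lborel. norm z * norm (cut_defect \<epsilon> (z::'a))) \<le> C * \<epsilon> powr (1 - s)" if \<epsilon>: "\<epsilon> > 0" for \<epsilon>
  proof (intro conjI)
    have e: "- (real DIM('a) + s) + real DIM('a) = - s" by simp
    have pw: "\<epsilon> powr (- (real DIM('a) + s)) * \<epsilon> ^ DIM('a) = \<epsilon> powr (- s)"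
      using \<epsilon> by (simp only: powr_realpow[symmetric] powr_add[symmetric] e)
    have "(LINT z|lborel. norm (cut_defect \<epsilon> (z::'a))) \<le> (LINT z|lborel. B * \<epsilon> powr (- (real DIM('a) + s)) * maj ((1 / \<epsilon>) *\<^sub>R (z::'a)))"
      using \<epsilon> by (intro integral_mono integrable_norm integrable_cut_defect integrable_mult_right integrable_lborel_scale integrable_maj B) auto
    also have "\<dots> = B * (LINT w|lborel. maj (w::'a)) * (\<epsilon> powr (- (real DIM('a) + s)) * \<epsilon> ^ DIM('a))"
      using \<epsilon> by (simp add: integral_lborel_scale[OF integrable_maj] power_one_over)
    also have "\<dots> \<le> C * \<epsilon> powr (- s)" unfolding pw by (intro mult_right_mono) (auto simp: C_def)
    finally show "(LINT z|lborel. norm (cut_defect \<epsilon> (z::'a))) \<le> C * \<epsilon> powr (- s)" .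
    have eq: "norm z * (B * \<epsilon> powr (- (real DIM('a) + s)) * maj ((1 / \<epsilon>) *\<^sub>R z)) = B * \<epsilon> powr (- (real DIM('a) + s)) * \<epsilon> * (\<lambda>w. norm w * maj w) ((1 / \<epsilon>) *\<^sub>R z)" for z :: 'a
      using \<epsilon> by (simp add: field_simps)
    have le: "norm z * norm (cut_defect \<epsilon> z) \<le> B * \<epsilon> powr (- (real DIM('a) + s)) * \<epsilon> * (\<lambda>w. norm w * maj w) ((1 / \<epsilon>) *\<^sub>R z)" for z :: 'a
      unfolding eq[symmetric] using B(2)[OF \<epsilon>, of z] by (intro mult_left_mono) auto
    have int: "integrable lborel (\<lambda>z::'a. B * \<epsilon> powr (- (real DIM('a) + s)) * \<epsilon> * (\<lambda>w. norm w * maj w) ((1 / \<epsilon>) *\<^sub>R z))"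
      by (rule integrable_mult_right, rule integrable_lborel_scale[OF integrable_norm_maj]) (use \<epsilon> in auto)
    show int': "integrable lborel (\<lambda>z::'a. norm z * norm (cut_defect \<epsilon> z))"
    proof (rule Bochner_Integration.integrable_bound[OF int])
      show "AE z in lborel. norm (norm z * norm (cut_defect \<epsilon> z)) \<le> norm (B * \<epsilon> powr (- (real DIM('a) + s)) * \<epsilon> * (\<lambda>w. norm w * maj w) ((1 / \<epsilon>) *\<^sub>R (z::'a)))"
      proof (rule AE_I2)
        fix z :: 'a
        have e: "norm (norm z * norm (cut_defect \<epsilon> z)) = norm z * norm (cut_defect \<epsilon> z)" by simp
        show "norm (norm z * norm (cut_defect \<epsilon> z)) \<le> norm (B * \<epsilon> powr (- (real DIM('a) + s)) * \<epsilon> * (\<lambda>w. norm w * maj w) ((1 / \<epsilon>) *\<^sub>R z))"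
          unfolding e by (rule order.trans[OF le]) (simp only: real_norm_def abs_ge_self)
      qed
    qed simp
    have "(LINT z|lborel. norm z * norm (cut_defect \<epsilon> (z::'a))) \<le> (LINT z|lborel. B * \<epsilon> powr (- (real DIM('a) + s)) * \<epsilon> * (\<lambda>w. norm w * maj w) ((1 / \<epsilon>) *\<^sub>R (z::'a)))"
      by (rule integral_mono[OF int' int le])
    also have "\<dots> = B * \<epsilon> powr (- (real DIM('a) + s)) * \<epsilon> * (LINT z|lborel. (\<lambda>w. norm w * maj w) ((1 / \<epsilon>) *\<^sub>R (z::'a)))"
      by (rule integral_mult_right_zero)
    also have "(LINT z|lborel. (\<lambda>w. norm w * maj w) ((1 / \<epsilon>) *\<^sub>R (z::'a))) = \<epsilon> ^ DIM('a) * (LINT w|lborel. norm w * maj (w::'a))"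
      using \<epsilon> by (subst integral_lborel_scale[OF integrable_norm_maj]) (auto simp: power_one_over)
    also have "B * \<epsilon> powr (- (real DIM('a) + s)) * \<epsilon> * (\<epsilon> ^ DIM('a) * (LINT w|lborel. norm w * maj (w::'a)))
      = B * (LINT w|lborel. norm w * maj (w::'a)) * (\<epsilon> * (\<epsilon> powr (- (real DIM('a) + s)) * \<epsilon> ^ DIM('a)))" by (simp only: mult_ac)
    also have "\<epsilon> * (\<epsilon> powr (- (real DIM('a) + s)) * \<epsilon> ^ DIM('a)) = \<epsilon> powr (1 - s)"
      unfolding pw using powr_mult_base[of \<epsilon> "- s"] \<epsilon> by simp
    also have "B * (LINT w|lborel. norm w * maj (w::'a)) * \<epsilon> powr (1 - s) \<le> C * \<epsilon> powr (1 - s)"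
      by (intro mult_right_mono) (auto simp: C_def)
    finally show "(LINT z|lborel. norm z * norm (cut_defect \<epsilon> (z::'a))) \<le> C * \<epsilon> powr (1 - s)" .
  qed
  then show ?thesis using C by blast
qed

end

lemma integrable_inner_bounded:
  fixes P Q :: "'a::euclidean_space \<Rightarrow> 'a"
  assumes P: "integrable lborel P" and Q: "Q \<in> borel_measurable borel" "\<And>z. norm (Q z) \<le> C"
  shows "integrable lborel (\<lambda>z. P z \<bullet> Q z)"
proof (rule Bochner_Integration.integrable_bound)
  show "integrable lborel (\<lambda>z. C * norm (P z))" using P by auto
  have "norm (P z \<bullet> Q z) \<le> norm (C * norm (P z))" for z
  proof -
    have "norm (P z \<bullet> Q z) \<le> norm (P z) * norm (Q z)" using Cauchy_Schwarz_ineq2 by simp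
    also have "\<dots> \<le> norm (P z) * C" by (intro mult_left_mono Q) auto
    also have "\<dots> \<le> norm (C * norm (P z))" by (simp add: mult.commute abs_le_D1)
    finally show ?thesis .
  qed
  then show "AE z in lborel. norm (P z \<bullet> Q z) \<le> norm (C * norm (P z))" by simp
  have [measurable]: "P \<in> borel_measurable borel" "Q \<in> borel_measurable borel" using P Q by auto
  show "(\<lambda>z. P z \<bullet> Q z) \<in> borel_measurable lborel" by measurable
qed

section \<open>Principal value of the convolution square of the kernel\<close>

context
  fixes s :: real and h :: "'a::euclidean_space"
  assumes s: "0 < s" "s < 1" and h: "h \<noteq> 0"
begin

lemma bounded_cut_defect: "\<epsilon> > 0 \<Longrightarrow> \<exists>C. \<forall>z::'a. norm (cut_defect s \<epsilon> z) \<le> C"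
proof -
  assume \<epsilon>: "\<epsilon> > 0"
  obtain C where C: "\<And>z::'a. norm (reg s (1 / \<epsilon>\<^sup>2) z) \<le> C" using bounded_reg[OF s, of "1 / \<epsilon>\<^sup>2"] \<epsilon> by auto
  have "norm (cut_defect s \<epsilon> z) \<le> \<epsilon> powr (- (real DIM('a) + s)) + C" for z :: 'a
    unfolding cut_defect_def[OF s] by (intro order.trans[OF norm_triangle_ineq4] add_mono bounded_cut[OF s \<epsilon>] C)
  then show ?thesis by blast
qed

text \<open>With reg = c - b for the sharp kernel c and the defect b, the convolution squares differ
  by twice the convolution of b and c minus the convolution square of b. Away from the origin b is
  of order \<epsilon>^2 and meets a mass \<epsilon>^(-s). Near the origin b meets the smooth
  function c(h - z); its value at z = 0 integrates to zero against the odd b, and the Lipschitz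
  remainder meets the first moment, of order \<epsilon>^(1-s).\<close>

lemma cut_conv_minus_rconv: "\<exists>K\<ge>0. \<forall>\<epsilon>>0. \<epsilon> < norm h / 2 \<longrightarrow>
   \<bar>(LINT z|lborel. cut s \<epsilon> z \<bullet> cut s \<epsilon> (h - z)) - rconv s (1 / \<epsilon>\<^sup>2) (1 / \<epsilon>\<^sup>2) h\<bar> \<le> K * (\<epsilon> powr (1 - s) + \<epsilon> powr (2 - s))"
proof -
  define n where "n = real DIM('a)"
  define r where "r = norm h / 2"
  have r: "r > 0" using h by (simp add: r_def)
  obtain L where L: "L \<ge> 0" "\<And>z. norm z \<le> r \<Longrightarrow> norm (riesz s (h - z) - riesz s h) \<le> L * norm z"
    using riesz_Lipschitz[OF s h] unfolding r_def by blast
  obtain B where B: "B \<ge> 0" "\<And>\<epsilon> z. \<epsilon> > 0 \<Longrightarrow> norm (cut_defect s \<epsilon> (z::'a)) \<le> B * \<epsilon> powr (- (real DIM('a) + s)) * maj s ((1 / \<epsilon>) *\<^sub>R z)"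
    using cut_defect_bound[OF s, where 'a='a] by blast
  obtain C where C: "C \<ge> 0" "\<And>\<epsilon>. \<epsilon> > 0 \<Longrightarrow> (LINT z|lborel. norm (cut s \<epsilon> (z::'a))) \<le> C * \<epsilon> powr (- s)"
    using L1_cut[OF s, where 'a='a] by blast
  obtain C' where C': "C' \<ge> 0" "\<And>\<epsilon>. \<epsilon> > 0 \<Longrightarrow> (LINT z|lborel. norm (cut_defect s \<epsilon> (z::'a))) \<le> C' * \<epsilon> powr (- s)"
    "\<And>\<epsilon>. \<epsilon> > 0 \<Longrightarrow> integrable lborel (\<lambda>z::'a. norm z * norm (cut_defect s \<epsilon> z))"
    "\<And>\<epsilon>. \<epsilon> > 0 \<Longrightarrow> (LINT z|lborel. norm z * norm (cut_defect s \<epsilon> (z::'a))) \<le> C' * \<epsilon> powr (1 - s)"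
    using L1_cut_defect[OF s, where 'a='a] by blast
  define S where "S = B * r powr (- (n + s + 2))"
  have S0: "S \<ge> 0" using B by (simp add: S_def)
  define K where "K = max (2 * L * C') (2 * S * C + 2 * S * C')"
  have K0: "K \<ge> 0" unfolding K_def using L C' by (simp add: max.coboundedI1)
  note [measurable] = borel_measurable_cut[OF s] borel_measurable_cut_defect[OF s] borel_measurable_riesz
  have "\<bar>(LINT z|lborel. cut s \<epsilon> z \<bullet> cut s \<epsilon> (h - z)) - rconv s (1 / \<epsilon>\<^sup>2) (1 / \<epsilon>\<^sup>2) h\<bar> \<le> K * (\<epsilon> powr (1 - s) + \<epsilon> powr (2 - s))"
    if \<epsilon>: "\<epsilon> > 0" and \<epsilon>r: "\<epsilon> < r" for \<epsilon>
  proof -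
    define b c where "b = (cut_defect s \<epsilon> :: 'a \<Rightarrow> 'a)" and "c = (cut s \<epsilon> :: 'a \<Rightarrow> 'a)"
    have [measurable]: "b \<in> borel_measurable borel" "c \<in> borel_measurable borel" unfolding b_def c_def by measurable
    have reg: "reg s (1 / \<epsilon>\<^sup>2) z = c z - b z" for z by (simp add: b_def c_def cut_defect_def[OF s])
    have bi: "integrable lborel b" and ci: "integrable lborel c"
      unfolding b_def c_def using integrable_cut_defect[OF s \<epsilon>] integrable_cut[OF s \<epsilon>] by auto
    obtain Bb where Bb: "\<And>z. norm (b z) \<le> Bb" using bounded_cut_defect[OF \<epsilon>] unfolding b_def by blast
    obtain Bc where Bc: "\<And>z. norm (c z) \<le> Bc" using bounded_cut[OF s \<epsilon>] unfolding c_def by blast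
    have i1: "integrable lborel (\<lambda>z. b z \<bullet> c (h - z))" by (rule integrable_inner_bounded[OF bi _ Bc]) measurable
    have i2: "integrable lborel (\<lambda>z. c z \<bullet> b (h - z))" by (rule integrable_inner_bounded[OF ci _ Bb]) measurable
    have i3: "integrable lborel (\<lambda>z. b z \<bullet> b (h - z))" by (rule integrable_inner_bounded[OF bi _ Bb]) measurable
    have i4: "integrable lborel (\<lambda>z. c z \<bullet> c (h - z))" by (rule integrable_inner_bounded[OF ci _ Bc]) measurable
    define I1 where "I1 = (LINT z|lborel. b z \<bullet> c (h - z))"
    define I2 where "I2 = (LINT z|lborel. b z \<bullet> b (h - z))"
    have sym: "(LINT z|lborel. c z \<bullet> b (h - z)) = I1"
      unfolding I1_def using integral_lborel_reflect[of "\<lambda>z. c z \<bullet> b (h - z)" h] by (simp add: inner_commute)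
    have "rconv s (1 / \<epsilon>\<^sup>2) (1 / \<epsilon>\<^sup>2) h = (LINT z|lborel. (c z \<bullet> c (h - z) - c z \<bullet> b (h - z)) - (b z \<bullet> c (h - z) - b z \<bullet> b (h - z)))"
      unfolding rconv_def reg by (simp add: inner_diff_left inner_diff_right algebra_simps)
    also have "\<dots> = (LINT z|lborel. c z \<bullet> c (h - z)) - I1 - (I1 - I2)"
      using i1 i2 i3 i4 by (simp add: sym I1_def[symmetric] I2_def[symmetric])
    finally have D: "(LINT z|lborel. cut s \<epsilon> z \<bullet> cut s \<epsilon> (h - z)) - rconv s (1 / \<epsilon>\<^sup>2) (1 / \<epsilon>\<^sup>2) h = 2 * I1 - I2"
      by (simp add: c_def)
    \<comment> \<open>Decay of \<open>maj\<close> at distance r: up to a constant,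
      \<epsilon>^(-(n+s)) (r / \<epsilon>)^(-(n+s+2)) equals \<epsilon>^2.\<close>
    have Sb: "norm (b z) \<le> S * \<epsilon>\<^sup>2" if "norm z \<ge> r" for z
    proof -
      have z: "norm z > 0" using that r by linarith
      have "norm (b z) \<le> B * \<epsilon> powr (- (n + s)) * maj s ((1 / \<epsilon>) *\<^sub>R z)" unfolding b_def n_def by (rule B(2)[OF \<epsilon>])
      also have "\<dots> \<le> B * \<epsilon> powr (- (n + s)) * (norm z / \<epsilon>) powr (- (n + s + 2))"
        using B \<epsilon> by (intro mult_left_mono) (auto simp: maj_def[OF s] n_def)
      also have "\<dots> = B * (\<epsilon> powr (- (n + s)) / \<epsilon> powr (- (n + s + 2))) * norm z powr (- (n + s + 2))"
        using z \<epsilon> by (simp add: powr_divide)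
      also have "\<epsilon> powr (- (n + s)) / \<epsilon> powr (- (n + s + 2)) = \<epsilon>\<^sup>2"
      proof -
        have "\<epsilon> powr (- (n + s)) / \<epsilon> powr (- (n + s + 2)) = \<epsilon> powr (- (n + s) - - (n + s + 2))" by (rule powr_diff[symmetric])
        also have "\<dots> = \<epsilon> powr 2" by simp
        finally show ?thesis using \<epsilon> by simp
      qed
      also have "B * \<epsilon>\<^sup>2 * norm z powr (- (n + s + 2)) \<le> B * \<epsilon>\<^sup>2 * r powr (- (n + s + 2))"
        using B r s that by (intro mult_left_mono powr_mono2') (auto simp: n_def)
      finally show ?thesis by (simp add: S_def mult_ac)
    qed
    have cn: "integrable lborel (\<lambda>z. norm (c (h - z)))" "(LINT z|lborel. norm (c (h - z))) \<le> C * \<epsilon> powr (- s)"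
      using integrable_lborel_reflect[of "\<lambda>z. norm (c z)" h] integral_lborel_reflect[of "\<lambda>z. norm (c z)" h] ci C(2)[OF \<epsilon>] by (auto simp: c_def)
    have bn: "integrable lborel (\<lambda>z. norm (b (h - z)))" "(LINT z|lborel. norm (b (h - z))) \<le> C' * \<epsilon> powr (- s)"
      using integrable_lborel_reflect[of "\<lambda>z. norm (b z)" h] integral_lborel_reflect[of "\<lambda>z. norm (b z)" h] bi C'(2)[OF \<epsilon>] by (auto simp: b_def)
    have e2s: "\<epsilon>\<^sup>2 * \<epsilon> powr (- s) = \<epsilon> powr (2 - s)"
    proof -
      have "\<epsilon>\<^sup>2 * \<epsilon> powr (- s) = \<epsilon> powr 2 * \<epsilon> powr (- s)" using \<epsilon> by simp
      also have "\<dots> = \<epsilon> powr (2 - s)" unfolding powr_add[symmetric] by simp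
      finally show ?thesis .
    qed
    have I2: "\<bar>I2\<bar> \<le> 2 * S * C' * \<epsilon> powr (2 - s)"
    proof -
      have le: "\<bar>b z \<bullet> b (h - z)\<bar> \<le> S * \<epsilon>\<^sup>2 * (norm (b z) + norm (b (h - z)))" for z
      proof -
        have 1: "\<bar>b z \<bullet> b (h - z)\<bar> \<le> norm (b z) * norm (b (h - z))" by (rule Cauchy_Schwarz_ineq2)
        \<comment> \<open>Since |h| = 2 r, the points z and h - z cannot both be closer than r to
          the origin.\<close>
        have "norm z \<ge> r \<or> norm (h - z) \<ge> r" using norm_triangle_ineq[of z "h - z"] by (auto simp: r_def)
        then show ?thesis
        proof
          assume "norm z \<ge> r"
          from Sb[OF this] have "norm (b z) * norm (b (h - z)) \<le> S * \<epsilon>\<^sup>2 * norm (b (h - z))" by (intro mult_right_mono) auto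
          moreover have "0 \<le> S * \<epsilon>\<^sup>2 * norm (b z)" using S0 by simp
          ultimately show ?thesis using 1 by (simp add: distrib_left)
        next
          assume "norm (h - z) \<ge> r"
          from Sb[OF this] have "norm (b z) * norm (b (h - z)) \<le> norm (b z) * (S * \<epsilon>\<^sup>2)" by (intro mult_left_mono) auto
          moreover have "0 \<le> S * \<epsilon>\<^sup>2 * norm (b (h - z))" using S0 by simp
          ultimately show ?thesis using 1 by (simp add: distrib_left mult.commute)
        qed
      qed
      have "\<bar>I2\<bar> \<le> (LINT z|lborel. \<bar>b z \<bullet> b (h - z)\<bar>)" unfolding I2_def by (rule integral_abs_bound)
      also have "\<dots> \<le> (LINT z|lborel. S * \<epsilon>\<^sup>2 * (norm (b z) + norm (b (h - z))))"
        using i3 bi bn(1) le by (intro integral_mono) auto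
      also have "\<dots> = S * \<epsilon>\<^sup>2 * ((LINT z|lborel. norm (b z)) + (LINT z|lborel. norm (b (h - z))))"
        using bi bn(1) by simp
      also have "\<dots> \<le> S * \<epsilon>\<^sup>2 * (C' * \<epsilon> powr (- s) + C' * \<epsilon> powr (- s))"
        using S0 bn(2) C'(2)[OF \<epsilon>] by (intro mult_left_mono add_mono) (auto simp: b_def)
      also have "\<dots> = 2 * S * C' * (\<epsilon>\<^sup>2 * \<epsilon> powr (- s))" by (simp add: algebra_simps)
      finally show ?thesis unfolding e2s .
    qed
    have I1: "\<bar>I1\<bar> \<le> L * C' * \<epsilon> powr (1 - s) + S * C * \<epsilon> powr (2 - s)"
    proof -
      \<comment> \<open>The part of b where the Lipschitz bound is available. The ball is symmetric,
        so J remains odd, and its pairing with the constant \<open>riesz s h\<close> may be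
        subtracted for free.\<close>
      define J where "J = (\<lambda>z. indicator (cball 0 r) z *\<^sub>R b z)"
      have [measurable]: "cball (0::'a) r \<in> sets borel" by simp
      have Ji: "integrable lborel J" unfolding J_def using bi by (intro integrable_mult_indicator) auto
      have "(LINT z|lborel. J z) = 0" by (rule integral_lborel_odd) (simp add: J_def b_def cut_defect_minus[OF s] indicator_def)
      then have J0: "(LINT z|lborel. J z \<bullet> riesz s h) = 0"
        using integral_inner_left[OF Ji, of "riesz s h"] by simp
      have Jr: "integrable lborel (\<lambda>z. J z \<bullet> riesz s h)" using Ji by (intro integrable_inner_left) auto
      have "I1 = (LINT z|lborel. b z \<bullet> c (h - z) - J z \<bullet> riesz s h)"
        using i1 Jr J0 by (simp add: I1_def)
      also have "\<bar>\<dots>\<bar> \<le> (LINT z|lborel. \<bar>b z \<bullet> c (h - z) - J z \<bullet> riesz s h\<bar>)" by (rule integral_abs_bound)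
      also have "\<dots> \<le> (LINT z|lborel. L * (norm z * norm (b z)) + S * \<epsilon>\<^sup>2 * norm (c (h - z)))"
      proof (rule integral_mono)
        show "integrable lborel (\<lambda>z. \<bar>b z \<bullet> c (h - z) - J z \<bullet> riesz s h\<bar>)" using i1 Jr by auto
        show "integrable lborel (\<lambda>z. L * (norm z * norm (b z)) + S * \<epsilon>\<^sup>2 * norm (c (h - z)))"
          using C'(3)[OF \<epsilon>] cn(1) by (auto simp: b_def)
        fix z :: 'a
        show "\<bar>b z \<bullet> c (h - z) - J z \<bullet> riesz s h\<bar> \<le> L * (norm z * norm (b z)) + S * \<epsilon>\<^sup>2 * norm (c (h - z))"
        proof (cases "norm z \<le> r")
          case True
          have "norm (h - z) \<ge> r" using norm_triangle_ineq2[of h z] True by (simp add: r_def)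
          then have "\<epsilon> < norm (h - z)" using \<epsilon>r by linarith
          then have "c (h - z) = riesz s (h - z)" by (simp add: c_def cut_def[OF s])
          then have "b z \<bullet> c (h - z) - J z \<bullet> riesz s h = b z \<bullet> (riesz s (h - z) - riesz s h)"
            using True by (simp add: J_def inner_diff_right)
          also have "\<bar>\<dots>\<bar> \<le> norm (b z) * norm (riesz s (h - z) - riesz s h)" by (rule Cauchy_Schwarz_ineq2)
          also have "\<dots> \<le> norm (b z) * (L * norm z)" by (intro mult_left_mono L True) auto
          finally have "\<bar>b z \<bullet> c (h - z) - J z \<bullet> riesz s h\<bar> \<le> L * (norm z * norm (b z))" by (simp add: mult_ac)
          moreover have "0 \<le> S * \<epsilon>\<^sup>2 * norm (c (h - z))" using S0 by simp
          ultimately show ?thesis by linarith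
        next
          case False
          then have "\<bar>b z \<bullet> c (h - z) - J z \<bullet> riesz s h\<bar> = \<bar>b z \<bullet> c (h - z)\<bar>" by (simp add: J_def)
          also have "\<dots> \<le> norm (b z) * norm (c (h - z))" by (rule Cauchy_Schwarz_ineq2)
          also have "\<dots> \<le> S * \<epsilon>\<^sup>2 * norm (c (h - z))" using Sb[of z] False by (intro mult_right_mono) auto
          finally have "\<bar>b z \<bullet> c (h - z) - J z \<bullet> riesz s h\<bar> \<le> S * \<epsilon>\<^sup>2 * norm (c (h - z))" .
          moreover have "0 \<le> L * (norm z * norm (b z))" using L by simp
          ultimately show ?thesis by linarith
        qed
      qed
      also have "\<dots> = L * (LINT z|lborel. norm z * norm (b z)) + S * \<epsilon>\<^sup>2 * (LINT z|lborel. norm (c (h - z)))"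
        using C'(3)[OF \<epsilon>] cn(1) by (simp add: b_def)
      also have "\<dots> \<le> L * (C' * \<epsilon> powr (1 - s)) + S * \<epsilon>\<^sup>2 * (C * \<epsilon> powr (- s))"
        using L S0 C'(4)[OF \<epsilon>] cn(2) by (intro add_mono mult_left_mono) (auto simp: b_def)
      also have "\<dots> = L * C' * \<epsilon> powr (1 - s) + S * C * (\<epsilon>\<^sup>2 * \<epsilon> powr (- s))" by (simp add: mult_ac)
      finally show ?thesis unfolding e2s .
    qed
    have "\<bar>2 * I1 - I2\<bar> \<le> 2 * \<bar>I1\<bar> + \<bar>I2\<bar>" by linarith
    also have "\<dots> \<le> 2 * (L * C' * \<epsilon> powr (1 - s) + S * C * \<epsilon> powr (2 - s)) + 2 * S * C' * \<epsilon> powr (2 - s)"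
      by (intro add_mono mult_left_mono I1 I2) auto
    also have "\<dots> = 2 * L * C' * \<epsilon> powr (1 - s) + (2 * S * C + 2 * S * C') * \<epsilon> powr (2 - s)" by (simp add: algebra_simps)
    also have "\<dots> \<le> K * \<epsilon> powr (1 - s) + K * \<epsilon> powr (2 - s)"
      by (intro add_mono mult_right_mono) (auto simp: K_def)
    finally show ?thesis unfolding D by (simp add: distrib_left)
  qed
  then show ?thesis using K0 unfolding r_def by blast
qed

lemma cut_conv_tendsto:
  "((\<lambda>\<epsilon>. LINT z|lborel. cut s \<epsilon> z \<bullet> cut s \<epsilon> (h - z)) \<longlongrightarrow> kappa TYPE('a) s * norm h powr (- (real DIM('a) + 2 * s))) (at_right 0)"
proof -
  define F where "F = (\<lambda>\<epsilon>. LINT z|lborel. cut s \<epsilon> z \<bullet> cut s \<epsilon> (h - z))"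
  define R where "R = (\<lambda>\<epsilon>. rconv s (1 / \<epsilon>\<^sup>2) (1 / \<epsilon>\<^sup>2) h)"
  have R: "(R \<longlongrightarrow> kappa TYPE('a) s * norm h powr (- (real DIM('a) + 2 * s))) (at_right 0)"
  proof (rule tendsto_at_right_sequentially[of _ 1])
    fix S :: "nat \<Rightarrow> real" assume S: "\<And>n. 0 < S n" "\<And>n. S n < 1" "S \<longlonglongrightarrow> 0"
    have "filterlim (\<lambda>k. 1 / (S k)\<^sup>2) at_top sequentially"
    proof -
      have "filterlim S (at_right 0) sequentially" using S by (intro tendsto_imp_filterlim_at_right) auto
      moreover have "filterlim (\<lambda>x::real. 1 / x\<^sup>2) at_top (at_right 0)" by real_asymp
      ultimately show ?thesis by (rule filterlim_compose[rotated])
    qed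
    then show "(\<lambda>n. R (S n)) \<longlonglongrightarrow> kappa TYPE('a) s * norm h powr (- (real DIM('a) + 2 * s))"
    proof -
      assume l: "filterlim (\<lambda>k. 1 / (S k)\<^sup>2) at_top sequentially"
      have "0 < 1 / (S k)\<^sup>2" for k using S(1)[of k] by simp
      then show ?thesis unfolding R_def by (intro rconv_tendsto[OF s h] l) auto
    qed
  qed simp
  obtain K where K: "K \<ge> 0" "\<And>\<epsilon>. \<epsilon> > 0 \<Longrightarrow> \<epsilon> < norm h / 2 \<Longrightarrow> \<bar>F \<epsilon> - R \<epsilon>\<bar> \<le> K * (\<epsilon> powr (1 - s) + \<epsilon> powr (2 - s))"
    using cut_conv_minus_rconv unfolding F_def R_def by blast
  have "((\<lambda>\<epsilon>. F \<epsilon> - R \<epsilon>) \<longlongrightarrow> 0) (at_right 0)"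
  proof (rule Lim_null_comparison)
    show "eventually (\<lambda>\<epsilon>. norm (F \<epsilon> - R \<epsilon>) \<le> K * (\<epsilon> powr (1 - s) + \<epsilon> powr (2 - s))) (at_right 0)"
      using h by (intro eventually_at_rightI[of 0 "norm h / 2"]) (auto intro: K)
    have "((\<lambda>\<epsilon>. K * (\<epsilon> powr (1 - s) + \<epsilon> powr (2 - s))) \<longlongrightarrow> K * (0 powr (1 - s) + 0 powr (2 - s))) (at_right 0)"
      using s by (intro tendsto_intros tendsto_powr2 eventually_at_right_less[THEN eventually_mono]) auto
    then show "((\<lambda>\<epsilon>. K * (\<epsilon> powr (1 - s) + \<epsilon> powr (2 - s))) \<longlongrightarrow> 0) (at_right 0)" by simp
  qed
  from tendsto_add[OF this R] show ?thesis by (simp add: F_def)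
qed

text \<open>The sharp kernel is odd and has mean zero, so removing a second ball around h leaves
  minus the integral over that ball, where the kernel is bounded independently of \<epsilon> and the
  volume is of order \<epsilon>^n.\<close>

lemma cut_away_tendsto: "((\<lambda>\<epsilon>. LINT w|lborel. indicator {w. \<epsilon> < norm (h - w)} w *\<^sub>R cut s \<epsilon> w) \<longlongrightarrow> 0) (at_right 0)"
proof (rule Lim_null_comparison)
  define r where "r = norm h / 2"
  have r: "r > 0" using h by (simp add: r_def)
  define K where "K = r powr (- (real DIM('a) + s)) * unit_ball_vol DIM('a)"
  note [measurable] = borel_measurable_cut[OF s]
  have "norm (LINT w|lborel. indicator {w. \<epsilon> < norm (h - w)} w *\<^sub>R cut s \<epsilon> w) \<le> K * \<epsilon> ^ DIM('a)" if \<epsilon>: "\<epsilon> > 0" "\<epsilon> < r" for \<epsilon>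
  proof -
    have ci: "integrable lborel (cut s \<epsilon> :: 'a \<Rightarrow> 'a)" by (rule integrable_cut[OF s \<epsilon>(1)])
    have ii: "integrable lborel (\<lambda>w. indicator {w. norm (h - w) \<le> \<epsilon>} w *\<^sub>R cut s \<epsilon> w)"
      by (intro integrable_mult_indicator ci) simp
    have "(LINT w|lborel. indicator {w. \<epsilon> < norm (h - w)} w *\<^sub>R cut s \<epsilon> w) = (LINT w|lborel. cut s \<epsilon> w - indicator {w. norm (h - w) \<le> \<epsilon>} w *\<^sub>R cut s \<epsilon> w)"
      by (intro Bochner_Integration.integral_cong refl) (auto split: split_indicator)
    also have "\<dots> = - (LINT w|lborel. indicator {w. norm (h - w) \<le> \<epsilon>} w *\<^sub>R cut s \<epsilon> w)"
      using ci ii integral_lborel_odd[of "cut s \<epsilon> :: 'a \<Rightarrow> 'a"] by (simp add: cut_minus[OF s])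
    finally have "norm (LINT w|lborel. indicator {w. \<epsilon> < norm (h - w)} w *\<^sub>R cut s \<epsilon> w) = norm (LINT w|lborel. indicator {w. norm (h - w) \<le> \<epsilon>} w *\<^sub>R cut s \<epsilon> w)" by simp
    also have "\<dots> \<le> (LINT w|lborel. norm (indicator {w. norm (h - w) \<le> \<epsilon>} w *\<^sub>R cut s \<epsilon> w))" by (rule integral_norm_bound)
    also have "\<dots> \<le> (LINT w|lborel. r powr (- (real DIM('a) + s)) * indicator (cball h \<epsilon>) w)"
    proof (rule integral_mono)
      show "integrable lborel (\<lambda>w. norm (indicator {w. norm (h - w) \<le> \<epsilon>} w *\<^sub>R cut s \<epsilon> w))" using ii by (rule integrable_norm)
      show "integrable lborel (\<lambda>w. r powr (- (real DIM('a) + s)) * indicator (cball h \<epsilon>) w :: real)"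
        using \<epsilon> by (intro integrable_mult_right integrable_real_indicator) (auto simp: emeasure_cball)
      fix w
      show "norm (indicator {w. norm (h - w) \<le> \<epsilon>} w *\<^sub>R cut s \<epsilon> w) \<le> r powr (- (real DIM('a) + s)) * indicator (cball h \<epsilon>) w"
      proof (cases "norm (h - w) \<le> \<epsilon>")
        case True
        have w: "norm w \<ge> r" using norm_triangle_ineq2[of h "h - w"] True \<epsilon> by (simp add: r_def)
        have "norm (cut s \<epsilon> w) \<le> norm w powr (- (real DIM('a) + s)) * indicator {z. \<epsilon> \<le> norm z} w" by (rule norm_cut_le[OF s])
        also have "\<dots> \<le> norm w powr (- (real DIM('a) + s))" by (simp split: split_indicator)
        also have "\<dots> \<le> r powr (- (real DIM('a) + s))" using w r s by (intro powr_mono2') auto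
        finally show ?thesis using True by (simp add: dist_norm)
      qed (simp add: dist_norm)
    qed
    also have "\<dots> = K * \<epsilon> ^ DIM('a)" using \<epsilon> by (simp add: K_def content_cball)
    finally show ?thesis .
  qed
  then show "eventually (\<lambda>\<epsilon>. norm (LINT w|lborel. indicator {w. \<epsilon> < norm (h - w)} w *\<^sub>R cut s \<epsilon> w) \<le> K * \<epsilon> ^ DIM('a)) (at_right 0)"
    using r by (intro eventually_at_rightI[of 0 r]) auto
  have "((\<lambda>\<epsilon>. K * \<epsilon> ^ DIM('a)) \<longlongrightarrow> K * 0 ^ DIM('a)) (at_right 0)" by (intro tendsto_intros)
  moreover have "K * 0 ^ DIM('a) = 0" by (simp add: zero_power)
  ultimately show "((\<lambda>\<epsilon>. K * \<epsilon> ^ DIM('a)) \<longlongrightarrow> 0) (at_right 0)" by (simp only:)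
qed

end

text \<open>The domain excludes balls about both x and y. With h = y - x, the third product
  integrates to the convolution square of the sharply truncated kernel at h. In each of the other
  two products one factor is the constant \<open>riesz s h\<close>, and the integral of the
  remaining factor vanishes in the limit.\<close>

theorem has_pv_integral_riesz:
  fixes x y :: "'a::euclidean_space"
  assumes s: "0 < s" "s < 1" and xy: "x \<noteq> y"
  shows "has_pv_integral {x, y} (\<lambda>z. riesz s (y - x) \<bullet> riesz s (z - x) + riesz s (y - z) \<bullet> riesz s (y - x) + riesz s (y - z) \<bullet> riesz s (z - x))
     (kappa TYPE('a) s * norm (x - y) powr (- (real DIM('a) + 2 * s)))"
proof -
  define h where "h = y - x"
  have h: "h \<noteq> 0" using xy by (simp add: h_def)
  define f where "f = (\<lambda>z. riesz s (y - x) \<bullet> riesz s (z - x) + riesz s (y - z) \<bullet> riesz s (y - x) + riesz s (y - z) \<bullet> riesz s (z - x))"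
  define S where "S = (\<lambda>\<epsilon>. {z. \<forall>p\<in>{x, y}. \<epsilon> < dist p z})"
  define A where "A = (\<lambda>\<epsilon>. LINT w|lborel. indicator {w. \<epsilon> < norm (h - w)} w *\<^sub>R cut s \<epsilon> w)"
  define F where "F = (\<lambda>\<epsilon>. LINT z|lborel. cut s \<epsilon> z \<bullet> cut s \<epsilon> (h - z))"
  note [measurable] = borel_measurable_cut[OF s]
  have main: "set_integrable lborel (S \<epsilon>) f \<and> (LINT z:S \<epsilon>|lborel. f z) = 2 * (riesz s h \<bullet> A \<epsilon>) + F \<epsilon>" if \<epsilon>: "\<epsilon> > 0" for \<epsilon>
  proof -
    define c where "c = (cut s \<epsilon> :: 'a \<Rightarrow> 'a)"
    have [measurable]: "c \<in> borel_measurable borel" unfolding c_def by measurable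
    have ci: "integrable lborel c" unfolding c_def by (rule integrable_cut[OF s \<epsilon>])
    define g where "g = (\<lambda>w. indicator {w. \<epsilon> < norm (h - w)} w *\<^sub>R c w)"
    have gi: "integrable lborel g" unfolding g_def by (intro integrable_mult_indicator ci) simp
    have A: "A \<epsilon> = (LINT w|lborel. g w)" unfolding A_def g_def c_def ..
    obtain Bc where Bc: "\<And>z. norm (c z) \<le> Bc" using bounded_cut[OF s \<epsilon>] unfolding c_def by blast
    have cc: "integrable lborel (\<lambda>z. c z \<bullet> c (h - z))"
      by (rule integrable_inner_bounded[OF ci _ Bc]) measurable
    \<comment> \<open>The arguments z - x and y - z bring the first two products into the same form
      \<open>g\<close>, once shifted and once reflected.\<close>
    have eq: "indicator (S \<epsilon>) z *\<^sub>R f z = riesz s h \<bullet> g (- x + z) + riesz s h \<bullet> g (y - z) + c (- x + z) \<bullet> c (h - (- x + z))" for z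
    proof -
      have 1: "- x + z = z - x" "h - (z - x) = y - z" "h - (y - z) = z - x" by (auto simp: h_def)
      have 2: "z \<in> S \<epsilon> \<longleftrightarrow> \<epsilon> < norm (z - x) \<and> \<epsilon> < norm (y - z)" by (auto simp: S_def dist_norm norm_minus_commute)
      show ?thesis unfolding g_def 1 f_def c_def cut_def[OF s] h_def[symmetric]
        by (auto simp: indicator_def 2 1 inner_commute)
    qed
    have i: "integrable lborel (\<lambda>z. riesz s h \<bullet> g (- x + z))" "integrable lborel (\<lambda>z. riesz s h \<bullet> g (y - z))" "integrable lborel (\<lambda>z. c (- x + z) \<bullet> c (h - (- x + z)))"
      using integrable_lborel_shift[of "\<lambda>z. riesz s h \<bullet> g z" "- x"] integrable_lborel_reflect[of "\<lambda>z. riesz s h \<bullet> g z" y]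
        integrable_lborel_shift[of "\<lambda>z. c z \<bullet> c (h - z)" "- x"] gi cc by auto
    have v: "(LINT z|lborel. riesz s h \<bullet> g (- x + z)) = riesz s h \<bullet> A \<epsilon>" "(LINT z|lborel. riesz s h \<bullet> g (y - z)) = riesz s h \<bullet> A \<epsilon>"
      "(LINT z|lborel. c (- x + z) \<bullet> c (h - (- x + z))) = F \<epsilon>"
      using integral_lborel_shift[of "\<lambda>z. riesz s h \<bullet> g z" "- x"] integral_lborel_reflect[of "\<lambda>z. riesz s h \<bullet> g z" y]
        integral_lborel_shift[of "\<lambda>z. c z \<bullet> c (h - z)" "- x"] gi by (auto simp: A F_def c_def)
    show ?thesis
      unfolding set_integrable_def set_lebesgue_integral_def eq using i v by simp
  qed
  have "((\<lambda>\<epsilon>. 2 * (riesz s h \<bullet> A \<epsilon>) + F \<epsilon>) \<longlongrightarrow> 2 * (riesz s h \<bullet> 0) + kappa TYPE('a) s * norm h powr (- (real DIM('a) + 2 * s))) (at_right 0)"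
    unfolding A_def F_def by (intro tendsto_intros cut_away_tendsto[OF s h] cut_conv_tendsto[OF s h])
  moreover have "2 * (riesz s h \<bullet> 0) + kappa TYPE('a) s * norm h powr (- (real DIM('a) + 2 * s)) = kappa TYPE('a) s * norm h powr (- (real DIM('a) + 2 * s))" by simp
  moreover have "eventually (\<lambda>\<epsilon>. 2 * (riesz s h \<bullet> A \<epsilon>) + F \<epsilon> = (LINT z:S \<epsilon>|lborel. f z)) (at_right 0)"
    using main by (intro eventually_at_rightI[of 0 1]) auto
  ultimately have "((\<lambda>\<epsilon>. LINT z:S \<epsilon>|lborel. f z) \<longlongrightarrow> kappa TYPE('a) s * norm h powr (- (real DIM('a) + 2 * s))) (at_right 0)"
    by (simp only: Lim_transform_eventually)
  moreover have "norm (x - y) = norm h" by (simp add: h_def norm_minus_commute)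
  ultimately show ?thesis
    using main unfolding has_pv_integral_def f_def[symmetric] S_def by (simp only:) blast
qed

section \<open>Square-integrable functions and convolutions\<close>

lemma
  fixes f g :: "'b \<Rightarrow> real"
  assumes [measurable]: "f \<in> borel_measurable M" "g \<in> borel_measurable M"
    and f: "integrable M (\<lambda>x. (f x)\<^sup>2)" and g: "integrable M (\<lambda>x. (g x)\<^sup>2)"
  shows integrable_mult_L2: "integrable M (\<lambda>x. f x * g x)"
    and Cauchy_Schwarz_integral: "(LINT x|M. \<bar>f x * g x\<bar>)\<^sup>2 \<le> (LINT x|M. (f x)\<^sup>2) * (LINT x|M. (g x)\<^sup>2)"
proof -
  have le: "\<bar>a * b\<bar> \<le> a\<^sup>2 + b\<^sup>2" for a b :: real
  proof -
    have "0 \<le> (\<bar>a\<bar> - \<bar>b\<bar>)\<^sup>2" by simp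
    then have "2 * (\<bar>a\<bar> * \<bar>b\<bar>) \<le> a\<^sup>2 + b\<^sup>2" by (simp add: power2_diff)
    moreover have "0 \<le> \<bar>a\<bar> * \<bar>b\<bar>" by simp
    ultimately show ?thesis unfolding abs_mult by linarith
  qed
  show *: "integrable M (\<lambda>x. f x * g x)"
    by (rule Bochner_Integration.integrable_bound[OF Bochner_Integration.integrable_add[OF f g]]) (auto intro!: AE_I2 le)
  define A B c where "A = (LINT x|M. (f x)\<^sup>2)" and "B = (LINT x|M. (g x)\<^sup>2)" and "c = (LINT x|M. \<bar>f x * g x\<bar>)"
  have AB: "A \<ge> 0" "B \<ge> 0" unfolding A_def B_def by (auto intro!: integral_nonneg_AE)
  have q: "0 \<le> t\<^sup>2 * A - 2 * t * c + B" for t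
  proof -
    have "0 \<le> (LINT x|M. (t * \<bar>f x\<bar> - \<bar>g x\<bar>)\<^sup>2)" by (intro integral_nonneg_AE) auto
    also have "(\<lambda>x. (t * \<bar>f x\<bar> - \<bar>g x\<bar>)\<^sup>2) = (\<lambda>x. t\<^sup>2 * (f x)\<^sup>2 - 2 * t * \<bar>f x * g x\<bar> + (g x)\<^sup>2)"
      by (auto simp: power2_diff power_mult_distrib abs_mult mult_ac)
    also have "(LINT x|M. t\<^sup>2 * (f x)\<^sup>2 - 2 * t * \<bar>f x * g x\<bar> + (g x)\<^sup>2) = t\<^sup>2 * A - 2 * t * c + B"
      using f g * by (simp add: A_def B_def c_def)
    finally show ?thesis .
  qed
  show "c\<^sup>2 \<le> A * B"
  proof (cases "A = 0")
    case True
    have "c \<le> 0"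
    proof (rule ccontr)
      assume "\<not> c \<le> 0"
      \<comment> \<open>For A = 0 the value of the polynomial at t = (B + 1) / c is - B - 2, which
        is negative.\<close>
      then have "0 \<le> - 2 * ((B + 1) / c) * c + B" "c > 0" using q[of "(B + 1) / c"] True by auto
      then show False using AB by simp
    qed
    moreover have "c \<ge> 0" unfolding c_def by (intro integral_nonneg_AE) auto
    ultimately show ?thesis using True by simp
  next
    case False
    then have A: "A > 0" using AB by simp
    have "0 \<le> A * ((c / A)\<^sup>2 * A - 2 * (c / A) * c + B)" using q[of "c / A"] A by simp
    also have "\<dots> = A * B - c\<^sup>2" using A by (simp add: field_simps power2_eq_square)
    finally show ?thesis by simp
  qed
qed

text \<open>Cauchy-Schwarz for the factors sqrt |p| and sqrt |p| |g|. In the extended reals 0 times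
  \<infinity> is 0, so a kernel of mass zero is treated apart; afterwards an infinite second factor
  is trivial.\<close>

lemma Cauchy_Schwarz_weighted:
  fixes p :: "'b \<Rightarrow> real" and g :: "'b \<Rightarrow> complex"
  assumes [measurable]: "g \<in> borel_measurable M" and p: "integrable M p"
  shows "ennreal ((cmod (LINT h|M. of_real (p h) * g h))\<^sup>2) \<le> (\<integral>\<^sup>+h. ennreal \<bar>p h\<bar> \<partial>M) * (\<integral>\<^sup>+h. ennreal (\<bar>p h\<bar> * (cmod (g h))\<^sup>2) \<partial>M)"
proof -
  have [measurable]: "p \<in> borel_measurable M" using p by auto
  have P: "(\<integral>\<^sup>+h. ennreal \<bar>p h\<bar> \<partial>M) = ennreal (LINT h|M. \<bar>p h\<bar>)"
    using p by (intro nn_integral_eq_integral) auto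
  show ?thesis
  proof (cases "(LINT h|M. \<bar>p h\<bar>) = 0")
    case True
    then have "AE h in M. \<bar>p h\<bar> = 0" using integral_nonneg_eq_0_iff_AE[of M "\<lambda>h. \<bar>p h\<bar>"] p by auto
    then have "(LINT h|M. of_real (p h) * g h) = (LINT h|M. 0)" by (intro integral_cong_AE) auto
    then show ?thesis by simp
  next
    case False
    then have Ppos: "(LINT h|M. \<bar>p h\<bar>) > 0" using integral_nonneg_AE[of "\<lambda>h. \<bar>p h\<bar>" M] by (simp add: less_le)
    show ?thesis
    proof (cases "(\<integral>\<^sup>+h. ennreal (\<bar>p h\<bar> * (cmod (g h))\<^sup>2) \<partial>M) = \<infinity>")
      case True
      then show ?thesis unfolding P using Ppos by (simp add: ennreal_mult_top)
    next
      case F: False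
      have i2: "integrable M (\<lambda>h. \<bar>p h\<bar> * (cmod (g h))\<^sup>2)"
        using F by (intro integrableI_nonneg) (auto simp: top.not_eq_extremum)
      have sq: "(sqrt \<bar>p h\<bar>)\<^sup>2 = \<bar>p h\<bar>" "(sqrt \<bar>p h\<bar> * cmod (g h))\<^sup>2 = \<bar>p h\<bar> * (cmod (g h))\<^sup>2"
        "\<bar>sqrt \<bar>p h\<bar> * (sqrt \<bar>p h\<bar> * cmod (g h))\<bar> = cmod (of_real (p h) * g h)" for h
        by (simp_all add: power_mult_distrib norm_mult abs_mult mult.assoc[symmetric])
      have "(LINT h|M. cmod (of_real (p h) * g h))\<^sup>2 \<le> (LINT h|M. \<bar>p h\<bar>) * (LINT h|M. \<bar>p h\<bar> * (cmod (g h))\<^sup>2)"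
        using Cauchy_Schwarz_integral[of "\<lambda>h. sqrt \<bar>p h\<bar>" M "\<lambda>h. sqrt \<bar>p h\<bar> * cmod (g h)"] p i2 unfolding sq by auto
      moreover have "(cmod (LINT h|M. of_real (p h) * g h))\<^sup>2 \<le> (LINT h|M. cmod (of_real (p h) * g h))\<^sup>2"
        by (intro power_mono integral_norm_bound) auto
      ultimately have "(cmod (LINT h|M. of_real (p h) * g h))\<^sup>2 \<le> (LINT h|M. \<bar>p h\<bar>) * (LINT h|M. \<bar>p h\<bar> * (cmod (g h))\<^sup>2)" by linarith
      moreover have "(\<integral>\<^sup>+h. ennreal (\<bar>p h\<bar> * (cmod (g h))\<^sup>2) \<partial>M) = ennreal (LINT h|M. \<bar>p h\<bar> * (cmod (g h))\<^sup>2)"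
        using i2 by (intro nn_integral_eq_integral) auto
      ultimately show ?thesis unfolding P using Ppos
        by (simp add: ennreal_mult[symmetric] integral_nonneg_AE less_imp_le ennreal_leI)
    qed
  qed
qed

lemma L2_D: assumes "u \<in> L2" shows "u \<in> borel_measurable borel" "integrable lborel (\<lambda>x. (norm (u x))\<^sup>2)"
  using assms by (auto simp: L2_def)

definition sqnorm :: "('a::euclidean_space \<Rightarrow> 'b::euclidean_space) \<Rightarrow> real" where
  "sqnorm u = (LINT x|lborel. (norm (u x))\<^sup>2)"

lemma sqnorm_nonneg: "0 \<le> sqnorm u"
  unfolding sqnorm_def by (intro integral_nonneg_AE) auto

lemma nn_integral_sqnorm: "u \<in> L2 \<Longrightarrow> (\<integral>\<^sup>+x. ennreal ((norm (u x))\<^sup>2) \<partial>lborel) = ennreal (sqnorm u)"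
  unfolding sqnorm_def by (intro nn_integral_eq_integral L2_D) auto

lemma L2_I:
  assumes "u \<in> borel_measurable borel" "(\<integral>\<^sup>+x. ennreal ((norm (u x))\<^sup>2) \<partial>lborel) < \<infinity>"
  shows "u \<in> L2"
  using assms unfolding L2_def by (auto intro!: integrableI_nonneg)

lemma norm_add_square_le: "(norm (a + b))\<^sup>2 \<le> 2 * (norm a)\<^sup>2 + 2 * (norm b)\<^sup>2" for a b :: "'b::real_normed_vector"
proof -
  have "(norm (a + b))\<^sup>2 \<le> (norm a + norm b)\<^sup>2" by (intro power_mono norm_triangle_ineq) auto
  also have "\<dots> \<le> 2 * (norm a)\<^sup>2 + 2 * (norm b)\<^sup>2"
  proof -
    have "0 \<le> (norm a - norm b)\<^sup>2" by simp
    then show ?thesis by (simp add: power2_sum power2_diff)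
  qed
  finally show ?thesis .
qed

lemma
  fixes u w :: "'a::euclidean_space \<Rightarrow> 'b::euclidean_space"
  assumes u: "u \<in> L2" and w: "w \<in> L2"
  shows L2_add: "(\<lambda>x. u x + w x) \<in> L2" and sqnorm_add: "sqnorm (\<lambda>x. u x + w x) \<le> 2 * sqnorm u + 2 * sqnorm w"
proof -
  note [measurable] = L2_D(1)[OF u] L2_D(1)[OF w]
  have i: "integrable lborel (\<lambda>x. 2 * (norm (u x))\<^sup>2 + 2 * (norm (w x))\<^sup>2)"
    using L2_D(2)[OF u] L2_D(2)[OF w] by auto
  have 1: "integrable lborel (\<lambda>x. (norm (u x + w x))\<^sup>2)"
    by (rule Bochner_Integration.integrable_bound[OF i]) (auto intro!: AE_I2 norm_add_square_le)
  then show "(\<lambda>x. u x + w x) \<in> L2" by (auto simp: L2_def)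
  have "sqnorm (\<lambda>x. u x + w x) \<le> (LINT x|lborel. 2 * (norm (u x))\<^sup>2 + 2 * (norm (w x))\<^sup>2)"
    unfolding sqnorm_def by (intro integral_mono 1 i norm_add_square_le)
  also have "\<dots> = 2 * sqnorm u + 2 * sqnorm w"
    unfolding sqnorm_def using L2_D(2)[OF u] L2_D(2)[OF w] by simp
  finally show "sqnorm (\<lambda>x. u x + w x) \<le> 2 * sqnorm u + 2 * sqnorm w" .
qed

lemma
  fixes u :: "'a::euclidean_space \<Rightarrow> 'b::euclidean_space"
  assumes u: "u \<in> L2"
  shows L2_minus: "(\<lambda>x. - u x) \<in> L2" and sqnorm_minus: "sqnorm (\<lambda>x. - u x) = sqnorm u"
  using L2_D[OF u] by (auto simp: L2_def sqnorm_def)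

lemma
  fixes u w :: "'a::euclidean_space \<Rightarrow> 'b::euclidean_space"
  assumes u: "u \<in> L2" and w: "w \<in> L2"
  shows L2_diff: "(\<lambda>x. u x - w x) \<in> L2" and sqnorm_diff: "sqnorm (\<lambda>x. u x - w x) \<le> 2 * sqnorm u + 2 * sqnorm w"
  using L2_add[OF u L2_minus[OF w]] sqnorm_add[OF u L2_minus[OF w]] sqnorm_minus[OF w] by auto

lemma
  fixes u :: "'a::euclidean_space \<Rightarrow> complex"
  assumes u: "u \<in> L2"
  shows L2_cmult: "(\<lambda>x. c * u x) \<in> L2" and sqnorm_cmult: "sqnorm (\<lambda>x. c * u x) = (cmod c)\<^sup>2 * sqnorm u"
    and L2_cnj: "(\<lambda>x. cnj (u x)) \<in> L2"
proof -
  have "cnj \<in> borel_measurable borel" by (intro borel_measurable_continuous_onI continuous_intros)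
  from measurable_compose[OF L2_D(1)[OF u] this] show "(\<lambda>x. cnj (u x)) \<in> L2"
    using L2_D(2)[OF u] by (simp add: L2_def)
qed (use L2_D[OF u] in \<open>auto simp: L2_def sqnorm_def norm_mult power_mult_distrib\<close>)

lemma
  fixes u :: "'a::euclidean_space \<Rightarrow> 'b::euclidean_space"
  assumes u: "u \<in> L2"
  shows L2_shift: "(\<lambda>x. u (x + h)) \<in> L2" and sqnorm_shift: "sqnorm (\<lambda>x. u (x + h)) = sqnorm u"
proof -
  note [measurable] = L2_D(1)[OF u]
  have d: "distr lborel borel ((+) h) = (lborel::'a measure)" by (rule lborel_distr_plus)
  have "integrable (distr lborel borel ((+) h)) (\<lambda>x. (norm (u x))\<^sup>2)" using L2_D(2)[OF u] by (simp add: d)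
  then have "integrable lborel (\<lambda>x. (norm (u (x + h)))\<^sup>2)" by (subst (asm) integrable_distr_eq) (auto simp: add.commute)
  then show "(\<lambda>x. u (x + h)) \<in> L2" by (auto simp: L2_def)
  have "sqnorm u = (LINT x|distr lborel borel ((+) h). (norm (u x))\<^sup>2)" by (simp add: sqnorm_def d)
  also have "\<dots> = sqnorm (\<lambda>x. u (x + h))" unfolding sqnorm_def by (subst integral_distr) (auto simp: add.commute)
  finally show "sqnorm (\<lambda>x. u (x + h)) = sqnorm u" ..
qed

lemma
  fixes u w :: "'a::euclidean_space \<Rightarrow> complex"
  assumes u: "u \<in> L2" and w: "w \<in> L2"
  shows L2_mult: "integrable lborel (\<lambda>x. u x * w x)"
    and L2_Cauchy_Schwarz: "(LINT x|lborel. cmod (u x * w x)) \<le> sqrt (sqnorm u) * sqrt (sqnorm w)"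
    and L2_Cauchy_Schwarz': "cmod (LINT x|lborel. u x * w x) \<le> sqrt (sqnorm u) * sqrt (sqnorm w)"
proof -
  note [measurable] = L2_D(1)[OF u] L2_D(1)[OF w]
  have "integrable lborel (\<lambda>x. cmod (u x) * cmod (w x))"
    using L2_D(2)[OF u] L2_D(2)[OF w] by (intro integrable_mult_L2) auto
  then show "integrable lborel (\<lambda>x. u x * w x)"
    by (rule Bochner_Integration.integrable_bound) (auto simp: norm_mult)
  have "(LINT x|lborel. cmod (u x * w x))\<^sup>2 \<le> sqnorm u * sqnorm w"
    using Cauchy_Schwarz_integral[of "\<lambda>x. cmod (u x)" lborel "\<lambda>x. cmod (w x)"] L2_D(2)[OF u] L2_D(2)[OF w]
    by (simp add: sqnorm_def norm_mult)
  then show 1: "(LINT x|lborel. cmod (u x * w x)) \<le> sqrt (sqnorm u) * sqrt (sqnorm w)"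
    unfolding real_sqrt_mult[symmetric] by (rule real_le_rsqrt)
  show "cmod (LINT x|lborel. u x * w x) \<le> sqrt (sqnorm u) * sqrt (sqnorm w)"
    by (rule order.trans[OF integral_norm_bound 1])
qed

text \<open>The Riesz-Fischer argument: a subsequence with summable increments converges almost
  everywhere, and Fatou's lemma identifies its limit as the L2 limit of the whole sequence.\<close>

lemma L2_complete:
  fixes f :: "nat \<Rightarrow> 'a::euclidean_space \<Rightarrow> complex"
  assumes f: "\<And>n. f n \<in> L2"
    and cauchy: "\<And>e. e > 0 \<Longrightarrow> \<exists>N. \<forall>m\<ge>N. \<forall>n\<ge>N. sqnorm (\<lambda>x. f m x - f n x) < e"
  obtains g where "g \<in> L2" "\<And>e. e > 0 \<Longrightarrow> \<exists>N. \<forall>n\<ge>N. sqnorm (\<lambda>x. f n x - g x) \<le> e"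
proof -
  note [measurable] = L2_D(1)[OF f]
  \<comment> \<open>The squared norms decay like 4^(-k), so they stay summable with the weights 2^k
    below; these weights give the pointwise bound of order 2^(-k/2) for the increments.\<close>
  have "\<exists>N. \<forall>m\<ge>N. \<forall>n\<ge>N. sqnorm (\<lambda>x. f m x - f n x) < (1/4) ^ k" for k :: nat by (rule cauchy) simp
  then obtain N where N: "\<And>k m n. m \<ge> N k \<Longrightarrow> n \<ge> N k \<Longrightarrow> sqnorm (\<lambda>x. f m x - f n x) < (1/4) ^ k" by metis
  define r where "r = rec_nat (N 0) (\<lambda>k rk. max (Suc rk) (N (Suc k)))"
  have rS: "r (Suc k) = max (Suc (r k)) (N (Suc k))" for k by (simp add: r_def)
  have rN: "r k \<ge> N k" for k by (cases k) (auto simp: r_def)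
  have sm: "strict_mono r" by (rule strict_monoI_Suc) (simp add: rS)
  define d where "d = (\<lambda>k x. f (r (Suc k)) x - f (r k) x)"
  have dL: "d k \<in> L2" for k unfolding d_def by (intro L2_diff f)
  note [measurable] = L2_D(1)[OF dL]
  have dn: "sqnorm (d k) < (1/4) ^ k" for k
    unfolding d_def using rN[of k] rN[of "Suc k"] rS[of k] by (intro N) auto
  have "(\<integral>\<^sup>+x. (\<Sum>k. ennreal (2 ^ k * (cmod (d k x))\<^sup>2)) \<partial>lborel) = (\<Sum>k. \<integral>\<^sup>+x. ennreal (2 ^ k * (cmod (d k x))\<^sup>2) \<partial>lborel)"
    by (rule nn_integral_suminf) measurable
  also have "\<dots> \<le> (\<Sum>k. ennreal ((1/2) ^ k))"
  proof (intro suminf_le)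
    fix k
    have "(\<integral>\<^sup>+x. ennreal (2 ^ k * (cmod (d k x))\<^sup>2) \<partial>lborel) = ennreal (2 ^ k) * ennreal (sqnorm (d k))"
      using nn_integral_sqnorm[OF dL] by (simp add: ennreal_mult nn_integral_cmult)
    also have "\<dots> \<le> ennreal (2 ^ k) * ennreal ((1/4) ^ k)" using dn[of k] by (intro mult_left_mono ennreal_leI) auto
    also have "\<dots> = ennreal ((1/2) ^ k)" by (simp add: ennreal_mult[symmetric] power_mult_distrib[symmetric])
    finally show "(\<integral>\<^sup>+x. ennreal (2 ^ k * (cmod (d k x))\<^sup>2) \<partial>lborel) \<le> ennreal ((1/2) ^ k)" .
  qed auto
  also have "\<dots> = ennreal 2" by (intro suminf_ennreal_eq) (auto intro: sums_unique2 geometric_sums[of "1/2::real", simplified] simp: geometric_sums[of "1/2::real", simplified])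
  also have "\<dots> < \<infinity>" by simp
  finally have "AE x in lborel. (\<Sum>k. ennreal (2 ^ k * (cmod (d k x))\<^sup>2)) \<noteq> \<infinity>"
    by (intro nn_integral_PInf_AE) (auto simp: top.not_eq_extremum)
  then have conv: "AE x in lborel. convergent (\<lambda>k. f (r k) x)"
  proof eventually_elim
    fix x assume x: "(\<Sum>k. ennreal (2 ^ k * (cmod (d k x))\<^sup>2)) \<noteq> \<infinity>"
    have "summable (\<lambda>k. 2 ^ k * (cmod (d k x))\<^sup>2)" using x by (intro summable_suminf_not_top) auto
    then have "bounded (range (\<lambda>k. 2 ^ k * (cmod (d k x))\<^sup>2))"
      using summable_LIMSEQ_zero convergent_imp_bounded by (metis convergent_def)
    then obtain B where B: "\<And>k. norm (2 ^ k * (cmod (d k x))\<^sup>2) \<le> B" by (auto simp: bounded_iff)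
    have dk: "cmod (d k x) \<le> sqrt B * (1 / sqrt 2) ^ k" for k
    proof -
      have "(cmod (d k x))\<^sup>2 \<le> B / 2 ^ k" using B[of k] by (simp add: field_simps)
      then have "cmod (d k x) \<le> sqrt (B / 2 ^ k)" by (rule real_le_rsqrt)
      then show ?thesis by (simp add: real_sqrt_divide real_sqrt_power power_one_over)
    qed
    have "summable (\<lambda>k. sqrt B * (1 / sqrt 2) ^ k)" by (intro summable_mult summable_geometric) auto
    then have "summable (\<lambda>k. d k x)" by (rule summable_comparison_test'[where N=0]) (use dk in auto)
    then have "convergent (\<lambda>m. \<Sum>k<m. d k x)" by (simp add: summable_iff_convergent)
    moreover have "(\<Sum>k<m. d k x) = f (r m) x - f (r 0) x" for m
      unfolding d_def by (rule sum_lessThan_telescope)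
    ultimately have "convergent (\<lambda>m. f (r m) x - f (r 0) x)" by simp
    then show "convergent (\<lambda>k. f (r k) x)" by (simp add: convergent_diff_const_right_iff)
  qed
  define g where "g = (\<lambda>x. lim (\<lambda>k. f (r k) x))"
  have [measurable]: "g \<in> borel_measurable borel" unfolding g_def by (rule borel_measurable_lim_metric) measurable
  have lim: "AE x in lborel. (\<lambda>k. f (r k) x) \<longlonglongrightarrow> g x"
    using conv by eventually_elim (simp add: g_def convergent_LIMSEQ_iff)
  have key: "\<exists>M. \<forall>n\<ge>M. (\<integral>\<^sup>+x. ennreal ((cmod (f n x - g x))\<^sup>2) \<partial>lborel) \<le> ennreal e" if e: "e > 0" for e
  proof -
    obtain M where M: "\<And>m n. m \<ge> M \<Longrightarrow> n \<ge> M \<Longrightarrow> sqnorm (\<lambda>x. f m x - f n x) < e" using cauchy[OF e] by blast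
    have "(\<integral>\<^sup>+x. ennreal ((cmod (f n x - g x))\<^sup>2) \<partial>lborel) \<le> ennreal e" if n: "n \<ge> M" for n
    proof -
      have "(\<integral>\<^sup>+x. ennreal ((cmod (f n x - g x))\<^sup>2) \<partial>lborel) = (\<integral>\<^sup>+x. liminf (\<lambda>k. ennreal ((cmod (f n x - f (r k) x))\<^sup>2)) \<partial>lborel)"
      proof (rule nn_integral_cong_AE)
        show "AE x in lborel. ennreal ((cmod (f n x - g x))\<^sup>2) = liminf (\<lambda>k. ennreal ((cmod (f n x - f (r k) x))\<^sup>2))"
          using lim
        proof eventually_elim
          fix x assume "(\<lambda>k. f (r k) x) \<longlonglongrightarrow> g x"
          then have "(\<lambda>k. ennreal ((cmod (f n x - f (r k) x))\<^sup>2)) \<longlonglongrightarrow> ennreal ((cmod (f n x - g x))\<^sup>2)"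
            by (intro tendsto_intros)
          then show "ennreal ((cmod (f n x - g x))\<^sup>2) = liminf (\<lambda>k. ennreal ((cmod (f n x - f (r k) x))\<^sup>2))"
            by (metis lim_imp_Liminf trivial_limit_sequentially)
        qed
      qed
      also have "\<dots> \<le> liminf (\<lambda>k. \<integral>\<^sup>+x. ennreal ((cmod (f n x - f (r k) x))\<^sup>2) \<partial>lborel)"
        by (rule nn_integral_liminf) measurable
      also have "\<dots> \<le> ennreal e"
      proof (rule Liminf_le)
        have "eventually (\<lambda>k. k \<ge> M) sequentially" by (rule eventually_ge_at_top)
        then show "\<forall>\<^sub>F k in sequentially. (\<integral>\<^sup>+x. ennreal ((cmod (f n x - f (r k) x))\<^sup>2) \<partial>lborel) \<le> ennreal e"
        proof eventually_elim
          fix k assume "k \<ge> M"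
          then have "r k \<ge> M" using seq_suble[OF sm, of k] by linarith
          then have "sqnorm (\<lambda>x. f n x - f (r k) x) < e" using n by (intro M)
          then show "(\<integral>\<^sup>+x. ennreal ((cmod (f n x - f (r k) x))\<^sup>2) \<partial>lborel) \<le> ennreal e"
            using nn_integral_sqnorm[OF L2_diff[OF f f]] by (simp add: ennreal_leI)
        qed
      qed simp
      finally show ?thesis .
    qed
    then show ?thesis by blast
  qed
  obtain M where M: "(\<integral>\<^sup>+x. ennreal ((cmod (f M x - g x))\<^sup>2) \<partial>lborel) \<le> ennreal 1" using key[of 1] by auto
  have "(\<lambda>x. f M x - g x) \<in> L2" using M by (intro L2_I) (auto intro: le_less_trans)
  from L2_diff[OF f[of M] this] have gL: "g \<in> L2" by simp
  show thesis
  proof (rule that[OF gL])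
    fix e :: real assume e: "e > 0"
    obtain M where M: "\<And>n. n \<ge> M \<Longrightarrow> (\<integral>\<^sup>+x. ennreal ((cmod (f n x - g x))\<^sup>2) \<partial>lborel) \<le> ennreal e" using key[OF e] by auto
    have "sqnorm (\<lambda>x. f n x - g x) \<le> e" if "n \<ge> M" for n
      using M[OF that] nn_integral_sqnorm[OF L2_diff[OF f[of n] gL]] e by simp
    then show "\<exists>N. \<forall>n\<ge>N. sqnorm (\<lambda>x. f n x - g x) \<le> e" by blast
  qed
qed

text \<open>Weighted Cauchy-Schwarz in h followed by Fubini. The weight |p h| is kept inside the
  outer integral, so that F may stand for increments whose norm depends on h.\<close>

lemma nn_integral_Minkowski:
  fixes F :: "'a::euclidean_space \<Rightarrow> 'a \<Rightarrow> complex" and p :: "'a \<Rightarrow> real"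
  assumes [measurable]: "(\<lambda>(x, h). F x h) \<in> borel_measurable (borel \<Otimes>\<^sub>M borel)" and p: "integrable lborel p"
  shows "(\<integral>\<^sup>+x. ennreal ((cmod (LINT h|lborel. of_real (p h) * F x h))\<^sup>2) \<partial>lborel)
    \<le> ennreal (LINT h|lborel. \<bar>p h\<bar>) * (\<integral>\<^sup>+h. ennreal \<bar>p h\<bar> * (\<integral>\<^sup>+x. ennreal ((cmod (F x h))\<^sup>2) \<partial>lborel) \<partial>lborel)"
proof -
  have [measurable]: "p \<in> borel_measurable borel" using p by auto
  have P: "(\<integral>\<^sup>+h. ennreal \<bar>p h\<bar> \<partial>lborel) = ennreal (LINT h|lborel. \<bar>p h\<bar>)"
    using p by (intro nn_integral_eq_integral) auto
  have "(\<integral>\<^sup>+x. ennreal ((cmod (LINT h|lborel. of_real (p h) * F x h))\<^sup>2) \<partial>lborel)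
     \<le> (\<integral>\<^sup>+x. ennreal (LINT h|lborel. \<bar>p h\<bar>) * (\<integral>\<^sup>+h. ennreal (\<bar>p h\<bar> * (cmod (F x h))\<^sup>2) \<partial>lborel) \<partial>lborel)"
  proof (intro nn_integral_mono)
    fix x :: 'a
    show "ennreal ((cmod (LINT h|lborel. of_real (p h) * F x h))\<^sup>2) \<le> ennreal (LINT h|lborel. \<bar>p h\<bar>) * (\<integral>\<^sup>+h. ennreal (\<bar>p h\<bar> * (cmod (F x h))\<^sup>2) \<partial>lborel)"
      unfolding P[symmetric] by (rule Cauchy_Schwarz_weighted[OF _ p]) measurable
  qed
  also have "\<dots> = ennreal (LINT h|lborel. \<bar>p h\<bar>) * (\<integral>\<^sup>+x. (\<integral>\<^sup>+h. ennreal (\<bar>p h\<bar> * (cmod (F x h))\<^sup>2) \<partial>lborel) \<partial>lborel)"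
    by (rule nn_integral_cmult) measurable
  also have "(\<integral>\<^sup>+x. (\<integral>\<^sup>+h. ennreal (\<bar>p h\<bar> * (cmod (F x h))\<^sup>2) \<partial>lborel) \<partial>lborel) = (\<integral>\<^sup>+h. (\<integral>\<^sup>+x. ennreal (\<bar>p h\<bar> * (cmod (F x h))\<^sup>2) \<partial>lborel) \<partial>lborel)"
    by (rule lborel_pair.Fubini') measurable
  also have "\<dots> = (\<integral>\<^sup>+h. ennreal \<bar>p h\<bar> * (\<integral>\<^sup>+x. ennreal ((cmod (F x h))\<^sup>2) \<partial>lborel) \<partial>lborel)"
    by (intro nn_integral_cong) (simp add: ennreal_mult nn_integral_cmult)
  finally show ?thesis .
qed

section \<open>Convolutions, correlations and increments\<close>

definition kern :: "('a::euclidean_space \<Rightarrow> real) \<Rightarrow> bool" where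
  "kern p \<longleftrightarrow> integrable lborel p \<and> (\<exists>B. \<forall>h. \<bar>p h\<bar> \<le> B)"

lemma kern_D: assumes "kern p" shows "integrable lborel p" "p \<in> borel_measurable borel"
  using assms by (auto simp: kern_def)

lemma kern_diff: "kern p \<Longrightarrow> kern q \<Longrightarrow> kern (\<lambda>h. p h - q h)"
proof -
  assume p: "kern p" and q: "kern q"
  obtain B C where B: "\<And>h. \<bar>p h\<bar> \<le> B" and C: "\<And>h. \<bar>q h\<bar> \<le> C" using p q unfolding kern_def by auto
  have "\<bar>p h - q h\<bar> \<le> B + C" for h using B[of h] C[of h] by linarith
  then show ?thesis using p q unfolding kern_def by auto
qed

text \<open>This is why \<open>kern\<close> asks for boundedness besides integrability: the
  convolution with a square-integrable function then exists at every point.\<close>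

lemma kern_L2: assumes "kern p" shows "(\<lambda>h. complex_of_real (p h)) \<in> L2"
proof -
  obtain B where B: "\<And>h. \<bar>p h\<bar> \<le> B" using assms unfolding kern_def by auto
  note [measurable] = kern_D(2)[OF assms]
  have "integrable lborel (\<lambda>h. (p h)\<^sup>2)"
  proof (rule Bochner_Integration.integrable_bound)
    show "integrable lborel (\<lambda>h. B * \<bar>p h\<bar>)" using kern_D(1)[OF assms] by auto
    have "(p h)\<^sup>2 \<le> B * \<bar>p h\<bar>" for h
      using mult_right_mono[OF B[of h], of "\<bar>p h\<bar>"] by (simp add: power2_eq_square abs_mult[symmetric])
    then show "AE h in lborel. norm ((p h)\<^sup>2) \<le> norm (B * \<bar>p h\<bar>)" by (intro AE_I2) (simp add: order.trans[OF _ abs_ge_self])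
  qed simp
  then show ?thesis by (auto simp: L2_def)
qed

text \<open>Convolution with the reflected kernel \<open>\<lambda>h. p (- h)\<close>; the kernels of interest are odd or even.\<close>

definition cv :: "('a::euclidean_space \<Rightarrow> real) \<Rightarrow> ('a \<Rightarrow> complex) \<Rightarrow> 'a \<Rightarrow> complex" where
  "cv p u x = (LINT h|lborel. of_real (p h) * u (x + h))"

text \<open>Bilinear, without conjugation, to match the duality pairing of
  \<open>has_pv_dual\<close>; where a norm is wanted, the conjugate goes into the argument.\<close>

definition corr :: "('a::euclidean_space \<Rightarrow> complex) \<Rightarrow> ('a \<Rightarrow> complex) \<Rightarrow> 'a \<Rightarrow> complex" where
  "corr u w m = (LINT x|lborel. u (x + m) * w x)"

text \<open>The function A of the overview.\<close>

definition dcorr :: "('a::euclidean_space \<Rightarrow> complex) \<Rightarrow> ('a \<Rightarrow> complex) \<Rightarrow> 'a \<Rightarrow> complex" where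
  "dcorr u w l = (LINT x|lborel. (u (x + l) - u x) * (w (x + l) - w x))"

text \<open>Integrated against |h|^(-n-2s) this is the squared Gagliardo seminorm.\<close>

definition dsq :: "('a::euclidean_space \<Rightarrow> complex) \<Rightarrow> 'a \<Rightarrow> real" where
  "dsq u h = sqnorm (\<lambda>x. u (x + h) - u x)"

lemma dsq_nonneg: "0 \<le> dsq u h" unfolding dsq_def by (rule sqnorm_nonneg)

context
  fixes u :: "'a::euclidean_space \<Rightarrow> complex"
  assumes u: "u \<in> L2"
begin

private lemmas [measurable] = L2_D(1)[OF u]

lemma cv_integrable: "kern p \<Longrightarrow> integrable lborel (\<lambda>h. of_real (p h) * u (x + h))"
  using L2_mult[OF kern_L2 L2_shift[OF u, of x], of p] by (simp add: add.commute)

lemma borel_measurable_cv: "kern p \<Longrightarrow> cv p u \<in> borel_measurable borel"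
proof -
  assume p: "kern p"
  note [measurable] = kern_D(2)[OF p]
  have "(\<lambda>(x, h). of_real (p h) * u (x + h)) \<in> borel_measurable (borel \<Otimes>\<^sub>M lborel)" by measurable
  then show ?thesis unfolding cv_def by (rule lborel.borel_measurable_lebesgue_integral)
qed

lemma nn_cv: assumes p: "kern p"
  shows "(\<integral>\<^sup>+x. ennreal ((cmod (cv p u x))\<^sup>2) \<partial>lborel) \<le> ennreal ((LINT h|lborel. \<bar>p h\<bar>)\<^sup>2 * sqnorm u)"
proof -
  have P0: "0 \<le> (LINT h|lborel. \<bar>p h\<bar>)" by (intro integral_nonneg_AE) auto
  note [measurable] = kern_D(2)[OF p]
  have "(\<integral>\<^sup>+x. ennreal ((cmod (cv p u x))\<^sup>2) \<partial>lborel) \<le> ennreal (LINT h|lborel. \<bar>p h\<bar>) * (\<integral>\<^sup>+h. ennreal \<bar>p h\<bar> * (\<integral>\<^sup>+x. ennreal ((cmod (u (x + h)))\<^sup>2) \<partial>lborel) \<partial>lborel)"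
    unfolding cv_def by (rule nn_integral_Minkowski[OF _ kern_D(1)[OF p]]) measurable
  also have "(\<integral>\<^sup>+h. ennreal \<bar>p h\<bar> * (\<integral>\<^sup>+x. ennreal ((cmod (u (x + h)))\<^sup>2) \<partial>lborel) \<partial>lborel) = (\<integral>\<^sup>+h. ennreal \<bar>p h\<bar> * ennreal (sqnorm u) \<partial>lborel)"
    using nn_integral_sqnorm[OF L2_shift[OF u]] by (simp add: sqnorm_shift[OF u])
  also have "\<dots> = (\<integral>\<^sup>+h. ennreal \<bar>p h\<bar> \<partial>lborel) * ennreal (sqnorm u)" by (rule nn_integral_multc) measurable
  also have "(\<integral>\<^sup>+h. ennreal \<bar>p h\<bar> \<partial>lborel) = ennreal (LINT h|lborel. \<bar>p h\<bar>)"
    using kern_D(1)[OF p] by (intro nn_integral_eq_integral) auto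
  finally show ?thesis using P0 sqnorm_nonneg[of u] by (simp add: ennreal_mult[symmetric] power2_eq_square mult.assoc)
qed

lemma cv_L2: assumes p: "kern p" shows "cv p u \<in> L2"
  using nn_cv[OF p] by (intro L2_I borel_measurable_cv[OF p]) (auto intro: le_less_trans)

lemma L2_delta: "(\<lambda>x. u (x + h) - u x) \<in> L2"
  by (intro L2_diff L2_shift u)

text \<open>A kernel of mean zero sees only increments.\<close>

lemma cv_delta: assumes p: "kern p" and 0: "(LINT h|lborel. p h) = 0"
  shows "cv p u x = (LINT h|lborel. of_real (p h) * (u (x + h) - u x))"
proof -
  have "(LINT h|lborel. complex_of_real (p h)) = 0" using 0 by simp
  moreover have "integrable lborel (\<lambda>h. complex_of_real (p h))" using kern_D(1)[OF p] by simp
  ultimately show ?thesis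
    unfolding cv_def right_diff_distrib using cv_integrable[OF p] by simp
qed

lemma borel_measurable_dsq: "dsq u \<in> borel_measurable borel"
proof -
  have "(\<lambda>(h, x). (cmod (u (x + h) - u x))\<^sup>2) \<in> borel_measurable (borel \<Otimes>\<^sub>M lborel)" by measurable
  then show ?thesis unfolding dsq_def sqnorm_def by (rule lborel.borel_measurable_lebesgue_integral)
qed

lemma dsq_le: "dsq u h \<le> 4 * sqnorm u"
  using sqnorm_diff[OF L2_shift[OF u, of h] u] by (simp add: dsq_def sqnorm_shift[OF u])

text \<open>Where \<open>nn_cv\<close> has the squared mass of the kernel, one of the two factors is
  now weighted with squared increments. For u of finite Gagliardo seminorm this compensates kernels
  whose mass blows up.\<close>

lemma nn_cv_delta: assumes p: "kern p" and 0: "(LINT h|lborel. p h) = 0"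
  shows "(\<integral>\<^sup>+x. ennreal ((cmod (cv p u x))\<^sup>2) \<partial>lborel) \<le> ennreal (LINT h|lborel. \<bar>p h\<bar>) * (\<integral>\<^sup>+h. ennreal (\<bar>p h\<bar> * dsq u h) \<partial>lborel)"
proof -
  note [measurable] = kern_D(2)[OF p]
  have "(\<integral>\<^sup>+x. ennreal ((cmod (cv p u x))\<^sup>2) \<partial>lborel) \<le> ennreal (LINT h|lborel. \<bar>p h\<bar>) * (\<integral>\<^sup>+h. ennreal \<bar>p h\<bar> * (\<integral>\<^sup>+x. ennreal ((cmod (u (x + h) - u x))\<^sup>2) \<partial>lborel) \<partial>lborel)"
    unfolding cv_delta[OF p 0] by (rule nn_integral_Minkowski[OF _ kern_D(1)[OF p]]) measurable
  also have "(\<integral>\<^sup>+h. ennreal \<bar>p h\<bar> * (\<integral>\<^sup>+x. ennreal ((cmod (u (x + h) - u x))\<^sup>2) \<partial>lborel) \<partial>lborel) = (\<integral>\<^sup>+h. ennreal (\<bar>p h\<bar> * dsq u h) \<partial>lborel)"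
    using nn_integral_sqnorm[OF L2_delta] by (simp add: dsq_def ennreal_mult sqnorm_nonneg)
  finally show ?thesis .
qed

end

context
  fixes u w :: "'a::euclidean_space \<Rightarrow> complex"
  assumes u: "u \<in> L2" and w: "w \<in> L2"
begin

private lemmas [measurable] = L2_D(1)[OF u] L2_D(1)[OF w]

lemma corr_integrable: "integrable lborel (\<lambda>x. u (x + m) * w x)"
  by (rule L2_mult[OF L2_shift[OF u] w])

lemma corr_bound: "cmod (corr u w m) \<le> sqrt (sqnorm u) * sqrt (sqnorm w)"
  unfolding corr_def using L2_Cauchy_Schwarz'[OF L2_shift[OF u] w] by (simp add: sqnorm_shift[OF u])

lemma borel_measurable_corr: "corr u w \<in> borel_measurable borel"
proof -
  have "(\<lambda>(m, x). u (x + m) * w x) \<in> borel_measurable (borel \<Otimes>\<^sub>M lborel)" by measurable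
  then show ?thesis unfolding corr_def by (rule lborel.borel_measurable_lebesgue_integral)
qed

lemma corr_shift: "(LINT x|lborel. u (x + h) * w (x + k)) = corr u w (h - k)"
  unfolding corr_def using integral_lborel_shift[of "\<lambda>x. u (x + (h - k)) * w x" k] by (simp add: algebra_simps)

lemma corr_swap: "corr w u m = corr u w (- m)"
  using corr_shift[of 0 m] by (simp add: corr_def mult.commute)

lemma dcorr_eq: "dcorr u w l = 2 * corr u w 0 - corr u w l - corr u w (- l)"
proof -
  have i: "integrable lborel (\<lambda>x. u (x + h) * w (x + k))" for h k
    by (rule L2_mult[OF L2_shift[OF u] L2_shift[OF w]])
  have e: "(u (x + l) - u x) * (w (x + l) - w x) = u (x + l) * w (x + l) - u (x + l) * w (x + 0) - (u (x + 0) * w (x + l) - u (x + 0) * w (x + 0))" for x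
    by (simp add: algebra_simps)
  show ?thesis unfolding dcorr_def e using i[of l l] i[of l 0] i[of 0 l] i[of 0 0]
    by (simp only: Bochner_Integration.integral_diff Bochner_Integration.integrable_diff corr_shift) simp
qed

lemma borel_measurable_dcorr: "dcorr u w \<in> borel_measurable borel"
proof -
  note [measurable] = borel_measurable_corr
  show ?thesis unfolding dcorr_eq[abs_def] by measurable
qed

lemma dcorr_le: "cmod (dcorr u w l) \<le> (dsq u l + dsq w l) / 2"
proof -
  have "cmod (dcorr u w l) \<le> sqrt (dsq u l) * sqrt (dsq w l)"
    unfolding dcorr_def dsq_def by (intro L2_Cauchy_Schwarz' L2_diff L2_shift u w)
  also have "\<dots> \<le> (dsq u l + dsq w l) / 2"
    using arith_geo_mean_sqrt[OF dsq_nonneg[of u l] dsq_nonneg[of w l]] by (simp add: real_sqrt_mult)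
  finally show ?thesis .
qed

lemma
  assumes p: "integrable lborel (p :: 'a \<Rightarrow> real)"
  shows integrable_corr: "integrable lborel (\<lambda>h. of_real (p h) * corr u w h)"
proof (rule Bochner_Integration.integrable_bound)
  have [measurable]: "p \<in> borel_measurable borel" using p by auto
  note [measurable] = borel_measurable_corr
  show "integrable lborel (\<lambda>h. p h * (sqrt (sqnorm u) * sqrt (sqnorm w)))" using p by auto
  have "cmod (of_real (p h) * corr u w h) \<le> \<bar>p h\<bar> * (sqrt (sqnorm u) * sqrt (sqnorm w))" for h
    unfolding norm_mult using corr_bound by (simp add: mult_left_mono)
  then show "AE h in lborel. norm (of_real (p h) * corr u w h) \<le> norm (p h * (sqrt (sqnorm u) * sqrt (sqnorm w)))"
    by (intro AE_I2) (simp add: abs_mult sqnorm_nonneg)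
  show "(\<lambda>h. of_real (p h) * corr u w h) \<in> borel_measurable lborel" by measurable
qed

lemma cv_pairing: assumes p: "kern p"
  shows "(LINT x|lborel. cv p u x * w x) = (LINT h|lborel. of_real (p h) * corr u w h)"
proof -
  note [measurable] = kern_D(2)[OF p]
  have int: "integrable (lborel \<Otimes>\<^sub>M lborel) (\<lambda>(h, x). of_real (p h) * (u (x + h) * w x))"
  proof (rule lborel_pair.Fubini_integrable)
    show "(\<lambda>(h, x). of_real (p h) * (u (x + h) * w x)) \<in> borel_measurable (lborel \<Otimes>\<^sub>M lborel)" by measurable
    show "AE h in lborel. integrable lborel (\<lambda>x. case (h, x) of (h, x) \<Rightarrow> of_real (p h) * (u (x + h) * w x))"
      using corr_integrable by auto
    show "integrable lborel (\<lambda>h. LINT x|lborel. norm (case (h, x) of (h, x) \<Rightarrow> of_real (p h) * (u (x + h) * w x)))"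
    proof (rule Bochner_Integration.integrable_bound)
      show "integrable lborel (\<lambda>h. p h * (sqrt (sqnorm u) * sqrt (sqnorm w)))" using kern_D(1)[OF p] by auto
      have "(LINT x|lborel. norm (of_real (p h) * (u (x + h) * w x))) \<le> \<bar>p h\<bar> * (sqrt (sqnorm u) * sqrt (sqnorm w))" for h
      proof -
        have "(LINT x|lborel. norm (of_real (p h) * (u (x + h) * w x))) = \<bar>p h\<bar> * (LINT x|lborel. cmod (u (x + h) * w x))"
          by (subst norm_mult) simp
        also have "\<dots> \<le> \<bar>p h\<bar> * (sqrt (sqnorm u) * sqrt (sqnorm w))"
          using L2_Cauchy_Schwarz[OF L2_shift[OF u, of h] w] by (intro mult_left_mono) (auto simp: sqnorm_shift[OF u])
        finally show ?thesis .
      qed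
      then show "AE h in lborel. norm (LINT x|lborel. norm (case (h, x) of (h, x) \<Rightarrow> of_real (p h) * (u (x + h) * w x))) \<le> norm (p h * (sqrt (sqnorm u) * sqrt (sqnorm w)))"
        by (intro AE_I2) (simp add: abs_mult integral_nonneg_AE sqnorm_nonneg)
      have "(\<lambda>(h, x). norm (of_real (p h) * (u (x + h) * w x))) \<in> borel_measurable (borel \<Otimes>\<^sub>M lborel)" by measurable
      then show "(\<lambda>h. LINT x|lborel. norm (case (h, x) of (h, x) \<Rightarrow> of_real (p h) * (u (x + h) * w x))) \<in> borel_measurable lborel"
        using lborel.borel_measurable_lebesgue_integral by simp
    qed
  qed
  have "(LINT x|lborel. cv p u x * w x) = (LINT x|lborel. LINT h|lborel. of_real (p h) * (u (x + h) * w x))"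
    unfolding cv_def by (subst integral_mult_left_zero[symmetric]) (simp add: mult.assoc)
  also have "\<dots> = (LINT h|lborel. LINT x|lborel. of_real (p h) * (u (x + h) * w x))"
    by (rule lborel_pair.Fubini_integral) (rule int)
  also have "\<dots> = (LINT h|lborel. of_real (p h) * corr u w h)"
    unfolding corr_def by simp
  finally show ?thesis .
qed

text \<open>Each value of \<open>dcorr\<close> contains the correlations at l and at - l, which an
  even kernel weighs equally.\<close>

lemma even_kernel_dcorr:
  assumes r: "integrable lborel (r :: 'a \<Rightarrow> real)" and even: "\<And>l. r (- l) = r l"
  shows "(LINT l|lborel. of_real (r l) * (corr u w 0 - corr u w l)) = (LINT l|lborel. of_real (r l) * dcorr u w l) / 2"
    and "integrable lborel (\<lambda>l. of_real (r l) * dcorr u w l)"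
proof -
  have i1: "integrable lborel (\<lambda>l. of_real (r l) * corr u w l)" by (rule integrable_corr[OF r])
  have i2: "integrable lborel (\<lambda>l. of_real (r l) * corr u w (- l))"
    using integrable_lborel_uminus[of "\<lambda>l. of_real (r l) * corr u w l"] i1 by (simp add: even)
  have v2: "(LINT l|lborel. of_real (r l) * corr u w (- l)) = (LINT l|lborel. of_real (r l) * corr u w l)"
    using integral_lborel_uminus[of "\<lambda>l. of_real (r l) * corr u w l"] by (simp add: even)
  have i0: "integrable lborel (\<lambda>l. of_real (r l) * corr u w 0)" using r by auto
  have e: "of_real (r l) * dcorr u w l = 2 * (of_real (r l) * corr u w 0) - of_real (r l) * corr u w l - of_real (r l) * corr u w (- l)" for l
    by (simp add: dcorr_eq algebra_simps)
  show "integrable lborel (\<lambda>l. of_real (r l) * dcorr u w l)" unfolding e using i0 i1 i2 by auto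
  show "(LINT l|lborel. of_real (r l) * (corr u w 0 - corr u w l)) = (LINT l|lborel. of_real (r l) * dcorr u w l) / 2"
    unfolding e right_diff_distrib using i0 i1 i2 v2 by simp
qed

end

text \<open>Reflection changes the sign of an odd kernel: this is the truncated form of divergence
  and gradient being negative adjoints of each other.\<close>

lemma cv_antisym:
  assumes u: "u \<in> L2" and w: "w \<in> L2" and p: "kern p" and odd: "\<And>h. p (- h) = - p h"
  shows "(LINT x|lborel. cv p u x * w x) = - (LINT x|lborel. u x * cv p w x)"
proof -
  have "(LINT x|lborel. u x * cv p w x) = (LINT h|lborel. of_real (p h) * corr u w (- h))"
    using cv_pairing[OF w u p] by (simp add: mult.commute corr_swap[OF u w])
  also have "\<dots> = (LINT h|lborel. of_real (p (- h)) * corr u w h)"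
    using integral_lborel_uminus[of "\<lambda>h. of_real (p (- h)) * corr u w h"] by simp
  also have "\<dots> = - (LINT h|lborel. of_real (p h) * corr u w h)" by (simp add: odd)
  finally show ?thesis using cv_pairing[OF u w p] by simp
qed

lemma
  assumes p: "kern p" and q: "kern q"
  shows kern_conv_integrable: "integrable lborel (\<lambda>h. p h * q (l - h))"
    and integrable_kern_conv: "integrable lborel (\<lambda>l. LINT h|lborel. p h * q (l - h))"
    and integral_kern_conv: "(LINT l|lborel. LINT h|lborel. p h * q (l - h)) = (LINT h|lborel. p h) * (LINT h|lborel. q h)"
    and integrable_kern_conv_pair: "integrable (lborel \<Otimes>\<^sub>M lborel) (\<lambda>(h, l). p h * q (l - h))"
proof -
  note [measurable] = kern_D(2)[OF p] kern_D(2)[OF q]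
  obtain B where B: "\<And>h. \<bar>q h\<bar> \<le> B" using q unfolding kern_def by auto
  show "integrable lborel (\<lambda>h. p h * q (l - h))"
  proof (rule Bochner_Integration.integrable_bound)
    show "integrable lborel (\<lambda>h. p h * B)" using kern_D(1)[OF p] by auto
    show "AE h in lborel. norm (p h * q (l - h)) \<le> norm (p h * B)"
      using B by (intro AE_I2) (auto simp: abs_mult intro!: mult_left_mono order.trans[OF B])
  qed simp
  have sh: "integrable lborel (\<lambda>l. f (l - h))" "(LINT l|lborel. f (l - h)) = (LINT l|lborel. f l)" if "integrable lborel f" for f :: "'a \<Rightarrow> real" and h
    using that integrable_lborel_shift[of f "- h"] integral_lborel_shift[of f "- h"] by auto
  show int: "integrable (lborel \<Otimes>\<^sub>M lborel) (\<lambda>(h, l). p h * q (l - h))"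
  proof (rule lborel_pair.Fubini_integrable)
    have "(LINT l|lborel. norm (p h * q (l - h))) = \<bar>p h\<bar> * (LINT l|lborel. \<bar>q l\<bar>)" for h
      using sh(2)[of "\<lambda>l. \<bar>q l\<bar>" h] kern_D(1)[OF q] by (simp add: abs_mult)
    then show "integrable lborel (\<lambda>h. LINT l|lborel. norm (case (h, l) of (h, l) \<Rightarrow> p h * q (l - h)))"
      using kern_D(1)[OF p] by auto
    show "AE h in lborel. integrable lborel (\<lambda>l. case (h, l) of (h, l) \<Rightarrow> p h * q (l - h))"
      using sh(1)[OF kern_D(1)[OF q]] by auto
  qed measurable
  show "integrable lborel (\<lambda>l. LINT h|lborel. p h * q (l - h))"
    using lborel_pair.integrable_snd[OF int] .
  have "(LINT l|lborel. LINT h|lborel. p h * q (l - h)) = (LINT h|lborel. LINT l|lborel. p h * q (l - h))"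
    by (rule lborel_pair.Fubini_integral) (rule int)
  also have "\<dots> = (LINT h|lborel. p h * (LINT l|lborel. q l))"
    using sh(2)[OF kern_D(1)[OF q]] by simp
  finally show "(LINT l|lborel. LINT h|lborel. p h * q (l - h)) = (LINT h|lborel. p h) * (LINT h|lborel. q h)" by simp
qed

text \<open>Moving q to the other factor gives minus the pairing of the convolution r of p and q
  with the correlation of u and w. Since r is even with mean zero, the correlation at 0 can be
  subtracted and the result symmetrised into increments. Thus the product of the two convolutions is
  governed by r alone, whose pointwise limit is known for the regularised kernels.\<close>

lemma cv_cv:
  assumes u: "u \<in> L2" and w: "w \<in> L2" and p: "kern p" and q: "kern q"
    and podd: "\<And>h. p (- h) = - p h" and qodd: "\<And>h. q (- h) = - q h"
  shows "(LINT x|lborel. cv p u x * cv q w x) = (LINT l|lborel. of_real (LINT h|lborel. p h * q (l - h)) * dcorr u w l) / 2"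
    and "integrable lborel (\<lambda>l. of_real (LINT h|lborel. p h * q (l - h)) * dcorr u w l)"
proof -
  note [measurable] = kern_D(2)[OF p] kern_D(2)[OF q] borel_measurable_corr[OF u w]
  define r where "r = (\<lambda>l. LINT h|lborel. p h * q (l - h))"
  have ri: "integrable lborel r" unfolding r_def by (rule integrable_kern_conv[OF p q])
  have reven: "r (- l) = r l" for l
  proof -
    have "p (- h) * q (- l - - h) = p h * q (l - h)" for h using qodd[of "l - h"] by (simp add: podd)
    then show ?thesis unfolding r_def
      using integral_lborel_uminus[of "\<lambda>h. p h * q (- l - h)"] by simp
  qed
  have r0: "(LINT l|lborel. r l) = 0"
    unfolding r_def integral_kern_conv[OF p q] using integral_lborel_odd[of p] podd by simp
  have c: "corr u (cv q w) h = (LINT l|lborel. of_real (q (h - l)) * corr u w l)" for h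
  proof -
    have "corr u (cv q w) h = (LINT x|lborel. cv q w x * u (x + h))" by (simp add: corr_def mult.commute)
    also have "\<dots> = (LINT k|lborel. of_real (q k) * corr w (\<lambda>x. u (x + h)) k)" by (rule cv_pairing[OF w L2_shift[OF u] q])
    also have "\<dots> = (LINT k|lborel. of_real (q k) * corr u w (h - k))"
    proof -
      have "corr w (\<lambda>x. u (x + h)) k = corr u w (h - k)" for k
        using corr_shift[OF u w, of h k] by (simp add: corr_def mult.commute)
      then show ?thesis by simp
    qed
    also have "(LINT k|lborel. of_real (q k) * corr u w (h - k)) = (LINT l|lborel. of_real (q (h - l)) * corr u w l)"
      using integral_lborel_reflect[of "\<lambda>k. of_real (q k) * corr u w (h - k)" h] by simp
    finally show ?thesis .
  qed
  have int: "integrable (lborel \<Otimes>\<^sub>M lborel) (\<lambda>(h, l). of_real (p h * q (l - h)) * corr u w l)"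
  proof (rule Bochner_Integration.integrable_bound)
    show "integrable (lborel \<Otimes>\<^sub>M lborel) (\<lambda>z. (case z of (h, l) \<Rightarrow> p h * q (l - h)) * (sqrt (sqnorm u) * sqrt (sqnorm w)))"
      using integrable_kern_conv_pair[OF p q] by (rule integrable_mult_left)
    show "AE z in lborel \<Otimes>\<^sub>M lborel. norm (case z of (h, l) \<Rightarrow> of_real (p h * q (l - h)) * corr u w l) \<le> norm ((case z of (h, l) \<Rightarrow> p h * q (l - h)) * (sqrt (sqnorm u) * sqrt (sqnorm w)))"
      using corr_bound[OF u w] by (intro AE_I2) (auto simp: norm_mult abs_mult sqnorm_nonneg intro!: mult_left_mono)
  qed measurable
  have "(LINT x|lborel. cv p u x * cv q w x) = (LINT h|lborel. of_real (p h) * corr u (cv q w) h)"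
    by (rule cv_pairing[OF u cv_L2[OF w q] p])
  also have "\<dots> = (LINT h|lborel. LINT l|lborel. - (of_real (p h * q (l - h)) * corr u w l))"
  proof (intro Bochner_Integration.integral_cong refl)
    fix h
    have "q (h - l) = - q (l - h)" for l using qodd[of "l - h"] by simp
    then show "of_real (p h) * corr u (cv q w) h = (LINT l|lborel. - (of_real (p h * q (l - h)) * corr u w l))"
      unfolding c by (subst integral_mult_right_zero[symmetric]) (simp add: mult.assoc)
  qed
  also have "\<dots> = - (LINT h|lborel. LINT l|lborel. of_real (p h * q (l - h)) * corr u w l)" by simp
  also have "(LINT h|lborel. LINT l|lborel. of_real (p h * q (l - h)) * corr u w l) = (LINT l|lborel. LINT h|lborel. of_real (p h * q (l - h)) * corr u w l)"
    by (rule lborel_pair.Fubini_integral[symmetric]) (rule int)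
  also have "\<dots> = (LINT l|lborel. of_real (r l) * corr u w l)"
  proof (intro Bochner_Integration.integral_cong refl)
    fix l
    have "(LINT h|lborel. of_real (p h * q (l - h)) * corr u w l) = (LINT h|lborel. complex_of_real (p h * q (l - h))) * corr u w l"
      by (rule integral_mult_left_zero)
    also have "(LINT h|lborel. complex_of_real (p h * q (l - h))) = of_real (r l)" unfolding r_def by (rule integral_complex_of_real)
    finally show "(LINT h|lborel. of_real (p h * q (l - h)) * corr u w l) = of_real (r l) * corr u w l" .
  qed
  also have "- \<dots> = (LINT l|lborel. of_real (r l) * (corr u w 0 - corr u w l))"
  proof -
    have "(LINT l|lborel. of_real (r l) * corr u w 0) = 0" using r0 by simp
    moreover have "integrable lborel (\<lambda>l. of_real (r l) * corr u w 0)" using ri by auto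
    ultimately show ?thesis unfolding right_diff_distrib using integrable_corr[OF u w ri] by simp
  qed
  also have "\<dots> = (LINT l|lborel. of_real (r l) * dcorr u w l) / 2" by (rule even_kernel_dcorr(1)[OF u w ri reven])
  finally show "(LINT x|lborel. cv p u x * cv q w x) = (LINT l|lborel. of_real (LINT h|lborel. p h * q (l - h)) * dcorr u w l) / 2"
    unfolding r_def .
  show "integrable lborel (\<lambda>l. of_real (LINT h|lborel. p h * q (l - h)) * dcorr u w l)"
    using even_kernel_dcorr(2)[OF u w ri reven] unfolding r_def .
qed

lemma dsq_add:
  assumes u: "u \<in> L2" and w: "w \<in> L2"
  shows "dsq (\<lambda>x. u x + w x) h \<le> 2 * dsq u h + 2 * dsq w h"
proof -
  have "(\<lambda>x. u (x + h) + w (x + h) - (u x + w x)) = (\<lambda>x. (u (x + h) - u x) + (w (x + h) - w x))" by (auto simp: algebra_simps)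
  then show ?thesis unfolding dsq_def using sqnorm_add[OF L2_delta[OF u, of h] L2_delta[OF w, of h]] by simp
qed

lemma dsq_cmult:
  assumes u: "u \<in> L2"
  shows "dsq (\<lambda>x. c * u x) h = (cmod c)\<^sup>2 * dsq u h"
  unfolding dsq_def right_diff_distrib[symmetric] by (rule sqnorm_cmult[OF L2_delta[OF u]])

section \<open>Continuity of translations in L2\<close>

definition transl_cont :: "('a::euclidean_space \<Rightarrow> complex) \<Rightarrow> bool" where
  "transl_cont u \<longleftrightarrow> u \<in> L2 \<and> (\<forall>h. h \<longlonglongrightarrow> 0 \<longrightarrow> (\<lambda>k. dsq u (h k)) \<longlonglongrightarrow> 0)"

lemma transl_cont_add: "transl_cont u \<Longrightarrow> transl_cont w \<Longrightarrow> transl_cont (\<lambda>x. u x + w x)"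
  unfolding transl_cont_def
proof (intro conjI allI impI)
  fix h :: "nat \<Rightarrow> 'a"
  assume u: "u \<in> L2 \<and> (\<forall>h. h \<longlonglongrightarrow> 0 \<longrightarrow> (\<lambda>k. dsq u (h k)) \<longlonglongrightarrow> 0)"
    and w: "w \<in> L2 \<and> (\<forall>h. h \<longlonglongrightarrow> 0 \<longrightarrow> (\<lambda>k. dsq w (h k)) \<longlonglongrightarrow> 0)" and h: "h \<longlonglongrightarrow> 0"
  show "(\<lambda>k. dsq (\<lambda>x. u x + w x) (h k)) \<longlonglongrightarrow> 0"
  proof (rule Lim_null_comparison)
    show "\<forall>\<^sub>F k in sequentially. norm (dsq (\<lambda>x. u x + w x) (h k)) \<le> 2 * dsq u (h k) + 2 * dsq w (h k)"
      using dsq_add u w by (intro always_eventually) (auto simp: dsq_nonneg)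
    have "(\<lambda>k. 2 * dsq u (h k) + 2 * dsq w (h k)) \<longlonglongrightarrow> 2 * 0 + 2 * 0" using u w h by (intro tendsto_intros) auto
    then show "(\<lambda>k. 2 * dsq u (h k) + 2 * dsq w (h k)) \<longlonglongrightarrow> 0" by simp
  qed
qed (auto intro: L2_add)

lemma transl_cont_cmult: "transl_cont u \<Longrightarrow> transl_cont (\<lambda>x. c * u x)"
  unfolding transl_cont_def by (auto simp: dsq_cmult L2_cmult intro!: tendsto_mult_right_zero)

lemma transl_cont_approx:
  assumes u: "u \<in> L2" and approx: "\<And>e. e > 0 \<Longrightarrow> \<exists>w. transl_cont w \<and> sqnorm (\<lambda>x. u x - w x) < e"
  shows "transl_cont u"
  unfolding transl_cont_def
proof (intro conjI u allI impI)
  fix h :: "nat \<Rightarrow> 'a" assume h: "h \<longlonglongrightarrow> 0"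
  show "(\<lambda>k. dsq u (h k)) \<longlonglongrightarrow> 0"
  proof (rule LIMSEQ_I)
    fix e :: real assume e: "e > 0"
    \<comment> \<open>The constants add up as follows: dsq u is at most 2 dsq w + 8 sqnorm (u - w),
      which is less than 2 e/4 + 8 e/16 = e.\<close>
    obtain w where w: "transl_cont w" "sqnorm (\<lambda>x. u x - w x) < e / 16" using approx[of "e / 16"] e by auto
    have wL: "w \<in> L2" using w by (simp add: transl_cont_def)
    have "(\<lambda>k. dsq w (h k)) \<longlonglongrightarrow> 0" using w h by (simp add: transl_cont_def)
    from LIMSEQ_D[OF this, of "e / 4"] e obtain N where N: "\<And>k. k \<ge> N \<Longrightarrow> norm (dsq w (h k) - 0) < e / 4" by auto
    have "norm (dsq u (h k) - 0) < e" if k: "k \<ge> N" for k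
    proof -
      have "dsq u (h k) = dsq (\<lambda>x. w x + (u x - w x)) (h k)" by simp
      also have "\<dots> \<le> 2 * dsq w (h k) + 2 * dsq (\<lambda>x. u x - w x) (h k)" by (rule dsq_add[OF wL L2_diff[OF u wL]])
      also have "dsq (\<lambda>x. u x - w x) (h k) \<le> 4 * sqnorm (\<lambda>x. u x - w x)" by (rule dsq_le[OF L2_diff[OF u wL]])
      finally have "dsq u (h k) \<le> 2 * dsq w (h k) + 2 * (4 * sqnorm (\<lambda>x. u x - w x))" by simp
      moreover have "dsq w (h k) < e / 4" using N[OF k] by (simp add: dsq_nonneg)
      ultimately show ?thesis using w(2) dsq_nonneg[of u "h k"] by simp
    qed
    then show "\<exists>no. \<forall>n\<ge>no. norm (dsq u (h n) - 0) < e" by blast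
  qed
qed

lemma
  fixes A :: "'a::euclidean_space set"
  assumes A[measurable]: "A \<in> sets borel" and fin: "emeasure lborel A < \<infinity>"
  shows L2_indicator: "(\<lambda>x. indicator A x :: complex) \<in> L2"
    and sqnorm_indicator: "sqnorm (\<lambda>x. indicator A x :: complex) = measure lborel A"
proof -
  have e: "(cmod (indicator A x))\<^sup>2 = indicator A x" for x by (simp split: split_indicator)
  have m: "(\<lambda>x. indicator A x :: complex) \<in> borel_measurable borel" using A by (rule borel_measurable_indicator)
  have i: "integrable lborel (\<lambda>x. indicator A x :: real)" using A fin by (intro integrable_real_indicator) auto
  show "(\<lambda>x. indicator A x :: complex) \<in> L2" unfolding L2_def mem_Collect_eq e using m i by blast
  show "sqnorm (\<lambda>x. indicator A x :: complex) = measure lborel A" unfolding sqnorm_def e by simp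
qed

text \<open>A point of an open set stays in it under small translations, so the part of U that
  leaves U shrinks to nothing. The other half of the symmetric difference becomes the same quantity
  for - h after a shift.\<close>

lemma transl_cont_open:
  fixes U :: "'a::euclidean_space set"
  assumes U: "open U" and fin: "emeasure lborel U < \<infinity>"
  shows "transl_cont (\<lambda>x. indicator U x)"
  unfolding transl_cont_def
proof (intro conjI allI impI)
  have [measurable]: "U \<in> sets borel" using U by simp
  show "(\<lambda>x. indicator U x :: complex) \<in> L2" by (rule L2_indicator) (use fin in auto)
  have Ui: "integrable lborel (indicator U :: 'a \<Rightarrow> real)" using fin by (intro integrable_real_indicator) auto
  have key: "(\<lambda>k. LINT x|lborel. indicator U x * (1 - indicator U (x + h k)) :: real) \<longlonglongrightarrow> 0" if h: "h \<longlonglongrightarrow> 0" for h :: "nat \<Rightarrow> 'a"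
  proof -
    have "(\<lambda>k. LINT x|lborel. indicator U x * (1 - indicator U (x + h k)) :: real) \<longlonglongrightarrow> (LINT x|lborel. (0::real) * indicator U (x::'a))"
    proof (rule integral_dominated_convergence[where w="indicator U"])
      show "AE x in lborel. (\<lambda>k. indicator U x * (1 - indicator U (x + h k)) :: real) \<longlonglongrightarrow> 0 * indicator U x"
      proof (rule AE_I2)
        fix x :: 'a
        show "(\<lambda>k. indicator U x * (1 - indicator U (x + h k)) :: real) \<longlonglongrightarrow> 0 * indicator U x"
        proof (cases "x \<in> U")
          case True
          have "(\<lambda>k. x + h k) \<longlonglongrightarrow> x + 0" using h by (intro tendsto_intros)
          then have "eventually (\<lambda>k. x + h k \<in> U) sequentially" using topological_tendstoD[of "\<lambda>k. x + h k" x sequentially U] U True by simp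
          then have "eventually (\<lambda>k. indicator U x * (1 - indicator U (x + h k)) = (0::real)) sequentially" by eventually_elim simp
          then show ?thesis by (simp add: tendsto_eventually)
        qed simp
      qed
      show "AE x in lborel. norm (indicator U x * (1 - indicator U (x + h k)) :: real) \<le> indicator U x" for k
        by (auto split: split_indicator)
    qed (use Ui in auto)
    then show ?thesis by simp
  qed
  fix h :: "nat \<Rightarrow> 'a" assume h: "h \<longlonglongrightarrow> 0"
  have eq: "dsq (\<lambda>x. indicator U x) l = (LINT x|lborel. indicator U x * (1 - indicator U (x + l)) :: real) + (LINT x|lborel. indicator U x * (1 - indicator U (x + - l)) :: real)" for l :: 'a
  proof -
    have i: "integrable lborel (\<lambda>x. indicator U x * (1 - indicator U (x + m)) :: real)" for m
      by (rule Bochner_Integration.integrable_bound[OF Ui]) (auto split: split_indicator)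
    have sh: "integrable lborel (\<lambda>x. indicator U (x + l) * (1 - indicator U x) :: real)" "(LINT x|lborel. indicator U (x + l) * (1 - indicator U x) :: real) = (LINT x|lborel. indicator U x * (1 - indicator U (x + - l)))"
      using integrable_lborel_shift[of "\<lambda>x. indicator U x * (1 - indicator U (x + - l)) :: real" l] integral_lborel_shift[of "\<lambda>x. indicator U x * (1 - indicator U (x + - l)) :: real" l] i[of "- l"]
      by (auto simp: add.commute)
    have "(cmod (indicator U (x + l) - indicator U x))\<^sup>2 = indicator U x * (1 - indicator U (x + l)) + indicator U (x + l) * (1 - indicator U x)" for x
      by (auto split: split_indicator)
    then show ?thesis unfolding dsq_def sqnorm_def using i[of l] sh by simp
  qed
  have "(\<lambda>k. - h k) \<longlonglongrightarrow> 0" using tendsto_minus[OF h] by simp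
  from tendsto_add[OF key[OF h] key[OF this]] show "(\<lambda>k. dsq (\<lambda>x. indicator U x) (h k)) \<longlonglongrightarrow> 0" unfolding eq by simp
qed

lemma transl_cont_indicator:
  fixes A :: "'a::euclidean_space set"
  assumes A: "A \<in> sets borel" and fin: "emeasure lborel A < \<infinity>"
  shows "transl_cont (\<lambda>x. indicator A x)"
proof (rule transl_cont_approx)
  show "(\<lambda>x. indicator A x :: complex) \<in> L2" by (rule L2_indicator[OF A fin])
  fix e :: real assume e: "e > 0"
  obtain U where U: "open U" "A \<subseteq> U" "emeasure lborel (U - A) < e" using outer_regular_lborel[OF A e] by blast
  have [measurable]: "U \<in> sets borel" "A \<in> sets borel" using U A by auto
  have f1: "emeasure lborel (U - A) < \<infinity>" using U(3) by (rule order.strict_trans) simp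
  have "emeasure lborel U = emeasure lborel A + emeasure lborel (U - A)"
    using U(2) by (subst plus_emeasure) (auto intro!: arg_cong[of _ _ "emeasure lborel"])
  then have "emeasure lborel U < \<infinity>" using fin f1 by simp
  then have "transl_cont (\<lambda>x. indicator U x)" by (rule transl_cont_open[OF U(1)])
  moreover have "sqnorm (\<lambda>x. indicator A x - indicator U x :: complex) < e"
  proof -
    have "(cmod (indicator A x - indicator U x))\<^sup>2 = (cmod (indicator (U - A) x))\<^sup>2" for x using U(2) by (auto split: split_indicator)
    then have "sqnorm (\<lambda>x. indicator A x - indicator U x :: complex) = sqnorm (\<lambda>x. indicator (U - A) x :: complex)" by (simp add: sqnorm_def)
    also have "\<dots> = measure lborel (U - A)" by (rule sqnorm_indicator) (use f1 in auto)
    also have "\<dots> < e" using U(3) f1 e by (simp add: measure_def enn2real_less_iff)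
    finally show ?thesis .
  qed
  ultimately show "\<exists>w. transl_cont w \<and> sqnorm (\<lambda>x. indicator A x - w x) < e" by blast
qed

lemma transl_cont_sum: "finite I \<Longrightarrow> (\<And>i. i \<in> I \<Longrightarrow> transl_cont (f i)) \<Longrightarrow> transl_cont (\<lambda>x. \<Sum>i\<in>I. f i x)"
proof (induction I rule: finite_induct)
  case empty
  show ?case using transl_cont_cmult[OF transl_cont_open[of "{}"], of 0] by simp
next
  case (insert i I)
  then show ?case by (simp add: transl_cont_add)
qed

lemma transl_cont_simple:
  fixes f :: "'a::euclidean_space \<Rightarrow> complex"
  assumes f: "simple_function lborel f" and L: "f \<in> L2"
  shows "transl_cont f"
proof -
  have fin: "finite (range f)" using f by (simp add: simple_function_def)
  note [measurable] = L2_D(1)[OF L]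
  have "transl_cont (\<lambda>x. y * indicator (f -` {y}) x)" for y
  proof (cases "y = 0")
    case True
    then show ?thesis using transl_cont_cmult[OF transl_cont_open[of "{}"], of 0] by simp
  next
    case False
    have B: "f -` {y} \<in> sets borel" using measurable_sets[OF L2_D(1)[OF L], of "{y}"] by simp
    \<comment> \<open>Chebyshev's inequality: a nonzero value of a square-integrable function is
      taken on a set of finite measure only.\<close>
    have "ennreal ((cmod y)\<^sup>2) * emeasure lborel (f -` {y}) = (\<integral>\<^sup>+x. ennreal ((cmod y)\<^sup>2) * indicator (f -` {y}) x \<partial>lborel)"
      using B by (simp add: nn_integral_cmult_indicator)
    also have "\<dots> \<le> (\<integral>\<^sup>+x. ennreal ((cmod (f x))\<^sup>2) \<partial>lborel)"
      by (intro nn_integral_mono) (auto split: split_indicator)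
    also have "\<dots> < \<infinity>" by (simp add: nn_integral_sqnorm[OF L])
    finally have "emeasure lborel (f -` {y}) < \<infinity>" using False by (auto simp: ennreal_mult_less_top ennreal_eq_0_iff)
    then show ?thesis by (intro transl_cont_cmult transl_cont_indicator B)
  qed
  then have "transl_cont (\<lambda>x. \<Sum>y\<in>range f. y * indicator (f -` {y}) x)" by (intro transl_cont_sum fin)
  moreover have "(\<Sum>y\<in>range f. y * indicator (f -` {y}) x) = f x" for x
  proof -
    have "(\<Sum>y\<in>range f. y * indicator (f -` {y}) x) = (\<Sum>y\<in>range f. if y = f x then y else 0)" by (intro sum.cong) (auto split: split_indicator)
    then show ?thesis using fin by simp
  qed
  ultimately show ?thesis by simp
qed

theorem L2_translation_continuous:
  fixes u :: "'a::euclidean_space \<Rightarrow> complex"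
  assumes u: "u \<in> L2" and h: "h \<longlonglongrightarrow> 0"
  shows "(\<lambda>k. dsq u (h k)) \<longlonglongrightarrow> 0"
proof -
  note [measurable] = L2_D(1)[OF u]
  \<comment> \<open>Simple functions with |F| \<le> 2 |u| are square integrable, and |u - F|^2 \<le>
    9 |u|^2 serves as majorant.\<close>
  obtain F where F: "\<And>i. simple_function lborel (F i)" "\<And>x. (\<lambda>i. F i x) \<longlonglongrightarrow> u x" "\<And>i x. cmod (F i x) \<le> 2 * cmod (u x)"
    using borel_measurable_implies_sequence_metric[of u lborel 0] by auto
  have [measurable]: "F i \<in> borel_measurable borel" for i using borel_measurable_simple_function[OF F(1)[of i]] by simp
  have i4: "integrable lborel (\<lambda>x. 4 * (cmod (u x))\<^sup>2)" "integrable lborel (\<lambda>x. 9 * (cmod (u x))\<^sup>2)" using L2_D(2)[OF u] by auto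
  have FL: "F i \<in> L2" for i
  proof -
    have "(cmod (F i x))\<^sup>2 \<le> 4 * (cmod (u x))\<^sup>2" for x using power_mono[OF F(3)[of i x], of 2] by (simp add: power_mult_distrib)
    then have "integrable lborel (\<lambda>x. (cmod (F i x))\<^sup>2)"
      by (intro Bochner_Integration.integrable_bound[OF i4(1)] AE_I2) auto
    moreover have "F i \<in> borel_measurable borel" by measurable
    ultimately show ?thesis unfolding L2_def mem_Collect_eq by (intro conjI)
  qed
  have "(\<lambda>i. LINT x|lborel. (cmod (u x - F i x))\<^sup>2) \<longlonglongrightarrow> (LINT x|lborel. (0::real) * cmod (u x))"
  proof (rule integral_dominated_convergence[where w="\<lambda>x. 9 * (cmod (u x))\<^sup>2"])
    show "AE x in lborel. (\<lambda>i. (cmod (u x - F i x))\<^sup>2) \<longlonglongrightarrow> 0 * cmod (u x)"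
    proof (rule AE_I2)
      fix x
      have "(\<lambda>i. (cmod (u x - F i x))\<^sup>2) \<longlonglongrightarrow> (cmod (u x - u x))\<^sup>2" by (intro tendsto_intros F)
      then show "(\<lambda>i. (cmod (u x - F i x))\<^sup>2) \<longlonglongrightarrow> 0 * cmod (u x)" by simp
    qed
    have "(cmod (u x - F i x))\<^sup>2 \<le> 9 * (cmod (u x))\<^sup>2" for i x
    proof -
      have "cmod (u x - F i x) \<le> 3 * cmod (u x)" using norm_triangle_ineq4[of "u x" "F i x"] F(3)[of i x] by linarith
      from power_mono[OF this, of 2] show ?thesis by (simp add: power_mult_distrib)
    qed
    then show "AE x in lborel. norm ((cmod (u x - F i x))\<^sup>2) \<le> 9 * (cmod (u x))\<^sup>2" for i by simp
  qed (use i4 in auto)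
  then have lim: "(\<lambda>i. sqnorm (\<lambda>x. u x - F i x)) \<longlonglongrightarrow> 0" by (simp add: sqnorm_def)
  have "transl_cont u"
  proof (rule transl_cont_approx[OF u])
    fix e :: real assume "e > 0"
    from LIMSEQ_D[OF lim this] obtain N where "norm (sqnorm (\<lambda>x. u x - F N x) - 0) < e" by auto
    then have "sqnorm (\<lambda>x. u x - F N x) < e" by (simp add: sqnorm_nonneg)
    then show "\<exists>w. transl_cont w \<and> sqnorm (\<lambda>x. u x - w x) < e" using transl_cont_simple[OF F(1) FL] by blast
  qed
  then show ?thesis using h by (simp add: transl_cont_def)
qed

section \<open>Gagliardo seminorm of Sobolev functions\<close>

lemma kern_gaussian:
  assumes t: "t > 0"
  shows "kern (\<lambda>h::'a::euclidean_space. exp (- (t * (norm h)\<^sup>2)))"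
  unfolding kern_def using integrable_gaussian[OF t, where 'a='a] t by (auto intro!: exI[of _ 1])

definition ft :: "('a::euclidean_space \<Rightarrow> complex) \<Rightarrow> 'a \<Rightarrow> complex" where
  "ft w \<xi> = (LINT x|lborel. cis (- (x \<bullet> \<xi>)) * w x)"

lemma borel_measurable_cis[measurable]: "cis \<in> borel_measurable borel"
  unfolding cis_conv_exp by (intro borel_measurable_continuous_onI continuous_intros)

lemma borel_measurable_ft:
  assumes [measurable]: "w \<in> borel_measurable borel"
  shows "ft w \<in> borel_measurable borel"
proof -
  have "(\<lambda>(\<xi>, x). cis (- (x \<bullet> \<xi>)) * w x) \<in> borel_measurable (borel \<Otimes>\<^sub>M lborel)" by measurable
  then show ?thesis unfolding ft_def by (rule lborel.borel_measurable_lebesgue_integral)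
qed

text \<open>Expanding |ft w|^2 and integrating over \<xi> before x and y, the Gaussian in \<xi>
  becomes a Gaussian in y - x, that is, a convolution with w. Integrability of w permits the
  exchange of the integrals.\<close>

lemma ft_gaussian_energy:
  fixes w :: "'a::euclidean_space \<Rightarrow> complex"
  assumes w1: "integrable lborel w" and w2: "w \<in> L2" and t: "t > 0"
  shows "(LINT \<xi>|lborel. of_real (exp (- ((norm \<xi>)\<^sup>2 / (4 * t))) * (cmod (ft w \<xi>))\<^sup>2))
    = of_real ((4 * pi * t) powr (DIM('a) / 2)) * (LINT h|lborel. of_real (exp (- (t * (norm h)\<^sup>2))) * corr (\<lambda>x. cnj (w x)) w h)"
proof -
  define g where "g = (\<lambda>h::'a. exp (- (t * (norm h)\<^sup>2)))"
  define \<gamma> where "\<gamma> = (\<lambda>\<xi>::'a. exp (- (1 / (4 * t) * (norm \<xi>)\<^sup>2)))"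
  define c where "c = (4 * pi * t) powr (DIM('a) / 2)"
  have t': "1 / (4 * t) > 0" using t by simp
  note [measurable] = L2_D(1)[OF w2] borel_measurable_ft[OF L2_D(1)[OF w2]]
  have [measurable]: "\<gamma> \<in> borel_measurable borel" unfolding \<gamma>_def by measurable
  have cL: "(\<lambda>x. cnj (w x)) \<in> L2" by (rule L2_cnj[OF w2])
  note [measurable] = L2_D(1)[OF cL]
  have \<gamma>i: "integrable lborel \<gamma>" unfolding \<gamma>_def by (rule integrable_gaussian[OF t'])
  have \<gamma>ft: "(LINT \<xi>|lborel. \<gamma> \<xi> * cis (\<xi> \<bullet> y)) = c * g y" for y
  proof -
    have "(LINT \<xi>|lborel. \<gamma> \<xi> * cis (\<xi> \<bullet> y)) = (LINT \<xi>|lborel. cis (\<xi> \<bullet> y) * exp (- (1 / (4 * t) * (norm \<xi>)\<^sup>2)))"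
      by (simp add: \<gamma>_def mult.commute)
    also have "\<dots> = of_real ((pi / (1 / (4 * t))) powr (DIM('a) / 2) * exp (- ((norm y)\<^sup>2 / (4 * (1 / (4 * t))))))"
      by (rule integral_gaussian_cis[OF t'])
    finally show ?thesis using t by (simp add: c_def g_def mult_ac)
  qed
  have ft_le: "cmod (ft w \<xi>) \<le> (LINT x|lborel. cmod (w x))" for \<xi>
    unfolding ft_def by (rule order.trans[OF integral_norm_bound]) (simp add: norm_mult)
  have cnj_ft: "cnj (ft w \<xi>) = (LINT y|lborel. cis (y \<bullet> \<xi>) * cnj (w y))" for \<xi>
  proof -
    have "cnj (LINT x|lborel. cis (- (x \<bullet> \<xi>)) * w x) = (LINT x|lborel. cnj (cis (- (x \<bullet> \<xi>)) * w x))"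
      by (rule Bochner_Integration.integral_cnj[symmetric])
    then show ?thesis unfolding ft_def by (simp add: cis_cnj del: Bochner_Integration.integral_cnj)
  qed
  have "(LINT \<xi>|lborel. of_real (exp (- ((norm \<xi>)\<^sup>2 / (4 * t))) * (cmod (ft w \<xi>))\<^sup>2)) = (LINT \<xi>|lborel. \<gamma> \<xi> * (ft w \<xi> * cnj (ft w \<xi>)))"
    by (simp add: \<gamma>_def complex_norm_square[symmetric])
  also have "\<dots> = (LINT \<xi>|lborel. LINT x|lborel. \<gamma> \<xi> * (cis (- (x \<bullet> \<xi>)) * w x * cnj (ft w \<xi>)))"
    by (simp add: ft_def)
  also have "\<dots> = (LINT x|lborel. LINT \<xi>|lborel. \<gamma> \<xi> * (cis (- (x \<bullet> \<xi>)) * w x * cnj (ft w \<xi>)))"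
  proof (rule lborel_pair.Fubini_integral)
    have *: "integrable (lborel \<Otimes>\<^sub>M lborel) (\<lambda>(x, \<xi>). (LINT x|lborel. cmod (w x)) * cmod (w x) * \<gamma> \<xi>)"
    proof (rule lborel_pair.Fubini_integrable)
      show "integrable lborel (\<lambda>x. LINT \<xi>|lborel. norm (case (x, \<xi>) of (x, \<xi>) \<Rightarrow> (LINT x|lborel. cmod (w x)) * cmod (w x) * \<gamma> \<xi>))"
        using w1 by (simp add: abs_mult)
      show "AE x in lborel. integrable lborel (\<lambda>\<xi>. case (x, \<xi>) of (x, \<xi>) \<Rightarrow> (LINT x|lborel. cmod (w x)) * cmod (w x) * \<gamma> \<xi>)"
        using \<gamma>i by auto
    qed measurable
    show "integrable (lborel \<Otimes>\<^sub>M lborel) (\<lambda>(x, \<xi>). of_real (\<gamma> \<xi>) * (cis (- (x \<bullet> \<xi>)) * w x * cnj (ft w \<xi>)))"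
    proof (rule Bochner_Integration.integrable_bound[OF *])
      have "cmod (of_real (\<gamma> \<xi>) * (cis (- (x \<bullet> \<xi>)) * w x * cnj (ft w \<xi>))) \<le> (LINT x|lborel. cmod (w x)) * cmod (w x) * \<gamma> \<xi>" for x \<xi>
      proof -
        have "cmod (of_real (\<gamma> \<xi>) * (cis (- (x \<bullet> \<xi>)) * w x * cnj (ft w \<xi>))) = \<gamma> \<xi> * cmod (w x) * cmod (ft w \<xi>)"
          by (simp add: norm_mult \<gamma>_def mult.assoc)
        also have "\<dots> \<le> \<gamma> \<xi> * cmod (w x) * (LINT x|lborel. cmod (w x))" by (intro mult_left_mono ft_le) (auto simp: \<gamma>_def)
        finally show ?thesis by (simp add: mult_ac)
      qed
      then show "AE z in lborel \<Otimes>\<^sub>M lborel. norm (case z of (x, \<xi>) \<Rightarrow> of_real (\<gamma> \<xi>) * (cis (- (x \<bullet> \<xi>)) * w x * cnj (ft w \<xi>)))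
        \<le> norm (case z of (x, \<xi>) \<Rightarrow> (LINT x|lborel. cmod (w x)) * cmod (w x) * \<gamma> \<xi>)"
        by (intro AE_I2) (auto intro: order.trans[OF _ abs_ge_self])
      \<comment> \<open>The conjugate of the transform of w is the transform of the conjugate of w
        at - \<xi>.\<close>
      have "(\<lambda>\<xi>. cnj (ft w \<xi>)) \<in> borel_measurable borel" unfolding cnj_ft
        using borel_measurable_ft[OF L2_D(1)[OF cL]] unfolding ft_def
        by (rule_tac measurable_compose[of uminus borel borel "\<lambda>\<xi>. LINT x|lborel. cis (- (x \<bullet> \<xi>)) * cnj (w x)", simplified]) auto
      note [measurable] = this
      show "(\<lambda>(x, \<xi>). of_real (\<gamma> \<xi>) * (cis (- (x \<bullet> \<xi>)) * w x * cnj (ft w \<xi>))) \<in> borel_measurable (lborel \<Otimes>\<^sub>M lborel)" by measurable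
    qed
  qed
  also have "\<dots> = (LINT x|lborel. of_real c * (cv g (\<lambda>x. cnj (w x)) x * w x))"
  proof (intro Bochner_Integration.integral_cong refl)
    fix x :: 'a
    have "(LINT \<xi>|lborel. of_real (\<gamma> \<xi>) * (cis (- (x \<bullet> \<xi>)) * w x * cnj (ft w \<xi>))) = (LINT \<xi>|lborel. w x * (LINT y|lborel. of_real (\<gamma> \<xi>) * (cis (\<xi> \<bullet> (y - x)) * cnj (w y))))"
    proof (intro Bochner_Integration.integral_cong refl)
      fix \<xi>
      have "(LINT y|lborel. of_real (\<gamma> \<xi>) * (cis (\<xi> \<bullet> (y - x)) * cnj (w y))) = (LINT y|lborel. (of_real (\<gamma> \<xi>) * cis (- (x \<bullet> \<xi>))) * (cis (y \<bullet> \<xi>) * cnj (w y)))"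
      proof (intro Bochner_Integration.integral_cong refl)
        fix y
        have "cis (\<xi> \<bullet> (y - x)) = cis (- (x \<bullet> \<xi>)) * cis (y \<bullet> \<xi>)" by (simp add: cis_mult inner_diff_right inner_commute)
        then show "of_real (\<gamma> \<xi>) * (cis (\<xi> \<bullet> (y - x)) * cnj (w y)) = (of_real (\<gamma> \<xi>) * cis (- (x \<bullet> \<xi>))) * (cis (y \<bullet> \<xi>) * cnj (w y))"
          by (simp only: mult.assoc)
      qed
      also have "\<dots> = (of_real (\<gamma> \<xi>) * cis (- (x \<bullet> \<xi>))) * cnj (ft w \<xi>)" unfolding cnj_ft by (rule integral_mult_right_zero)
      finally show "of_real (\<gamma> \<xi>) * (cis (- (x \<bullet> \<xi>)) * w x * cnj (ft w \<xi>)) = w x * (LINT y|lborel. of_real (\<gamma> \<xi>) * (cis (\<xi> \<bullet> (y - x)) * cnj (w y)))"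
        by (simp add: mult_ac)
    qed
    also have "\<dots> = w x * (LINT \<xi>|lborel. LINT y|lborel. of_real (\<gamma> \<xi>) * (cis (\<xi> \<bullet> (y - x)) * cnj (w y)))" by (rule integral_mult_right_zero)
    also have "(LINT \<xi>|lborel. LINT y|lborel. of_real (\<gamma> \<xi>) * (cis (\<xi> \<bullet> (y - x)) * cnj (w y))) = (LINT y|lborel. LINT \<xi>|lborel. of_real (\<gamma> \<xi>) * (cis (\<xi> \<bullet> (y - x)) * cnj (w y)))"
    proof (rule lborel_pair.Fubini_integral)
      have *: "integrable (lborel \<Otimes>\<^sub>M lborel) (\<lambda>(y, \<xi>). cmod (w y) * \<gamma> \<xi>)"
      proof (rule lborel_pair.Fubini_integrable)
        show "integrable lborel (\<lambda>y. LINT \<xi>|lborel. norm (case (y, \<xi>) of (y, \<xi>) \<Rightarrow> cmod (w y) * \<gamma> \<xi>))"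
          using w1 by (simp add: abs_mult)
        show "AE y in lborel. integrable lborel (\<lambda>\<xi>. case (y, \<xi>) of (y, \<xi>) \<Rightarrow> cmod (w y) * \<gamma> \<xi>)"
          using \<gamma>i by auto
      qed measurable
      show "integrable (lborel \<Otimes>\<^sub>M lborel) (\<lambda>(y, \<xi>). of_real (\<gamma> \<xi>) * (cis (\<xi> \<bullet> (y - x)) * cnj (w y)))"
        by (rule Bochner_Integration.integrable_bound[OF *]) (auto simp: norm_mult \<gamma>_def intro!: AE_I2)
    qed
    also have "\<dots> = (LINT y|lborel. of_real c * (of_real (g (y - x)) * cnj (w y)))"
    proof (intro Bochner_Integration.integral_cong refl)
      fix y
      have "(LINT \<xi>|lborel. of_real (\<gamma> \<xi>) * (cis (\<xi> \<bullet> (y - x)) * cnj (w y))) = (LINT \<xi>|lborel. of_real (\<gamma> \<xi>) * cis (\<xi> \<bullet> (y - x))) * cnj (w y)"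
        by (subst integral_mult_left_zero[symmetric]) (simp add: mult.assoc)
      then show "(LINT \<xi>|lborel. of_real (\<gamma> \<xi>) * (cis (\<xi> \<bullet> (y - x)) * cnj (w y))) = of_real c * (of_real (g (y - x)) * cnj (w y))"
        unfolding \<gamma>ft by simp
    qed
    also have "\<dots> = of_real c * (LINT y|lborel. of_real (g (y - x)) * cnj (w y))" by (rule integral_mult_right_zero)
    also have "(LINT y|lborel. of_real (g (y - x)) * cnj (w y)) = cv g (\<lambda>x. cnj (w x)) x"
      unfolding cv_def using integral_lborel_shift[of "\<lambda>y. of_real (g (y - x)) * cnj (w y)" x] by simp
    finally show "(LINT \<xi>|lborel. of_real (\<gamma> \<xi>) * (cis (- (x \<bullet> \<xi>)) * w x * cnj (ft w \<xi>))) = of_real c * (cv g (\<lambda>x. cnj (w x)) x * w x)"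
      by (simp add: mult_ac)
  qed
  also have "\<dots> = of_real c * (LINT x|lborel. cv g (\<lambda>x. cnj (w x)) x * w x)" by (rule integral_mult_right_zero)
  also have "(LINT x|lborel. cv g (\<lambda>x. cnj (w x)) x * w x) = (LINT h|lborel. of_real (g h) * corr (\<lambda>x. cnj (w x)) w h)"
    unfolding g_def by (rule cv_pairing[OF cL w2 kern_gaussian[OF t]])
  finally show ?thesis unfolding g_def c_def .
qed

context
  fixes u v :: "real^'n \<Rightarrow> complex"
  assumes u: "u \<in> L2" and v: "has_fourier u v"
begin

text \<open>Truncations to balls of integer radius: their Fourier integrals are those in
  \<open>has_fourier\<close>, and they are integrable as well as square integrable.\<close>

private definition uc :: "nat \<Rightarrow> real^'n \<Rightarrow> complex" where "uc k x = indicator (cball 0 (real k)) x * u x"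

private lemma uc_meas[measurable]: "uc k \<in> borel_measurable borel"
proof -
  note [measurable] = L2_D(1)[OF u]
  have [measurable]: "cball (0::real^'n) (real k) \<in> sets borel" by simp
  show ?thesis unfolding uc_def by measurable
qed

private lemma uc_le: "cmod (uc k x) \<le> cmod (u x)" by (simp add: uc_def split: split_indicator)

private lemma uc_L2: "uc k \<in> L2"
proof -
  have "integrable lborel (\<lambda>x. (cmod (uc k x))\<^sup>2)"
    by (rule Bochner_Integration.integrable_bound[OF L2_D(2)[OF u]]) (auto intro!: AE_I2 power_mono uc_le)
  then show ?thesis unfolding L2_def using uc_meas by blast
qed

private lemma uc_L1: "integrable lborel (uc k)"
proof -
  have cb: "cball (0::real^'n) (real k) \<in> sets borel" by simp
  have "(\<lambda>x. indicator (cball (0::real^'n) (real k)) x :: complex) \<in> L2" by (rule L2_indicator[OF cb]) (simp add: emeasure_cball)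
  from L2_mult[OF this u] show ?thesis by (simp add: uc_def[abs_def])
qed

private lemma uc_lim: "(\<lambda>k. uc k x) \<longlonglongrightarrow> u x"
proof -
  obtain N :: nat where "norm x \<le> real N" using real_arch_simple by blast
  then have "eventually (\<lambda>k. uc k x = u x) sequentially"
    unfolding eventually_sequentially by (intro exI[of _ N]) (auto simp: uc_def split: split_indicator)
  then show ?thesis by (rule tendsto_eventually)
qed

private lemma v_L2: "v \<in> L2" using v by (simp add: has_fourier_def)

private lemma ft_uc_tendsto: "(\<lambda>k. \<integral>\<^sup>+\<xi>. ennreal ((cmod (ft (uc k) \<xi> - v \<xi>))\<^sup>2) \<partial>lborel) \<longlonglongrightarrow> 0"
proof -
  have "ft (uc k) \<xi> = (LINT x:cball 0 (real k)|lborel. cis (- (x \<bullet> \<xi>)) * u x)" for k \<xi>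
    unfolding ft_def uc_def set_lebesgue_integral_def
    by (intro Bochner_Integration.integral_cong refl) (auto split: split_indicator)
  moreover have "((\<lambda>R. \<integral>\<^sup>+\<xi>. ennreal ((cmod ((LINT x:cball 0 R|lborel. cis (- (x \<bullet> \<xi>)) * u x) - v \<xi>))\<^sup>2) \<partial>lborel) \<longlongrightarrow> 0) at_top"
    using v by (simp add: has_fourier_def L2_tendsto_def)
  ultimately show ?thesis using filterlim_compose[OF _ filterlim_real_sequentially] by fastforce
qed

text \<open>The bound |a - b|^2 + 2 |b| |a - b| for the difference of |a|^2 and |b|^2, with
  Cauchy-Schwarz, turns convergence in L2 into convergence of the weighted energies.\<close>

private lemma energy_limit:
  fixes \<gamma> :: "real^'n \<Rightarrow> real"
  assumes [measurable]: "\<gamma> \<in> borel_measurable borel" and \<gamma>: "\<And>\<xi>. 0 \<le> \<gamma> \<xi>" "\<And>\<xi>. \<gamma> \<xi> \<le> 1"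
  shows "(\<lambda>k. LINT \<xi>|lborel. \<gamma> \<xi> * (cmod (ft (uc k) \<xi>))\<^sup>2) \<longlonglongrightarrow> (LINT \<xi>|lborel. \<gamma> \<xi> * (cmod (v \<xi>))\<^sup>2)"
proof -
  note [measurable] = L2_D(1)[OF v_L2] borel_measurable_ft[OF uc_meas]
  define D where "D = (\<lambda>k. sqnorm (\<lambda>\<xi>. ft (uc k) \<xi> - v \<xi>))"
  \<comment> \<open>The convergence concerns extended integrals, so membership of the differences in
    L2 is obtained only from some index on.\<close>
  have ev: "eventually (\<lambda>k. (\<integral>\<^sup>+\<xi>. ennreal ((cmod (ft (uc k) \<xi> - v \<xi>))\<^sup>2) \<partial>lborel) < 1) sequentially"
    using ft_uc_tendsto by (rule order_tendstoD) simp
  have evL: "eventually (\<lambda>k. (\<lambda>\<xi>. ft (uc k) \<xi> - v \<xi>) \<in> L2) sequentially"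
    using ev by eventually_elim (auto intro!: L2_I intro: order.strict_trans)
  have D_nonneg: "0 \<le> D k" for k by (simp add: D_def sqnorm_nonneg)
  have D0: "D \<longlonglongrightarrow> 0"
  proof -
    have "eventually (\<lambda>k. (\<integral>\<^sup>+\<xi>. ennreal ((cmod (ft (uc k) \<xi> - v \<xi>))\<^sup>2) \<partial>lborel) = ennreal (D k)) sequentially"
      using evL by eventually_elim (use nn_integral_sqnorm in \<open>auto simp: D_def\<close>)
    from Lim_transform_eventually[OF ft_uc_tendsto this] have "(\<lambda>k. ennreal (D k)) \<longlonglongrightarrow> ennreal 0" by simp
    then show ?thesis by (simp only: ennreal_0 ennreal_tendsto_0_iff[of D, OF D_nonneg])
  qed
  have bd: "eventually (\<lambda>k. norm ((LINT \<xi>|lborel. \<gamma> \<xi> * (cmod (ft (uc k) \<xi>))\<^sup>2) - (LINT \<xi>|lborel. \<gamma> \<xi> * (cmod (v \<xi>))\<^sup>2)) \<le> D k + 2 * (sqrt (sqnorm v) * sqrt (D k))) sequentially"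
    using evL
  proof eventually_elim
    fix k assume L: "(\<lambda>\<xi>. ft (uc k) \<xi> - v \<xi>) \<in> L2"
    define d where "d = (\<lambda>\<xi>. ft (uc k) \<xi> - v \<xi>)"
    have dL: "d \<in> L2" using L by (simp add: d_def)
    have fL: "ft (uc k) \<in> L2" using L2_add[OF dL v_L2] by (simp add: d_def)
    have gi: "integrable lborel (\<lambda>\<xi>. \<gamma> \<xi> * (cmod (f \<xi>))\<^sup>2)" if f: "f \<in> L2" for f :: "real^'n \<Rightarrow> complex"
    proof -
      note [measurable] = L2_D(1)[OF f]
      show ?thesis
        by (rule Bochner_Integration.integrable_bound[OF L2_D(2)[OF f]]) (auto simp: abs_mult \<gamma> intro!: AE_I2 mult_left_le_one_le)
    qed
    have dv: "integrable lborel (\<lambda>\<xi>. cmod (v \<xi> * d \<xi>))" using L2_mult[OF v_L2 dL] by (rule integrable_norm)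
    have le: "\<bar>\<gamma> \<xi> * (cmod (ft (uc k) \<xi>))\<^sup>2 - \<gamma> \<xi> * (cmod (v \<xi>))\<^sup>2\<bar> \<le> (cmod (d \<xi>))\<^sup>2 + 2 * cmod (v \<xi> * d \<xi>)" for \<xi>
    proof -
      have "\<bar>(cmod (ft (uc k) \<xi>))\<^sup>2 - (cmod (v \<xi>))\<^sup>2\<bar> = \<bar>cmod (ft (uc k) \<xi>) - cmod (v \<xi>)\<bar> * (cmod (ft (uc k) \<xi>) + cmod (v \<xi>))"
        by (simp add: power2_eq_square square_diff_square_factored abs_mult)
      also have "\<dots> \<le> cmod (d \<xi>) * (cmod (d \<xi>) + 2 * cmod (v \<xi>))"
      proof (intro mult_mono)
        show "\<bar>cmod (ft (uc k) \<xi>) - cmod (v \<xi>)\<bar> \<le> cmod (d \<xi>)" unfolding d_def by (rule norm_triangle_ineq3)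
        have "cmod (ft (uc k) \<xi>) \<le> cmod (d \<xi>) + cmod (v \<xi>)" unfolding d_def using norm_triangle_ineq[of "ft (uc k) \<xi> - v \<xi>" "v \<xi>"] by simp
        then show "cmod (ft (uc k) \<xi>) + cmod (v \<xi>) \<le> cmod (d \<xi>) + 2 * cmod (v \<xi>)" by simp
      qed auto
      also have "\<dots> = (cmod (d \<xi>))\<^sup>2 + 2 * cmod (v \<xi> * d \<xi>)" by (simp add: norm_mult power2_eq_square algebra_simps)
      finally have 1: "\<bar>(cmod (ft (uc k) \<xi>))\<^sup>2 - (cmod (v \<xi>))\<^sup>2\<bar> \<le> (cmod (d \<xi>))\<^sup>2 + 2 * cmod (v \<xi> * d \<xi>)" .
      have "\<bar>\<gamma> \<xi> * (cmod (ft (uc k) \<xi>))\<^sup>2 - \<gamma> \<xi> * (cmod (v \<xi>))\<^sup>2\<bar> = \<gamma> \<xi> * \<bar>(cmod (ft (uc k) \<xi>))\<^sup>2 - (cmod (v \<xi>))\<^sup>2\<bar>"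
        unfolding right_diff_distrib[symmetric] abs_mult using \<gamma>(1)[of \<xi>] by simp
      also have "\<dots> \<le> 1 * \<bar>(cmod (ft (uc k) \<xi>))\<^sup>2 - (cmod (v \<xi>))\<^sup>2\<bar>" by (intro mult_right_mono \<gamma>) auto
      finally show ?thesis unfolding mult_1_left by (rule order.trans[OF _ 1])
    qed
    have "norm ((LINT \<xi>|lborel. \<gamma> \<xi> * (cmod (ft (uc k) \<xi>))\<^sup>2) - (LINT \<xi>|lborel. \<gamma> \<xi> * (cmod (v \<xi>))\<^sup>2)) = \<bar>LINT \<xi>|lborel. \<gamma> \<xi> * (cmod (ft (uc k) \<xi>))\<^sup>2 - \<gamma> \<xi> * (cmod (v \<xi>))\<^sup>2\<bar>"
      using gi[OF fL] gi[OF v_L2] by simp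
    also have "\<dots> \<le> (LINT \<xi>|lborel. \<bar>\<gamma> \<xi> * (cmod (ft (uc k) \<xi>))\<^sup>2 - \<gamma> \<xi> * (cmod (v \<xi>))\<^sup>2\<bar>)" by (rule integral_abs_bound)
    also have "\<dots> \<le> (LINT \<xi>|lborel. (cmod (d \<xi>))\<^sup>2 + 2 * cmod (v \<xi> * d \<xi>))"
      by (intro integral_mono le integrable_abs Bochner_Integration.integrable_diff Bochner_Integration.integrable_add gi fL v_L2 L2_D(2)[OF dL] integrable_mult_right dv)
    also have "\<dots> = sqnorm d + 2 * (LINT \<xi>|lborel. cmod (v \<xi> * d \<xi>))"
      using L2_D(2)[OF dL] dv by (simp add: sqnorm_def)
    also have "\<dots> \<le> sqnorm d + 2 * (sqrt (sqnorm v) * sqrt (sqnorm d))" using L2_Cauchy_Schwarz[OF v_L2 dL] by simp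
    finally show "norm ((LINT \<xi>|lborel. \<gamma> \<xi> * (cmod (ft (uc k) \<xi>))\<^sup>2) - (LINT \<xi>|lborel. \<gamma> \<xi> * (cmod (v \<xi>))\<^sup>2)) \<le> D k + 2 * (sqrt (sqnorm v) * sqrt (D k))"
      by (simp add: D_def d_def)
  qed
  have "(\<lambda>k. D k + 2 * (sqrt (sqnorm v) * sqrt (D k))) \<longlonglongrightarrow> 0 + 2 * (sqrt (sqnorm v) * sqrt 0)" by (intro tendsto_intros D0)
  then have "(\<lambda>k. (LINT \<xi>|lborel. \<gamma> \<xi> * (cmod (ft (uc k) \<xi>))\<^sup>2) - (LINT \<xi>|lborel. \<gamma> \<xi> * (cmod (v \<xi>))\<^sup>2)) \<longlonglongrightarrow> 0"
    using Lim_null_comparison[OF bd] by simp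
  then show ?thesis by (rule LIM_zero_cancel)
qed

text \<open>The identity for the truncations passes to the limit. The correlation at 0 is the
  squared norm, and the rest is rewritten in increments; the constant comes from (4 \<pi> t) (\<pi>
  / t) = (2 \<pi>)^2.\<close>

lemma fourier_gaussian_energy:
  assumes t: "t > 0"
  shows "(LINT \<xi>|lborel. exp (- ((norm \<xi>)\<^sup>2 / (4 * t))) * (cmod (v \<xi>))\<^sup>2)
    = (2 * pi) ^ CARD('n) * sqnorm u - (4 * pi * t) powr (CARD('n) / 2) / 2 * (LINT h|lborel. exp (- (t * (norm h)\<^sup>2)) * dsq u h)"
proof -
  define c where "c = (4 * pi * t) powr (CARD('n) / 2)"
  define g where "g = (\<lambda>h::real^'n. exp (- (t * (norm h)\<^sup>2)))"
  have gi: "integrable lborel g" unfolding g_def by (rule integrable_gaussian[OF t])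
  have uc': "(\<lambda>x. cnj (u x)) \<in> L2" by (rule L2_cnj[OF u])
  note [measurable] = L2_D(1)[OF u] L2_D(1)[OF uc']
  have [measurable]: "g \<in> borel_measurable borel" unfolding g_def by measurable
  have "(\<lambda>k. LINT h|lborel. of_real (g h) * corr (\<lambda>x. cnj (uc k x)) (uc k) h) \<longlonglongrightarrow> (LINT h|lborel. of_real (g h) * corr (\<lambda>x. cnj (u x)) u h)"
  proof (rule integral_dominated_convergence[where w="\<lambda>h. g h * sqnorm u"])
    have [measurable]: "corr (\<lambda>x. cnj (u x)) u \<in> borel_measurable borel" "corr (\<lambda>x. cnj (uc k x)) (uc k) \<in> borel_measurable borel" for k
      by (rule borel_measurable_corr[OF uc' u] borel_measurable_corr[OF L2_cnj[OF uc_L2] uc_L2])+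
    show "(\<lambda>h. of_real (g h) * corr (\<lambda>x. cnj (u x)) u h) \<in> borel_measurable lborel" by measurable
    show "(\<lambda>h. of_real (g h) * corr (\<lambda>x. cnj (uc k x)) (uc k) h) \<in> borel_measurable lborel" for k by measurable
    show "integrable lborel (\<lambda>h. g h * sqnorm u)" using gi by auto
    show "AE h in lborel. (\<lambda>k. of_real (g h) * corr (\<lambda>x. cnj (uc k x)) (uc k) h) \<longlonglongrightarrow> of_real (g h) * corr (\<lambda>x. cnj (u x)) u h"
    proof (intro AE_I2 tendsto_mult_left)
      fix h
      show "(\<lambda>k. corr (\<lambda>x. cnj (uc k x)) (uc k) h) \<longlonglongrightarrow> corr (\<lambda>x. cnj (u x)) u h"
        unfolding corr_def
      proof (rule integral_dominated_convergence[where w="\<lambda>x. cmod (cnj (u (x + h)) * u x)"])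
        show "integrable lborel (\<lambda>x. cmod (cnj (u (x + h)) * u x))" using corr_integrable[OF uc' u] by (rule integrable_norm)
        show "AE x in lborel. (\<lambda>k. cnj (uc k (x + h)) * uc k x) \<longlonglongrightarrow> cnj (u (x + h)) * u x"
          by (intro AE_I2 tendsto_intros uc_lim)
        show "AE x in lborel. cmod (cnj (uc k (x + h)) * uc k x) \<le> cmod (cnj (u (x + h)) * u x)" for k
          by (intro AE_I2) (auto simp: norm_mult intro!: mult_mono uc_le)
        note [measurable] = L2_D(1)[OF L2_cnj[OF uc_L2]]
        show "(\<lambda>x. cnj (uc k (x + h)) * uc k x) \<in> borel_measurable lborel" for k by measurable
      qed measurable
    qed
    have "cmod (corr (\<lambda>x. cnj (uc k x)) (uc k) h) \<le> sqnorm u" for k h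
    proof -
      have "sqnorm (uc k) \<le> sqnorm u" unfolding sqnorm_def
        by (intro integral_mono L2_D u uc_L2 power_mono uc_le) auto
      moreover have "cmod (corr (\<lambda>x. cnj (uc k x)) (uc k) h) \<le> sqrt (sqnorm (\<lambda>x. cnj (uc k x))) * sqrt (sqnorm (uc k))"
        by (rule corr_bound[OF L2_cnj[OF uc_L2] uc_L2])
      moreover have "sqnorm (\<lambda>x. cnj (uc k x)) = sqnorm (uc k)" by (simp add: sqnorm_def)
      ultimately show ?thesis by (simp add: sqnorm_nonneg)
    qed
    then show "AE h in lborel. norm (of_real (g h) * corr (\<lambda>x. cnj (uc k x)) (uc k) h) \<le> g h * sqnorm u" for k
      by (intro AE_I2) (auto simp: norm_mult g_def)
  qed
  then have "(\<lambda>k. of_real c * (LINT h|lborel. of_real (g h) * corr (\<lambda>x. cnj (uc k x)) (uc k) h)) \<longlonglongrightarrow> of_real c * (LINT h|lborel. of_real (g h) * corr (\<lambda>x. cnj (u x)) u h)"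
    by (intro tendsto_intros)
  moreover have "of_real c * (LINT h|lborel. of_real (g h) * corr (\<lambda>x. cnj (uc k x)) (uc k) h) = complex_of_real (LINT \<xi>|lborel. exp (- ((norm \<xi>)\<^sup>2 / (4 * t))) * (cmod (ft (uc k) \<xi>))\<^sup>2)" for k
    using ft_gaussian_energy[OF uc_L1 uc_L2 t, of k] unfolding g_def c_def integral_complex_of_real by simp
  moreover have "(\<lambda>k. complex_of_real (LINT \<xi>|lborel. exp (- ((norm \<xi>)\<^sup>2 / (4 * t))) * (cmod (ft (uc k) \<xi>))\<^sup>2)) \<longlonglongrightarrow> of_real (LINT \<xi>|lborel. exp (- ((norm \<xi>)\<^sup>2 / (4 * t))) * (cmod (v \<xi>))\<^sup>2)"
    using t by (intro tendsto_of_real energy_limit) auto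
  ultimately have "complex_of_real (LINT \<xi>|lborel. exp (- ((norm \<xi>)\<^sup>2 / (4 * t))) * (cmod (v \<xi>))\<^sup>2) = of_real c * (LINT h|lborel. of_real (g h) * corr (\<lambda>x. cnj (u x)) u h)"
    by (simp add: LIMSEQ_unique)
  also have "(LINT h|lborel. of_real (g h) * corr (\<lambda>x. cnj (u x)) u h) = of_real ((LINT h|lborel. g h) * sqnorm u - (LINT h|lborel. g h * dsq u h) / 2)"
  proof -
    have c0: "corr (\<lambda>x. cnj (u x)) u 0 = of_real (sqnorm u)"
      unfolding corr_def sqnorm_def by (subst integral_complex_of_real[symmetric]) (simp add: complex_norm_square[symmetric] mult.commute[of "cnj _"] del: of_real_power)
    have d: "dcorr (\<lambda>x. cnj (u x)) u l = of_real (dsq u l)" for l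
    proof -
      have "(cnj (u (x + l)) - cnj (u x)) * (u (x + l) - u x) = complex_of_real ((cmod (u (x + l) - u x))\<^sup>2)" for x
        unfolding complex_norm_square by (simp add: mult.commute)
      then show ?thesis unfolding dcorr_def dsq_def sqnorm_def by (simp only: integral_complex_of_real)
    qed
    have "(LINT h|lborel. of_real (g h) * (corr (\<lambda>x. cnj (u x)) u 0 - corr (\<lambda>x. cnj (u x)) u h)) = (LINT h|lborel. of_real (g h) * dcorr (\<lambda>x. cnj (u x)) u h) / 2"
      by (rule even_kernel_dcorr(1)[OF uc' u gi]) (simp add: g_def)
    also have "(LINT h|lborel. of_real (g h) * dcorr (\<lambda>x. cnj (u x)) u h) = of_real (LINT h|lborel. g h * dsq u h)"
      unfolding d of_real_mult[symmetric] by (rule integral_complex_of_real)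
    finally have e: "(LINT h|lborel. of_real (g h) * (corr (\<lambda>x. cnj (u x)) u 0 - corr (\<lambda>x. cnj (u x)) u h)) = of_real (LINT h|lborel. g h * dsq u h) / 2" .
    have i1: "integrable lborel (\<lambda>h. of_real (g h) * corr (\<lambda>x. cnj (u x)) u 0)" using gi by auto
    have d1: "(LINT h|lborel. of_real (g h) * corr (\<lambda>x. cnj (u x)) u 0) = of_real (LINT h|lborel. g h) * of_real (sqnorm u)" unfolding c0 by simp
    have d2: "(LINT h|lborel. of_real (g h) * (corr (\<lambda>x. cnj (u x)) u 0 - corr (\<lambda>x. cnj (u x)) u h))
      = (LINT h|lborel. of_real (g h) * corr (\<lambda>x. cnj (u x)) u 0) - (LINT h|lborel. of_real (g h) * corr (\<lambda>x. cnj (u x)) u h)"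
      unfolding right_diff_distrib by (rule Bochner_Integration.integral_diff[OF i1 integrable_corr[OF uc' u gi]])
    have aux: "a - b = c \<Longrightarrow> b = a - c" for a b c :: complex by auto
    have "(LINT h|lborel. of_real (g h) * corr (\<lambda>x. cnj (u x)) u h) = of_real (LINT h|lborel. g h) * of_real (sqnorm u) - of_real (LINT h|lborel. g h * dsq u h) / 2"
      using aux[OF e[unfolded d2 d1]] .
    then show ?thesis by (simp only: of_real_diff of_real_mult of_real_divide of_real_numeral)
  qed
  finally have "(LINT \<xi>|lborel. exp (- ((norm \<xi>)\<^sup>2 / (4 * t))) * (cmod (v \<xi>))\<^sup>2) = c * ((LINT h|lborel. g h) * sqnorm u - (LINT h|lborel. g h * dsq u h) / 2)"
    unfolding of_real_mult[symmetric] of_real_eq_iff .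
  moreover have "c * (LINT h|lborel. g h) = (2 * pi) ^ CARD('n)"
  proof -
    have "c * (LINT h|lborel. g h) = (4 * pi * t) powr (CARD('n) / 2) * (pi / t) powr (CARD('n) / 2)"
      unfolding c_def g_def by (simp add: integral_gaussian[OF t])
    also have "\<dots> = (4 * pi * t * (pi / t)) powr (CARD('n) / 2)" by (rule powr_mult[symmetric])
    also have "4 * pi * t * (pi / t) = (norm (2 * pi))\<^sup>2" using t by (simp add: power2_eq_square)
    also have "((norm (2 * pi))\<^sup>2) powr (CARD('n) / 2) = (2 * pi) ^ CARD('n)" unfolding powr_norm_square by (simp add: powr_realpow)
    finally show ?thesis .
  qed
  moreover have "c * ((LINT h|lborel. g h) * sqnorm u - (LINT h|lborel. g h * dsq u h) / 2) = (c * (LINT h|lborel. g h)) * sqnorm u - c / 2 * (LINT h|lborel. g h * dsq u h)"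
    by (simp add: right_diff_distrib)
  moreover have "(LINT h|lborel. g h * dsq u h) = (LINT h|lborel. exp (- (t * (norm h)\<^sup>2)) * dsq u h)" by (simp add: g_def)
  ultimately show ?thesis unfolding c_def[symmetric] by (simp only:)
qed

text \<open>As t tends to \<infinity>, the Gaussian weight on the Fourier side tends to 1. On the
  other side h = w / sqrt t absorbs the normalisation, and the increment term vanishes because
  translations are continuous in L2.\<close>

lemma fourier_Plancherel: "sqnorm v = (2 * pi) ^ CARD('n) * sqnorm u"
proof -
  define T where "T = (\<lambda>k. real (Suc k))"
  have T: "T k > 0" for k by (simp add: T_def)
  note [measurable] = L2_D(1)[OF v_L2] borel_measurable_dsq[OF u]
  have 1: "(\<lambda>k. LINT \<xi>|lborel. exp (- ((norm \<xi>)\<^sup>2 / (4 * T k))) * (cmod (v \<xi>))\<^sup>2) \<longlonglongrightarrow> sqnorm v"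
    unfolding sqnorm_def
  proof (rule integral_dominated_convergence[where w="\<lambda>\<xi>. (cmod (v \<xi>))\<^sup>2"])
    show "AE \<xi> in lborel. (\<lambda>k. exp (- ((norm \<xi>)\<^sup>2 / (4 * T k))) * (cmod (v \<xi>))\<^sup>2) \<longlonglongrightarrow> (cmod (v \<xi>))\<^sup>2"
    proof (rule AE_I2)
      fix \<xi> :: "real^'n"
      have "(\<lambda>k. exp (- (a / (4 * T k)))) \<longlonglongrightarrow> 1" for a :: real unfolding T_def by real_asymp
      from tendsto_mult[OF this tendsto_const, of "(norm \<xi>)\<^sup>2" "(cmod (v \<xi>))\<^sup>2"]
      show "(\<lambda>k. exp (- ((norm \<xi>)\<^sup>2 / (4 * T k))) * (cmod (v \<xi>))\<^sup>2) \<longlonglongrightarrow> (cmod (v \<xi>))\<^sup>2" by simp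
    qed
    show "AE \<xi> in lborel. norm (exp (- ((norm \<xi>)\<^sup>2 / (4 * T k))) * (cmod (v \<xi>))\<^sup>2) \<le> (cmod (v \<xi>))\<^sup>2" for k
      using T[of k] by (intro AE_I2) (auto simp: abs_mult intro!: mult_left_le_one_le)
  qed (use L2_D(2)[OF v_L2] in auto)
  have 2: "(\<lambda>k. (4 * pi * T k) powr (CARD('n) / 2) / 2 * (LINT h|lborel. exp (- (T k * (norm h)\<^sup>2)) * dsq u h)) \<longlonglongrightarrow> 0"
  proof -
    have eq: "(4 * pi * T k) powr (CARD('n) / 2) / 2 * (LINT h|lborel. exp (- (T k * (norm h)\<^sup>2)) * dsq u h)
      = (4 * pi) powr (CARD('n) / 2) / 2 * (LINT w|lborel. exp (- (1 * (norm w)\<^sup>2)) * dsq u ((1 / sqrt (T k)) *\<^sub>R w))" for k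
    proof -
      define F where "F = (\<lambda>h. exp (- (T k * (norm h)\<^sup>2)) * dsq u h)"
      have [measurable]: "F \<in> borel_measurable borel" unfolding F_def by measurable
      have Fi: "integrable lborel F"
      proof (rule Bochner_Integration.integrable_bound)
        show "integrable lborel (\<lambda>h::real^'n. exp (- (T k * (norm h)\<^sup>2)) * (4 * sqnorm u))" using integrable_gaussian[OF T] by auto
        show "AE h in lborel. norm (F h) \<le> norm (exp (- (T k * (norm h)\<^sup>2)) * (4 * sqnorm u))"
          by (intro AE_I2) (auto simp: F_def abs_mult dsq_nonneg sqnorm_nonneg intro!: mult_left_mono dsq_le[OF u])
      qed simp
      have "(LINT w|lborel. F ((1 / sqrt (T k)) *\<^sub>R w)) = (1 / \<bar>1 / sqrt (T k)\<bar> ^ DIM(real^'n)) *\<^sub>R (LINT h|lborel. F h)"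
        by (rule integral_lborel_scale[OF Fi]) (use T[of k] in auto)
      also have "1 / \<bar>1 / sqrt (T k)\<bar> ^ DIM(real^'n) = T k powr (CARD('n) / 2)"
      proof -
        have "1 / \<bar>1 / sqrt (T k)\<bar> ^ DIM(real^'n) = sqrt (T k) ^ CARD('n)" using T[of k] by (simp add: power_one_over)
        also have "\<dots> = (T k powr (1 / 2)) powr (CARD('n))" using T[of k] by (simp add: powr_half_sqrt powr_realpow)
        finally show ?thesis by (simp add: powr_powr)
      qed
      finally have sc: "(LINT w|lborel. F ((1 / sqrt (T k)) *\<^sub>R w)) = T k powr (CARD('n) / 2) * (LINT h|lborel. F h)" by simp
      have Fw: "F ((1 / sqrt (T k)) *\<^sub>R w) = exp (- (1 * (norm w)\<^sup>2)) * dsq u ((1 / sqrt (T k)) *\<^sub>R w)" for w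
        using T[of k] by (simp add: F_def power_divide)
      show ?thesis using sc unfolding Fw F_def[symmetric] by (simp add: powr_mult)
    qed
    have "(\<lambda>k. LINT w|lborel. exp (- (1 * (norm w)\<^sup>2)) * dsq u ((1 / sqrt (T k)) *\<^sub>R w)) \<longlonglongrightarrow> (LINT w|lborel. exp (- (1 * (norm (w::real^'n))\<^sup>2)) * 0)"
    proof (rule integral_dominated_convergence[where w="\<lambda>w. exp (- (1 * (norm w)\<^sup>2)) * (4 * sqnorm u)"])
      show "integrable lborel (\<lambda>w::real^'n. exp (- (1 * (norm w)\<^sup>2)) * (4 * sqnorm u))"
        by (rule integrable_mult_left) (rule integrable_gaussian, simp)
      show "AE w in lborel. (\<lambda>k. exp (- (1 * (norm w)\<^sup>2)) * dsq u ((1 / sqrt (T k)) *\<^sub>R w)) \<longlonglongrightarrow> exp (- (1 * (norm w)\<^sup>2)) * 0"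
      proof (intro AE_I2 tendsto_mult_left L2_translation_continuous[OF u])
        fix w :: "real^'n"
        have "(\<lambda>k. 1 / sqrt (T k)) \<longlonglongrightarrow> 0" unfolding T_def by real_asymp
        from tendsto_scaleR[OF this tendsto_const, of w] show "(\<lambda>k. (1 / sqrt (T k)) *\<^sub>R w) \<longlonglongrightarrow> 0" by simp
      qed
      show "AE w in lborel. norm (exp (- (1 * (norm w)\<^sup>2)) * dsq u ((1 / sqrt (T k)) *\<^sub>R w)) \<le> exp (- (1 * (norm w)\<^sup>2)) * (4 * sqnorm u)" for k
        by (intro AE_I2) (auto simp: abs_mult dsq_nonneg intro!: mult_left_mono dsq_le[OF u])
    qed measurable
    from tendsto_mult_left[OF this, of "(4 * pi) powr (CARD('n) / 2) / 2"] show ?thesis unfolding eq by simp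
  qed
  have "(\<lambda>k. LINT \<xi>|lborel. exp (- ((norm \<xi>)\<^sup>2 / (4 * T k))) * (cmod (v \<xi>))\<^sup>2) \<longlonglongrightarrow> (2 * pi) ^ CARD('n) * sqnorm u - 0"
    unfolding fourier_gaussian_energy[OF T] by (intro tendsto_diff tendsto_const 2)
  from LIMSEQ_unique[OF 1 this] show ?thesis by simp
qed

text \<open>Difference of Plancherel's identity and its Gaussian-weighted form; the squared norm of
  u cancels.\<close>

lemma gaussian_increment_energy:
  assumes t: "t > 0"
  shows "(4 * pi * t) powr (CARD('n) / 2) / 2 * (LINT h|lborel. exp (- (t * (norm h)\<^sup>2)) * dsq u h)
    = (LINT \<xi>|lborel. (1 - exp (- ((norm \<xi>)\<^sup>2 / (4 * t)))) * (cmod (v \<xi>))\<^sup>2)"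
proof -
  note [measurable] = L2_D(1)[OF v_L2]
  have i: "integrable lborel (\<lambda>\<xi>. exp (- ((norm \<xi>)\<^sup>2 / (4 * t))) * (cmod (v \<xi>))\<^sup>2)"
    by (rule Bochner_Integration.integrable_bound[OF L2_D(2)[OF v_L2]])
       (use t in \<open>auto simp: abs_mult intro!: AE_I2 mult_left_le_one_le\<close>)
  show ?thesis
    unfolding left_diff_distrib using i L2_D(2)[OF v_L2] fourier_gaussian_energy[OF t] fourier_Plancherel
    by (simp add: sqnorm_def)
qed

end

text \<open>Split at t = a, with 1 - exp(- x) \<le> 1 below and 1 - exp(- x) \<le> x above. The two
  summands of the constant are the integrals of t^(s-1) over (0, a] and of a t^(s-2) over [a,
  \<infinity>), each divided by a^s.\<close>

lemma nn_integral_powr_one_minus_exp: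
  fixes a s :: real
  assumes s: "0 < s" "s < 1" and a: "a \<ge> 0"
  shows "(\<integral>\<^sup>+t. ennreal (t powr (s - 1) * (1 - exp (- (a / t)))) * indicator {0<..} t \<partial>lborel) \<le> ennreal ((1 / s + 1 / (1 - s)) * a powr s)"
proof (cases "a = 0")
  case False
  then have a: "a > 0" using a by simp
  have "(\<integral>\<^sup>+t. ennreal (t powr (s - 1) * (1 - exp (- (a / t)))) * indicator {0<..} t \<partial>lborel)
    \<le> (\<integral>\<^sup>+t. ennreal (t powr (s - 1)) * indicator {0<..a} t + ennreal a * (ennreal (t powr (- (1 - s) - 1)) * indicator {a..} t) \<partial>lborel)"
  proof (intro nn_integral_mono)
    fix t :: real
    show "ennreal (t powr (s - 1) * (1 - exp (- (a / t)))) * indicator {0<..} t \<le> ennreal (t powr (s - 1)) * indicator {0<..a} t + ennreal a * (ennreal (t powr (- (1 - s) - 1)) * indicator {a..} t)"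
    proof (cases "t > 0")
      case t: True
      show ?thesis
      proof (cases "t \<le> a")
        case True
        have "t powr (s - 1) * (1 - exp (- (a / t))) \<le> t powr (s - 1) * 1" by (intro mult_left_mono) auto
        then have "ennreal (t powr (s - 1) * (1 - exp (- (a / t)))) \<le> ennreal (t powr (s - 1))" by (simp add: ennreal_leI)
        then have "ennreal (t powr (s - 1) * (1 - exp (- (a / t)))) + 0 \<le> ennreal (t powr (s - 1)) + ennreal a * (ennreal (t powr (- (1 - s) - 1)) * indicator {a..} t)"
          by (rule add_mono) (rule zero_le)
        then show ?thesis using t True by simp
      next
        case False
        have "1 - exp (- (a / t)) \<le> a / t" using exp_ge_add_one_self[of "- (a / t)"] by simp
        then have "t powr (s - 1) * (1 - exp (- (a / t))) \<le> t powr (s - 1) * (a / t)" by (intro mult_left_mono) auto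
        also have "\<dots> = a * t powr (- (1 - s) - 1)"
        proof -
          have e: "(s - 1) + - 1 = - (1 - s) - 1" by simp
          have "t powr (s - 1) * t powr (- 1) = t powr (- (1 - s) - 1)" by (simp only: powr_add[symmetric] e)
          moreover have "t powr (- 1) = 1 / t" using t by (simp add: powr_minus_divide)
          moreover have "t powr (s - 1) * (a / t) = a * (t powr (s - 1) * (1 / t))" by simp
          ultimately show ?thesis by (simp only:)
        qed
        finally have "ennreal (t powr (s - 1) * (1 - exp (- (a / t)))) \<le> ennreal a * ennreal (t powr (- (1 - s) - 1))"
          using a by (simp add: ennreal_mult[symmetric] ennreal_leI)
        then show ?thesis using t False by simp
      qed
    qed simp
  qed
  also have "\<dots> = (\<integral>\<^sup>+t. ennreal (t powr (s - 1)) * indicator {0<..a} t \<partial>lborel) + ennreal a * (\<integral>\<^sup>+t. ennreal (t powr (- (1 - s) - 1)) * indicator {a..} t \<partial>lborel)"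
    by (subst nn_integral_add) (auto simp: nn_integral_cmult)
  also have "\<dots> = ennreal (a powr s / s) + ennreal a * ennreal (a powr (- (1 - s)) / (1 - s))"
    using s a nn_integral_powr_from_0[of s a] nn_integral_powr_tail[of "1 - s" a] by simp
  also have "\<dots> = ennreal ((1 / s + 1 / (1 - s)) * a powr s)"
  proof -
    have "a * a powr (- (1 - s)) = a powr s" using a powr_mult_base[of a "- (1 - s)"] by simp
    then have e: "(1 / s + 1 / (1 - s)) * a powr s = a powr s / s + a * (a powr (- (1 - s)) / (1 - s))"
      by (simp add: distrib_right)
    show ?thesis unfolding e using a s by (simp add: ennreal_mult[symmetric] ennreal_plus[symmetric] del: ennreal_plus)
  qed
  finally show ?thesis .
qed simp

theorem sobolev_gagliardo:
  fixes u :: "real^'n \<Rightarrow> complex"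
  assumes s: "0 < s" "s < 1" and u: "u \<in> sobolev s"
  shows "integrable lborel (\<lambda>h. norm h powr (- (real CARD('n) + 2 * s)) * dsq u h)"
proof -
  obtain v where v: "has_fourier u v" and vi: "integrable lborel (\<lambda>\<xi>. (1 + (norm \<xi>)\<^sup>2) powr s * (cmod (v \<xi>))\<^sup>2)" and uL: "u \<in> L2"
    using u by (auto simp: sobolev_def)
  have vL: "v \<in> L2" using v by (simp add: has_fourier_def)
  note [measurable] = L2_D(1)[OF uL] L2_D(1)[OF vL] borel_measurable_dsq[OF uL]
  define n where "n = real CARD('n)"
  \<comment> \<open>Gamma exponent with (|h|^2)^(-b) = |h|^(-n-2s); the Gaussian normalisation
    t^(n/2) then turns t^(b-1) into t^(s-1).\<close>
  define b where "b = n / 2 + s"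
  have b: "b > 0" using s by (simp add: b_def n_def add_nonneg_pos)
  define K where "K = 2 / (4 * pi) powr (n / 2)"
  have K: "K \<ge> 0" by (simp add: K_def)
  define X where "X = (\<lambda>t. LINT h|lborel. exp (- (t * (norm h)\<^sup>2)) * dsq u h)"
  have Xi: "integrable lborel (\<lambda>h. exp (- (t * (norm h)\<^sup>2)) * dsq u h)" if "t > 0" for t
  proof (rule Bochner_Integration.integrable_bound)
    show "integrable lborel (\<lambda>h::real^'n. exp (- (t * (norm h)\<^sup>2)) * (4 * sqnorm u))" using integrable_gaussian[OF that] by auto
    show "AE h in lborel. norm (exp (- (t * (norm h)\<^sup>2)) * dsq u h) \<le> norm (exp (- (t * (norm h)\<^sup>2)) * (4 * sqnorm u))"
      by (intro AE_I2) (auto simp: abs_mult dsq_nonneg sqnorm_nonneg intro!: mult_left_mono dsq_le[OF uL])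
  qed simp
  define Y where "Y = (\<lambda>t. LINT \<xi>|lborel. (1 - exp (- ((norm \<xi>)\<^sup>2 / (4 * t)))) * (cmod (v \<xi>))\<^sup>2)"
  have Yi: "integrable lborel (\<lambda>\<xi>. (1 - exp (- ((norm \<xi>)\<^sup>2 / (4 * t)))) * (cmod (v \<xi>))\<^sup>2)" if "t > 0" for t
    by (rule Bochner_Integration.integrable_bound[OF L2_D(2)[OF vL]])
       (use that in \<open>auto simp: abs_mult intro!: AE_I2 mult_left_le_one_le\<close>)
  have XY: "t powr (b - 1) * X t = K * (t powr (s - 1) * Y t)" if t: "t > 0" for t
  proof -
    have "(4 * pi * t) powr (n / 2) / 2 * X t = Y t" unfolding X_def Y_def n_def by (rule gaussian_increment_energy[OF uL v t])
    moreover have "(4 * pi * t) powr (n / 2) = (4 * pi) powr (n / 2) * t powr (n / 2)" by (rule powr_mult)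
    moreover have "(4 * pi) powr (n / 2) \<noteq> 0" "t powr (n / 2) \<noteq> 0" using t by auto
    ultimately have "X t = K * (t powr (- (n / 2)) * Y t)" unfolding K_def powr_minus_divide
      by (simp add: divide_simps mult_ac)
    moreover have "t powr (b - 1) * t powr (- (n / 2)) = t powr (s - 1)" by (simp add: b_def powr_add[symmetric])
    ultimately show ?thesis by (simp add: mult.left_commute mult.assoc[symmetric])
  qed
  have "ennreal (Gamma b) * (\<integral>\<^sup>+h. ennreal (norm h powr (- (n + 2 * s)) * dsq u h) \<partial>lborel) = (\<integral>\<^sup>+h. ennreal (Gamma b * norm h powr (- (n + 2 * s))) * ennreal (dsq u h) \<partial>lborel)"
    using b by (subst nn_integral_cmult[symmetric]) (auto simp: ennreal_mult dsq_nonneg Gamma_real_nonneg mult.assoc)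
  also have "\<dots> = (\<integral>\<^sup>+h. \<integral>\<^sup>+t. ennreal (t powr (b - 1) * exp (- ((norm h)\<^sup>2 * t))) * indicator {0<..} t * ennreal (dsq u h) \<partial>lborel \<partial>lborel)"
  proof (rule nn_integral_cong_AE)
    show "AE h in lborel. ennreal (Gamma b * norm h powr (- (n + 2 * s))) * ennreal (dsq u h) = (\<integral>\<^sup>+t. ennreal (t powr (b - 1) * exp (- ((norm h)\<^sup>2 * t))) * indicator {0<..} t * ennreal (dsq u h) \<partial>lborel)"
      using AE_lborel_singleton[of "0::real^'n"]
    proof eventually_elim
      fix h :: "real^'n" assume h: "h \<noteq> 0"
      have e: "2 * - b = - (n + 2 * s)" by (simp add: b_def)
      have "(\<integral>\<^sup>+t. ennreal (t powr (b - 1) * exp (- ((norm h)\<^sup>2 * t))) * indicator {0<..} t * ennreal (dsq u h) \<partial>lborel) = (\<integral>\<^sup>+t. ennreal (t powr (b - 1) * exp (- ((norm h)\<^sup>2 * t))) * indicator {0<..} t \<partial>lborel) * ennreal (dsq u h)"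
        by (rule nn_integral_multc) measurable
      also have "(\<integral>\<^sup>+t. ennreal (t powr (b - 1) * exp (- ((norm h)\<^sup>2 * t))) * indicator {0<..} t \<partial>lborel) = ennreal (Gamma b * ((norm h)\<^sup>2) powr (- b))"
        by (rule nn_integral_Gamma) (use b h in auto)
      finally show "ennreal (Gamma b * norm h powr (- (n + 2 * s))) * ennreal (dsq u h) = (\<integral>\<^sup>+t. ennreal (t powr (b - 1) * exp (- ((norm h)\<^sup>2 * t))) * indicator {0<..} t * ennreal (dsq u h) \<partial>lborel)"
        unfolding powr_norm_square e by simp
    qed
  qed
  also have "\<dots> = (\<integral>\<^sup>+t. \<integral>\<^sup>+h. ennreal (t powr (b - 1) * exp (- ((norm h)\<^sup>2 * t))) * indicator {0<..} t * ennreal (dsq u h) \<partial>lborel \<partial>lborel)"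
    by (rule lborel_pair.Fubini'[symmetric]) measurable
  also have "\<dots> = (\<integral>\<^sup>+t. \<integral>\<^sup>+\<xi>. ennreal K * (ennreal (t powr (s - 1) * (1 - exp (- ((norm \<xi>)\<^sup>2 / 4 / t)))) * indicator {0<..} t * ennreal ((cmod (v \<xi>))\<^sup>2)) \<partial>lborel \<partial>lborel)"
  proof (rule nn_integral_cong)
    fix t :: real
    show "(\<integral>\<^sup>+h. ennreal (t powr (b - 1) * exp (- ((norm h)\<^sup>2 * t))) * indicator {0<..} t * ennreal (dsq u h) \<partial>lborel)
      = (\<integral>\<^sup>+\<xi>. ennreal K * (ennreal (t powr (s - 1) * (1 - exp (- ((norm \<xi>)\<^sup>2 / 4 / t)))) * indicator {0<..} t * ennreal ((cmod (v \<xi>))\<^sup>2)) \<partial>lborel)"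
    proof (cases "t > 0")
      case t: True
      have "(\<integral>\<^sup>+h. ennreal (t powr (b - 1) * exp (- ((norm h)\<^sup>2 * t))) * indicator {0<..} t * ennreal (dsq u h) \<partial>lborel) = (\<integral>\<^sup>+h. ennreal (t powr (b - 1) * (exp (- (t * (norm h)\<^sup>2)) * dsq u h)) \<partial>lborel)"
        using t by (intro nn_integral_cong) (simp add: ennreal_mult[symmetric] dsq_nonneg mult_ac)
      also have "\<dots> = ennreal (t powr (b - 1) * X t)"
        unfolding X_def using Xi[OF t] by (subst nn_integral_eq_integral) (auto simp: dsq_nonneg)
      also have "\<dots> = (\<integral>\<^sup>+\<xi>. ennreal (K * (t powr (s - 1) * ((1 - exp (- ((norm \<xi>)\<^sup>2 / (4 * t)))) * (cmod (v \<xi>))\<^sup>2))) \<partial>lborel)"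
        unfolding XY[OF t] Y_def using Yi[OF t] t K by (subst nn_integral_eq_integral) auto
      also have "\<dots> = (\<integral>\<^sup>+\<xi>. ennreal K * (ennreal (t powr (s - 1) * (1 - exp (- ((norm \<xi>)\<^sup>2 / 4 / t)))) * indicator {0<..} t * ennreal ((cmod (v \<xi>))\<^sup>2)) \<partial>lborel)"
        using t K by (intro nn_integral_cong) (simp add: ennreal_mult[symmetric] mult_ac)
      finally show ?thesis .
    qed simp
  qed
  also have "\<dots> = (\<integral>\<^sup>+\<xi>. \<integral>\<^sup>+t. ennreal K * (ennreal (t powr (s - 1) * (1 - exp (- ((norm \<xi>)\<^sup>2 / 4 / t)))) * indicator {0<..} t * ennreal ((cmod (v \<xi>))\<^sup>2)) \<partial>lborel \<partial>lborel)"
    by (rule lborel_pair.Fubini') measurable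
  also have "\<dots> \<le> (\<integral>\<^sup>+\<xi>. ennreal (K * (1 / s + 1 / (1 - s)) * ((1 + (norm \<xi>)\<^sup>2) powr s * (cmod (v \<xi>))\<^sup>2)) \<partial>lborel)"
  proof (rule nn_integral_mono)
    fix \<xi> :: "real^'n"
    have "(\<integral>\<^sup>+t. ennreal K * (ennreal (t powr (s - 1) * (1 - exp (- ((norm \<xi>)\<^sup>2 / 4 / t)))) * indicator {0<..} t * ennreal ((cmod (v \<xi>))\<^sup>2)) \<partial>lborel)
      = ennreal K * ((\<integral>\<^sup>+t. ennreal (t powr (s - 1) * (1 - exp (- ((norm \<xi>)\<^sup>2 / 4 / t)))) * indicator {0<..} t \<partial>lborel) * ennreal ((cmod (v \<xi>))\<^sup>2))"
      by (subst nn_integral_cmult, measurable) (subst nn_integral_multc, measurable)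
    also have "\<dots> \<le> ennreal K * (ennreal ((1 / s + 1 / (1 - s)) * ((norm \<xi>)\<^sup>2 / 4) powr s) * ennreal ((cmod (v \<xi>))\<^sup>2))"
      by (intro mult_left_mono mult_right_mono nn_integral_powr_one_minus_exp s) auto
    also have "\<dots> = ennreal (K * (1 / s + 1 / (1 - s)) * (((norm \<xi>)\<^sup>2 / 4) powr s * (cmod (v \<xi>))\<^sup>2))"
      using K s by (simp add: ennreal_mult[symmetric] mult_ac)
    also have "\<dots> \<le> ennreal (K * (1 / s + 1 / (1 - s)) * ((1 + (norm \<xi>)\<^sup>2) powr s * (cmod (v \<xi>))\<^sup>2))"
      using K s by (intro ennreal_leI mult_left_mono mult_right_mono powr_mono2) auto
    finally show "(\<integral>\<^sup>+t. ennreal K * (ennreal (t powr (s - 1) * (1 - exp (- ((norm \<xi>)\<^sup>2 / 4 / t)))) * indicator {0<..} t * ennreal ((cmod (v \<xi>))\<^sup>2)) \<partial>lborel)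
      \<le> ennreal (K * (1 / s + 1 / (1 - s)) * ((1 + (norm \<xi>)\<^sup>2) powr s * (cmod (v \<xi>))\<^sup>2))" .
  qed
  also have "\<dots> = ennreal (LINT \<xi>|lborel. K * (1 / s + 1 / (1 - s)) * ((1 + (norm \<xi>)\<^sup>2) powr s * (cmod (v \<xi>))\<^sup>2))"
    using vi K s by (intro nn_integral_eq_integral) auto
  finally have "ennreal (Gamma b) * (\<integral>\<^sup>+h. ennreal (norm h powr (- (n + 2 * s)) * dsq u h) \<partial>lborel) < \<infinity>"
    by (rule le_less_trans) simp
  moreover have "ennreal (Gamma b) > 0" using Gamma_real_pos[OF b] by simp
  ultimately have "(\<integral>\<^sup>+h. ennreal (norm h powr (- (n + 2 * s)) * dsq u h) \<partial>lborel) < \<infinity>"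
    by (auto simp: ennreal_mult_less_top)
  then show ?thesis unfolding n_def by (intro integrableI_nonneg) (auto simp: dsq_nonneg)
qed

section \<open>Weighted gradient and its quadratic form\<close>

lemma DIM_real_vec: "DIM(real^'n) = CARD('n)" by simp

lemma kern_component:
  fixes F :: "real^'n \<Rightarrow> real^'n"
  assumes "integrable lborel F" "\<exists>C. \<forall>z. norm (F z) \<le> C"
  shows "kern (\<lambda>h. F h $ i)"
  unfolding kern_def
proof
  show "integrable lborel (\<lambda>h. F h $ i)" by (rule integrable_bounded_linear[OF bounded_linear_vec_nth assms(1)])
  obtain C where "\<forall>z. norm (F z) \<le> C" using assms(2) by blast
  then show "\<exists>B. \<forall>h. \<bar>F h $ i\<bar> \<le> B" using component_le_norm_cart order.trans by blast
qed

lemma cnj_cv: "cnj (cv p u x) = cv p (\<lambda>x. cnj (u x)) x"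
  unfolding cv_def by (subst Bochner_Integration.integral_cnj[symmetric]) simp

lemma cv_diff_kernel:
  assumes u: "u \<in> L2" and p: "kern p" and q: "kern q"
  shows "cv (\<lambda>h. p h - q h) u x = cv p u x - cv q u x"
  unfolding cv_def
  by (subst Bochner_Integration.integral_diff[symmetric, OF cv_integrable[OF u p] cv_integrable[OF u q]]) (simp add: left_diff_distrib)

text \<open>Four bilinear pairings with conjugates, so that summation over components yields values
  of \<open>reg_form\<close>.\<close>

lemma sqnorm_diff_eq:
  fixes a b :: "'a::euclidean_space \<Rightarrow> complex"
  assumes a: "a \<in> L2" and b: "b \<in> L2"
  shows "sqnorm (\<lambda>x. a x - b x) = Re ((LINT x|lborel. a x * cnj (a x)) - (LINT x|lborel. a x * cnj (b x))
    - ((LINT x|lborel. b x * cnj (a x)) - (LINT x|lborel. b x * cnj (b x))))"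
proof -
  note i = L2_mult[OF a L2_cnj[OF a]] L2_mult[OF a L2_cnj[OF b]] L2_mult[OF b L2_cnj[OF a]] L2_mult[OF b L2_cnj[OF b]]
  have "complex_of_real (sqnorm (\<lambda>x. a x - b x)) = (LINT x|lborel. complex_of_real ((cmod (a x - b x))\<^sup>2))"
    unfolding sqnorm_def by (rule integral_complex_of_real[symmetric])
  also have "\<dots> = (LINT x|lborel. (a x * cnj (a x) - a x * cnj (b x)) - (b x * cnj (a x) - b x * cnj (b x)))"
    unfolding complex_norm_square by (intro Bochner_Integration.integral_cong refl) (simp add: algebra_simps)
  also have "\<dots> = (LINT x|lborel. a x * cnj (a x)) - (LINT x|lborel. a x * cnj (b x))
    - ((LINT x|lborel. b x * cnj (a x)) - (LINT x|lborel. b x * cnj (b x)))"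
    using i by simp
  finally show ?thesis by (metis Re_complex_of_real)
qed

lemma L2_product_limit:
  fixes f f' :: "nat \<Rightarrow> 'a::euclidean_space \<Rightarrow> complex"
  assumes L: "\<And>k. f k \<in> L2" "\<And>k. f' k \<in> L2" "g \<in> L2" "g' \<in> L2"
    and lim: "(\<lambda>k. sqnorm (\<lambda>x. f k x - g x)) \<longlonglongrightarrow> 0" "(\<lambda>k. sqnorm (\<lambda>x. f' k x - g' x)) \<longlonglongrightarrow> 0"
  shows "(\<lambda>k. LINT x|lborel. f k x * f' k x) \<longlonglongrightarrow> (LINT x|lborel. g x * g' x)"
proof -
  define a where "a = (\<lambda>k x. f k x - g x)"
  define b where "b = (\<lambda>k x. f' k x - g' x)"
  have aL: "a k \<in> L2" "b k \<in> L2" for k unfolding a_def b_def by (rule L2_diff; fact L)+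
  have "(\<lambda>k. sqrt (sqnorm (a k)) * sqrt (sqnorm (b k)) + (sqrt (sqnorm (a k)) * sqrt (sqnorm g') + sqrt (sqnorm g) * sqrt (sqnorm (b k)))) \<longlonglongrightarrow> sqrt 0 * sqrt 0 + (sqrt 0 * sqrt (sqnorm g') + sqrt (sqnorm g) * sqrt 0)"
    using lim unfolding a_def b_def by (intro tendsto_intros)
  then have 1: "(\<lambda>k. sqrt (sqnorm (a k)) * sqrt (sqnorm (b k)) + (sqrt (sqnorm (a k)) * sqrt (sqnorm g') + sqrt (sqnorm g) * sqrt (sqnorm (b k)))) \<longlonglongrightarrow> 0" by simp
  have 2: "(\<lambda>k. (LINT x|lborel. f k x * f' k x) - (LINT x|lborel. g x * g' x)) \<longlonglongrightarrow> 0"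
  proof (rule Lim_null_comparison[OF _ 1], intro always_eventually allI)
    fix k
    have "(LINT x|lborel. f k x * f' k x) = (LINT x|lborel. a k x * b k x + (a k x * g' x + g x * b k x) + g x * g' x)"
      by (intro Bochner_Integration.integral_cong refl) (simp add: a_def b_def algebra_simps)
    also have "\<dots> = (LINT x|lborel. a k x * b k x) + ((LINT x|lborel. a k x * g' x) + (LINT x|lborel. g x * b k x)) + (LINT x|lborel. g x * g' x)"
      using L2_mult[OF aL(1)[of k] aL(2)[of k]] L2_mult[OF aL(1)[of k] L(4)] L2_mult[OF L(3) aL(2)[of k]] L2_mult[OF L(3,4)] by simp
    finally have e: "(LINT x|lborel. f k x * f' k x) - (LINT x|lborel. g x * g' x) = (LINT x|lborel. a k x * b k x) + ((LINT x|lborel. a k x * g' x) + (LINT x|lborel. g x * b k x))"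
      by simp
    show "norm ((LINT x|lborel. f k x * f' k x) - (LINT x|lborel. g x * g' x)) \<le> sqrt (sqnorm (a k)) * sqrt (sqnorm (b k)) + (sqrt (sqnorm (a k)) * sqrt (sqnorm g') + sqrt (sqnorm g) * sqrt (sqnorm (b k)))"
      unfolding e by (intro norm_triangle_le add_mono L2_Cauchy_Schwarz' aL L)
  qed
  show ?thesis using 2 by (simp add: LIM_zero_iff)
qed

text \<open>Finite Gagliardo seminorm. The limits below are proved on this class, and the Fourier
  description of H^s enters only through the inclusion
  \<open>sobolev_subset_gagliardo\<close>.\<close>

definition gagliardo :: "real \<Rightarrow> (real^'n \<Rightarrow> complex) set" where
  "gagliardo s = {u \<in> L2. integrable lborel (\<lambda>h. norm h powr (- (real CARD('n) + 2 * s)) * dsq u h)}"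

text \<open>Bilinear Gagliardo form; half of it represents the fractional Laplacian after
  multiplication by C, and the weighted Laplacian after multiplication by -
  \<open>kappa\<close>.\<close>

definition energy :: "real \<Rightarrow> (real^'n \<Rightarrow> complex) \<Rightarrow> (real^'n \<Rightarrow> complex) \<Rightarrow> complex" where
  "energy s u w = (LINT l|lborel. of_real (norm l powr (- (real CARD('n) + 2 * s))) * dcorr u w l)"

lemma gagliardo_D:
  fixes u :: "real^'n \<Rightarrow> complex"
  assumes "u \<in> gagliardo s"
  shows "u \<in> L2" "integrable lborel (\<lambda>h. norm h powr (- (real CARD('n) + 2 * s)) * dsq u h)"
  using assms by (simp_all add: gagliardo_def)

lemma gagliardo_cnj:
  assumes "u \<in> gagliardo s" shows "(\<lambda>x. cnj (u x)) \<in> gagliardo s"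
proof -
  have "dsq (\<lambda>x. cnj (u x)) = dsq u"
    by (intro ext) (simp add: dsq_def sqnorm_def complex_cnj_diff[symmetric] del: complex_cnj_diff)
  then show ?thesis using assms L2_cnj[of u] by (simp add: gagliardo_def)
qed

text \<open>Dominated convergence, with a multiple of |l|^(-n-2s) (dsq u l + dsq w l) as majorant.
  It serves the regularised convolutions and the truncated fractional kernel alike.\<close>

lemma dcorr_limit:
  fixes u w :: "real^'n \<Rightarrow> complex" and r :: "nat \<Rightarrow> real^'n \<Rightarrow> real"
  assumes u: "u \<in> gagliardo s" and w: "w \<in> gagliardo s"
    and meas: "\<And>k. (\<lambda>l. of_real (r k l) * dcorr u w l) \<in> borel_measurable lborel"
    and bound: "\<And>k l. l \<noteq> 0 \<Longrightarrow> \<bar>r k l\<bar> \<le> C * norm l powr (- (real CARD('n) + 2 * s))"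
    and lim: "\<And>l. l \<noteq> 0 \<Longrightarrow> (\<lambda>k. r k l) \<longlonglongrightarrow> c * norm l powr (- (real CARD('n) + 2 * s))"
  shows "(\<lambda>k. LINT l|lborel. of_real (r k l) * dcorr u w l) \<longlonglongrightarrow> of_real c * energy s u w"
proof -
  define N where "N = (\<lambda>l::real^'n. norm l powr (- (real CARD('n) + 2 * s)))"
  note uL = gagliardo_D(1)[OF u] and wL = gagliardo_D(1)[OF w]
  note [measurable] = borel_measurable_dcorr[OF uL wL]
  have [measurable]: "N \<in> borel_measurable borel" unfolding N_def by measurable
  have "(\<lambda>k. LINT l|lborel. of_real (r k l) * dcorr u w l) \<longlonglongrightarrow> (LINT l|lborel. of_real c * (of_real (N l) * dcorr u w l))"
  proof (rule integral_dominated_convergence[where w="\<lambda>l. C / 2 * (N l * dsq u l + N l * dsq w l)"])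
    show "integrable lborel (\<lambda>l. C / 2 * (N l * dsq u l + N l * dsq w l))"
      using gagliardo_D(2)[OF u] gagliardo_D(2)[OF w] unfolding N_def by (intro Bochner_Integration.integrable_add integrable_mult_right) auto
    show "AE l in lborel. (\<lambda>k. of_real (r k l) * dcorr u w l) \<longlonglongrightarrow> of_real c * (of_real (N l) * dcorr u w l)"
      using AE_lborel_singleton[of "0::real^'n"]
    proof eventually_elim
      fix l :: "real^'n" assume l: "l \<noteq> 0"
      have "(\<lambda>k. complex_of_real (r k l) * dcorr u w l) \<longlonglongrightarrow> of_real (c * N l) * dcorr u w l"
        unfolding N_def by (intro tendsto_intros lim l)
      then show "(\<lambda>k. of_real (r k l) * dcorr u w l) \<longlonglongrightarrow> of_real c * (of_real (N l) * dcorr u w l)" by (simp add: mult.assoc)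
    qed
    show "AE l in lborel. norm (of_real (r k l) * dcorr u w l) \<le> C / 2 * (N l * dsq u l + N l * dsq w l)" for k
      using AE_lborel_singleton[of "0::real^'n"]
    proof eventually_elim
      fix l :: "real^'n" assume l: "l \<noteq> 0"
      have "norm (of_real (r k l) * dcorr u w l) \<le> (C * N l) * ((dsq u l + dsq w l) / 2)"
        unfolding norm_mult norm_of_real N_def using bound[OF l, of k] abs_ge_zero[of "r k l"]
        by (intro mult_mono dcorr_le uL wL) (auto simp: dsq_nonneg intro: order.trans)
      then show "norm (of_real (r k l) * dcorr u w l) \<le> C / 2 * (N l * dsq u l + N l * dsq w l)" by (simp add: field_simps)
    qed
  qed (use meas in \<open>auto simp: N_def\<close>)
  then show ?thesis unfolding N_def energy_def by simp
qed

section \<open>Convergence of regularised and of truncated gradients\<close>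

context
  fixes s :: real
  assumes s: "0 < s" "s < 1"
begin

lemma kern_reg: "T > 0 \<Longrightarrow> kern (\<lambda>h::real^'n. reg s T h $ i)"
  by (intro kern_component integrable_reg[OF s] bounded_reg[OF s])

lemma kern_cut: "\<epsilon> > 0 \<Longrightarrow> kern (\<lambda>h::real^'n. cut s \<epsilon> h $ i)"
  using bounded_cut[OF s, where 'a="real^'n"] by (intro kern_component integrable_cut[OF s]) blast+

lemma kern_cut_defect: "\<epsilon> > 0 \<Longrightarrow> kern (\<lambda>h::real^'n. cut_defect s \<epsilon> h $ i)"
  unfolding cut_defect_def[OF s] using kern_diff[OF kern_cut[of \<epsilon>] kern_reg[of "1 / \<epsilon>\<^sup>2"]] by simp

text \<open>Pairing of two regularised gradients; the parameters may differ because the Cauchy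
  property needs the mixed terms.\<close>

definition reg_form :: "real \<Rightarrow> real \<Rightarrow> (real^'n \<Rightarrow> complex) \<Rightarrow> (real^'n \<Rightarrow> complex) \<Rightarrow> complex" where
  "reg_form T T' u w = (\<Sum>i\<in>UNIV. LINT x|lborel. cv (\<lambda>h. reg s T h $ i) u x * cv (\<lambda>h. reg s T' h $ i) w x)"

lemma reg_form_eq:
  fixes u w :: "real^'n \<Rightarrow> complex"
  assumes u: "u \<in> L2" and w: "w \<in> L2" and T: "T > 0" "T' > 0"
  shows "reg_form T T' u w = (LINT l|lborel. of_real (rconv s T T' l) * dcorr u w l) / 2"
    and "integrable lborel (\<lambda>l. of_real (rconv s T T' l) * dcorr u w l)"
proof -
  have odd: "reg s t (- h) $ i = - (reg s t h $ i)" for t i and h :: "real^'n" by (simp add: reg_minus)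
  note c = cv_cv[OF u w kern_reg[OF T(1)] kern_reg[OF T(2)] odd odd]
  have r: "rconv s T T' l = (\<Sum>i\<in>UNIV. LINT h|lborel. reg s T h $ i * reg s T' (l - h) $ i)" for l :: "real^'n"
    unfolding rconv_def inner_vec_def inner_real_def
    by (rule Bochner_Integration.integral_sum) (rule kern_conv_integrable[OF kern_reg[OF T(1)] kern_reg[OF T(2)]])
  have e: "complex_of_real (rconv s T T' l) * dcorr u w l = (\<Sum>i\<in>UNIV. of_real (LINT h|lborel. reg s T h $ i * reg s T' (l - h) $ i) * dcorr u w l)" for l
    unfolding r by (simp add: sum_distrib_right)
  show "integrable lborel (\<lambda>l. of_real (rconv s T T' l) * dcorr u w l)"
    unfolding e by (intro Bochner_Integration.integrable_sum c)
  show "reg_form T T' u w = (LINT l|lborel. of_real (rconv s T T' l) * dcorr u w l) / 2"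
    unfolding e reg_form_def c(1) by (subst Bochner_Integration.integral_sum) (auto intro: c simp: sum_divide_distrib)
qed

lemma reg_form_limit:
  fixes u w :: "real^'n \<Rightarrow> complex" and T T' :: "nat \<Rightarrow> real"
  assumes u: "u \<in> gagliardo s" and w: "w \<in> gagliardo s"
    and T: "\<And>k. T k > 0" "\<And>k. T' k > 0" "filterlim T at_top sequentially" "filterlim T' at_top sequentially"
  shows "(\<lambda>k. reg_form (T k) (T' k) u w) \<longlonglongrightarrow> of_real (kappa TYPE(real^'n) s) / 2 * energy s u w"
proof -
  note uL = gagliardo_D(1)[OF u] and wL = gagliardo_D(1)[OF w]
  obtain C where C: "\<forall>T>0. \<forall>T'>0. \<forall>h::real^'n. h \<noteq> 0 \<longrightarrow> \<bar>rconv s T T' h\<bar> \<le> C * norm h powr (- (real CARD('n) + 2 * s))"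
    using rconv_bound[OF s, where 'a="real^'n"] unfolding DIM_real_vec by blast
  have "(\<lambda>k. LINT l|lborel. of_real (rconv s (T k) (T' k) l) * dcorr u w l) \<longlonglongrightarrow> of_real (kappa TYPE(real^'n) s) * energy s u w"
  proof (rule dcorr_limit[OF u w])
    show "(\<lambda>l. of_real (rconv s (T k) (T' k) l) * dcorr u w l) \<in> borel_measurable lborel" for k
      using reg_form_eq(2)[OF uL wL T(1) T(2)] by (rule borel_measurable_integrable)
    show "\<bar>rconv s (T k) (T' k) l\<bar> \<le> C * norm l powr (- (real CARD('n) + 2 * s))" if "l \<noteq> 0" for k and l :: "real^'n"
      using C[rule_format, OF T(1) T(2) that] .
    show "(\<lambda>k. rconv s (T k) (T' k) l) \<longlonglongrightarrow> kappa TYPE(real^'n) s * norm l powr (- (real CARD('n) + 2 * s))" if "l \<noteq> 0" for l :: "real^'n"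
      using rconv_tendsto[OF s that T] unfolding DIM_real_vec .
  qed
  then have "(\<lambda>k. (LINT l|lborel. of_real (rconv s (T k) (T' k) l) * dcorr u w l) / 2) \<longlonglongrightarrow> of_real (kappa TYPE(real^'n) s) * energy s u w / 2"
    by (intro tendsto_intros) auto
  then show ?thesis unfolding reg_form_eq(1)[OF uL wL T(1) T(2)] by simp
qed

text \<open>Summed over components, the squared distance is a combination of four pairings with
  signs +, -, -, +, all of which have the same limit whatever the two sequences.\<close>

lemma reg_differences:
  fixes u :: "real^'n \<Rightarrow> complex" and T T' :: "nat \<Rightarrow> real"
  assumes u: "u \<in> gagliardo s"
    and T: "\<And>k. T k > 0" "\<And>k. T' k > 0" "filterlim T at_top sequentially" "filterlim T' at_top sequentially"
  shows "(\<lambda>k. sqnorm (\<lambda>x. cv (\<lambda>h. reg s (T k) h $ i) u x - cv (\<lambda>h. reg s (T' k) h $ i) u x)) \<longlonglongrightarrow> 0"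
proof -
  note uL = gagliardo_D(1)[OF u]
  let ?R = "\<lambda>T j. cv (\<lambda>h. reg s T h $ j) u"
  let ?u' = "\<lambda>x. cnj (u x)"
  let ?B = "\<lambda>T T'. reg_form T T' u ?u'"
  define \<Lambda> where "\<Lambda> = of_real (kappa TYPE(real^'n) s) / 2 * energy s u ?u'"
  note lim = reg_form_limit[OF u gagliardo_cnj[OF u], folded \<Lambda>_def]
  have "(\<lambda>k. Re (?B (T k) (T k) - ?B (T k) (T' k) - (?B (T' k) (T k) - ?B (T' k) (T' k)))) \<longlonglongrightarrow> Re (\<Lambda> - \<Lambda> - (\<Lambda> - \<Lambda>))"
    by (intro tendsto_intros lim T)
  then have 1: "(\<lambda>k. Re (?B (T k) (T k) - ?B (T k) (T' k) - (?B (T' k) (T k) - ?B (T' k) (T' k)))) \<longlonglongrightarrow> 0" by simp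
  show ?thesis
  proof (rule tendsto_sandwich[OF _ _ tendsto_const 1]; intro always_eventually allI)
    fix k
    show "0 \<le> sqnorm (\<lambda>x. ?R (T k) i x - ?R (T' k) i x)" by (rule sqnorm_nonneg)
    have "sqnorm (\<lambda>x. ?R (T k) i x - ?R (T' k) i x) \<le> (\<Sum>j\<in>UNIV. sqnorm (\<lambda>x. ?R (T k) j x - ?R (T' k) j x))"
      by (rule member_le_sum) (auto simp: sqnorm_nonneg)
    also have "\<dots> = Re (?B (T k) (T k) - ?B (T k) (T' k) - (?B (T' k) (T k) - ?B (T' k) (T' k)))"
      unfolding reg_form_def
      by (simp only: sqnorm_diff_eq[OF cv_L2[OF uL kern_reg[OF T(1)]] cv_L2[OF uL kern_reg[OF T(2)]]] cnj_cv Re_sum[symmetric] sum_subtractf)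
    finally show "sqnorm (\<lambda>x. ?R (T k) i x - ?R (T' k) i x) \<le> Re (?B (T k) (T k) - ?B (T k) (T' k) - (?B (T' k) (T k) - ?B (T' k) (T' k)))" .
  qed
qed

text \<open>Convergence is demanded along every sequence, so that T = k + 1 and T = \<epsilon>^-2
  lead to the same limit.\<close>

definition reg_gradient :: "(real^'n \<Rightarrow> complex) \<Rightarrow> ('n \<Rightarrow> real^'n \<Rightarrow> complex) \<Rightarrow> bool" where
  "reg_gradient u g \<longleftrightarrow> (\<forall>i. g i \<in> L2 \<and> (\<forall>T. (\<forall>k. T k > 0) \<and> filterlim T at_top sequentially \<longrightarrow>
     (\<lambda>k. sqnorm (\<lambda>x. cv (\<lambda>h. reg s (T k) h $ i) u x - g i x)) \<longlonglongrightarrow> 0))"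

lemma reg_gradient_exists:
  fixes u :: "real^'n \<Rightarrow> complex"
  assumes u: "u \<in> gagliardo s"
  shows "\<exists>g. reg_gradient u g"
proof -
  note uL = gagliardo_D(1)[OF u]
  have "\<exists>g. g \<in> L2 \<and> (\<forall>T. (\<forall>k. T k > 0) \<and> filterlim T at_top sequentially \<longrightarrow>
     (\<lambda>k. sqnorm (\<lambda>x. cv (\<lambda>h. reg s (T k) h $ i) u x - g x)) \<longlonglongrightarrow> 0)" for i
  proof -
    define f where "f = (\<lambda>k::nat. cv (\<lambda>h. reg s (real (Suc k)) h $ i) u)"
    have fL: "f k \<in> L2" for k unfolding f_def by (intro cv_L2 uL kern_reg) simp
    have at_top: "filterlim (\<lambda>k. real (Suc (n k))) at_top sequentially" if "\<And>k. n k \<ge> k" for n :: "nat \<Rightarrow> nat"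
      by (rule filterlim_at_top_mono[OF filterlim_real_sequentially]) (intro always_eventually allI of_nat_mono le_SucI that)
    have "\<exists>N. \<forall>m\<ge>N. \<forall>n\<ge>N. sqnorm (\<lambda>x. f m x - f n x) < e" if e: "e > 0" for e
    \<comment> \<open>If the sequence were not Cauchy, there would be index sequences m and n
      tending to \<infinity> whose terms stay apart, contrary to
      \<open>reg_differences\<close>.\<close>
    proof (rule ccontr)
      assume "\<not> ?thesis"
      then have "\<forall>N. \<exists>m n. m \<ge> N \<and> n \<ge> N \<and> e \<le> sqnorm (\<lambda>x. f m x - f n x)" by (meson not_less)
      then obtain m n where mn: "\<And>N. m N \<ge> N" "\<And>N. n N \<ge> N" "\<And>N. e \<le> sqnorm (\<lambda>x. f (m N) x - f (n N) x)" by metis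
      have "(\<lambda>N. sqnorm (\<lambda>x. f (m N) x - f (n N) x)) \<longlonglongrightarrow> 0"
        unfolding f_def by (rule reg_differences[OF u]) (use at_top[of m] at_top[of n] mn in auto)
      then have "\<forall>\<^sub>F N in sequentially. sqnorm (\<lambda>x. f (m N) x - f (n N) x) < e" using e by (rule order_tendstoD)
      then show False using mn(3) by (meson eventually_sequentially not_less order_refl)
    qed
    then obtain g where g: "g \<in> L2" "\<And>e. e > 0 \<Longrightarrow> \<exists>N. \<forall>n\<ge>N. sqnorm (\<lambda>x. f n x - g x) \<le> e"
      using L2_complete[of f] fL by blast
    have lim: "(\<lambda>n. sqnorm (\<lambda>x. f n x - g x)) \<longlonglongrightarrow> 0"
    proof (rule LIMSEQ_I)
      fix r :: real assume "r > 0"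
      then obtain N where "\<forall>n\<ge>N. sqnorm (\<lambda>x. f n x - g x) \<le> r / 2" using g(2)[of "r / 2"] by auto
      then show "\<exists>N. \<forall>n\<ge>N. norm (sqnorm (\<lambda>x. f n x - g x) - 0) < r" using \<open>r > 0\<close> by (intro exI[of _ N]) (fastforce simp: sqnorm_nonneg)
    qed
    show ?thesis
    proof (intro exI[of _ g] conjI g allI impI)
      fix T :: "nat \<Rightarrow> real" assume T: "(\<forall>k. T k > 0) \<and> filterlim T at_top sequentially"
      have a: "(\<lambda>k. sqnorm (\<lambda>x. cv (\<lambda>h. reg s (T k) h $ i) u x - f k x)) \<longlonglongrightarrow> 0"
        unfolding f_def by (rule reg_differences[OF u]) (use T at_top[of "\<lambda>k. k"] in auto)
      have b: "(\<lambda>k. 2 * sqnorm (\<lambda>x. cv (\<lambda>h. reg s (T k) h $ i) u x - f k x) + 2 * sqnorm (\<lambda>x. f k x - g x)) \<longlonglongrightarrow> 0"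
        using tendsto_add[OF tendsto_mult_left[OF a, of 2] tendsto_mult_left[OF lim, of 2]] by simp
      show "(\<lambda>k. sqnorm (\<lambda>x. cv (\<lambda>h. reg s (T k) h $ i) u x - g x)) \<longlonglongrightarrow> 0"
      proof (rule tendsto_sandwich[OF _ _ tendsto_const b]; intro always_eventually allI)
        fix k
        show "0 \<le> sqnorm (\<lambda>x. cv (\<lambda>h. reg s (T k) h $ i) u x - g x)" by (rule sqnorm_nonneg)
        have Tk: "T k > 0" using T by blast
        show "sqnorm (\<lambda>x. cv (\<lambda>h. reg s (T k) h $ i) u x - g x) \<le> 2 * sqnorm (\<lambda>x. cv (\<lambda>h. reg s (T k) h $ i) u x - f k x) + 2 * sqnorm (\<lambda>x. f k x - g x)"
          using sqnorm_add[OF L2_diff[OF cv_L2[OF uL kern_reg[OF Tk, of i]] fL[of k]] L2_diff[OF fL[of k] g(1)]] by simp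
      qed
    qed
  qed
  then have "\<exists>g. \<forall>i. g i \<in> L2 \<and> (\<forall>T. (\<forall>k. T k > 0) \<and> filterlim T at_top sequentially \<longrightarrow>
     (\<lambda>k. sqnorm (\<lambda>x. cv (\<lambda>h. reg s (T k) h $ i) u x - g i x)) \<longlonglongrightarrow> 0)"
    by (intro choice allI)
  then show ?thesis unfolding reg_gradient_def .
qed

text \<open>The limit of \<open>reg_form\<close> is computed twice: from the L2 convergence of the
  gradients and from the convergence of the convolved kernels.\<close>

lemma reg_gradient_pairing:
  fixes u w :: "real^'n \<Rightarrow> complex"
  assumes u: "u \<in> gagliardo s" and w: "w \<in> gagliardo s" and g: "reg_gradient u g" "reg_gradient w g'"
  shows "(\<Sum>i\<in>UNIV. LINT x|lborel. g i x * g' i x) = of_real (kappa TYPE(real^'n) s) / 2 * energy s u w"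
proof -
  define T where "T = (\<lambda>k. real (Suc k))"
  have T: "T k > 0" for k by (simp add: T_def)
  have Tl: "filterlim T at_top sequentially" unfolding T_def
    by (rule filterlim_at_top_mono[OF filterlim_real_sequentially]) (auto intro!: always_eventually)
  note uL = gagliardo_D(1)[OF u] and wL = gagliardo_D(1)[OF w]
  have "(\<lambda>k. reg_form (T k) (T k) u w) \<longlonglongrightarrow> (\<Sum>i\<in>UNIV. LINT x|lborel. g i x * g' i x)"
    unfolding reg_form_def
  proof (intro tendsto_sum L2_product_limit)
    fix i
    show "(\<lambda>k. sqnorm (\<lambda>x. cv (\<lambda>h. reg s (T k) h $ i) u x - g i x)) \<longlonglongrightarrow> 0"
      "(\<lambda>k. sqnorm (\<lambda>x. cv (\<lambda>h. reg s (T k) h $ i) w x - g' i x)) \<longlonglongrightarrow> 0"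
      using g T Tl unfolding reg_gradient_def by blast+
    show "g i \<in> L2" "g' i \<in> L2" using g unfolding reg_gradient_def by blast+
  qed (intro cv_L2 uL wL kern_reg T)+
  then show ?thesis using reg_form_limit[OF u w T T Tl Tl] by (rule LIMSEQ_unique)
qed

text \<open>Compares the defect profile with the weight |h|^(-n-2s). The factor with
  \<open>min\<close> is at most 1 and tends to 0 for fixed h as \<epsilon> tends to 0, so one
  inequality provides both ingredients of dominated convergence. The exponent s - 2 is the one with
  (s - 2) - (n + 2s) = -(n + s + 2).\<close>

lemma maj_scaled_le:
  fixes h :: "real^'n"
  assumes \<epsilon>: "\<epsilon> > 0" and h: "h \<noteq> 0"
  shows "\<epsilon> powr (- (real CARD('n) + 2 * s)) * maj s ((1 / \<epsilon>) *\<^sub>R h) \<le> min 1 ((norm h / \<epsilon>) powr (s - 2)) * norm h powr (- (real CARD('n) + 2 * s))"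
proof -
  define m where "m = real CARD('n) + 2 * s"
  define r where "r = norm h / \<epsilon>"
  have r: "r > 0" using \<epsilon> h by (simp add: r_def)
  have nr: "norm ((1 / \<epsilon>) *\<^sub>R h) = r" using \<epsilon> by (simp add: r_def)
  have maj: "maj s ((1 / \<epsilon>) *\<^sub>R h) = min (r powr (- (real CARD('n) + s + 2))) r"
    unfolding maj_def[OF s] nr DIM_real_vec ..
  have hm: "norm h powr (- m) = \<epsilon> powr (- m) * r powr (- m)"
    using \<epsilon> r by (simp add: powr_mult[symmetric] r_def)
  have e: "(s - 2) + - m = - (real CARD('n) + s + 2)" by (simp add: m_def)
  have "maj s ((1 / \<epsilon>) *\<^sub>R h) \<le> min 1 (r powr (s - 2)) * r powr (- m)"
  proof -
    have 1: "maj s ((1 / \<epsilon>) *\<^sub>R h) \<le> r powr (s - 2) * r powr (- m)" unfolding maj by (simp only: powr_add[symmetric] e min.cobounded1)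
    have "maj s ((1 / \<epsilon>) *\<^sub>R h) \<le> r powr (- m)"
    proof (cases "r \<ge> 1")
      case True
      have "r powr (- (real CARD('n) + s + 2)) \<le> r powr (- m)" using True s by (intro powr_mono) (auto simp: m_def)
      then show ?thesis unfolding maj by simp
    next
      case False
      have "1 \<le> r powr (- m)" using False r s powr_mono2'[of "- m" r 1] by (simp add: m_def)
      then show ?thesis unfolding maj using False by simp
    qed
    then show ?thesis using 1 by (simp add: min_def)
  qed
  then have "\<epsilon> powr (- m) * maj s ((1 / \<epsilon>) *\<^sub>R h) \<le> \<epsilon> powr (- m) * (min 1 (r powr (s - 2)) * r powr (- m))" by (intro mult_left_mono) auto
  also have "\<dots> = min 1 (r powr (s - 2)) * norm h powr (- m)" unfolding hm by (simp only: mult.left_commute)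
  finally show ?thesis unfolding m_def r_def .
qed

text \<open>The mass of the defect is of order \<epsilon>^(-s), and its integral against the squared
  increments of u is bounded by a multiple of \<epsilon>^s J with J tending to 0. In the product of
  the two the powers of \<epsilon> cancel.\<close>

lemma cut_defect_limit:
  fixes u :: "real^'n \<Rightarrow> complex" and \<epsilon> :: "nat \<Rightarrow> real"
  assumes u: "u \<in> gagliardo s" and \<epsilon>: "\<And>k. \<epsilon> k > 0" "\<epsilon> \<longlonglongrightarrow> 0"
  shows "(\<lambda>k. sqnorm (cv (\<lambda>h. cut_defect s (\<epsilon> k) h $ i) u)) \<longlonglongrightarrow> 0"
proof -
  define N where "N = (\<lambda>l::real^'n. norm l powr (- (real CARD('n) + 2 * s)))"
  note uL = gagliardo_D(1)[OF u]
  note [measurable] = borel_measurable_dsq[OF uL]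
  have [measurable]: "N \<in> borel_measurable borel" unfolding N_def by measurable
  have Ni: "integrable lborel (\<lambda>h. N h * dsq u h)" using gagliardo_D(2)[OF u] unfolding N_def .
  obtain C where C: "C \<ge> 0" "\<forall>\<epsilon>>0. \<forall>z::real^'n. norm (cut_defect s \<epsilon> z) \<le> C * \<epsilon> powr (- (real CARD('n) + s)) * maj s ((1 / \<epsilon>) *\<^sub>R z)"
    using cut_defect_bound[OF s, where 'a="real^'n"] unfolding DIM_real_vec by blast
  obtain C' where C': "C' \<ge> 0" "\<forall>\<epsilon>>0. (LINT z|lborel. norm (cut_defect s \<epsilon> (z::real^'n))) \<le> C' * \<epsilon> powr (- s)"
    using L1_cut_defect[OF s, where 'a="real^'n"] by blast
  define J where "J = (\<lambda>k. LINT h|lborel. min 1 ((norm h / \<epsilon> k) powr (s - 2)) * (N h * dsq u h))"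
  have Ji: "integrable lborel (\<lambda>h. min 1 ((norm h / \<epsilon> k) powr (s - 2)) * (N h * dsq u h))" for k
    by (rule Bochner_Integration.integrable_bound[OF Ni]) (auto simp: abs_mult N_def dsq_nonneg intro!: AE_I2 mult_left_le_one_le)
  have "J \<longlonglongrightarrow> (LINT h::real^'n|lborel. 0)" unfolding J_def
  proof (rule integral_dominated_convergence[where w="\<lambda>h. N h * dsq u h"])
    show "AE h in lborel. (\<lambda>k. min 1 ((norm h / \<epsilon> k) powr (s - 2)) * (N h * dsq u h)) \<longlonglongrightarrow> 0"
      using AE_lborel_singleton[of "0::real^'n"]
    proof eventually_elim
      fix h :: "real^'n" assume h: "h \<noteq> 0"
      have "filterlim (\<lambda>k. norm h / \<epsilon> k) at_top sequentially"
        using h by (intro LIM_at_top_divide[OF tendsto_const _ \<epsilon>(2)]) (simp_all add: \<epsilon>(1))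
      then have "(\<lambda>k. (norm h / \<epsilon> k) powr (s - 2)) \<longlonglongrightarrow> 0" using s by (intro tendsto_neg_powr) auto
      then have "(\<lambda>k. min 1 ((norm h / \<epsilon> k) powr (s - 2)) * (N h * dsq u h)) \<longlonglongrightarrow> min 1 0 * (N h * dsq u h)" by (intro tendsto_intros)
      then show "(\<lambda>k. min 1 ((norm h / \<epsilon> k) powr (s - 2)) * (N h * dsq u h)) \<longlonglongrightarrow> 0" by simp
    qed
    show "AE h in lborel. norm (min 1 ((norm h / \<epsilon> k) powr (s - 2)) * (N h * dsq u h)) \<le> N h * dsq u h" for k
      by (auto simp: abs_mult N_def dsq_nonneg intro!: AE_I2 mult_left_le_one_le)
  qed (auto simp: Ni)
  then have 1: "(\<lambda>k. C' * C * J k) \<longlonglongrightarrow> 0" using tendsto_mult_left[of J 0 sequentially "C' * C"] by simp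
  show ?thesis
  proof (rule tendsto_sandwich[OF _ _ tendsto_const 1]; intro always_eventually allI)
    fix k
    let ?b = "\<lambda>h::real^'n. cut_defect s (\<epsilon> k) h $ i"
    note e = \<epsilon>(1)[of k]
    show "0 \<le> sqnorm (cv ?b u)" by (rule sqnorm_nonneg)
    note kb = kern_cut_defect[OF e, of i]
    have 0: "(LINT h|lborel. ?b h) = 0" by (rule integral_lborel_odd) (simp add: cut_defect_minus[OF s])
    have J0: "J k \<ge> 0" unfolding J_def by (intro integral_nonneg_AE AE_I2) (auto simp: N_def dsq_nonneg)
    have L1: "(LINT h|lborel. \<bar>?b h\<bar>) \<le> C' * \<epsilon> k powr (- s)"
    proof -
      have "(LINT h|lborel. \<bar>?b h\<bar>) \<le> (LINT z|lborel. norm (cut_defect s (\<epsilon> k) (z::real^'n)))"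
        using kern_D(1)[OF kb] integrable_cut_defect[OF s e, where 'a="real^'n"] by (intro integral_mono) (auto simp: component_le_norm_cart)
      then show ?thesis using C'(2) e by force
    qed
    have "(\<integral>\<^sup>+h. ennreal (\<bar>?b h\<bar> * dsq u h) \<partial>lborel) \<le> (\<integral>\<^sup>+h. ennreal (C * \<epsilon> k powr s * (min 1 ((norm h / \<epsilon> k) powr (s - 2)) * (N h * dsq u h))) \<partial>lborel)"
    proof (rule nn_integral_mono_AE)
      show "AE h in lborel. ennreal (\<bar>?b h\<bar> * dsq u h) \<le> ennreal (C * \<epsilon> k powr s * (min 1 ((norm h / \<epsilon> k) powr (s - 2)) * (N h * dsq u h)))"
        using AE_lborel_singleton[of "0::real^'n"]
      proof eventually_elim
        fix h :: "real^'n" assume h: "h \<noteq> 0"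
        have ex: "s + - (real CARD('n) + 2 * s) = - (real CARD('n) + s)" by simp
        have "\<bar>?b h\<bar> \<le> C * \<epsilon> k powr (- (real CARD('n) + s)) * maj s ((1 / \<epsilon> k) *\<^sub>R h)"
          using component_le_norm_cart[of "cut_defect s (\<epsilon> k) h" i] C(2) e by (meson order.trans)
        also have "\<dots> = C * \<epsilon> k powr s * (\<epsilon> k powr (- (real CARD('n) + 2 * s)) * maj s ((1 / \<epsilon> k) *\<^sub>R h))"
          unfolding ex[symmetric] powr_add by (simp only: mult.assoc)
        also have "\<dots> \<le> C * \<epsilon> k powr s * (min 1 ((norm h / \<epsilon> k) powr (s - 2)) * N h)"
          unfolding N_def using C(1) by (intro mult_left_mono maj_scaled_le e h) auto
        finally have "\<bar>?b h\<bar> * dsq u h \<le> C * \<epsilon> k powr s * (min 1 ((norm h / \<epsilon> k) powr (s - 2)) * N h) * dsq u h"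
          by (rule mult_right_mono) (rule dsq_nonneg)
        then show "ennreal (\<bar>?b h\<bar> * dsq u h) \<le> ennreal (C * \<epsilon> k powr s * (min 1 ((norm h / \<epsilon> k) powr (s - 2)) * (N h * dsq u h)))"
          by (intro ennreal_leI) (simp only: mult.assoc)
      qed
    qed
    also have "\<dots> = ennreal (LINT h|lborel. C * \<epsilon> k powr s * (min 1 ((norm h / \<epsilon> k) powr (s - 2)) * (N h * dsq u h)))"
      by (rule nn_integral_eq_integral) (use Ji C in \<open>auto simp: N_def dsq_nonneg\<close>)
    also have "(LINT h|lborel. C * \<epsilon> k powr s * (min 1 ((norm h / \<epsilon> k) powr (s - 2)) * (N h * dsq u h))) = C * \<epsilon> k powr s * J k"
      unfolding J_def by (rule integral_mult_right_zero)
    finally have D: "(\<integral>\<^sup>+h. ennreal (\<bar>?b h\<bar> * dsq u h) \<partial>lborel) \<le> ennreal (C * \<epsilon> k powr s * J k)" .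
    have "ennreal (sqnorm (cv ?b u)) = (\<integral>\<^sup>+x. ennreal ((cmod (cv ?b u x))\<^sup>2) \<partial>lborel)" by (rule nn_integral_sqnorm[symmetric, OF cv_L2[OF uL kb]])
    also have "\<dots> \<le> ennreal (LINT h|lborel. \<bar>?b h\<bar>) * (\<integral>\<^sup>+h. ennreal (\<bar>?b h\<bar> * dsq u h) \<partial>lborel)" by (rule nn_cv_delta[OF uL kb 0])
    also have "\<dots> \<le> ennreal (C' * \<epsilon> k powr (- s)) * ennreal (C * \<epsilon> k powr s * J k)" by (intro mult_mono ennreal_leI L1 D) auto
    also have "\<dots> = ennreal (C' * C * J k)"
    proof -
      have "\<epsilon> k powr (- s) * \<epsilon> k powr s = 1" using e by (simp add: powr_add[symmetric])
      moreover have "C' * \<epsilon> k powr (- s) * (C * \<epsilon> k powr s * J k) = C' * C * J k * (\<epsilon> k powr (- s) * \<epsilon> k powr s)" by (simp only: mult_ac)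
      ultimately have "C' * \<epsilon> k powr (- s) * (C * \<epsilon> k powr s * J k) = C' * C * J k" by (simp only: mult_1_right)
      then show ?thesis using C' C J0 by (simp add: ennreal_mult[symmetric])
    qed
    finally show "sqnorm (cv ?b u) \<le> C' * C * J k" using C' C J0 by (simp add: ennreal_le_iff)
  qed
qed

text \<open>The sharp kernel is the regularised one with T = 1 / \<epsilon>^2 plus the defect, whose
  contribution vanishes in L2.\<close>

lemma cut_gradient:
  fixes u :: "real^'n \<Rightarrow> complex" and \<epsilon> :: "nat \<Rightarrow> real"
  assumes u: "u \<in> gagliardo s" and g: "reg_gradient u g" and \<epsilon>: "\<And>k. \<epsilon> k > 0" "\<epsilon> \<longlonglongrightarrow> 0"
  shows "(\<lambda>k. sqnorm (\<lambda>x. cv (\<lambda>h. cut s (\<epsilon> k) h $ i) u x - g i x)) \<longlonglongrightarrow> 0"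
proof -
  note uL = gagliardo_D(1)[OF u]
  define T where "T = (\<lambda>k. 1 / (\<epsilon> k)\<^sup>2)"
  have T: "T k > 0" for k using \<epsilon>(1)[of k] by (simp add: T_def)
  have "(\<lambda>k. (\<epsilon> k)\<^sup>2) \<longlonglongrightarrow> 0" using tendsto_power[OF \<epsilon>(2), of 2] by simp
  then have Tl: "filterlim T at_top sequentially" unfolding T_def
    using \<epsilon>(1) by (intro LIM_at_top_divide[OF tendsto_const]) (simp_all add: less_imp_neq[symmetric])
  have gi: "g i \<in> L2" and l: "(\<lambda>k. sqnorm (\<lambda>x. cv (\<lambda>h. reg s (T k) h $ i) u x - g i x)) \<longlonglongrightarrow> 0"
    using g T Tl unfolding reg_gradient_def by blast+
  have b: "(\<lambda>k. 2 * sqnorm (cv (\<lambda>h. cut_defect s (\<epsilon> k) h $ i) u) + 2 * sqnorm (\<lambda>x. cv (\<lambda>h. reg s (T k) h $ i) u x - g i x)) \<longlonglongrightarrow> 0"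
    using tendsto_add[OF tendsto_mult_left[OF cut_defect_limit[OF u \<epsilon>], of 2] tendsto_mult_left[OF l, of 2]] by simp
  show ?thesis
  proof (rule tendsto_sandwich[OF _ _ tendsto_const b]; intro always_eventually allI)
    fix k
    show "0 \<le> sqnorm (\<lambda>x. cv (\<lambda>h. cut s (\<epsilon> k) h $ i) u x - g i x)" by (rule sqnorm_nonneg)
    have e: "cv (\<lambda>h. cut_defect s (\<epsilon> k) h $ i) u x = cv (\<lambda>h. cut s (\<epsilon> k) h $ i) u x - cv (\<lambda>h. reg s (T k) h $ i) u x" for x
      using cv_diff_kernel[OF uL kern_cut[OF \<epsilon>(1), of k i] kern_reg[OF T, of k i], of x]
      unfolding cut_defect_def[OF s] T_def vector_minus_component .
    show "sqnorm (\<lambda>x. cv (\<lambda>h. cut s (\<epsilon> k) h $ i) u x - g i x) \<le> 2 * sqnorm (cv (\<lambda>h. cut_defect s (\<epsilon> k) h $ i) u) + 2 * sqnorm (\<lambda>x. cv (\<lambda>h. reg s (T k) h $ i) u x - g i x)"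
    proof -
      have f: "cv (\<lambda>h. cut s (\<epsilon> k) h $ i) u x - g i x = cv (\<lambda>h. cut_defect s (\<epsilon> k) h $ i) u x + (cv (\<lambda>h. reg s (T k) h $ i) u x - g i x)" for x
        by (simp only: e) simp
      show ?thesis unfolding f
        by (rule sqnorm_add[OF cv_L2[OF uL kern_cut_defect[OF \<epsilon>(1)]] L2_diff[OF cv_L2[OF uL kern_reg[OF T]] gi]])
    qed
  qed
qed

end

section \<open>The operators\<close>

lemma truncation_shift:
  fixes K :: "'a::euclidean_space \<Rightarrow> 'a \<Rightarrow> 'b::euclidean_space"
  shows "set_integrable lborel {y. \<epsilon> < dist x y} (K x) \<longleftrightarrow> integrable lborel (\<lambda>h. indicator {h. \<epsilon> < norm h} h *\<^sub>R K x (x + h))"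
    and "truncation \<epsilon> K x = (LINT h|lborel. indicator {h. \<epsilon> < norm h} h *\<^sub>R K x (x + h))"
proof -
  have e: "indicator {y. \<epsilon> < dist x y} (x + h) *\<^sub>R K x (x + h) = indicator {h. \<epsilon> < norm h} h *\<^sub>R K x (x + h)" for h
    by (simp add: indicator_def dist_norm)
  show "set_integrable lborel {y. \<epsilon> < dist x y} (K x) \<longleftrightarrow> integrable lborel (\<lambda>h. indicator {h. \<epsilon> < norm h} h *\<^sub>R K x (x + h))"
    using integrable_lborel_shift[of "\<lambda>y. indicator {y. \<epsilon> < dist x y} y *\<^sub>R K x y" x] unfolding set_integrable_def e by simp
  show "truncation \<epsilon> K x = (LINT h|lborel. indicator {h. \<epsilon> < norm h} h *\<^sub>R K x (x + h))"
    using integral_lborel_shift[of "\<lambda>y. indicator {y. \<epsilon> < dist x y} y *\<^sub>R K x y" x] unfolding truncation_def set_lebesgue_integral_def e by simp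
qed

lemma has_pv_dual_cmult:
  assumes "has_pv_dual s K \<Lambda>"
  shows "has_pv_dual s (\<lambda>x y. c * K x y) (\<lambda>\<psi>. c * \<Lambda> \<psi>)"
proof -
  have t: "truncation \<epsilon> (\<lambda>x y. c * K x y) x = c * truncation \<epsilon> K x" for \<epsilon> x
    unfolding truncation_def set_lebesgue_integral_def mult_scaleR_right[symmetric] integral_mult_right_zero ..
  have "truncations_defined (\<lambda>x y. c * K x y)"
    unfolding truncations_defined_def set_integrable_def mult_scaleR_right[symmetric]
  proof (intro allI impI)
    fix \<epsilon> :: real assume "\<epsilon> > 0"
    then have "AE x in lborel. integrable lborel (\<lambda>y. indicator {y. \<epsilon> < dist x y} y *\<^sub>R K x y)"
      using assms unfolding has_pv_dual_def truncations_defined_def set_integrable_def by blast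
    then show "AE x in lborel. integrable lborel (\<lambda>y. c * (indicator {y. \<epsilon> < dist x y} y *\<^sub>R K x y))"
      by eventually_elim (rule integrable_mult_right)
  qed
  moreover have "((\<lambda>\<epsilon>. LINT x|lborel. c * (truncation \<epsilon> K x * \<psi> x)) \<longlongrightarrow> c * \<Lambda> \<psi>) (at_right 0)" if "\<psi> \<in> sobolev s" for \<psi>
    using assms that unfolding has_pv_dual_def integral_mult_right_zero by (intro tendsto_intros) blast
  ultimately show ?thesis using assms unfolding has_pv_dual_def t mult.assoc by simp
qed

lemma has_pv_integral_unique:
  assumes "has_pv_integral S f I" "has_pv_integral S f J" shows "I = J"
  using assms tendsto_unique[OF trivial_limit_at_right_real] unfolding has_pv_integral_def by blast

lemma pv_integral_eq: "has_pv_integral S f I \<Longrightarrow> pv_integral S f = I"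
  unfolding pv_integral_def using has_pv_integral_unique by (intro the_equality) blast+

lemma sobolev_subset_gagliardo: "0 < s \<Longrightarrow> s < 1 \<Longrightarrow> sobolev s \<subseteq> gagliardo s"
  using sobolev_gagliardo by (auto simp: gagliardo_def sobolev_def)

section \<open>Componentwise integration of vector-valued functions\<close>

lemma bounded_linear_axis: "bounded_linear (axis i :: complex \<Rightarrow> complex^'n)"
proof (rule bounded_linear_intro[where K=1])
  fix x :: complex
  have "(norm (axis i x $ j))\<^sup>2 = (if j = i then (norm x)\<^sup>2 else 0)" for j by (simp add: axis_def)
  then show "norm (axis i x) \<le> norm x * 1" by (simp add: norm_vec_def L2_set_def)
qed (auto simp: vec_eq_iff axis_def)

lemma
  fixes F :: "'a::euclidean_space \<Rightarrow> 'n::finite \<Rightarrow> complex"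
  assumes F: "\<And>i. integrable lborel (\<lambda>h. F h i)"
  shows integrable_vec_lambda: "integrable lborel (\<lambda>h. \<chi> i. F h i)"
    and integral_vec_lambda: "(LINT h|lborel. (\<chi> i. F h i)) = (\<chi> i. LINT h|lborel. F h i)"
proof -
  have e: "(\<lambda>h. \<chi> i. F h i) = (\<lambda>h. \<Sum>i\<in>UNIV. axis i (F h i))"
    by (auto simp: vec_eq_iff axis_def fun_eq_iff sum.delta)
  show i: "integrable lborel (\<lambda>h. \<chi> i. F h i)"
    unfolding e by (intro Bochner_Integration.integrable_sum integrable_bounded_linear[OF bounded_linear_axis F])
  show "(LINT h|lborel. (\<chi> i. F h i)) = (\<chi> i. LINT h|lborel. F h i)"
    using integral_bounded_linear[OF bounded_linear_vec_nth i, symmetric] by (simp add: vec_eq_iff)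
qed

lemma norm_vec_square: "(norm v)\<^sup>2 = (\<Sum>i\<in>UNIV. (norm (v $ i))\<^sup>2)" for v :: "complex^'n"
  by (simp add: norm_vec_def L2_set_def sum_nonneg)

lemma borel_measurable_vec_lambda:
  fixes g :: "'n::finite \<Rightarrow> 'a::euclidean_space \<Rightarrow> complex"
  assumes "\<And>i. g i \<in> borel_measurable borel"
  shows "(\<lambda>x. \<chi> i. g i x) \<in> borel_measurable borel"
proof -
  have e: "(\<lambda>x. \<chi> i. g i x) = (\<lambda>x. \<Sum>i\<in>UNIV. axis i (g i x))"
    by (auto simp: vec_eq_iff axis_def fun_eq_iff sum.delta)
  show ?thesis unfolding e
    by (intro borel_measurable_sum measurable_compose[OF assms borel_measurable_continuous_onI] linear_continuous_on bounded_linear_axis)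
qed

lemma L2_vec_lambda:
  fixes g :: "'n::finite \<Rightarrow> 'a::euclidean_space \<Rightarrow> complex"
  assumes g: "\<And>i. g i \<in> L2"
  shows "(\<lambda>x. \<chi> i. g i x) \<in> L2"
  unfolding L2_def mem_Collect_eq norm_vec_square vec_lambda_beta
  by (intro conjI borel_measurable_vec_lambda Bochner_Integration.integrable_sum L2_D g)

lemma nn_vec_lambda:
  fixes g :: "'n::finite \<Rightarrow> 'a::euclidean_space \<Rightarrow> complex"
  assumes g: "\<And>i. g i \<in> L2"
  shows "(\<integral>\<^sup>+x. ennreal ((norm (\<chi> i. g i x))\<^sup>2) \<partial>lborel) = ennreal (\<Sum>i\<in>UNIV. sqnorm (g i))"
proof -
  have "sqnorm (\<lambda>x. \<chi> i. g i x) = (\<Sum>i\<in>UNIV. sqnorm (g i))"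
    unfolding sqnorm_def norm_vec_square vec_lambda_beta by (intro Bochner_Integration.integral_sum L2_D g)
  then show ?thesis using nn_integral_sqnorm[OF L2_vec_lambda[of g, OF g]] by simp
qed

section \<open>Principal values of gradient, divergence and fractional Laplacian\<close>

context
  fixes s :: real
  assumes s: "0 < s" "s < 1"
begin

text \<open>The truncated kernel is odd, so the term with u x integrates to 0 and the truncation is
  a convolution.\<close>

lemma gradient_truncation:
  fixes u :: "real^'n \<Rightarrow> complex"
  defines "K \<equiv> \<lambda>x y. \<chi> i. (u y - u x) * of_real (riesz s (y - x) $ i)"
  assumes u: "u \<in> L2" and \<epsilon>: "\<epsilon> > 0"
  shows "set_integrable lborel {y. \<epsilon> < dist x y} (K x)"
    and "truncation \<epsilon> K x = (\<chi> i. cv (\<lambda>h. cut s \<epsilon> h $ i) u x)"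
proof -
  note kc = kern_cut[OF s \<epsilon>]
  have e: "indicator {h. \<epsilon> < norm h} h *\<^sub>R K x (x + h) = (\<chi> i. of_real (cut s \<epsilon> h $ i) * u (x + h) - of_real (cut s \<epsilon> h $ i) * u x)" for h
    by (simp add: K_def vec_eq_iff cut_def[OF s] indicator_def algebra_simps)
  have j: "integrable lborel (\<lambda>h. of_real (cut s \<epsilon> h $ i) * u x)" for i
    by (intro integrable_mult_left integrable_of_real kern_D(1)[OF kc])
  have i: "integrable lborel (\<lambda>h. of_real (cut s \<epsilon> h $ i) * u (x + h) - of_real (cut s \<epsilon> h $ i) * u x)" for i
    by (intro Bochner_Integration.integrable_diff cv_integrable[OF u kc] j)
  have 0: "(LINT h|lborel. cut s \<epsilon> h $ i) = 0" for i :: 'n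
    by (rule integral_lborel_odd) (simp add: cut_minus[OF s])
  have "(LINT h|lborel. of_real (cut s \<epsilon> h $ i) * u (x + h) - of_real (cut s \<epsilon> h $ i) * u x) = cv (\<lambda>h. cut s \<epsilon> h $ i) u x" for i
  proof -
    have "(LINT h|lborel. of_real (cut s \<epsilon> h $ i) * u x) = 0"
      unfolding integral_mult_left_zero integral_complex_of_real 0 by simp
    then show ?thesis unfolding cv_def
      by (subst Bochner_Integration.integral_diff[OF cv_integrable[OF u kc] j]) simp
  qed
  then show "truncation \<epsilon> K x = (\<chi> i. cv (\<lambda>h. cut s \<epsilon> h $ i) u x)"
    unfolding truncation_shift e by (subst integral_vec_lambda[OF i]) simp
  show "set_integrable lborel {y. \<epsilon> < dist x y} (K x)"
    unfolding truncation_shift e by (rule integrable_vec_lambda[OF i])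
qed

lemma has_pv_gradient:
  fixes u :: "real^'n \<Rightarrow> complex"
  assumes u: "u \<in> gagliardo s" and g: "reg_gradient s u g"
  shows "has_pv_L2 (\<lambda>x y. \<chi> i. (u y - u x) * of_real (riesz s (y - x) $ i)) (\<lambda>x. \<chi> i. g i x)"
proof -
  note uL = gagliardo_D(1)[OF u]
  have gL: "g i \<in> L2" for i using g unfolding reg_gradient_def[OF s] by blast
  note t = gradient_truncation[OF uL]
  show ?thesis
    unfolding has_pv_L2_def
  proof (intro conjI L2_vec_lambda gL)
    show "truncations_defined (\<lambda>x y. \<chi> i. (u y - u x) * of_real (riesz s (y - x) $ i))"
      unfolding truncations_defined_def using t(1) by blast
    show "L2_tendsto (\<lambda>\<epsilon>. truncation \<epsilon> (\<lambda>x y. \<chi> i. (u y - u x) * of_real (riesz s (y - x) $ i))) (\<lambda>x. \<chi> i. g i x) (at_right 0)"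
      unfolding L2_tendsto_def
    proof (rule tendsto_at_right_sequentially[of 0 1])
      fix \<epsilon> :: "nat \<Rightarrow> real" assume \<epsilon>: "\<And>n. 0 < \<epsilon> n" "\<epsilon> \<longlonglongrightarrow> 0"
      have e: "(\<chi> i. cv (\<lambda>h. cut s (\<epsilon> k) h $ i) u x) - (\<chi> i. g i x) = (\<chi> i. cv (\<lambda>h. cut s (\<epsilon> k) h $ i) u x - g i x)" for k x
        by (simp add: vec_eq_iff)
      have nn: "(\<integral>\<^sup>+x. ennreal ((norm (truncation (\<epsilon> k) (\<lambda>x y. \<chi> i. (u y - u x) * of_real (riesz s (y - x) $ i)) x - (\<chi> i. g i x)))\<^sup>2) \<partial>lborel)
        = ennreal (\<Sum>i\<in>UNIV. sqnorm (\<lambda>x. cv (\<lambda>h. cut s (\<epsilon> k) h $ i) u x - g i x))" for k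
        unfolding t(2)[OF \<epsilon>(1)] e by (rule nn_vec_lambda) (intro L2_diff cv_L2 uL kern_cut[OF s] \<epsilon> gL)
      have "(\<lambda>k. \<Sum>i\<in>UNIV. sqnorm (\<lambda>x. cv (\<lambda>h. cut s (\<epsilon> k) h $ i) u x - g i x)) \<longlonglongrightarrow> (\<Sum>i\<in>(UNIV::'n set). 0)"
        by (intro tendsto_sum cut_gradient[OF s u g] \<epsilon>)
      then have "(\<lambda>k. ennreal (\<Sum>i\<in>UNIV. sqnorm (\<lambda>x. cv (\<lambda>h. cut s (\<epsilon> k) h $ i) u x - g i x))) \<longlonglongrightarrow> ennreal 0"
        by (intro tendsto_ennrealI) simp
      then show "(\<lambda>k. \<integral>\<^sup>+x. ennreal ((norm (truncation (\<epsilon> k) (\<lambda>x y. \<chi> i. (u y - u x) * of_real (riesz s (y - x) $ i)) x - (\<chi> i. g i x)))\<^sup>2) \<partial>lborel) \<longlonglongrightarrow> 0"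
        unfolding nn by simp
    qed simp
  qed
qed

text \<open>The same cancellation removes g i x, so the plus sign in the divergence and the minus
  sign in the gradient lead to the same kind of convolution.\<close>

lemma divergence_truncation:
  fixes g :: "'n::finite \<Rightarrow> real^'n \<Rightarrow> complex"
  defines "K \<equiv> \<lambda>x y. \<Sum>i\<in>UNIV. (g i x + g i y) * of_real (riesz s (y - x) $ i)"
  assumes g: "\<And>i. g i \<in> L2" and \<epsilon>: "\<epsilon> > 0"
  shows "set_integrable lborel {y. \<epsilon> < dist x y} (K x)"
    and "truncation \<epsilon> K x = (\<Sum>i\<in>UNIV. cv (\<lambda>h. cut s \<epsilon> h $ i) (g i) x)"
proof -
  note kc = kern_cut[OF s \<epsilon>]
  have e: "indicator {h. \<epsilon> < norm h} h *\<^sub>R K x (x + h) = (\<Sum>i\<in>UNIV. of_real (cut s \<epsilon> h $ i) * g i (x + h) + of_real (cut s \<epsilon> h $ i) * g i x)" for h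
    by (simp add: K_def cut_def[OF s] indicator_def algebra_simps)
  have j: "integrable lborel (\<lambda>h. of_real (cut s \<epsilon> h $ i) * g i x)" for i
    by (intro integrable_mult_left integrable_of_real kern_D(1)[OF kc])
  have i: "integrable lborel (\<lambda>h. of_real (cut s \<epsilon> h $ i) * g i (x + h) + of_real (cut s \<epsilon> h $ i) * g i x)" for i
    by (intro Bochner_Integration.integrable_add cv_integrable[OF g kc] j)
  have 0: "(LINT h|lborel. cut s \<epsilon> h $ i) = 0" for i :: 'n
    by (rule integral_lborel_odd) (simp add: cut_minus[OF s])
  have "(LINT h|lborel. of_real (cut s \<epsilon> h $ i) * g i (x + h) + of_real (cut s \<epsilon> h $ i) * g i x) = cv (\<lambda>h. cut s \<epsilon> h $ i) (g i) x" for i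
  proof -
    have "(LINT h|lborel. of_real (cut s \<epsilon> h $ i) * g i x) = 0"
      unfolding integral_mult_left_zero integral_complex_of_real 0 by simp
    then show ?thesis unfolding cv_def
      by (subst Bochner_Integration.integral_add[OF cv_integrable[OF g kc] j]) simp
  qed
  then show "truncation \<epsilon> K x = (\<Sum>i\<in>UNIV. cv (\<lambda>h. cut s \<epsilon> h $ i) (g i) x)"
    unfolding truncation_shift e by (subst Bochner_Integration.integral_sum[OF i]) simp
  show "set_integrable lborel {y. \<epsilon> < dist x y} (K x)"
    unfolding truncation_shift e by (intro Bochner_Integration.integrable_sum i)
qed

text \<open>Antisymmetry of the odd kernel moves the truncated operator from g to the test function,
  where it is a truncated gradient converging in L2. This is why the limit exists in duality with
  H^s; it is minus the pairing of the two gradients.\<close>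

lemma has_pv_divergence:
  fixes u :: "real^'n \<Rightarrow> complex"
  assumes u: "u \<in> gagliardo s" and g: "reg_gradient s u g"
  shows "has_pv_dual s (\<lambda>x y. \<Sum>i\<in>UNIV. (g i x + g i y) * of_real (riesz s (y - x) $ i))
    (\<lambda>\<psi>. - (of_real (kappa TYPE(real^'n) s) / 2 * energy s u \<psi>))"
proof -
  note uL = gagliardo_D(1)[OF u]
  have gL: "g i \<in> L2" for i using g unfolding reg_gradient_def[OF s] by blast
  note t = divergence_truncation[of g, OF gL]
  show ?thesis
    unfolding has_pv_dual_def
  proof (intro conjI ballI)
    show "truncations_defined (\<lambda>x y. \<Sum>i\<in>UNIV. (g i x + g i y) * of_real (riesz s (y - x) $ i))"
      unfolding truncations_defined_def using t(1) by blast
    fix \<psi> :: "real^'n \<Rightarrow> complex" assume "\<psi> \<in> sobolev s"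
    then have \<psi>: "\<psi> \<in> gagliardo s" using sobolev_subset_gagliardo[OF s] by blast
    note \<psi>L = gagliardo_D(1)[OF \<psi>]
    obtain g' where g': "reg_gradient s \<psi> g'" using reg_gradient_exists[OF s \<psi>] by blast
    have g'L: "g' i \<in> L2" for i using g' unfolding reg_gradient_def[OF s] by blast
    have i: "integrable lborel (\<lambda>x. cv (\<lambda>h. cut s \<epsilon> h $ i) (g i) x * \<psi> x)" if "\<epsilon> > 0" for \<epsilon> i
      by (intro L2_mult cv_L2 gL \<psi>L kern_cut[OF s that])
    show "\<forall>\<epsilon>>0. integrable lborel (\<lambda>x. truncation \<epsilon> (\<lambda>x y. \<Sum>i\<in>UNIV. (g i x + g i y) * of_real (riesz s (y - x) $ i)) x * \<psi> x)"
    proof (intro allI impI)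
      fix \<epsilon> :: real assume \<epsilon>: "\<epsilon> > 0"
      show "integrable lborel (\<lambda>x. truncation \<epsilon> (\<lambda>x y. \<Sum>i\<in>UNIV. (g i x + g i y) * of_real (riesz s (y - x) $ i)) x * \<psi> x)"
        unfolding t(2)[OF \<epsilon>] sum_distrib_right by (intro Bochner_Integration.integrable_sum i \<epsilon>)
    qed
    show "((\<lambda>\<epsilon>. LINT x|lborel. truncation \<epsilon> (\<lambda>x y. \<Sum>i\<in>UNIV. (g i x + g i y) * of_real (riesz s (y - x) $ i)) x * \<psi> x)
      \<longlongrightarrow> - (of_real (kappa TYPE(real^'n) s) / 2 * energy s u \<psi>)) (at_right 0)"
    proof (rule tendsto_at_right_sequentially[of 0 1])
      fix \<epsilon> :: "nat \<Rightarrow> real" assume \<epsilon>: "\<And>n. 0 < \<epsilon> n" "\<epsilon> \<longlonglongrightarrow> 0"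
      have e: "(LINT x|lborel. truncation (\<epsilon> k) (\<lambda>x y. \<Sum>i\<in>UNIV. (g i x + g i y) * of_real (riesz s (y - x) $ i)) x * \<psi> x)
        = - (\<Sum>i\<in>UNIV. LINT x|lborel. g i x * cv (\<lambda>h. cut s (\<epsilon> k) h $ i) \<psi> x)" for k
      proof -
        have "(LINT x|lborel. truncation (\<epsilon> k) (\<lambda>x y. \<Sum>i\<in>UNIV. (g i x + g i y) * of_real (riesz s (y - x) $ i)) x * \<psi> x)
          = (\<Sum>i\<in>UNIV. LINT x|lborel. cv (\<lambda>h. cut s (\<epsilon> k) h $ i) (g i) x * \<psi> x)"
          unfolding t(2)[OF \<epsilon>(1)] sum_distrib_right by (rule Bochner_Integration.integral_sum) (rule i[OF \<epsilon>(1)])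
        also have "\<dots> = (\<Sum>i\<in>UNIV. - (LINT x|lborel. g i x * cv (\<lambda>h. cut s (\<epsilon> k) h $ i) \<psi> x))"
          by (intro sum.cong refl cv_antisym gL \<psi>L kern_cut[OF s \<epsilon>(1)]) (simp add: cut_minus[OF s])
        finally show ?thesis by (simp only: sum_negf)
      qed
      have "(\<lambda>k. \<Sum>i\<in>UNIV. LINT x|lborel. g i x * cv (\<lambda>h. cut s (\<epsilon> k) h $ i) \<psi> x) \<longlonglongrightarrow> (\<Sum>i\<in>UNIV. LINT x|lborel. g i x * g' i x)"
        by (intro tendsto_sum L2_product_limit cut_gradient[OF s \<psi> g'] \<epsilon> cv_L2 \<psi>L kern_cut[OF s] gL g'L) (simp add: sqnorm_def)
      then show "(\<lambda>k. LINT x|lborel. truncation (\<epsilon> k) (\<lambda>x y. \<Sum>i\<in>UNIV. (g i x + g i y) * of_real (riesz s (y - x) $ i)) x * \<psi> x)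
        \<longlonglongrightarrow> - (of_real (kappa TYPE(real^'n) s) / 2 * energy s u \<psi>)"
        unfolding e reg_gradient_pairing[OF s u \<psi> g g'] by (rule tendsto_minus)
    qed simp
  qed
qed

text \<open>The truncated kernel is even and integrable, so the pairing is C times its integral
  against corr(0) - corr(l), which symmetrises into increments with the factor 1 / 2; dominated
  convergence then removes the truncation.\<close>

lemma has_fractional_laplacian_energy:
  fixes u :: "real^'n \<Rightarrow> complex"
  assumes u: "u \<in> gagliardo s"
  shows "has_fractional_laplacian s u (\<lambda>\<psi>. of_real (C_const CARD('n) s) / 2 * energy s u \<psi>)"
proof -
  note uL = gagliardo_D(1)[OF u]
  define m where "m = real CARD('n) + 2 * s"
  define C where "C = C_const CARD('n) s"
  define kf where "kf = (\<lambda>\<epsilon> (h::real^'n). indicator {h. \<epsilon> < norm h} h * norm h powr (- m))"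
  define K where "K = (\<lambda>x y. of_real C * ((u x - u y) / of_real (norm (x - y) powr m)))"
  have m: "m > 0" using s by (simp add: m_def)
  have kf_int: "integrable lborel (kf \<epsilon>)" if \<epsilon>: "\<epsilon> > 0" for \<epsilon>
  proof (rule Bochner_Integration.integrable_bound)
    show "integrable lborel (\<lambda>x::real^'n. norm x powr (- m) * indicator {x. \<epsilon> \<le> norm x} x)"
      by (rule integrable_norm_powr_tail[OF _ \<epsilon>]) (use s in \<open>simp add: m_def\<close>)
    show "kf \<epsilon> \<in> borel_measurable lborel" unfolding kf_def by measurable
  qed (auto simp: kf_def split: split_indicator)
  have kf_le: "\<bar>kf \<epsilon> h\<bar> \<le> norm h powr (- m)" for \<epsilon> h by (auto simp: kf_def split: split_indicator)
  have kf: "kern (kf \<epsilon>)" if \<epsilon>: "\<epsilon> > 0" for \<epsilon>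
    unfolding kern_def
  proof (intro conjI kf_int \<epsilon> exI[of _ "\<epsilon> powr (- m)"] allI)
    show "\<bar>kf \<epsilon> h\<bar> \<le> \<epsilon> powr (- m)" for h
      using \<epsilon> m powr_mono2'[of "- m" \<epsilon> "norm h"] by (auto simp: kf_def split: split_indicator)
  qed
  have even: "kf \<epsilon> (- h) = kf \<epsilon> h" for \<epsilon> h by (simp add: kf_def indicator_def)
  have e: "indicator {h. \<epsilon> < norm h} h *\<^sub>R K x (x + h) = of_real C * (of_real (kf \<epsilon> h) * u x - of_real (kf \<epsilon> h) * u (x + h))" for \<epsilon> x h
    by (simp add: K_def kf_def indicator_def powr_minus divide_inverse algebra_simps)
  have i1: "integrable lborel (\<lambda>h. of_real (kf \<epsilon> h) * u x)" if "\<epsilon> > 0" for \<epsilon> x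
    using kf_int[OF that] by auto
  have i2: "integrable lborel (\<lambda>h. of_real (kf \<epsilon> h) * u (x + h))" if "\<epsilon> > 0" for \<epsilon> x
    by (rule cv_integrable[OF uL kf[OF that]])
  have t: "truncation \<epsilon> K x = of_real C * (of_real (LINT h|lborel. kf \<epsilon> h) * u x - cv (kf \<epsilon>) u x)" if \<epsilon>: "\<epsilon> > 0" for \<epsilon> x
  proof -
    have "(LINT h|lborel. of_real (kf \<epsilon> h) * u x) = of_real (LINT h|lborel. kf \<epsilon> h) * u x"
      unfolding integral_mult_left_zero integral_complex_of_real ..
    then show ?thesis unfolding truncation_shift e integral_mult_right_zero cv_def
      by (subst Bochner_Integration.integral_diff[OF i1[OF \<epsilon>] i2[OF \<epsilon>]]) simp
  qed
  have "has_pv_dual s K (\<lambda>\<psi>. of_real C / 2 * energy s u \<psi>)"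
    unfolding has_pv_dual_def
  proof (intro conjI ballI)
    show "truncations_defined K"
      unfolding truncations_defined_def truncation_shift e
      by (intro allI impI AE_I2 integrable_mult_right Bochner_Integration.integrable_diff i1 i2)
    fix \<psi> :: "real^'n \<Rightarrow> complex" assume "\<psi> \<in> sobolev s"
    then have \<psi>: "\<psi> \<in> gagliardo s" using sobolev_subset_gagliardo[OF s] by blast
    note \<psi>L = gagliardo_D(1)[OF \<psi>]
    have e2: "truncation \<epsilon> K x * \<psi> x = of_real C * (of_real (LINT h|lborel. kf \<epsilon> h) * (u x * \<psi> x) - cv (kf \<epsilon>) u x * \<psi> x)" if "\<epsilon> > 0" for \<epsilon> x
      unfolding t[OF that] by (simp add: algebra_simps)
    have j: "integrable lborel (\<lambda>x. cv (kf \<epsilon>) u x * \<psi> x)" if "\<epsilon> > 0" for \<epsilon>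
      by (intro L2_mult cv_L2 uL \<psi>L kf that)
    show "\<forall>\<epsilon>>0. integrable lborel (\<lambda>x. truncation \<epsilon> K x * \<psi> x)"
    proof (intro allI impI)
      fix \<epsilon> :: real assume \<epsilon>: "\<epsilon> > 0"
      show "integrable lborel (\<lambda>x. truncation \<epsilon> K x * \<psi> x)"
        unfolding e2[OF \<epsilon>] by (intro integrable_mult_right Bochner_Integration.integrable_diff j[OF \<epsilon>] L2_mult uL \<psi>L)
    qed
    show "((\<lambda>\<epsilon>. LINT x|lborel. truncation \<epsilon> K x * \<psi> x) \<longlongrightarrow> of_real C / 2 * energy s u \<psi>) (at_right 0)"
    proof (rule tendsto_at_right_sequentially[of 0 1])
      fix \<epsilon> :: "nat \<Rightarrow> real" assume \<epsilon>: "\<And>n. 0 < \<epsilon> n" "\<epsilon> \<longlonglongrightarrow> 0"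
      have e3: "(LINT x|lborel. truncation (\<epsilon> k) K x * \<psi> x) = of_real C / 2 * (LINT l|lborel. of_real (kf (\<epsilon> k) l) * dcorr u \<psi> l)" for k
      proof -
        note k = kf[OF \<epsilon>(1), of k]
        have "(LINT x|lborel. truncation (\<epsilon> k) K x * \<psi> x) = of_real C * (of_real (LINT h|lborel. kf (\<epsilon> k) h) * (LINT x|lborel. u x * \<psi> x) - (LINT x|lborel. cv (kf (\<epsilon> k)) u x * \<psi> x))"
          unfolding e2[OF \<epsilon>(1)] integral_mult_right_zero
          using j[OF \<epsilon>(1), of k] L2_mult[OF uL \<psi>L] by (subst Bochner_Integration.integral_diff) auto
        also have "(LINT x|lborel. u x * \<psi> x) = corr u \<psi> 0" by (simp add: corr_def)
        also have "(LINT x|lborel. cv (kf (\<epsilon> k)) u x * \<psi> x) = (LINT h|lborel. of_real (kf (\<epsilon> k) h) * corr u \<psi> h)"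
          by (rule cv_pairing[OF uL \<psi>L k])
        also have "of_real (LINT h|lborel. kf (\<epsilon> k) h) * corr u \<psi> 0 = (LINT h|lborel. of_real (kf (\<epsilon> k) h) * corr u \<psi> 0)"
          unfolding integral_mult_left_zero integral_complex_of_real ..
        also have "(LINT h|lborel. of_real (kf (\<epsilon> k) h) * corr u \<psi> 0) - (LINT h|lborel. of_real (kf (\<epsilon> k) h) * corr u \<psi> h)
          = (LINT h|lborel. of_real (kf (\<epsilon> k) h) * (corr u \<psi> 0 - corr u \<psi> h))"
          unfolding right_diff_distrib
          by (rule Bochner_Integration.integral_diff[symmetric]) (use kern_D(1)[OF k] integrable_corr[OF uL \<psi>L kern_D(1)[OF k]] in auto)
        also have "\<dots> = (LINT l|lborel. of_real (kf (\<epsilon> k) l) * dcorr u \<psi> l) / 2"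
          by (rule even_kernel_dcorr(1)[OF uL \<psi>L kern_D(1)[OF k] even])
        finally show ?thesis by simp
      qed
      have "(\<lambda>k. LINT l|lborel. of_real (kf (\<epsilon> k) l) * dcorr u \<psi> l) \<longlonglongrightarrow> of_real 1 * energy s u \<psi>"
      proof (rule dcorr_limit[OF u \<psi>, where C=1])
        show "(\<lambda>l. of_real (kf (\<epsilon> k) l) * dcorr u \<psi> l) \<in> borel_measurable lborel" for k
          by (rule borel_measurable_integrable[OF even_kernel_dcorr(2)[OF uL \<psi>L kern_D(1)[OF kf[OF \<epsilon>(1)]] even]])
        show "\<bar>kf (\<epsilon> k) l\<bar> \<le> 1 * norm l powr (- (real CARD('n) + 2 * s))" for k l using kf_le[of "\<epsilon> k" l] by (simp add: m_def)
        show "(\<lambda>k. kf (\<epsilon> k) l) \<longlonglongrightarrow> 1 * norm l powr (- (real CARD('n) + 2 * s))" if l: "l \<noteq> 0" for l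
        proof (rule tendsto_eventually)
          have "\<forall>\<^sub>F k in sequentially. \<epsilon> k < norm l" using \<epsilon>(2) l by (intro order_tendstoD) auto
          then show "\<forall>\<^sub>F k in sequentially. kf (\<epsilon> k) l = 1 * norm l powr (- (real CARD('n) + 2 * s))"
            by eventually_elim (simp add: kf_def m_def)
        qed
      qed
      then show "(\<lambda>k. LINT x|lborel. truncation (\<epsilon> k) K x * \<psi> x) \<longlonglongrightarrow> of_real C / 2 * energy s u \<psi>"
        unfolding e3 by (intro tendsto_mult tendsto_const) simp
    qed simp
  qed
  then show ?thesis unfolding has_fractional_laplacian_def K_def C_def m_def .
qed

end

section \<open>The equivalence kernel and the three Laplacians\<close>

theorem corollary4p2:
  fixes s :: real and \<phi> :: "real \<Rightarrow> real" and \<delta> :: ereal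
    and \<omega> :: "real^'n \<Rightarrow> real^'n \<Rightarrow> real"
    and \<rho> \<alpha> :: "real^'n \<Rightarrow> real^'n \<Rightarrow> real^'n"
    and \<gamma>\<^sub>e\<^sub>q :: "real^'n \<Rightarrow> real^'n \<Rightarrow> real"
  assumes n: "CARD('n) \<in> {1, 2, 3}"
    and s: "0 < s" "s < 1"
    and \<phi>: "\<And>r. \<phi> r = 1 / r powr (real CARD('n) + 1 + s)"
    and \<omega>: "\<And>x y. \<omega> x y = norm (y - x) * \<phi> (norm (y - x))"
    and \<rho>: "\<And>x y. \<rho> x y = (y - x) /\<^sub>R norm (y - x)"
    and \<delta>: "\<delta> = \<infinity>"
    and \<alpha>: "\<alpha> = interaction_kernel \<rho> \<delta>"
    and \<gamma>: "\<gamma>\<^sub>e\<^sub>q = equivalence_kernel \<omega> \<alpha>"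
  shows "(\<forall>x y. x \<noteq> y \<longrightarrow>
            \<omega> x y *\<^sub>R \<alpha> x y = norm (y - x) powr (- (real CARD('n) + s + 1)) *\<^sub>R (y - x))
       \<and> (\<forall>x y. x \<noteq> y \<longrightarrow>
            has_pv_integral {x, y} (equivalence_integrand \<omega> \<alpha> x y) (2 * \<gamma>\<^sub>e\<^sub>q x y) \<and>
            2 * \<gamma>\<^sub>e\<^sub>q x y = - (C_const CARD('n) s * D_const TYPE('n) s / (G_const s)\<^sup>2)
                           * (1 / norm (x - y) powr (real CARD('n) + 2 * s)))
       \<and> (\<forall>u \<in> sobolev s. \<exists>\<Lambda>.
            has_fractional_laplacian s u \<Lambda> \<and>
            has_nonlocal_laplacian s \<gamma>\<^sub>e\<^sub>q u
              (\<lambda>\<psi>. of_real (D_const TYPE('n) s / (G_const s)\<^sup>2) * \<Lambda> \<psi>) \<and>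
            has_weighted_laplacian s \<omega> \<alpha> u
              (\<lambda>\<psi>. of_real (D_const TYPE('n) s / (G_const s)\<^sup>2) * \<Lambda> \<psi>))"
proof -
  define m where "m = real CARD('n) + 2 * s"
  define R where "R = D_const TYPE('n) s / (G_const s)\<^sup>2"
  have kappa: "kappa TYPE(real^'n) s = - (C_const CARD('n) s * R)" using kappa_eq[OF s, where 'n='n] by (simp add: R_def)
  have \<alpha>': "\<alpha> x y = (y - x) /\<^sub>R norm (y - x)" for x y by (simp add: \<alpha> \<delta> interaction_kernel_def \<rho>)
  have \<eta>: "\<omega> x y *\<^sub>R \<alpha> x y = riesz s (y - x)" for x y
  proof (cases "y = x")
    case False
    have e: "real CARD('n) + 1 + s = real CARD('n) + s + 1" by simp
    have "\<omega> x y = norm (y - x) * norm (y - x) powr (- (real CARD('n) + s + 1))" unfolding \<omega> \<phi> e powr_minus_divide ..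
    then show ?thesis using False by (simp add: \<alpha>' riesz_def)
  qed (simp add: \<alpha>' riesz_def)
  have 1: "\<omega> x y *\<^sub>R \<alpha> x y = norm (y - x) powr (- (real CARD('n) + s + 1)) *\<^sub>R (y - x)" for x y
    unfolding \<eta> riesz_def DIM_real_vec ..
  have pv: "has_pv_integral {x, y} (equivalence_integrand \<omega> \<alpha> x y) (- (C_const CARD('n) s * R) * norm (x - y) powr (- m))" if "x \<noteq> y" for x y
  proof -
    have "equivalence_integrand \<omega> \<alpha> x y = (\<lambda>z. riesz s (y - x) \<bullet> riesz s (z - x) + riesz s (y - z) \<bullet> riesz s (y - x) + riesz s (y - z) \<bullet> riesz s (z - x))"
      unfolding equivalence_integrand_def weighted_kernel_def Let_def \<eta> ..
    then show ?thesis using has_pv_integral_riesz[OF s that] unfolding kappa DIM_real_vec m_def by simp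
  qed
  have \<gamma>': "2 * \<gamma>\<^sub>e\<^sub>q x y = - (C_const CARD('n) s * R) * norm (x - y) powr (- m)" if "x \<noteq> y" for x y
    unfolding \<gamma> equivalence_kernel_def using pv_integral_eq[OF pv[OF that]] by simp
  have 2: "has_pv_integral {x, y} (equivalence_integrand \<omega> \<alpha> x y) (2 * \<gamma>\<^sub>e\<^sub>q x y) \<and>
      2 * \<gamma>\<^sub>e\<^sub>q x y = - (C_const CARD('n) s * D_const TYPE('n) s / (G_const s)\<^sup>2) * (1 / norm (x - y) powr (real CARD('n) + 2 * s))" if "x \<noteq> y" for x y
    using pv[OF that] unfolding \<gamma>'[OF that] by (simp add: R_def m_def powr_minus_divide del: minus_add_distrib)
  have 3: "\<exists>\<Lambda>. has_fractional_laplacian s u \<Lambda> \<and>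
            has_nonlocal_laplacian s \<gamma>\<^sub>e\<^sub>q u (\<lambda>\<psi>. of_real R * \<Lambda> \<psi>) \<and>
            has_weighted_laplacian s \<omega> \<alpha> u (\<lambda>\<psi>. of_real R * \<Lambda> \<psi>)" if "u \<in> sobolev s" for u
  proof -
    have u: "u \<in> gagliardo s" using that sobolev_subset_gagliardo[OF s] by blast
    define \<Lambda> where "\<Lambda> = (\<lambda>\<psi>. of_real (C_const CARD('n) s) / 2 * energy s u \<psi>)"
    have F: "has_fractional_laplacian s u \<Lambda>" unfolding \<Lambda>_def by (rule has_fractional_laplacian_energy[OF s u])
    have N: "has_nonlocal_laplacian s \<gamma>\<^sub>e\<^sub>q u (\<lambda>\<psi>. of_real R * \<Lambda> \<psi>)"
    proof -
      \<comment> \<open>On the diagonal both sides vanish, so the formula for the kernel at distinct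
        points suffices.\<close>
      have "2 * ((u y - u x) * of_real (\<gamma>\<^sub>e\<^sub>q x y)) = of_real R * (of_real (C_const CARD('n) s) * ((u x - u y) / of_real (norm (x - y) powr m)))" for x y
      proof (cases "x = y")
        case False
        have "2 * ((u y - u x) * of_real (\<gamma>\<^sub>e\<^sub>q x y)) = (u y - u x) * of_real (2 * \<gamma>\<^sub>e\<^sub>q x y)" by simp
        also have "\<dots> = of_real R * (of_real (C_const CARD('n) s) * ((u x - u y) / of_real (norm (x - y) powr m)))"
          unfolding \<gamma>'[OF False] by (simp add: powr_minus divide_inverse algebra_simps)
        finally show ?thesis .
      qed simp
      then show ?thesis using has_pv_dual_cmult[OF F[unfolded has_fractional_laplacian_def, folded m_def], of "of_real R"]
        unfolding has_nonlocal_laplacian_def by simp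
    qed
    obtain g where g: "reg_gradient s u g" using reg_gradient_exists[OF s u] by blast
    have "has_weighted_gradient \<omega> \<alpha> u (\<lambda>x. \<chi> i. g i x)"
      unfolding has_weighted_gradient_def weighted_kernel_def \<eta> by (rule has_pv_gradient[OF s u g])
    moreover have "has_weighted_divergence s \<omega> \<alpha> (\<lambda>x. \<chi> i. g i x) (\<lambda>\<psi>. of_real R * \<Lambda> \<psi>)"
    proof -
      \<comment> \<open>Symmetry of \<omega> reduces the divergence integrand to g x + g y paired
        with \<omega> \<alpha>, which is \<open>riesz\<close>.\<close>
      have sym: "\<omega> y x = \<omega> x y" for x y unfolding \<omega> by (simp add: norm_minus_commute)
      have k: "(\<omega> x y *\<^sub>R (\<chi> i. g i x) + \<omega> y x *\<^sub>R (\<chi> i. g i y)) $ i * of_real (\<alpha> x y $ i) = (g i x + g i y) * of_real (riesz s (y - x) $ i)" for x y i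
      proof -
        have "riesz s (y - x) $ i = \<omega> x y * \<alpha> x y $ i"
          unfolding \<eta>[symmetric] by (simp only: vector_scaleR_component real_scaleR_def)
        moreover have "(\<omega> x y *\<^sub>R (\<chi> i. g i x) + \<omega> y x *\<^sub>R (\<chi> i. g i y)) $ i = \<omega> x y *\<^sub>R (g i x + g i y)"
          by (simp only: sym[of x y] vector_add_component vector_scaleR_component vec_lambda_beta scaleR_add_right)
        ultimately show ?thesis by (simp add: scaleR_conv_of_real)
      qed
      \<comment> \<open>Two minus signs cancel: one from \<open>kappa\<close> being - C R, one from
        the divergence being minus the adjoint of the gradient.\<close>
      have l: "- (of_real (kappa TYPE(real^'n) s) / 2 * energy s u \<psi>) = of_real R * \<Lambda> \<psi>" for \<psi>
        unfolding kappa \<Lambda>_def by simp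
      show ?thesis using has_pv_divergence[OF s u g] unfolding has_weighted_divergence_def k l .
    qed
    ultimately have "has_weighted_laplacian s \<omega> \<alpha> u (\<lambda>\<psi>. of_real R * \<Lambda> \<psi>)" unfolding has_weighted_laplacian_def by blast
    then show ?thesis using F N by blast
  qed
  show ?thesis using 1 2 3 unfolding R_def by blast
qed

end
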